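(* Let $\Omega\subset\mathbb{R}^3$ be a simply connected smooth bounded domain, and let $\mu>0$, $2\mu+3\lambda\ge 0$, $\gamma>1$. Assume that the initial data $(\rho_0,u_0)$ with $\rho_0\ge 0$ satisfies $$\|\rho_0-\bar\rho_0\|_{L^2}+\|\sqrt{\rho_0}\,u_0\|_{L^2}+\|\nabla u_0\|_{H^1}<\infty ,$$ and let $(\rho,u)$ be a global strong solution of the compressible isentropic Navier--Stokes initial-boundary value problem with slip boundary conditions (written out in the context) such that $$\sup_{t\ge 0}\|\rho(\cdot,t)\|_{L^\infty}\le\hat\rho$$ for some positive constant $\hat\rho$. If additionally $\inf_{x\in\Omega}\rho_0(x)=0$, then $$\inf_{x\in\Omega}\rho(x,t)=0\quad\text{for any } t\ge 0.$$
   Context: The problem: the unknowns are the density $\rho=\rho(x,t)\ge0$ and the velocity $u=(u^1,u^2,u^3)(x,t)$, satisfying $$\rho_t+\operatorname{div}(\rho u)=0,\qquad (\rho u)_t+\operatorname{div}(\rho u\otimes u)+\nabla P=\mu\Delta u+(\mu+\lambda)\nabla\operatorname{div}u\quad\text{in }\Omega,\ t>0,$$ with pressure $P=\rho^\gamma$ and constant viscosities $\mu,\lambda$, initial data $$\rho(x,0)=\rho_0(x),\quad \rho u(x,0)=\rho_0u_0(x),\quad x\in\Omega,$$ and slip boundary conditions $$u\cdot n=0,\quad \operatorname{curl}u\times n=0,\quad x\in\partial\Omega,\ t>0,$$ where $n$ is the unit outward normal to $\partial\Omega$. Notation: $L^p=L^p(\Omega)$, $W^{k,p}=W^{k,p}(\Omega)$,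 $H^k=W^{k,2}$; $\bar f=\frac1{|\Omega|}\int_\Omega f\,dx$ is the spatial average (so $\bar\rho_0$ is the average of $\rho_0$). Strong solution: for $T>0$, $(\rho,u)$ is a strong solution of the problem on $\Omega\times[0,T]$ if for some $q\in(3,6]$, $$0\le\rho\in C([0,T];W^{1,q}),\quad \rho_t\in C([0,T];L^q),\quad u\in C([0,T];H^2)\cap L^2(0,T;W^{2,q}),$$ $$\sqrt\rho\,u_t\in L^\infty(0,T;L^2),\quad u_t\in L^2(0,T;H^1),$$ and $(\rho,u)$ satisfies the equations a.e. in $\Omega\times[0,T]$ (together with the initial and boundary conditions). A global strong solution is one that is a strong solution on $\Omega\times[0,T]$ for every $T>0$. *)

theory Defs
  imports "HOL-Analysis.Analysis" "HOL-Probability.Essential_Supremum"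
begin

section \<open>Smooth functions and smooth domains\<close>

text \<open>The set in the next two definitions is meant to be open.\<close>

primrec Ck_on :: "nat \<Rightarrow> 'a::euclidean_space set \<Rightarrow> ('a \<Rightarrow> 'b::real_normed_vector) \<Rightarrow> bool" where
  "Ck_on 0 S f \<longleftrightarrow> continuous_on S f"
| "Ck_on (Suc k) S f \<longleftrightarrow>
     f differentiable_on S \<and> (\<forall>i\<in>Basis. Ck_on k S (\<lambda>x. frechet_derivative f (at x) i))"

definition smooth_on :: "'a::euclidean_space set \<Rightarrow> ('a \<Rightarrow> 'b::real_normed_vector) \<Rightarrow> bool" where
  "smooth_on S f \<longleftrightarrow> (\<forall>k. Ck_on k S f)"

text \<open>The space of test functions, usually written C_c^infinity of S.\<close>

definition test_function :: "'a::euclidean_space set \<Rightarrow> ('a \<Rightarrow> real) \<Rightarrow> bool" where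
  "test_function S \<phi> \<longleftrightarrow>
     smooth_on UNIV \<phi> \<and> (\<exists>K. compact K \<and> K \<subseteq> S \<and> (\<forall>x. x \<notin> K \<longrightarrow> \<phi> x = 0))"

definition gradient :: "(real^3 \<Rightarrow> real) \<Rightarrow> real^3 \<Rightarrow> real^3" where
  "gradient \<psi> x = (\<chi> i. frechet_derivative \<psi> (at x) (axis i 1))"

definition local_defining_function ::
    "(real^3) set \<Rightarrow> real^3 \<Rightarrow> (real^3) set \<Rightarrow> (real^3 \<Rightarrow> real) \<Rightarrow> bool" where
  "local_defining_function \<Omega> x U \<psi> \<longleftrightarrow>
     open U \<and> x \<in> U \<and> smooth_on U \<psi> \<and> (\<forall>y\<in>U. gradient \<psi> y \<noteq> 0) \<and>
     \<Omega> \<inter> U = {y \<in> U. \<psi> y < 0} \<and> frontier \<Omega> \<inter> U = {y \<in> U. \<psi> y = 0}"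

definition smooth_bounded_domain :: "(real^3) set \<Rightarrow> bool" where
  "smooth_bounded_domain \<Omega> \<longleftrightarrow>
     \<Omega> \<noteq> {} \<and> open \<Omega> \<and> connected \<Omega> \<and> bounded \<Omega> \<and>
     (\<forall>x\<in>frontier \<Omega>. \<exists>U \<psi>. local_defining_function \<Omega> x U \<psi>)"

text \<open>Two local defining functions at the same boundary point have positively proportional
  gradients there, so the outward unit normal does not depend on the choice.\<close>

definition outward_normal :: "(real^3) set \<Rightarrow> real^3 \<Rightarrow> real^3" where
  "outward_normal \<Omega> x =
     (THE n. \<exists>U \<psi>. local_defining_function \<Omega> x U \<psi> \<and> n = sgn (gradient \<psi> x))"


section \<open>Lebesgue and Sobolev spaces\<close>

text \<open>A function space is a pair of its carrier and its norm. Its elements are functions, not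
  equivalence classes; all notions below are invariant under changes on null sets of \<Omega>.\<close>

type_synonym ('a, 'b) fspace = "('a \<Rightarrow> 'b) set \<times> (('a \<Rightarrow> 'b) \<Rightarrow> real)"

definition Lp :: "real \<Rightarrow> 'a::euclidean_space set \<Rightarrow> ('a, 'b::euclidean_space) fspace" where
  "Lp p \<Omega> =
     ({f \<in> borel_measurable (lebesgue_on \<Omega>). integrable (lebesgue_on \<Omega>) (\<lambda>x. norm (f x) powr p)},
      \<lambda>f. (LINT x|lebesgue_on \<Omega>. norm (f x) powr p) powr (1 / p))"

definition mean :: "'a::euclidean_space set \<Rightarrow> ('a \<Rightarrow> real) \<Rightarrow> real" where
  "mean \<Omega> f = (LINT x|lebesgue_on \<Omega>. f x) / measure lebesgue \<Omega>"

definition essinf :: "'a measure \<Rightarrow> ('a \<Rightarrow> ereal) \<Rightarrow> ereal" where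
  "essinf M f = - esssup M (\<lambda>x. - f x)"

text \<open>An element of W^{1,q} with q > 3 has a continuous representative. Its infimum over an open
  set is the essential infimum, which does not depend on the representative.\<close>

lemma essinf_eq_INF:
  fixes f :: "'a::euclidean_space \<Rightarrow> real"
  assumes "open \<Omega>" and cont: "continuous_on \<Omega> f"
  shows "essinf (lebesgue_on \<Omega>) (\<lambda>x. ereal (f x)) = (INF x\<in>\<Omega>. ereal (f x))"
proof -
  let ?M = "lebesgue_on \<Omega>" and ?g = "\<lambda>x. - ereal (f x)"
  have \<Omega>: "\<Omega> \<in> sets lebesgue"
    using assms(1) by (simp add: borel_open)
  have "f \<in> borel_measurable ?M"
    using cont \<Omega> by (rule continuous_imp_measurable_on_sets_lebesgue)
  then have meas: "?g \<in> borel_measurable ?M"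
    by simp
  have "esssup ?M ?g \<le> (SUP x\<in>\<Omega>. ?g x)"
    by (rule esssup_I[OF meas], rule AE_I2)
      (auto simp: space_restrict_space simp del: uminus_ereal.simps intro: SUP_upper)
  moreover have "?g x \<le> esssup ?M ?g" if "x \<in> \<Omega>" for x
  proof (rule ccontr)
    assume "\<not> ?g x \<le> esssup ?M ?g"
    then have "esssup ?M ?g < ?g x"
      by simp
    then obtain c where c: "esssup ?M ?g < ereal c" "ereal c < ?g x"
      using ereal_dense2 by blast
    let ?S = "{y \<in> \<Omega>. f y < - c}"
    have "open ?S"
      using continuous_open_preimage[OF cont \<open>open \<Omega>\<close> open_lessThan[of "- c"]]
      unfolding vimage_def Int_def lessThan_def mem_Collect_eq .
    moreover have "x \<in> ?S"
      using c(2) \<open>x \<in> \<Omega>\<close> by simp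
    ultimately have "?S \<notin> null_sets lebesgue"
      using open_not_negligible[of ?S] negligible_iff_null_sets by blast
    moreover have "AE y in ?M. y \<notin> ?S"
      using esssup_AE[of ?g ?M]
    proof (rule AE_mp, intro AE_I2 impI)
      fix y assume "?g y \<le> esssup ?M ?g"
      then have "?g y < ereal c" using c(1) by (rule le_less_trans)
      then show "y \<notin> ?S" by simp
    qed
    then have "AE y in lebesgue. y \<notin> ?S"
      using \<Omega> by (subst (asm) AE_restrict_space_iff) (auto elim: eventually_mono)
    then have "?S \<in> null_sets lebesgue"
      using \<open>open ?S\<close> AE_iff_null_sets[of ?S lebesgue] by (auto simp: borel_open)
    ultimately show False by blast
  qed
  then have "(SUP x\<in>\<Omega>. ?g x) \<le> esssup ?M ?g"
    by (rule SUP_least)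
  ultimately have "esssup ?M ?g = (SUP x\<in>\<Omega>. ?g x)"
    by (rule antisym)
  then show ?thesis
    by (simp add: essinf_def ereal_SUP_uminus_eq del: uminus_ereal.simps)
qed

definition locally_integrable ::
    "'a::euclidean_space set \<Rightarrow> ('a \<Rightarrow> 'b::euclidean_space) \<Rightarrow> bool" where
  "locally_integrable \<Omega> f \<longleftrightarrow> (\<forall>K. compact K \<and> K \<subseteq> \<Omega> \<longrightarrow> f absolutely_integrable_on K)"

definition weak_deriv ::
    "'a::euclidean_space set \<Rightarrow> 'a \<Rightarrow> ('a \<Rightarrow> 'b::euclidean_space) \<Rightarrow> ('a \<Rightarrow> 'b) \<Rightarrow> bool" where
  "weak_deriv \<Omega> i f g \<longleftrightarrow>
     locally_integrable \<Omega> f \<and> locally_integrable \<Omega> g \<and>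
     (\<forall>\<phi>. test_function \<Omega> \<phi> \<longrightarrow>
        (LINT x|lebesgue_on \<Omega>. frechet_derivative \<phi> (at x) i *\<^sub>R f x) =
        - (LINT x|lebesgue_on \<Omega>. \<phi> x *\<^sub>R g x))"

text \<open>Some representative of the weak derivative. It is unique up to null sets of \<Omega>, and is
  unspecified if the weak derivative does not exist.\<close>

definition wderiv ::
    "'a::euclidean_space set \<Rightarrow> 'a \<Rightarrow> ('a \<Rightarrow> 'b::euclidean_space) \<Rightarrow> 'a \<Rightarrow> 'b" where
  "wderiv \<Omega> i f = (SOME g. weak_deriv \<Omega> i f g)"

primrec sobolev_carrier ::
    "nat \<Rightarrow> real \<Rightarrow> 'a::euclidean_space set \<Rightarrow> ('a \<Rightarrow> 'b::euclidean_space) set" where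
  "sobolev_carrier 0 p \<Omega> = fst (Lp p \<Omega>)"
| "sobolev_carrier (Suc k) p \<Omega> =
     {f \<in> fst (Lp p \<Omega>). \<forall>i\<in>Basis. \<exists>g\<in>sobolev_carrier k p \<Omega>. weak_deriv \<Omega> i f g}"

text \<open>The norm is the sum of the norms of the iterated partial derivatives up to order k, where
  a mixed derivative is counted once for each order of differentiation. This is equivalent to
  the usual norm; only the topology and finiteness matter below.\<close>

primrec sobolev_norm ::
    "nat \<Rightarrow> real \<Rightarrow> 'a::euclidean_space set \<Rightarrow> ('a \<Rightarrow> 'b::euclidean_space) \<Rightarrow> real" where
  "sobolev_norm 0 p \<Omega> f = snd (Lp p \<Omega>) f"
| "sobolev_norm (Suc k) p \<Omega> f =
     snd (Lp p \<Omega>) f + (\<Sum>i\<in>Basis. sobolev_norm k p \<Omega> (wderiv \<Omega> i f))"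

definition Wkp ::
    "nat \<Rightarrow> real \<Rightarrow> 'a::euclidean_space set \<Rightarrow> ('a, 'b::euclidean_space) fspace" where
  "Wkp k p \<Omega> = (sobolev_carrier k p \<Omega>, sobolev_norm k p \<Omega>)"

abbreviation Hk :: "nat \<Rightarrow> 'a::euclidean_space set \<Rightarrow> ('a, 'b::euclidean_space) fspace" where
  "Hk k \<Omega> \<equiv> Wkp k 2 \<Omega>"


section \<open>Weak differential operators\<close>

definition wgrad :: "(real^3) set \<Rightarrow> (real^3 \<Rightarrow> real) \<Rightarrow> real^3 \<Rightarrow> real^3" where
  "wgrad \<Omega> f x = (\<chi> i. wderiv \<Omega> (axis i 1) f x)"

definition wdiv :: "(real^3) set \<Rightarrow> (real^3 \<Rightarrow> real^3) \<Rightarrow> real^3 \<Rightarrow> real" where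
  "wdiv \<Omega> v x = (\<Sum>i\<in>UNIV. wderiv \<Omega> (axis i 1) v x $ i)"

definition wcurl :: "(real^3) set \<Rightarrow> (real^3 \<Rightarrow> real^3) \<Rightarrow> real^3 \<Rightarrow> real^3" where
  "wcurl \<Omega> v x =
     vector [wderiv \<Omega> (axis 2 1) v x $ 3 - wderiv \<Omega> (axis 3 1) v x $ 2,
             wderiv \<Omega> (axis 3 1) v x $ 1 - wderiv \<Omega> (axis 1 1) v x $ 3,
             wderiv \<Omega> (axis 1 1) v x $ 2 - wderiv \<Omega> (axis 2 1) v x $ 1]"

definition wlaplace :: "(real^3) set \<Rightarrow> (real^3 \<Rightarrow> real^3) \<Rightarrow> real^3 \<Rightarrow> real^3" where
  "wlaplace \<Omega> v x = (\<Sum>i\<in>UNIV. wderiv \<Omega> (axis i 1) (wderiv \<Omega> (axis i 1) v) x)"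

definition tensor :: "real^3 \<Rightarrow> real^3 \<Rightarrow> real^3^3" where
  "tensor v w = (\<chi> i j. v $ i * w $ j)"

definition wdiv_matrix :: "(real^3) set \<Rightarrow> (real^3 \<Rightarrow> real^3^3) \<Rightarrow> real^3 \<Rightarrow> real^3" where
  "wdiv_matrix \<Omega> M x = (\<Sum>i\<in>UNIV. wderiv \<Omega> (axis i 1) (\<lambda>y. M y $ i) x)"


section \<open>Boundary traces\<close>

text \<open>Two-dimensional Hausdorff measure. The outer measure is countably additive on Borel sets,
  so that emeasure of the measure below agrees with it there.\<close>

definition hausdorff2_outer :: "(real^3) set \<Rightarrow> ennreal" where
  "hausdorff2_outer S =
     (SUP \<delta>\<in>{0::real<..}.
        INF A\<in>{A :: nat \<Rightarrow> (real^3) set.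
                 S \<subseteq> (\<Union>n. A n) \<and> (\<forall>n. bounded (A n) \<and> diameter (A n) \<le> \<delta>)}.
          (\<Sum>n. ennreal (pi / 4 * (diameter (A n))\<^sup>2)))"

definition surface_measure :: "(real^3) set \<Rightarrow> (real^3) measure" where
  "surface_measure \<Omega> =
     restrict_space (measure_of UNIV (sets borel) hausdorff2_outer) (frontier \<Omega>)"

text \<open>The function g is the trace of f, in the square integrable functions on the boundary, when
  functions that are smooth up to the boundary approximate f in H^1 of \<Omega> and g on the boundary.\<close>

definition has_trace ::
    "(real^3) set \<Rightarrow> (real^3 \<Rightarrow> real^3) \<Rightarrow> (real^3 \<Rightarrow> real^3) \<Rightarrow> bool" where
  "has_trace \<Omega> f g \<longleftrightarrow>
     f \<in> fst (Hk 1 \<Omega>) \<and> g \<in> borel_measurable (surface_measure \<Omega>) \<and>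
     (\<exists>\<phi> :: nat \<Rightarrow> real^3 \<Rightarrow> real^3.
        (\<forall>n. smooth_on UNIV (\<phi> n)) \<and>
        (\<lambda>n. snd (Hk 1 \<Omega>) (\<lambda>x. \<phi> n x - f x)) \<longlonglongrightarrow> 0 \<and>
        (\<lambda>n. \<integral>\<^sup>+x. ennreal ((norm (\<phi> n x - g x))\<^sup>2) \<partial>surface_measure \<Omega>) \<longlonglongrightarrow> 0)"


section \<open>Functions of time with values in a function space\<close>

definition C_time ::
    "real \<Rightarrow> ('a, 'b::euclidean_space) fspace \<Rightarrow> (real \<Rightarrow> 'a \<Rightarrow> 'b) \<Rightarrow> bool" where
  "C_time T X f \<longleftrightarrow>
     (\<forall>t\<in>{0..T}. f t \<in> fst X \<and>
        ((\<lambda>s. snd X (\<lambda>x. f s x - f t x)) \<longlongrightarrow> 0) (at t within {0..T}))"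

text \<open>Bochner measurability: limit almost everywhere, in norm, of simple functions.\<close>

definition strongly_measurable ::
    "real \<Rightarrow> ('a, 'b::euclidean_space) fspace \<Rightarrow> (real \<Rightarrow> 'a \<Rightarrow> 'b) \<Rightarrow> bool" where
  "strongly_measurable T X f \<longleftrightarrow>
     (\<exists>s :: nat \<Rightarrow> real \<Rightarrow> 'a \<Rightarrow> 'b.
        (\<forall>n. simple_function (lebesgue_on {0..T}) (s n) \<and> (\<forall>t. s n t \<in> fst X)) \<and>
        (AE t in lebesgue_on {0..T}.
           f t \<in> fst X \<and> (\<lambda>n. snd X (\<lambda>x. s n t x - f t x)) \<longlonglongrightarrow> 0))"

definition Lp_time ::
    "real \<Rightarrow> real \<Rightarrow> ('a, 'b::euclidean_space) fspace \<Rightarrow> (real \<Rightarrow> 'a \<Rightarrow> 'b) \<Rightarrow> bool" where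
  "Lp_time p T X f \<longleftrightarrow>
     strongly_measurable T X f \<and> integrable (lebesgue_on {0..T}) (\<lambda>t. snd X (f t) powr p)"

definition Linfty_time ::
    "real \<Rightarrow> ('a, 'b::euclidean_space) fspace \<Rightarrow> (real \<Rightarrow> 'a \<Rightarrow> 'b) \<Rightarrow> bool" where
  "Linfty_time T X f \<longleftrightarrow>
     strongly_measurable T X f \<and> (\<exists>C. AE t in lebesgue_on {0..T}. snd X (f t) \<le> C)"

text \<open>The distributional derivative with respect to time on the open cylinder. The integrals are
  iterated so that they do not depend on the representative of f t chosen at each time.\<close>

definition weak_time_deriv ::
    "real \<Rightarrow> 'a::euclidean_space set \<Rightarrow> (real \<Rightarrow> 'a \<Rightarrow> 'b::euclidean_space) \<Rightarrow>
     (real \<Rightarrow> 'a \<Rightarrow> 'b) \<Rightarrow> bool" where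
  "weak_time_deriv T \<Omega> f g \<longleftrightarrow>
     Lp_time 1 T (Lp 1 \<Omega>) f \<and> Lp_time 1 T (Lp 1 \<Omega>) g \<and>
     (\<forall>\<phi>. test_function ({0<..<T} \<times> \<Omega>) \<phi> \<longrightarrow>
        (LINT t|lebesgue_on {0..T}. LINT x|lebesgue_on \<Omega>.
            frechet_derivative \<phi> (at (t, x)) (1, 0) *\<^sub>R f t x) =
        - (LINT t|lebesgue_on {0..T}. LINT x|lebesgue_on \<Omega>. \<phi> (t, x) *\<^sub>R g t x))"


section \<open>Strong solutions of the compressible isentropic Navier-Stokes equations\<close>

text \<open>Functions of time and space take the time first. The functions rt, ut and mt are the time
  derivatives of the density, the velocity and the momentum. In this regularity class all the
  weak derivatives in the two equations exist. An equation holds almost everywhere on the cylinder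
  when, for almost every t, it holds for almost every x.\<close>

definition strong_solution ::
    "real \<Rightarrow> real \<Rightarrow> real \<Rightarrow> (real^3) set \<Rightarrow> (real^3 \<Rightarrow> real) \<Rightarrow> (real^3 \<Rightarrow> real^3) \<Rightarrow>
     real \<Rightarrow> (real \<Rightarrow> real^3 \<Rightarrow> real) \<Rightarrow> (real \<Rightarrow> real^3 \<Rightarrow> real^3) \<Rightarrow> bool" where
  "strong_solution \<mu> lam \<gamma> \<Omega> \<rho>0 u0 T \<rho> u \<longleftrightarrow>
     (\<exists>q rt ut mt. 3 < q \<and> q \<le> 6 \<and>
        weak_time_deriv T \<Omega> \<rho> rt \<and>
        weak_time_deriv T \<Omega> u ut \<and>
        weak_time_deriv T \<Omega> (\<lambda>t x. \<rho> t x *\<^sub>R u t x) mt \<and>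
        (\<forall>t\<in>{0..T}. AE x in lebesgue_on \<Omega>. 0 \<le> \<rho> t x) \<and>
        C_time T (Wkp 1 q \<Omega>) \<rho> \<and>
        C_time T (Lp q \<Omega>) rt \<and>
        C_time T (Hk 2 \<Omega>) u \<and>
        Lp_time 2 T (Wkp 2 q \<Omega>) u \<and>
        Linfty_time T (Lp 2 \<Omega>) (\<lambda>t x. sqrt (\<rho> t x) *\<^sub>R ut t x) \<and>
        Lp_time 2 T (Hk 1 \<Omega>) ut \<and>
        (AE t in lebesgue_on {0..T}. AE x in lebesgue_on \<Omega>.
           rt t x + wdiv \<Omega> (\<lambda>y. \<rho> t y *\<^sub>R u t y) x = 0) \<and>
        (AE t in lebesgue_on {0..T}. AE x in lebesgue_on \<Omega>.
           mt t x + wdiv_matrix \<Omega> (\<lambda>y. \<rho> t y *\<^sub>R tensor (u t y) (u t y)) x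
             + wgrad \<Omega> (\<lambda>y. \<rho> t y powr \<gamma>) x
           = \<mu> *\<^sub>R wlaplace \<Omega> (u t) x + (\<mu> + lam) *\<^sub>R wgrad \<Omega> (wdiv \<Omega> (u t)) x)) \<and>
     (AE x in lebesgue_on \<Omega>. \<rho> 0 x = \<rho>0 x) \<and>
     (AE x in lebesgue_on \<Omega>. \<rho> 0 x *\<^sub>R u 0 x = \<rho>0 x *\<^sub>R u0 x) \<and>
     (\<forall>t\<in>{0<..T}.
        (\<exists>g. has_trace \<Omega> (u t) g \<and>
             (AE x in surface_measure \<Omega>. g x \<bullet> outward_normal \<Omega> x = 0)) \<and>
        (\<exists>g. has_trace \<Omega> (wcurl \<Omega> (u t)) g \<and>
             (AE x in surface_measure \<Omega>. cross3 (g x) (outward_normal \<Omega> x) = 0)))"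

definition global_strong_solution ::
    "real \<Rightarrow> real \<Rightarrow> real \<Rightarrow> (real^3) set \<Rightarrow> (real^3 \<Rightarrow> real) \<Rightarrow> (real^3 \<Rightarrow> real^3) \<Rightarrow>
     (real \<Rightarrow> real^3 \<Rightarrow> real) \<Rightarrow> (real \<Rightarrow> real^3 \<Rightarrow> real^3) \<Rightarrow> bool" where
  "global_strong_solution \<mu> lam \<gamma> \<Omega> \<rho>0 u0 \<rho> u \<longleftrightarrow>
     (\<forall>T>0. strong_solution \<mu> lam \<gamma> \<Omega> \<rho>0 u0 T \<rho> u)"

end

theory Submission
 imports Defs "HOL-Computational_Algebra.Polynomial"
begin

text \<open>The density cannot lose vacuum because a positive lower bound propagates backwards in time. Along the
particle paths of the flow the continuity equation reads d/dt log rho = - div u, and for a strong solution the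
supremum of |div u(t)| is an integrable function of time: for q > 3 the Morrey embedding bounds it by the norm of u(t)
in W^{2,q}, which is square integrable in time. So if rho(T) \<ge> c > 0, then rho(0) \<ge> c exp (- A), where A is the
time integral of that bound, and this contradicts that the initial essential infimum vanishes.

Particle paths are replaced by integral functionals of the density. For a polynomial F the functional
E(t), the integral of F(rho(t)) over the domain, satisfies E' = integral of (F(rho) - rho F'(rho)) div u:
this is the chain rule and the product rule for weak derivatives, followed by the divergence theorem, in which
the boundary term vanishes because u is tangent to the boundary (\<open>renormalized_divergence\<close>, \<open>energy_has_derivative\<close>).
With F(rho) = rho^(-n) one would have |F - rho F'| = (1 + n) F, hence |E'| \<le> (1 + n) sup |div u| E, and the Gronwall
inequality compares E(0) with E(T). This F is not admissible, as the density may vanish, but the Taylor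
polynomials of rho^(-n) around the upper bound M of the density satisfy the same differential inequality with the same
constant (\<open>weight_bounds\<close>). Letting their degree and then n tend to infinity turns the bounds for E into
the pointwise lower bound (\<open>AE_ge_if_weighted_bound\<close>, \<open>density_lower_bound_backwards\<close>).

Three ingredients take most of the work. The first is a calculus of weak derivatives: it rests on the identity
f(x + y) - f(x) = mean over the segment of the derivative of f in direction y, obtained by testing
(\<open>wd_translation_test\<close>); it yields the product rule (\<open>wd_mult\<close>), the Morrey embedding (\<open>morrey\<close>) and, in the time
variable, the differentiability of the density with values in L^1 (\<open>density_differentiable_L1\<close>). The second is the
divergence theorem for tangent fields (\<open>divergence_theorem_tangent\<close>). It is not derived from Gauss' theorem: the
field is multiplied by a cutoff that vanishes near the boundary, and the flux through the thin boundary strip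
where the cutoff varies is shown to be small, since the normal component vanishes on the boundary in the sense
of traces. The third is the relation between this strip and the boundary measure, which is a Hausdorff measure: volumes of
cylinders over a surface are bounded by the surface area of the base (\<open>cylinder_volume_le_hausdorff2\<close>).\<close>

text \<open>Short notation; most integrals below are taken over the whole space.\<close>

abbreviation (input) "bmeas \<equiv> borel_measurable"
abbreviation (input) "en \<equiv> ennreal"
abbreviation (input) integ :: "('a::euclidean_space => 'b::{banach,second_countable_topology}) => bool" where
 "integ \<equiv> integrable lborel"
abbreviation (input) "leb \<equiv> lebesgue_on"
abbreviation (input) "ind \<equiv> indicator"
abbreviation (input) "fder f x \<equiv> frechet_derivative f (at x)"
abbreviation (input) seq_limit :: "(nat => 'a::topological_space) => 'a => bool" ("(_ ----> _)" [60, 60] 60) where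
 "f ----> l \<equiv> filterlim f (nhds l) sequentially"
abbreviation (input) lint :: "('a::euclidean_space => 'b::{banach,second_countable_topology}) => 'b" (binder "LL " 10) where
 "lint f \<equiv> integral\<^sup>L lborel f"
abbreviation (input) nnint :: "('a::euclidean_space => ennreal) => ennreal" (binder "NN " 10) where
 "nnint f \<equiv> integral\<^sup>N lborel f"

lemmas Bintegral_sum = Bochner_Integration.integral_sum
lemmas Bintegrable_sum = Bochner_Integration.integrable_sum
lemmas Bintegrable_add = Bochner_Integration.integrable_add
lemmas Bintegral_nonneg = Bochner_Integration.integral_nonneg
lemmas Bintegrable_bound = Bochner_Integration.integrable_bound
lemmas Bintegral_add = Bochner_Integration.integral_add
lemmas Bintegrable_diff = Bochner_Integration.integrable_diff
lemmas Bintegral_diff = Bochner_Integration.integral_diff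
lemmas Bintegral_cong = Bochner_Integration.integral_cong
lemmas Bintegrable_cong = Bochner_Integration.integrable_cong

section \<open>Smooth functions and cutoffs\<close>

text \<open>The derivatives in the definition of \<open>Ck_on\<close> are taken at points of the open set,
where they only depend on the values nearby.\<close>
lemma Ck_on_cong:
 assumes "open S" "Ck_on k S f" "\<And>x. x \<in> S ==> f x = g x"
 shows "Ck_on k S g"
 using assms
proof (induction k arbitrary: f g)
 case 0
 have "continuous_on S g = continuous_on S f" using 0(3) by (intro continuous_on_cong) simp_all
 then show ?case using 0 by simp
next
 case (Suc k)
 have *: "(g has_derivative fder f x) (at x)" if "x \<in> S" for x
 proof -
  have "f differentiable (at x within S)"
   using Suc.prems that by (simp add: differentiable_on_def)
  then have "(f has_derivative fder f x) (at x)"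
   using Suc.prems that by (metis at_within_open frechet_derivative_works)
  then show ?thesis
   by (rule has_derivative_transform_within_open[OF _ \<open>open S\<close> that]) (use Suc.prems in auto)
 qed
 have "g differentiable_on S"
  using * by (auto simp: differentiable_on_def differentiable_def intro: has_derivative_at_withinI)
 moreover have "Ck_on k S (\<lambda>x. fder g x i)" if "i \<in> Basis" for i
 proof (rule Suc.IH[of "\<lambda>x. fder f x i"])
  show "Ck_on k S (\<lambda>x. fder f x i)" using Suc.prems that by simp
  show "fder f x i = fder g x i" if "x \<in> S" for x
   using frechet_derivative_at[OF *[OF that]] by simp
 qed fact
 ultimately show ?case by simp
qed

lemma Ck_on_SucI:
 assumes "open S" "\<And>x. x \<in> S ==> (f has_derivative f' x) (at x)"
  "\<And>i. i \<in> Basis ==> Ck_on k S (\<lambda>x. f' x i)"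
 shows "Ck_on (Suc k) S f"
proof -
 have "f differentiable_on S"
  using assms(2) by (auto simp: differentiable_on_def differentiable_def intro: has_derivative_at_withinI)
 moreover have "Ck_on k S (\<lambda>x. fder f x i)" if "i \<in> Basis" for i
  by (rule Ck_on_cong[OF \<open>open S\<close> assms(3)[OF that]])
   (use frechet_derivative_at[OF assms(2)] in simp)
 ultimately show ?thesis by simp
qed

lemma Ck_on_SucD:
 assumes "open S" "Ck_on (Suc k) S f" "x \<in> S"
 shows "(f has_derivative fder f x) (at x)"
proof -
 have "f differentiable (at x within S)"
  using assms by (simp add: differentiable_on_def)
 then show ?thesis using assms by (metis at_within_open frechet_derivative_works)
qed

lemma Ck_on_Suc_imp: "open S ==> Ck_on (Suc k) S f ==> Ck_on k S f"
proof (induction k arbitrary: f)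
 case 0
 then show ?case by (simp add: differentiable_imp_continuous_on)
next
 case (Suc k)
 then show ?case by auto
qed

lemma Ck_on_subset: "Ck_on k S f ==> T \<subseteq> S ==> Ck_on k T f"
 by (induction k arbitrary: f) (auto intro: continuous_on_subset differentiable_on_subset)

lemma Ck_on_const: "Ck_on k S (\<lambda>x. c)"
 by (induction k arbitrary: c) auto

lemma Ck_on_add:
 assumes "open S"
 shows "Ck_on k S f ==> Ck_on k S g ==> Ck_on k S (\<lambda>x. f x + g x)"
proof (induction k arbitrary: f g)
 case 0
 then show ?case by (auto intro: continuous_on_add)
next
 case (Suc k)
 show ?case
  by (rule Ck_on_SucI[OF assms has_derivative_add[OF Ck_on_SucD Ck_on_SucD]])
   (use Suc assms in auto)
qed

lemma Ck_on_sum: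
 assumes "open S" "\<And>i. i \<in> I ==> Ck_on k S (f i)"
 shows "Ck_on k S (\<lambda>x. \<Sum>i\<in>I. f i x)"
 using assms(2)
 by (induction I rule: infinite_finite_induct) (auto intro: Ck_on_const Ck_on_add[OF assms(1)])

lemma Ck_on_bounded_linear:
 assumes "open S" "bounded_linear L"
 shows "Ck_on k S f ==> Ck_on k S (\<lambda>x. L (f x))"
proof (induction k arbitrary: f)
 case 0
 then show ?case using assms by (auto intro: bounded_linear.continuous_on)
next
 case (Suc k)
 show ?case
  by (rule Ck_on_SucI[OF assms(1) bounded_linear.has_derivative[OF assms(2) Ck_on_SucD]])
   (use Suc assms in auto)
qed

lemma Ck_on_ident: assumes "open S" shows "Ck_on k S (\<lambda>x. x)"
proof (cases k)
 case (Suc k)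
 show ?thesis unfolding Suc
  by (rule Ck_on_SucI[OF assms has_derivative_ident Ck_on_const])
qed simp

lemma Ck_on_linear: "open S ==> bounded_linear L ==> Ck_on k S L"
 using Ck_on_bounded_linear[OF _ _ Ck_on_ident] by blast

lemma Ck_on_scaleR:
 fixes f :: "'a::euclidean_space => real"
 assumes "open S"
 shows "Ck_on k S f ==> Ck_on k S g ==> Ck_on k S (\<lambda>x. f x *\<^sub>R g x)"
proof (induction k arbitrary: f g)
 case 0
 then show ?case by (auto intro: continuous_on_scaleR)
next
 case (Suc k)
 show ?case
 proof (rule Ck_on_SucI[OF assms has_derivative_scaleR[OF Ck_on_SucD Ck_on_SucD]])
  fix i :: 'a assume i: "i \<in> Basis"
  show "Ck_on k S (\<lambda>x. f x *\<^sub>R fder g x i + fder f x i *\<^sub>R g x)"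
  proof (intro Ck_on_add[OF assms] Suc.IH)
   show "Ck_on k S f" "Ck_on k S g" using Suc.prems assms by (blast intro: Ck_on_Suc_imp)+
  qed (use Suc.prems i in auto)
 qed (use Suc assms in auto)
qed

lemma Ck_on_mult:
 fixes f g :: "'a::euclidean_space => real"
 assumes "open S" "Ck_on k S f" "Ck_on k S g"
 shows "Ck_on k S (\<lambda>x. f x * g x)"
 using Ck_on_scaleR[OF assms] by simp

lemma linear_basis_expansion:
 fixes L :: "'a::euclidean_space => 'b::real_vector"
 assumes "linear L" shows "L v = (\<Sum>j\<in>Basis. (v \<bullet> j) *\<^sub>R L j)"
proof -
 have "L (\<Sum>j\<in>Basis. (v \<bullet> j) *\<^sub>R j) = (\<Sum>j\<in>Basis. (v \<bullet> j) *\<^sub>R L j)"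
  by (simp add: linear_sum[OF assms] linear_scale[OF assms])
 then show ?thesis by (simp add: euclidean_representation)
qed

text \<open>Each partial derivative of a composition is a finite sum of products of partial derivatives of the
outer function, composed with the inner one, and components of partial derivatives of the inner function, so
the claim for order k gives the one for order k + 1.\<close>
lemma Ck_on_compose:
 fixes f :: "'a::euclidean_space => 'b::euclidean_space"
 assumes "open S" "open T" "f ` S \<subseteq> T"
 shows "Ck_on k S f ==> Ck_on k T g ==> Ck_on k S (\<lambda>x. g (f x))"
proof (induction k arbitrary: g)
 case 0
 then show ?case using assms by (auto intro: continuous_on_compose2)
next
 case (Suc k)
 have *: "((\<lambda>x. g (f x)) has_derivative
   (\<lambda>h. \<Sum>j\<in>Basis. (fder f x h \<bullet> j) *\<^sub>R fder g (f x) j)) (at x)"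
  if x: "x \<in> S" for x
 proof -
  let ?f = "fder f x" and ?g = "fder g (f x)"
  have g: "(g has_derivative ?g) (at (f x))"
   using Suc.prems assms x by (intro Ck_on_SucD) auto
  have lin: "linear ?g" using g by (simp add: has_derivative_linear)
  have "?g v = (\<Sum>j\<in>Basis. (v \<bullet> j) *\<^sub>R ?g j)" for v
   by (rule linear_basis_expansion[OF lin])
  then have "(\<lambda>h. ?g (?f h)) = (\<lambda>h. \<Sum>j\<in>Basis. (?f h \<bullet> j) *\<^sub>R ?g j)"
   by (intro ext)
  moreover have "((\<lambda>x. g (f x)) has_derivative (\<lambda>h. ?g (?f h))) (at x)"
   by (rule has_derivative_compose[OF Ck_on_SucD[OF assms(1) Suc.prems(1) x] g])
  ultimately show ?thesis by simp
 qed
 show ?case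
 proof (rule Ck_on_SucI[OF assms(1) *])
  fix i :: 'a assume i: "i \<in> Basis"
  have f: "Ck_on k S f" by (rule Ck_on_Suc_imp[OF assms(1) Suc.prems(1)])
  show "Ck_on k S (\<lambda>x. \<Sum>j\<in>Basis. (fder f x i \<bullet> j) *\<^sub>R fder g (f x) j)"
  proof (intro Ck_on_sum[OF assms(1)] Ck_on_scaleR[OF assms(1)]
    Ck_on_bounded_linear[OF assms(1) bounded_linear_inner_left])
   fix j :: 'b assume j: "j \<in> Basis"
   show "Ck_on k S (\<lambda>x. fder f x i)" using Suc.prems(1) i by simp
   show "Ck_on k S (\<lambda>x. fder g (f x) j)"
    by (rule Suc.IH[OF f]) (use Suc.prems(2) j in simp)
  qed
 qed
qed

lemma Ck_on_Un:
 assumes "open S" "open T" shows "Ck_on k S f ==> Ck_on k T f ==> Ck_on k (S \<union> T) f"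
proof (induction k arbitrary: f)
 case 0
 then show ?case using assms by (auto intro: continuous_on_open_Un)
next
 case (Suc k)
 show ?case
  by (rule Ck_on_SucI[where f'="\<lambda>x. fder f x"])
   (use Suc assms Ck_on_SucD[of S k f] Ck_on_SucD[of T k f] in auto)
qed

lemma smooth_onD: "open S ==> smooth_on S f ==> x \<in> S ==>
  (f has_derivative fder f x) (at x)"
 unfolding smooth_on_def using Ck_on_SucD by blast

lemma smooth_on_deriv:
 assumes "smooth_on S f" "i \<in> Basis" shows "smooth_on S (\<lambda>x. fder f x i)"
 using assms unfolding smooth_on_def by (metis Ck_on.simps(2))

lemma smooth_on_continuous: "smooth_on S f ==> continuous_on S f"
 unfolding smooth_on_def by (metis Ck_on.simps(1))

lemma smooth_on_compose:
 fixes f :: "'a::euclidean_space => 'b::euclidean_space"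
 shows "open S ==> open T ==> smooth_on S f ==> smooth_on T g ==> f ` S \<subseteq> T ==> smooth_on S (\<lambda>x. g (f x))"
 unfolding smooth_on_def using Ck_on_compose by blast

lemma smooth_on_const: "smooth_on S (\<lambda>x. c)"
 unfolding smooth_on_def by (auto intro: Ck_on_const)

lemma smooth_on_ident: "open S ==> smooth_on S (\<lambda>x. x)"
 unfolding smooth_on_def by (auto intro: Ck_on_ident)

lemma smooth_on_add:
 "open S ==> smooth_on S f ==> smooth_on S g ==> smooth_on S (\<lambda>x. f x + g x)"
 unfolding smooth_on_def by (auto intro: Ck_on_add)

lemma smooth_on_mult:
 fixes f g :: "'a::euclidean_space => real"
 shows "open S ==> smooth_on S f ==> smooth_on S g ==> smooth_on S (\<lambda>x. f x * g x)"
 unfolding smooth_on_def by (auto intro: Ck_on_mult)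

lemma smooth_on_bounded_linear:
 "open S ==> bounded_linear L ==> smooth_on S f ==> smooth_on S (\<lambda>x. L (f x))"
 unfolding smooth_on_def by (auto intro: Ck_on_bounded_linear)

lemma smooth_on_linear: "open S ==> bounded_linear L ==> smooth_on S L"
 unfolding smooth_on_def by (auto intro: Ck_on_linear)

lemma smooth_on_subset: "smooth_on S f ==> T \<subseteq> S ==> smooth_on T f"
 unfolding smooth_on_def by (auto intro: Ck_on_subset)

lemma smooth_on_Un:
 "open S ==> open T ==> smooth_on S f ==> smooth_on T f ==> smooth_on (S \<union> T) f"
 unfolding smooth_on_def by (auto intro: Ck_on_Un)

lemma smooth_on_cong:
 "open S ==> smooth_on S f ==> (\<And>x. x \<in> S ==> f x = g x) ==> smooth_on S g"
 unfolding smooth_on_def using Ck_on_cong by blast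

lemma smooth_on_minus: "open S ==> smooth_on S f ==> smooth_on S (\<lambda>x. - f x)"
 by (rule smooth_on_bounded_linear[OF _ bounded_linear_minus[OF bounded_linear_ident]])

lemma smooth_on_diff:
 assumes "open S" "smooth_on S f" "smooth_on S g"
 shows "smooth_on S (\<lambda>x. f x - g x)"
 using smooth_on_add[OF assms(1,2) smooth_on_minus[OF assms(1,3)]] by simp

lemma smooth_on_real_polynomial:
 assumes "real_polynomial_function p" shows "smooth_on UNIV p"
 using assms
 by induction (auto intro: smooth_on_linear smooth_on_const smooth_on_add smooth_on_mult)

text \<open>The derivatives of exp (- 1 / x) for x > 0, extended by zero, are linear combinations of these
functions; the power of 1 / x makes the family closed under differentiation.\<close>
definition flat_fun :: "nat => real => real" where
 "flat_fun m x = (if x > 0 then (1 / x) ^ m * exp (- (1 / x)) else 0)"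

lemma flat_fun_nonneg: "0 \<le> flat_fun m x"
 by (simp add: flat_fun_def)

lemma flat_fun_tendsto_0: "(flat_fun m \<longlongrightarrow> 0) (at_right 0)"
proof -
 have "((\<lambda>y. y ^ m / exp y) \<longlongrightarrow> 0) (at_top :: real filter)"
  by (rule tendsto_power_div_exp_0)
 then have "((\<lambda>x. (1 / x) ^ m / exp (1 / x)) \<longlongrightarrow> 0) (at_right (0::real))"
  by (rule filterlim_compose) (simp add: divide_inverse filterlim_inverse_at_top_right)
 then show ?thesis
  by (rule Lim_transform_eventually)
   (auto simp: flat_fun_def exp_minus field_simps eventually_at_right_less intro!: eventually_mono[OF eventually_at_right_less])
qed

lemma flat_fun_deriv:
 "(flat_fun m has_real_derivative (flat_fun (Suc (Suc m)) x - m * flat_fun (Suc m) x)) (at x)"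
proof -
 consider "x > 0" | "x < 0" | "x = 0" by linarith
 then show ?thesis
 proof cases
  case 1
  have "((\<lambda>x. (1 / x) ^ m * exp (- (1 / x))) has_real_derivative
    (flat_fun (Suc (Suc m)) x - m * flat_fun (Suc m) x)) (at x)"
  proof (cases m)
   case 0
   then show ?thesis
    using 1 by (auto intro!: derivative_eq_intros simp: flat_fun_def field_simps power2_eq_square)
  next
   case (Suc n)
   show ?thesis
    using 1 unfolding Suc
    by (cases "n = 0") (auto intro!: derivative_eq_intros
      simp: flat_fun_def field_simps power2_eq_square power_eq_if[of x n])
  qed
  then show ?thesis
   by (rule has_field_derivative_transform_within_open[where S="{0<..}"]) (use 1 in \<open>auto simp: flat_fun_def\<close>)
 next
  case 2
  have "((\<lambda>x. 0) has_real_derivative (flat_fun (Suc (Suc m)) x - m * flat_fun (Suc m) x)) (at x)"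
   using 2 by (simp add: flat_fun_def)
  then show ?thesis
   by (rule has_field_derivative_transform_within_open[where S="{..<0}"]) (use 2 in \<open>auto simp: flat_fun_def\<close>)
 next
  case 3
  have "((\<lambda>h. flat_fun m h / h) \<longlongrightarrow> 0) (at_right 0)"
   by (rule Lim_transform_eventually[OF flat_fun_tendsto_0[of "Suc m"]])
    (auto simp: flat_fun_def field_simps intro!: eventually_mono[OF eventually_at_right_less])
  moreover have "((\<lambda>h. flat_fun m h / h) \<longlongrightarrow> 0) (at_left 0)"
   by (rule Lim_transform_eventually[OF tendsto_const])
    (auto simp: flat_fun_def eventually_at_left_field intro!: exI[of _ "-1"])
  ultimately have "((\<lambda>h. flat_fun m h / h) \<longlongrightarrow> 0) (at 0)"
   by (simp add: filterlim_split_at)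
  then show ?thesis using 3 by (simp add: DERIV_def flat_fun_def[of _ 0])
 qed
qed

lemma Ck_on_real_SucI:
 fixes f :: "real => real"
 assumes "open S" "\<And>x. x \<in> S ==> (f has_real_derivative f' x) (at x)" "Ck_on k S f'"
 shows "Ck_on (Suc k) S f"
 by (rule Ck_on_SucI[OF assms(1), where f'="\<lambda>x h. f' x * h"])
  (use assms in \<open>auto simp: has_field_derivative_def\<close>)

lemma smooth_on_flat_fun: "smooth_on UNIV (flat_fun m)"
proof -
 have "Ck_on k UNIV (flat_fun m)" for k
 proof (induction k arbitrary: m)
  case 0
  show ?case using flat_fun_deriv by (auto intro!: continuous_at_imp_continuous_on DERIV_isCont)
 next
  case (Suc k)
  have "Ck_on k UNIV (\<lambda>x. flat_fun (Suc (Suc m)) x + (- real m) * flat_fun (Suc m) x)"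
   by (intro Ck_on_add Ck_on_mult Ck_on_const Suc) auto
  then show ?case
   by (intro Ck_on_real_SucI[OF _ flat_fun_deriv]) auto
 qed
 then show ?thesis by (simp add: smooth_on_def)
qed

lemma smooth_on_inverse: "smooth_on {0<..} (inverse :: real => real)"
proof -
 have "Ck_on k {0<..} (inverse :: real => real)" for k
 proof (induction k)
  case 0
  show ?case by (auto intro!: continuous_intros)
 next
  case (Suc k)
  have "Ck_on k {0<..} (\<lambda>x::real. (-1) * (inverse x * inverse x))"
   by (intro Ck_on_mult Ck_on_const Suc) auto
  then show ?case
   by (intro Ck_on_real_SucI[where f'="\<lambda>x::real. (-1) * (inverse x * inverse x)"])
    (auto intro!: derivative_eq_intros simp: power2_eq_square)
 qed
 then show ?thesis by (simp add: smooth_on_def)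
qed

text \<open>The denominator never vanishes, because x > 0 or 1 - x > 0. The function rises from 0 to 1 on the
unit interval.\<close>
definition smooth_step :: "real => real" where
 "smooth_step x = flat_fun 0 x * inverse (flat_fun 0 x + flat_fun 0 (1 - x))"

lemma flat_fun_sum_pos: "0 < flat_fun 0 x + flat_fun 0 (1 - x)"
 by (cases "x > 0") (auto simp: flat_fun_def intro: add_pos_nonneg)

lemma smooth_on_smooth_step: "smooth_on UNIV smooth_step"
proof -
 have 1: "smooth_on UNIV (\<lambda>x. flat_fun 0 x + flat_fun 0 (1 - x))"
 proof (rule smooth_on_add[OF open_UNIV smooth_on_flat_fun])
  have "smooth_on UNIV (\<lambda>x::real. 1 - x)"
   by (intro smooth_on_diff smooth_on_const smooth_on_ident open_UNIV)
  then show "smooth_on UNIV (\<lambda>x. flat_fun 0 (1 - x))"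
   by (rule smooth_on_compose[OF open_UNIV open_UNIV _ smooth_on_flat_fun]) simp
 qed
 have "smooth_on UNIV (\<lambda>x. inverse (flat_fun 0 x + flat_fun 0 (1 - x)))"
  by (rule smooth_on_compose[OF _ _ 1 smooth_on_inverse]) (use flat_fun_sum_pos in auto)
 then show ?thesis
  unfolding smooth_step_def [abs_def]
  by (intro smooth_on_mult smooth_on_flat_fun) auto
qed

lemma smooth_step_bounds: "0 \<le> smooth_step x" "smooth_step x \<le> 1"
 using flat_fun_sum_pos[of x] flat_fun_nonneg[of 0 x] flat_fun_nonneg[of 0 "1-x"]
 by (auto simp: smooth_step_def field_simps)

lemma smooth_step_0: "x \<le> 0 ==> smooth_step x = 0"
 by (simp add: smooth_step_def flat_fun_def)

lemma smooth_step_1: "x \<ge> 1 ==> smooth_step x = 1"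
 by (simp add: smooth_step_def flat_fun_def)

lemma smooth_step_has_derivative:
 "(smooth_step has_real_derivative deriv smooth_step x) (at x)"
 unfolding DERIV_deriv_iff_real_differentiable
 using smooth_onD[OF open_UNIV smooth_on_smooth_step UNIV_I] by (rule differentiableI)

lemma deriv_smooth_step_cont: "continuous_on UNIV (deriv smooth_step)"
proof -
 have "deriv smooth_step = (\<lambda>x. fder smooth_step x 1)"
  using frechet_derivative_at[OF smooth_step_has_derivative[unfolded has_field_derivative_def]]
  by (metis (no_types, lifting) ext mult.right_neutral)
 then show ?thesis
  using smooth_on_continuous[OF smooth_on_deriv[OF smooth_on_smooth_step, of 1]] by simp
qed

lemma test_functionD:
 assumes "test_function S \<phi>"
 shows "smooth_on UNIV \<phi>" "continuous_on UNIV \<phi>" "\<phi> \<in> bmeas borel"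
  "\<And>x. x \<notin> S ==> \<phi> x = 0" "(\<phi> has_derivative fder \<phi> x) (at x)"
 using assms smooth_on_continuous smooth_onD[of UNIV \<phi> x]
 by (auto simp: test_function_def intro!: borel_measurable_continuous_onI)

lemma test_function_mono: "test_function S \<phi> ==> S \<subseteq> T ==> test_function T \<phi>"
 unfolding test_function_def by blast

lemma test_function_mult:
 assumes "test_function S \<phi>" "smooth_on UNIV f" shows "test_function S (\<lambda>x. \<phi> x * f x)"
 using assms unfolding test_function_def by (auto intro!: smooth_on_mult)

lemma test_function_cmult: "test_function S \<phi> ==> test_function S (\<lambda>x. c * \<phi> x)"
 using test_function_mult[OF _ smooth_on_const[of UNIV c]] by (simp add: mult.commute)

lemma test_function_add:
 assumes "test_function S f" "test_function S g" shows "test_function S (\<lambda>x. f x + g x)"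
proof -
 obtain K L where "compact K" "compact L" "K \<subseteq> S" "L \<subseteq> S" "\<forall>x. x \<notin> K --> f x = 0" "\<forall>x. x \<notin> L --> g x = 0"
  using assms unfolding test_function_def by blast
 then have "compact (K \<union> L)" "K \<union> L \<subseteq> S" "\<forall>x. x \<notin> K \<union> L --> f x + g x = 0" by auto
 moreover have "smooth_on UNIV (\<lambda>x. f x + g x)"
  using assms by (auto simp: test_function_def intro: smooth_on_add)
 ultimately show ?thesis unfolding test_function_def by blast
qed

lemma test_function_diff:
 assumes "test_function S f" "test_function S g" shows "test_function S (\<lambda>x. f x - g x)"
 using test_function_add[OF assms(1) test_function_cmult[OF assms(2), of "-1"]] by simp

lemma frechet_derivative_zero_outside:
 assumes "closed K" "\<And>x. x \<notin> K ==> f x = 0" "x \<notin> K"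
 shows "fder f x = (\<lambda>h. 0)"
proof -
 have "(f has_derivative (\<lambda>h. 0)) (at x)"
  by (rule has_derivative_transform_within_open[OF has_derivative_const[of 0], of "- K"])
   (use assms in auto)
 then show ?thesis using frechet_derivative_at by metis
qed

lemma test_function_deriv:
 assumes "test_function S \<phi>" "i \<in> Basis"
 shows "test_function S (\<lambda>x. fder \<phi> x i)"
proof -
 obtain K where "compact K" "K \<subseteq> S" "\<And>x. x \<notin> K ==> \<phi> x = 0" and s: "smooth_on UNIV \<phi>"
  using assms unfolding test_function_def by blast
 moreover from this have "\<forall>x. x \<notin> K --> fder \<phi> x i = 0"
  using frechet_derivative_zero_outside[of K \<phi>] by (simp add: compact_imp_closed)
 ultimately show ?thesis unfolding test_function_def
  using smooth_on_deriv[OF s assms(2)] by blast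
qed

lemma test_function_bounded:
 assumes "test_function S \<phi>" obtains B where "B > 0" "\<And>x. \<bar>\<phi> x\<bar> \<le> B"
proof -
 obtain K where K: "compact K" "\<And>x. x \<notin> K ==> \<phi> x = 0"
  using assms unfolding test_function_def by blast
 have "compact (\<phi> ` K)"
  by (rule compact_continuous_image[OF continuous_on_subset[OF test_functionD(2)[OF assms]] K(1)]) simp
 then obtain B where "B > 0" "\<And>y. y \<in> \<phi> ` K ==> norm y \<le> B"
  using compact_imp_bounded bounded_pos by metis
 then have "\<bar>\<phi> x\<bar> \<le> B" for x using K(2)[of x] by (cases "x \<in> K") auto
 with \<open>B > 0\<close> show ?thesis by (rule that)
qed

lemma test_function_integrable:
 assumes "test_function S \<phi>" shows "integ \<phi>"
proof -
 obtain K where K: "compact K" "\<And>x. x \<notin> K ==> \<phi> x = 0"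
  using assms unfolding test_function_def by blast
 have "set_integrable lborel K \<phi>"
  unfolding set_integrable_def using K test_functionD(2)[OF assms]
  by (intro borel_integrable_compact) (auto intro: continuous_on_subset)
 then have "integ (\<lambda>x. ind K x *\<^sub>R \<phi> x)" by (simp add: set_integrable_def)
 moreover have "(\<lambda>x. ind K x *\<^sub>R \<phi> x) = \<phi>" using K(2) by (force simp: indicator_def)
 ultimately show ?thesis by simp
qed

lemma test_function_translate:
 assumes "test_function S \<phi>" "(\<lambda>x. x + y) ` S \<subseteq> T"
 shows "test_function T (\<lambda>x. \<phi> (x - y))"
proof -
 obtain K where K: "compact K" "K \<subseteq> S" "\<And>x. x \<notin> K ==> \<phi> x = 0" and s: "smooth_on UNIV \<phi>"
  using assms unfolding test_function_def by blast
 have "compact ((\<lambda>x. x + y) ` K)" by (intro compact_continuous_image K continuous_intros)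
 moreover have "\<phi> (x - y) = 0" if "x \<notin> (\<lambda>x. x + y) ` K" for x
  using K(3)[of "x - y"] that by (force intro: rev_image_eqI)
 moreover have "smooth_on UNIV (\<lambda>x. \<phi> (x - y))"
  by (rule smooth_on_compose[OF _ _ smooth_on_diff[OF _ smooth_on_ident smooth_on_const] s]) auto
 ultimately show ?thesis unfolding test_function_def
  using K(2) assms(2) by (intro conjI exI[of _ "(\<lambda>x. x + y) ` K"]) auto
qed

lemma frechet_derivative_translate:
 assumes "smooth_on UNIV \<phi>"
 shows "fder (\<lambda>x. \<phi> (x - y)) x = fder \<phi> (x - y)"
proof -
 have "((\<lambda>x. \<phi> (x - y)) has_derivative (\<lambda>h. fder \<phi> (x - y) h)) (at x)"
  by (rule has_derivative_compose[OF _ smooth_onD[OF _ assms]])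
   (auto intro!: derivative_eq_intros)
 then show ?thesis using frechet_derivative_at by metis
qed

text \<open>A smooth step applied to the squared distance: the argument is 1 on the sphere of radius r and
negative outside the ball of radius 2 r.\<close>
lemma ball_bump:
 fixes a :: "'a::euclidean_space"
 assumes "r > 0"
 obtains b :: "'a => real" where "smooth_on UNIV b" "\<And>x. 0 \<le> b x" "\<And>x. b x \<le> 1"
  "\<And>x. x \<in> cball a r ==> b x = 1" "\<And>x. x \<notin> cball a (2 * r) ==> b x = 0"
proof -
 define b where "b = (\<lambda>x. smooth_step (2 - inverse (r^2) * ((x - a) \<bullet> (x - a))))"
 have "smooth_on UNIV (\<lambda>x. (x - a) \<bullet> (x - a))"
 proof -
  have "smooth_on UNIV (\<lambda>x::'a. \<Sum>i\<in>Basis. ((x - a) \<bullet> i) * ((x - a) \<bullet> i))"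
   unfolding smooth_on_def
   by (intro allI Ck_on_sum Ck_on_mult Ck_on_bounded_linear[OF _ bounded_linear_inner_left])
    (use smooth_on_diff[OF _ smooth_on_ident smooth_on_const, of UNIV a] in \<open>auto simp: smooth_on_def\<close>)
  then show ?thesis by (subst euclidean_inner) simp
 qed
 then have "smooth_on UNIV (\<lambda>x. 2 - inverse (r^2) * ((x - a) \<bullet> (x - a)))"
  by (intro smooth_on_diff smooth_on_const smooth_on_mult) auto
 then have "smooth_on UNIV b" unfolding b_def
  by (rule smooth_on_compose[OF _ _ _ smooth_on_smooth_step, rotated 2]) auto
 moreover have "b x = 1" if "x \<in> cball a r" for x
 proof -
  have "(x - a) \<bullet> (x - a) \<le> r\<^sup>2"
   using that by (simp add: power2_norm_eq_inner[symmetric] dist_norm norm_minus_commute power_mono)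
  then show ?thesis using assms by (auto simp: b_def field_simps intro!: smooth_step_1)
 qed
 moreover have "b x = 0" if "x \<notin> cball a (2*r)" for x
 proof -
  have "(2*r)\<^sup>2 \<le> (x - a) \<bullet> (x - a)"
   unfolding power2_norm_eq_inner[symmetric]
   using that assms by (intro power_mono) (auto simp: dist_norm norm_minus_commute)
  then have "4 * r\<^sup>2 \<le> (x - a) \<bullet> (x - a)" by (simp add: power_mult_distrib)
  moreover have "2 * r\<^sup>2 \<le> 4 * r\<^sup>2" by simp
  ultimately have "2 * r\<^sup>2 \<le> (x - a) \<bullet> (x - a)" by linarith
  then show ?thesis using assms by (auto simp: b_def field_simps intro!: smooth_step_0)
 qed
 ultimately show ?thesis using that smooth_step_bounds by (metis b_def)
qed

text \<open>Finitely many bumps b cover the compact set; they are combined by replacing psi with 1 - (1 -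
psi)(1 - b), which stays between 0 and 1 and equals 1 wherever one of the two does.\<close>
lemma compact_cutoff:
 fixes K U :: "'a::euclidean_space set"
 assumes "compact K" "open U" "K \<subseteq> U"
 obtains \<psi> where "test_function U \<psi>" "\<And>x. 0 \<le> \<psi> x" "\<And>x. \<psi> x \<le> 1" "\<And>x. x \<in> K ==> \<psi> x = 1"
proof -
 have "\<forall>x\<in>K. \<exists>r>0. cball x (2 * r) \<subseteq> U"
 proof
  fix x assume "x \<in> K"
  then obtain e where "e > 0" "cball x e \<subseteq> U" using assms open_contains_cball by blast
  then show "\<exists>r>0. cball x (2 * r) \<subseteq> U" by (intro exI[of _ "e/2"]) auto
 qed
 then obtain r where r: "\<And>x. x \<in> K ==> r x > 0 \<and> cball x (2 * r x) \<subseteq> U" by metis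
 obtain C where C: "C \<subseteq> K" "finite C" "K \<subseteq> (\<Union>c\<in>C. ball c (r c))"
  by (rule compactE_image[OF \<open>compact K\<close>, of K "\<lambda>x. ball x (r x)"]) (use r in force)+
 have "\<exists>\<psi>. test_function U \<psi> \<and> (\<forall>x. 0 \<le> \<psi> x \<and> \<psi> x \<le> 1) \<and> (\<forall>x\<in>(\<Union>c\<in>C. ball c (r c)). \<psi> x = 1)"
  using C(2,1)
 proof (induction C)
  case empty
  show ?case by (rule exI[of _ "\<lambda>x. 0"]) (auto simp: test_function_def smooth_on_const)
 next
  case (insert c C)
  then obtain \<psi> where \<psi>: "test_function U \<psi>" "\<forall>x. 0 \<le> \<psi> x \<and> \<psi> x \<le> 1" "\<forall>x\<in>(\<Union>c\<in>C. ball c (r c)). \<psi> x = 1"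
   by auto
  have c: "r c > 0" "cball c (2 * r c) \<subseteq> U" using r insert by auto
  obtain b :: "'a => real" where b: "smooth_on UNIV b" "\<And>x. 0 \<le> b x" "\<And>x. b x \<le> 1"
   "\<And>x. x \<in> cball c (r c) ==> b x = 1" "\<And>x. x \<notin> cball c (2 * r c) ==> b x = 0"
   by (rule ball_bump[OF c(1), of c]) blast
  have tb: "test_function U b" unfolding test_function_def
   using b c(2) by (intro conjI exI[of _ "cball c (2 * r c)"]) auto
  let ?\<psi> = "\<lambda>x. \<psi> x + (b x - b x * \<psi> x)"
  have "test_function U ?\<psi>"
   using test_function_add[OF \<psi>(1) test_function_diff[OF tb test_function_mult[OF tb test_functionD(1)[OF \<psi>(1)]]]] .
  moreover have "0 \<le> ?\<psi> x \<and> ?\<psi> x \<le> 1" for x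
  proof -
   have "0 \<le> \<psi> x + b x * (1 - \<psi> x)" using \<psi>(2) b(2)[of x] by simp
   moreover have "b x * (1 - \<psi> x) \<le> 1 * (1 - \<psi> x)" using \<psi>(2) b(3)[of x] by (intro mult_right_mono) auto
   ultimately show ?thesis by (auto simp: algebra_simps)
  qed
  moreover have "\<forall>x\<in>(\<Union>c\<in>insert c C. ball c (r c)). ?\<psi> x = 1"
   using \<psi>(3) b(4) by (auto simp: less_eq_real_def)
  ultimately show ?case by blast
 qed
 then show ?thesis using that C(3) by blast
qed

section \<open>Density of test functions\<close>

lemma tendsto_if_uniformly_close:
 fixes p g :: "nat => real"
 assumes "\<And>n. \<bar>g n - p n\<bar> < inverse (real (Suc n))" "g ----> l"
 shows "p ----> l"
proof -
 have "(\<lambda>n. g n - p n) ----> 0"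
  by (rule tendsto_rabs_zero_cancel, rule tendsto_sandwich[OF _ _ tendsto_const LIMSEQ_inverse_real_of_nat])
   (use assms(1) in \<open>auto intro!: always_eventually less_imp_le\<close>)
 from tendsto_diff[OF assms(2) this] show ?thesis by simp
qed

text \<open>A measurable function is a limit almost everywhere of continuous functions, these are close to
polynomials on a compact set by the Stone-Weierstrass theorem, and polynomials become test functions by a
cutoff.\<close>
lemma test_function_approx:
 fixes V :: "'a::euclidean_space set" and k :: "'a => real"
 assumes V: "open V" "bounded V" and k: "k \<in> bmeas borel" "\<And>x. 0 \<le> k x" "\<And>x. k x \<le> 1"
 obtains \<psi> :: "nat => 'a => real" where "\<And>n. test_function V (\<psi> n)"
  "\<And>n x. 0 \<le> \<psi> n x" "\<And>n x. \<psi> n x \<le> 1" "AE x in lborel. x \<in> V --> (\<lambda>n. \<psi> n x) ----> k x"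
proof -
 have "k measurable_on UNIV"
  using k(1) by (intro lebesgue_measurable_imp_measurable_on) (auto intro: measurable_completion)
 then obtain N g where N: "negligible N" and g: "\<And>n. continuous_on UNIV (g n)"
  and lim: "\<And>x. x \<notin> N ==> (\<lambda>n. g n x) ----> k x"
  unfolding measurable_on_def by auto
 define h where "h n x = max 0 (min 1 (g n x))" for n x
 have h: "continuous_on UNIV (h n)" for n unfolding h_def using g by (intro continuous_intros)
 have h01: "0 \<le> h n x" "h n x \<le> 1" for n x by (auto simp: h_def)
 have "compact (closure V)" using V by (simp add: compact_closure)
 have "\<exists>p. real_polynomial_function p \<and> (\<forall>x\<in>closure V. \<bar>h n x - p x\<bar> < inverse (real (Suc n)))" for n
  by (rule Stone_Weierstrass_real_polynomial_function[OF \<open>compact (closure V)\<close>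
     continuous_on_subset[OF h[of n] subset_UNIV], of "inverse (real (Suc n))"]) auto
 then obtain p where p: "\<And>n. real_polynomial_function (p n)"
  "\<And>n x. x \<in> closure V ==> \<bar>h n x - p n x\<bar> < inverse (real (Suc n))" by metis
 obtain C where C: "\<And>n. compact (C n)" "\<And>n. C n \<subseteq> V" "\<And>n. C n \<subseteq> interior (C (Suc n))" "\<Union>(range C) = V"
  "\<And>K. [|compact K; K \<subseteq> V|] ==> \<exists>N. \<forall>n\<ge>N. K \<subseteq> C n"
by (rule open_Union_compact_subsets[OF V(1)]) (rule that)
 have "\<forall>n. \<exists>c. test_function V c \<and> (\<forall>x. 0 \<le> c x \<and> c x \<le> 1) \<and> (\<forall>x\<in>C n. c x = 1)"
  using compact_cutoff[OF C(1) V(1) C(2)] by metis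
 then obtain c where c: "\<And>n. test_function V (c n)" "\<And>n x. 0 \<le> c n x" "\<And>n x. c n x \<le> 1"
  "\<And>n x. x \<in> C n ==> c n x = 1" by metis
 \<comment> \<open>The polynomials are within d n of the clipped functions; the affine map sends the interval from - d n to 1 + d n to the unit interval.\<close>
 define d :: "nat => real" where "d n = inverse (real (Suc n))" for n
 define \<psi> where "\<psi> n x = c n x * (inverse (1 + 2 * d n) * (p n x + d n))" for n :: nat and x
 have d: "d n > 0" for n by (simp add: d_def)
 show ?thesis
 proof
  show "test_function V (\<psi> n)" for n
   unfolding \<psi>_def using p(1)
   by (intro test_function_mult[OF c(1)] smooth_on_mult smooth_on_add smooth_on_const smooth_on_real_polynomial) auto
  have *: "0 \<le> inverse (1 + 2 * d n) * (p n x + d n) \<and> inverse (1 + 2 * d n) * (p n x + d n) \<le> 1"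
   if "x \<in> V" for n x
  proof -
   have "\<bar>h n x - p n x\<bar> < d n" using p(2)[of x n] that closure_subset by (auto simp: d_def)
   then have "0 \<le> p n x + d n" "p n x + d n \<le> 1 + 2 * d n" using h01[of n x] by linarith+
   then show ?thesis using d[of n] by (simp add: field_simps)
  qed
  have z: "c n x = 0" if "x \<notin> V" for n x using test_functionD(4)[OF c(1)] that by blast
  show "0 \<le> \<psi> n x" "\<psi> n x \<le> 1" for n x
   using *[of x n] z[of x n] c(2,3)[of n x] by (cases "x \<in> V"; auto simp: \<psi>_def intro: mult_le_one)+
  have "N \<in> null_sets lebesgue" using N negligible_iff_null_sets by blast
  then have "AE x in lborel. x \<notin> N"
   using AE_completion_iff[of "\<lambda>x. x \<notin> N" lborel] AE_not_in by blast
  then show "AE x in lborel. x \<in> V --> (\<lambda>n. \<psi> n x) ----> k x"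
  proof (rule AE_mp, intro AE_I2 impI)
   fix x assume x: "x \<notin> N" "x \<in> V"
   have "(\<lambda>n. h n x) ----> max 0 (min 1 (k x))"
    unfolding h_def using lim[OF x(1)] by (intro tendsto_intros)
   then have "(\<lambda>n. h n x) ----> k x" using k(2,3)[of x] by simp
   then have pl: "(\<lambda>n. p n x) ----> k x"
    using tendsto_if_uniformly_close[of "\<lambda>n. h n x" "\<lambda>n. p n x"] p(2) x(2) closure_subset by blast
   have dl: "d ----> 0" using LIMSEQ_inverse_real_of_nat by (simp add: d_def[abs_def])
   have "\<exists>M. \<forall>n\<ge>M. {x} \<subseteq> C n" using C(5)[of "{x}"] x by auto
   then have "\<forall>\<^sub>F n in sequentially. c n x = 1"
    using c(4) by (auto simp: eventually_sequentially)
   then have "(\<lambda>n. c n x) ----> 1" by (rule tendsto_eventually)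
   then have "(\<lambda>n. \<psi> n x) ----> 1 * (inverse (1 + 2 * 0) * (k x + 0))"
    unfolding \<psi>_def by (intro tendsto_intros pl dl) auto
   then show "(\<lambda>n. \<psi> n x) ----> k x" by simp
  qed
 qed
qed

lemma integrable_bounded_mult:
 fixes f g :: "'a::euclidean_space => real"
 assumes "integ f" "g \<in> bmeas borel" "\<And>x. \<bar>g x\<bar> \<le> B"
 shows "integ (\<lambda>x. g x * f x)"
proof (rule Bintegrable_bound[of _ "\<lambda>x. B * f x"])
 show "AE x in lborel. norm (g x * f x) \<le> norm (B * f x)"
  using assms(3) by (auto simp: abs_mult intro!: AE_I2 mult_right_mono order_trans[OF assms(3) abs_ge_self])
qed (use assms in auto)

lemma test_function_approx_integral:
 fixes V :: "'a::euclidean_space set" and g k :: "'a => real"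
 assumes V: "open V" "bounded V" and k: "k \<in> bmeas borel" "\<And>x. 0 \<le> k x" "\<And>x. k x \<le> 1"
  and g: "integ g"
  and \<psi>: "\<And>n. test_function V (\<psi> n)" "\<And>n x. 0 \<le> \<psi> n x" "\<And>n x. \<psi> n x \<le> 1"
    "AE x in lborel. x \<in> V --> (\<lambda>n. \<psi> n x) ----> k x"
 shows "(\<lambda>n. LL x. \<psi> n x * g x) ----> (LL x. ind V x * k x * g x)"
proof (rule integral_dominated_convergence[where w="\<lambda>x. \<bar>g x\<bar>"])
 have [measurable]: "g \<in> bmeas borel" "V \<in> sets borel"
  using g V by auto
 have [measurable]: "\<psi> n \<in> bmeas borel" for n using test_functionD(3)[OF \<psi>(1)] .
 note k(1)[measurable]
 show "(\<lambda>x. ind V x * k x * g x) \<in> bmeas lborel"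
  "(\<lambda>x. \<psi> n x * g x) \<in> bmeas lborel" for n by measurable
 show "integ (\<lambda>x. \<bar>g x\<bar>)" using g by simp
 show "AE x in lborel. norm (\<psi> n x * g x) \<le> \<bar>g x\<bar>" for n
  using \<psi>(2,3)[of n] by (auto simp: abs_mult intro!: AE_I2 mult_left_le_one_le)
 show "AE x in lborel. (\<lambda>n. \<psi> n x * g x) ----> ind V x * k x * g x"
  using \<psi>(4)
 proof (rule AE_mp, intro AE_I2 impI)
  fix x assume *: "x \<in> V --> (\<lambda>n. \<psi> n x) ----> k x"
  have "\<psi> n x = 0" if "x \<notin> V" for n using test_functionD(4)[OF \<psi>(1)] that by blast
  with * show "(\<lambda>n. \<psi> n x * g x) ----> ind V x * k x * g x"
   by (cases "x \<in> V") (auto intro: tendsto_mult_right)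
 qed
qed

text \<open>Testing with approximations of the indicator of the set where g is negative.\<close>
lemma AE_nonneg_if_test_nonneg:
 fixes V :: "'a::euclidean_space set" and g :: "'a => real"
 assumes V: "open V" "bounded V" and g: "integ g"
  and pos: "\<And>\<psi>. test_function V \<psi> ==> (\<And>x. 0 \<le> \<psi> x) ==> 0 \<le> (LL x. \<psi> x * g x)"
 shows "AE x in lborel. x \<in> V --> 0 \<le> g x"
proof -
 have [measurable]: "g \<in> bmeas borel" "V \<in> sets borel" using g V by auto
 define k :: "'a => real" where "k = ind {x. g x < 0}"
 have k[measurable]: "k \<in> bmeas borel" unfolding k_def by measurable
 obtain \<psi> where \<psi>: "\<And>n. test_function V (\<psi> n)" "\<And>n x. 0 \<le> \<psi> n x" "\<And>n x. \<psi> n x \<le> 1"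
    "AE x in lborel. x \<in> V --> (\<lambda>n. \<psi> n x) ----> k x"
  by (rule test_function_approx[OF V k]) (auto simp: k_def)
 have "(\<lambda>n. LL x. \<psi> n x * g x) ----> (LL x. ind V x * k x * g x)"
  by (rule test_function_approx_integral[OF V k _ _ g \<psi>]) (auto simp: k_def)
 then have 1: "0 \<le> (LL x. ind V x * k x * g x)"
  using pos[OF \<psi>(1,2)] by (intro LIMSEQ_le_const) auto
 have int: "integ (\<lambda>x. - (ind V x * k x * g x))"
  using integrable_bounded_mult[OF g, of "\<lambda>x. ind V x * k x" 1]
  by (auto simp: k_def indicator_def)
 have nn: "0 \<le> - (ind V x * k x * g x)" for x by (auto simp: k_def indicator_def)
 have "(LL x. - (ind V x * k x * g x)) = 0"
  using 1 Bintegral_nonneg[of lborel "\<lambda>x. - (ind V x * k x * g x)"] nn by simp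
 then have "AE x in lborel. - (ind V x * k x * g x) = 0"
  using integral_nonneg_eq_0_iff_AE[OF int] nn by auto
 then show ?thesis by (rule AE_mp) (auto simp: k_def indicator_def intro!: AE_I2)
qed

lemma AE_zero_if_test_zero:
 fixes V :: "'a::euclidean_space set" and g :: "'a => real"
 assumes V: "open V" "bounded V" and g: "integ g"
  and zero: "\<And>\<psi>. test_function V \<psi> ==> (LL x. \<psi> x * g x) = 0"
 shows "AE x in lborel. x \<in> V --> g x = 0"
proof -
 have "AE x in lborel. x \<in> V --> 0 \<le> g x"
  by (rule AE_nonneg_if_test_nonneg[OF V g]) (simp add: zero)
 moreover have "AE x in lborel. x \<in> V --> 0 \<le> - g x"
  by (rule AE_nonneg_if_test_nonneg[OF V]) (use g in \<open>auto simp: zero\<close>)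
 ultimately show ?thesis by eventually_elim auto
qed

lemma abs_diff_le_one: "0 \<le> (a::real) ==> a \<le> 1 ==> 0 \<le> b ==> b \<le> 1 ==> \<bar>a - b\<bar> \<le> 1"
 by linarith

text \<open>The supremum over test functions is attained in the limit of approximations of the sign of g,
written as the difference of the indicators of the sets where g is positive and negative.\<close>
lemma L1_norm_le_if_test_le:
 fixes V :: "'a::euclidean_space set" and g :: "'a => real"
 assumes V: "open V" "bounded V" and g: "integ g"
  and le: "\<And>\<psi>. test_function V \<psi> ==> (\<And>x. \<bar>\<psi> x\<bar> \<le> 1) ==> (LL x. \<psi> x * g x) \<le> K"
 shows "(LL x. ind V x * \<bar>g x\<bar>) \<le> K"
proof -
 have [measurable]: "g \<in> bmeas borel" "V \<in> sets borel" using g V by auto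
 define k :: "real => 'a => real" where "k s = ind {x. s * g x < 0}" for s
 have k[measurable]: "k s \<in> bmeas borel" for s unfolding k_def by measurable
 have "\<exists>\<psi>. (\<forall>n. test_function V (\<psi> n)) \<and> (\<forall>n x. 0 \<le> \<psi> n x \<and> \<psi> n x \<le> 1) \<and>
  (\<lambda>n. LL x. \<psi> n x * g x) ----> (LL x. ind V x * k s x * g x)" for s
 proof -
  obtain \<psi> where \<psi>: "\<And>n. test_function V (\<psi> n)" "\<And>n x. 0 \<le> \<psi> n x" "\<And>n x. \<psi> n x \<le> 1"
     "AE x in lborel. x \<in> V --> (\<lambda>n. \<psi> n x) ----> k s x"
   by (rule test_function_approx[OF V k, of s]) (auto simp: k_def)
  have "(\<lambda>n. LL x. \<psi> n x * g x) ----> (LL x. ind V x * k s x * g x)"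
   by (rule test_function_approx_integral[OF V k _ _ g \<psi>]) (auto simp: k_def)
  with \<psi> show ?thesis by blast
 qed
 then have "\<forall>s. \<exists>\<psi>. (\<forall>n. test_function V (\<psi> n)) \<and> (\<forall>n x. 0 \<le> \<psi> n x \<and> \<psi> n x \<le> 1) \<and>
  (\<lambda>n. LL x. \<psi> n x * g x) ----> (LL x. ind V x * k s x * g x)" by blast
 from choice[OF this] obtain \<psi> where "\<forall>s. (\<forall>n. test_function V (\<psi> s n)) \<and> (\<forall>n x. 0 \<le> \<psi> s n x \<and> \<psi> s n x \<le> 1) \<and>
  (\<lambda>n. LL x. \<psi> s n x * g x) ----> (LL x. ind V x * k s x * g x)" ..
 then have \<psi>: "\<And>s n. test_function V (\<psi> s n)" "\<And>s n x. 0 \<le> \<psi> s n x" "\<And>s n x. \<psi> s n x \<le> 1"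
  and lim: "\<And>s. (\<lambda>n. LL x. \<psi> s n x * g x) ----> (LL x. ind V x * k s x * g x)"
  by simp_all
 have int: "integ (\<lambda>x. \<psi> s n x * g x)" for s n
  using test_functionD(3)[OF \<psi>(1)] \<psi>(2,3) by (intro integrable_bounded_mult[OF g, where B=1]) auto
 have int2: "integ (\<lambda>x. ind V x * k s x * g x)" for s
  using integrable_bounded_mult[OF g, of "\<lambda>x. ind V x * k s x" 1]
  by (auto simp: k_def indicator_def)
 have "(LL x. \<psi> (-1) n x * g x) - (LL x. \<psi> 1 n x * g x) \<le> K" for n
 proof -
  have "(LL x. (\<psi> (-1) n x - \<psi> 1 n x) * g x) \<le> K"
   by (rule le[OF test_function_diff[OF \<psi>(1) \<psi>(1)]]) (intro abs_diff_le_one \<psi>)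
  then show ?thesis using int by (simp add: left_diff_distrib)
 qed
 then have "(LL x. ind V x * k (-1) x * g x) - (LL x. ind V x * k 1 x * g x) \<le> K"
  using tendsto_diff[OF lim[of "-1"] lim[of 1]] by (intro LIMSEQ_le_const2) auto
 moreover have "(LL x. ind V x * k (-1) x * g x) - (LL x. ind V x * k 1 x * g x)
   = (LL x. ind V x * k (-1) x * g x - ind V x * k 1 x * g x)"
  by (rule Bintegral_diff[symmetric]) (rule int2)+
 moreover have "ind V x * k (-1) x * g x - ind V x * k 1 x * g x = ind V x * \<bar>g x\<bar>" for x
  by (auto simp: k_def indicator_def)
 ultimately show ?thesis by simp
qed

section \<open>Translations\<close>

lemma nn_integral_translate:
 fixes f :: "'a::euclidean_space => ennreal"
 assumes [measurable]: "f \<in> bmeas borel"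
 shows "(NN x. f (x + y)) = (NN x. f x)"
 by (subst lborel_distr_plus[of y, symmetric], subst nn_integral_distr) (auto simp: add.commute)

lemma integrable_translate:
 fixes f :: "'a::euclidean_space => real"
 assumes "integ f"
 shows "integ (\<lambda>x. f (x + y))"
proof -
 have [measurable]: "f \<in> bmeas borel" using assms by simp
 have "integrable (distr lborel borel ((+) y)) f" using assms by (simp add: lborel_distr_plus)
 then show ?thesis by (subst (asm) integrable_distr_eq) (auto simp: add.commute)
qed

lemma integral_translate:
 fixes f :: "'a::euclidean_space => real"
 assumes [measurable]: "f \<in> bmeas borel"
 shows "(LL x. f (x + y)) = (LL x. f x)"
 by (subst lborel_distr_plus[of y, symmetric], subst integral_distr) (auto simp: add.commute)

text \<open>Truncation in space and in value reduces the claim to bounded functions T n on a ball; the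
positive and the negative part of T n, divided by n, take values in the unit interval and are approximated
separately.\<close>
lemma test_functions_dense_L1:
 fixes f :: "'a::euclidean_space => real"
 assumes f: "integ f" and "e > 0"
 obtains R \<phi> where "R > 0" "test_function (ball 0 R) \<phi>" "(LL x. \<bar>f x - \<phi> x\<bar>) < e"
proof -
 have [measurable]: "f \<in> bmeas borel" using f by simp
 define T where "T n x = ind (ball 0 (real n)) x * max (- real n) (min (real n) (f x))" for n x
 have [measurable]: "T n \<in> bmeas borel" for n unfolding T_def
  by (intro borel_measurable_times borel_measurable_indicator borel_measurable_max borel_measurable_min) auto
 have Tb: "\<bar>T n x\<bar> \<le> real n" for n x by (auto simp: T_def indicator_def)
 have Tf: "\<bar>T n x\<bar> \<le> \<bar>f x\<bar>" for n x by (auto simp: T_def indicator_def)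
 have intT: "integ (T n)" for n
  by (rule Bintegrable_bound[OF f]) (use Tf in auto)
 have "(\<lambda>n. LL x. \<bar>f x - T n x\<bar>) ----> (LINT x|(lborel::'a measure). (0::real))"
 proof (rule integral_dominated_convergence[where w="\<lambda>x. 2 * \<bar>f x\<bar>"])
  show "AE x in lborel. norm \<bar>f x - T n x\<bar> \<le> 2 * \<bar>f x\<bar>" for n
  proof (intro AE_I2)
   show "norm \<bar>f x - T n x\<bar> \<le> 2 * \<bar>f x\<bar>" for x using Tf[of n x] by simp
  qed
  show "AE x in lborel. (\<lambda>n. \<bar>f x - T n x\<bar>) ----> 0"
  proof (intro AE_I2 tendsto_eventually)
   fix x
   show "\<forall>\<^sub>F n in sequentially. \<bar>f x - T n x\<bar> = 0"
    using eventually_gt_at_top[of "nat \<lceil>max \<bar>f x\<bar> (norm x)\<rceil>"]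
   proof eventually_elim
    case (elim n)
    then have "max \<bar>f x\<bar> (norm x) < real n" by linarith
    then show ?case by (auto simp: T_def indicator_def)
   qed
  qed
 qed (use f in auto)
 then have "\<forall>\<^sub>F n in sequentially. (LL x. \<bar>f x - T n x\<bar>) < e / 2"
  using \<open>e > 0\<close> by (intro order_tendstoD) auto
 then obtain n where n: "(LL x. \<bar>f x - T n x\<bar>) < e / 2" "n > 0"
  using eventually_conj[OF _ eventually_gt_at_top[of 0]] eventually_happens by (metis (mono_tags, lifting) sequentially_bot)
 let ?V = "ball (0::'a) (real n)"
 define k where "k s x = max 0 (s * T n x / n)" for s x
 have k[measurable]: "k s \<in> bmeas borel" for s unfolding k_def by measurable
 have k01: "0 \<le> k s x" "s \<in> {1,-1} ==> k s x \<le> 1" for s x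
  using Tb[of n x] n(2) by (auto simp: k_def field_simps)
 have Tk: "T n x = n * (k 1 x - k (-1) x)" for x using n(2) by (auto simp: k_def max_def field_simps)
 obtain \<psi>1 where \<psi>1: "\<And>m. test_function ?V (\<psi>1 m)" "\<And>m x. 0 \<le> \<psi>1 m x" "\<And>m x. \<psi>1 m x \<le> 1"
    "AE x in lborel. x \<in> ?V --> (\<lambda>m. \<psi>1 m x) ----> k 1 x"
  by (rule test_function_approx[OF open_ball bounded_ball k k01(1) k01(2), of 1 0 "real n"]) auto
 obtain \<psi>2 where \<psi>2: "\<And>m. test_function ?V (\<psi>2 m)" "\<And>m x. 0 \<le> \<psi>2 m x" "\<And>m x. \<psi>2 m x \<le> 1"
    "AE x in lborel. x \<in> ?V --> (\<lambda>m. \<psi>2 m x) ----> k (-1) x"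
  by (rule test_function_approx[OF open_ball bounded_ball k k01(1) k01(2), of "-1" 0 "real n"]) auto
 define \<phi> where "\<phi> m x = n * (\<psi>1 m x - \<psi>2 m x)" for m x
 have \<phi>: "test_function ?V (\<phi> m)" for m
  unfolding \<phi>_def by (intro test_function_cmult test_function_diff \<psi>1 \<psi>2)
 have [measurable]: "\<phi> m \<in> bmeas borel" for m using test_functionD(3)[OF \<phi>] .
 have \<phi>b: "\<bar>\<phi> m x\<bar> \<le> real n" for m x
 proof -
  have "\<bar>\<psi>1 m x - \<psi>2 m x\<bar> \<le> 1" by (intro abs_diff_le_one \<psi>1 \<psi>2)
  then show ?thesis using n(2) by (simp add: \<phi>_def abs_mult)
 qed
 have intV: "integ (\<lambda>x. (2 * real n) * ind ?V x :: real)"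
  using emeasure_lborel_ball_finite[of "0::'a" "real n"]
  by (intro integrable_mult_right) (auto intro!: integrable_real_indicator)
 have "(\<lambda>m. LL x. \<bar>T n x - \<phi> m x\<bar>) ----> (LINT x|(lborel::'a measure). (0::real))"
 proof (rule integral_dominated_convergence[OF _ _ intV])
  show "AE x in lborel. norm \<bar>T n x - \<phi> m x\<bar> \<le> 2 * real n * ind ?V x" for m
  proof (intro AE_I2)
   fix x
   show "norm \<bar>T n x - \<phi> m x\<bar> \<le> 2 * real n * ind ?V x"
    using Tb[of n x] \<phi>b[of m x] test_functionD(4)[OF \<phi>[of m], of x]
    by (cases "x \<in> ?V") (auto simp: T_def)
  qed
  show "AE x in lborel. (\<lambda>m. \<bar>T n x - \<phi> m x\<bar>) ----> 0"
   using \<psi>1(4) \<psi>2(4)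
  proof eventually_elim
   case (elim x)
   show ?case
   proof (cases "x \<in> ?V")
    case True
    then have "(\<lambda>m. \<bar>T n x - \<phi> m x\<bar>) ----> \<bar>T n x - n * (k 1 x - k (-1) x)\<bar>"
     unfolding \<phi>_def using elim by (intro tendsto_intros) auto
    then show ?thesis by (simp add: Tk)
   next
    case False
    then show ?thesis using test_functionD(4)[OF \<phi>, of x] by (auto simp: T_def)
   qed
  qed
 qed measurable
 then have "\<forall>\<^sub>F m in sequentially. (LL x. \<bar>T n x - \<phi> m x\<bar>) < e / 2"
  using \<open>e > 0\<close> by (intro order_tendstoD) auto
 then obtain m where m: "(LL x. \<bar>T n x - \<phi> m x\<bar>) < e / 2"
  using eventually_happens by (metis (mono_tags, lifting) sequentially_bot)
 have int\<phi>: "integ (\<phi> m)" using test_function_integrable[OF \<phi>] .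
 have "(LL x. \<bar>f x - \<phi> m x\<bar>) \<le> (LL x. \<bar>f x - T n x\<bar> + \<bar>T n x - \<phi> m x\<bar>)"
  using f intT int\<phi> by (intro integral_mono) auto
 also have "\<dots> = (LL x. \<bar>f x - T n x\<bar>) + (LL x. \<bar>T n x - \<phi> m x\<bar>)"
  using f intT int\<phi> by simp
 finally have "(LL x. \<bar>f x - \<phi> m x\<bar>) < e" using n m by simp
 then show ?thesis using that[OF _ \<phi>[of m]] n(2) by simp
qed

lemma L1_translation_continuous:
 fixes f :: "'a::euclidean_space => real"
 assumes f: "integ f" and h: "h ----> 0"
 shows "(\<lambda>n. LL x. \<bar>f (x + h n) - f x\<bar>) ----> 0"
proof (rule LIMSEQ_I)
 fix e :: real assume "e > 0"
 obtain R \<phi> where R: "R > 0" and \<phi>: "test_function (ball 0 R) \<phi>" and e: "(LL x. \<bar>f x - \<phi> x\<bar>) < e / 3"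
  using test_functions_dense_L1[OF f, of "e/3"] \<open>e > 0\<close> by auto
 have [measurable]: "f \<in> bmeas borel" "\<phi> \<in> bmeas borel"
  using f test_functionD(3)[OF \<phi>] by auto
 have int\<phi>: "integ \<phi>" using test_function_integrable[OF \<phi>] .
 obtain B where B: "B > 0" "\<And>x. \<bar>\<phi> x\<bar> \<le> B" using test_function_bounded[OF \<phi>] by blast
 let ?W = "ball (0::'a) (R + 1)"
 have intW: "integ (\<lambda>x. 2 * B * ind ?W x :: real)"
  using emeasure_lborel_ball_finite[of "0::'a" "R + 1"]
  by (intro integrable_mult_right) (auto intro!: integrable_real_indicator)
 obtain N where N: "\<And>n. n \<ge> N ==> norm (h n) < 1" using LIMSEQ_D[OF h, of 1] by auto
 have "(\<lambda>n. LL x. \<bar>\<phi> (x + h (n + N)) - \<phi> x\<bar>) ----> (LINT x|(lborel::'a measure). (0::real))"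
 proof (rule integral_dominated_convergence[OF _ _ intW])
  show "AE x in lborel. norm \<bar>\<phi> (x + h (n + N)) - \<phi> x\<bar> \<le> 2 * B * ind ?W x" for n
  proof (intro AE_I2)
   fix x
   have "\<phi> (x + h (n + N)) = 0 \<and> \<phi> x = 0" if "x \<notin> ?W"
   proof -
    have "norm x \<le> norm (x + h (n + N)) + norm (h (n + N))"
     using norm_triangle_ineq4[of "x + h (n + N)" "h (n + N)"] by simp
    then have "x + h (n + N) \<notin> ball 0 R" "x \<notin> ball 0 R" using that N[of "n + N"] by auto
    then show ?thesis using test_functionD(4)[OF \<phi>] by blast
   qed
   then show "norm \<bar>\<phi> (x + h (n + N)) - \<phi> x\<bar> \<le> 2 * B * ind ?W x"
    using B(2)[of x] B(2)[of "x + h (n + N)"] by (cases "x \<in> ?W") auto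
  qed
  have "(\<lambda>n. h (n + N)) ----> 0" using h by (rule LIMSEQ_ignore_initial_segment)
  then have xl: "(\<lambda>n. x + h (n + N)) ----> x" for x using tendsto_add[OF tendsto_const, of _ 0 _ x] by simp
  have "isCont \<phi> x" for x
   using test_functionD(2)[OF \<phi>] continuous_on_eq_continuous_at by blast
  then have "(\<lambda>n. \<phi> (x + h (n + N))) ----> \<phi> x" for x
   using xl isCont_tendsto_compose by blast
  from tendsto_rabs_zero[OF LIM_zero[OF this]]
  show "AE x in lborel. (\<lambda>n. \<bar>\<phi> (x + h (n + N)) - \<phi> x\<bar>) ----> 0"
   by (intro AE_I2)
 qed measurable
 then have "\<forall>\<^sub>F n in sequentially. (LL x. \<bar>\<phi> (x + h (n + N)) - \<phi> x\<bar>) < e / 3"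
  using \<open>e > 0\<close> by (intro order_tendstoD) auto
 then obtain M where M: "\<And>n. n \<ge> M ==> (LL x. \<bar>\<phi> (x + h (n + N)) - \<phi> x\<bar>) < e / 3"
  unfolding eventually_sequentially by auto
 show "\<exists>no. \<forall>n\<ge>no. norm ((LL x. \<bar>f (x + h n) - f x\<bar>) - 0) < e"
 proof (intro exI[of _ "M + N"] allI impI)
  fix n assume n: "n \<ge> M + N"
  then have *: "(LL x. \<bar>\<phi> (x + h n) - \<phi> x\<bar>) < e / 3" using M[of "n - N"] by simp
  note i = f int\<phi> integrable_translate[OF f, of "h n"] integrable_translate[OF int\<phi>, of "h n"]
  have tr: "(LL x. \<bar>f (x + h n) - \<phi> (x + h n)\<bar>) = (LL x. \<bar>f x - \<phi> x\<bar>)"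
   using integral_translate[of "\<lambda>x. \<bar>f x - \<phi> x\<bar>" "h n"] by simp
  have "(LL x. \<bar>f (x + h n) - f x\<bar>)
    \<le> (LL x. \<bar>f (x + h n) - \<phi> (x + h n)\<bar> + \<bar>\<phi> (x + h n) - \<phi> x\<bar> + \<bar>f x - \<phi> x\<bar>)"
   using i by (intro integral_mono) auto
  also have "\<dots> = (LL x. \<bar>f x - \<phi> x\<bar>) + (LL x. \<bar>\<phi> (x + h n) - \<phi> x\<bar>) + (LL x. \<bar>f x - \<phi> x\<bar>)"
   using i tr by simp
  finally have "(LL x. \<bar>f (x + h n) - f x\<bar>) < e" using * e by simp
  then show "norm ((LL x. \<bar>f (x + h n) - f x\<bar>) - 0) < e"
   using Bintegral_nonneg[of lborel "\<lambda>x. \<bar>f (x + h n) - f x\<bar>"] by simp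
 qed
qed

section \<open>Weak derivatives of integrable scalar functions\<close>

text \<open>Weak derivatives in an arbitrary direction, for Borel functions that are integrable over the whole
space. The domain only restricts the test functions; in the applications f and g vanish outside of it.\<close>
definition wd :: "'a::euclidean_space set => 'a => ('a => real) => ('a => real) => bool" where
 "wd X y f g \<longleftrightarrow> integ f \<and> integ g \<and>
   (\<forall>\<phi>. test_function X \<phi> -->
    (LL x. fder \<phi> x y * f x) = - (LL x. \<phi> x * g x))"

lemma wdD:
 assumes "wd X y f g"
 shows "integ f" "integ g"
  "\<And>\<phi>. test_function X \<phi> ==> (LL x. fder \<phi> x y * f x) = - (LL x. \<phi> x * g x)"
  "f \<in> bmeas borel" "g \<in> bmeas borel"
 using assms by (auto simp: wd_def dest: borel_measurable_integrable)

lemma test_function_directional_deriv: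
 assumes "test_function S \<phi>"
 shows "test_function S (\<lambda>x. fder \<phi> x y)"
proof -
 have eq: "fder \<phi> x y = (\<Sum>j\<in>Basis. (y \<bullet> j) *\<^sub>R fder \<phi> x j)" for x
  by (rule linear_basis_expansion) (rule has_derivative_linear[OF test_functionD(5)[OF assms]])
 have "test_function S (\<lambda>x. \<Sum>j\<in>J. (y \<bullet> j) * fder \<phi> x j)"
  if "finite J" "J \<subseteq> Basis" for J
  using that
 proof induction
  case empty
  then show ?case by (auto simp: test_function_def smooth_on_const intro: exI[of _ "{}"])
 next
  case (insert j J)
  then show ?case
   by simp (intro test_function_add test_function_cmult test_function_deriv assms; simp)
 qed
 then show ?thesis unfolding eq by simp
qed

lemma test_mult_integrable:
 assumes "test_function S \<phi>" "integ f"
 shows "integ (\<lambda>x. \<phi> x * f x)"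
proof -
 obtain B where B: "\<And>x. \<bar>\<phi> x\<bar> \<le> B" using test_function_bounded[OF assms(1)] by blast
 then show ?thesis using integrable_bounded_mult[OF assms(2) test_functionD(3)[OF assms(1)] B] by simp
qed

lemma wd_direction:
 assumes "\<And>j. j \<in> Basis ==> wd X j f (g j)"
 shows "wd X y f (\<lambda>x. \<Sum>j\<in>Basis. (y \<bullet> j) * g j x)"
proof -
 obtain b :: 'a where b: "b \<in> Basis" using nonempty_Basis by blast
 note f = wdD(1)[OF assms[OF b]]
 note g = wdD(2)[OF assms]
 show ?thesis unfolding wd_def
 proof (intro conjI allI impI f)
  show "integ (\<lambda>x. \<Sum>j\<in>Basis. (y \<bullet> j) * g j x)"
   using g by auto
  fix \<phi> assume \<phi>: "test_function X \<phi>"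
  have "(LL x. fder \<phi> x y * f x)
    = (LL x. (\<Sum>j\<in>Basis. (y \<bullet> j) * (fder \<phi> x j * f x)))"
   by (subst linear_basis_expansion[OF has_derivative_linear[OF test_functionD(5)[OF \<phi>]], of _ y])
    (simp add: sum_distrib_right mult.assoc)
  also have "\<dots> = (\<Sum>j\<in>Basis. (y \<bullet> j) * (LL x. fder \<phi> x j * f x))"
   using test_mult_integrable[OF test_function_deriv[OF \<phi>] f]
   by (subst Bintegral_sum) auto
  also have "\<dots> = (\<Sum>j\<in>Basis. (y \<bullet> j) * - (LL x. \<phi> x * g j x))"
   using wdD(3)[OF assms \<phi>] by simp
  also have "\<dots> = - (LL x. (\<Sum>j\<in>Basis. (y \<bullet> j) * (\<phi> x * g j x)))"
   using test_mult_integrable[OF \<phi> g]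
   by (subst Bintegral_sum) (auto simp: sum_negf)
  also have "\<dots> = - (LL x. \<phi> x * (\<Sum>j\<in>Basis. (y \<bullet> j) * g j x))"
   by (simp add: sum_distrib_left algebra_simps)
  finally show "(LL x. fder \<phi> x y * f x) = - (LL x. \<phi> x * (\<Sum>j\<in>Basis. (y \<bullet> j) * g j x))" .
 qed
qed

lemma wd_scale_direction:
 assumes "wd X i f g" shows "wd X (c *\<^sub>R i) f (\<lambda>x. c * g x)"
proof -
 have "(LL x. fder \<phi> x (c *\<^sub>R i) * f x) = - (LL x. \<phi> x * (c * g x))"
  if "test_function X \<phi>" for \<phi>
 proof -
  have "fder \<phi> x (c *\<^sub>R i) = c * fder \<phi> x i" for x
   using linear_scale[OF has_derivative_linear[OF test_functionD(5)[OF that]]] by simp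
  then have "(LL x. fder \<phi> x (c *\<^sub>R i) * f x) = (LL x. c * (fder \<phi> x i * f x))"
   by (simp add: mult.assoc)
  also have "\<dots> = - (LL x. c * (\<phi> x * g x))"
   using wdD(3)[OF assms that] by simp
  finally show ?thesis by (simp only: mult.left_commute)
 qed
 then show ?thesis using assms by (simp add: wd_def)
qed

lemma wd_add:
 assumes "wd X y f1 g1" "wd X y f2 g2" shows "wd X y (\<lambda>x. f1 x + f2 x) (\<lambda>x. g1 x + g2 x)"
 unfolding wd_def
proof (intro conjI allI impI)
 fix \<phi> assume \<phi>: "test_function X \<phi>"
 note i = test_mult_integrable[OF \<phi>] test_mult_integrable[OF test_function_directional_deriv[OF \<phi>, of y]]
 show "(LL x. fder \<phi> x y * (f1 x + f2 x)) = - (LL x. \<phi> x * (g1 x + g2 x))"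
  using i wdD(1,2)[OF assms(1)] wdD(1,2)[OF assms(2)] wdD(3)[OF assms(1) \<phi>] wdD(3)[OF assms(2) \<phi>]
  by (simp add: distrib_left)
qed (use assms in \<open>auto simp: wd_def\<close>)

lemma wd_cmult:
 assumes "wd X y f g" shows "wd X y (\<lambda>x. c * f x) (\<lambda>x. c * g x)"
 unfolding wd_def
proof (intro conjI allI impI)
 fix \<phi> assume \<phi>: "test_function X \<phi>"
 have "(LL x. fder \<phi> x y * (c * f x)) = c * (LL x. fder \<phi> x y * f x)"
  "(LL x. \<phi> x * (c * g x)) = c * (LL x. \<phi> x * g x)"
  by (simp_all add: mult.left_commute[of _ c])
 then show "(LL x. fder \<phi> x y * (c * f x)) = - (LL x. \<phi> x * (c * g x))"
  using wdD(3)[OF assms \<phi>] by simp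
qed (use assms in \<open>auto simp: wd_def\<close>)

section \<open>Averages along a segment\<close>

lemma segment_integrable:
 fixes f :: "'a::euclidean_space => real"
 assumes f: "integ f"
 shows "integrable (lborel \<Otimes>\<^sub>M lborel) (\<lambda>(t, x). ind {0..1::real} t * f (x + t *\<^sub>R y))"
proof (rule lborel_pair.Fubini_integrable)
 have [measurable]: "f \<in> bmeas borel" using f by simp
 show "(\<lambda>(t, x). ind {0..1::real} t * f (x + t *\<^sub>R y)) \<in> bmeas (lborel \<Otimes>\<^sub>M lborel)"
  by measurable
 have "(LL x. norm (case (t, x) of (t, x) => ind {0..1::real} t * f (x + t *\<^sub>R y)))
   = ind {0..1} t * (LL x. \<bar>f x\<bar>)" for t
  using integral_translate[of "\<lambda>x. \<bar>f x\<bar>" "t *\<^sub>R y"] by (simp add: abs_mult)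
 then show "integ (\<lambda>t. LL x. norm (case (t, x) of (t, x) => ind {0..1::real} t * f (x + t *\<^sub>R y)))"
  by (simp add: integrable_real_indicator)
 show "AE t in lborel. integ (\<lambda>x. case (t, x) of (t, x) => ind {0..1::real} t * f (x + t *\<^sub>R y))"
  using integrable_translate[OF f] by (auto intro!: AE_I2)
qed

definition segment_mean :: "'a::euclidean_space => ('a => real) => 'a => real" where
 "segment_mean y f x = (LL t. ind {0..1::real} t * f (x + t *\<^sub>R y))"

lemma integrable_segment_mean:
 assumes "integ f" shows "integ (segment_mean y f)"
 using lborel_pair.integrable_fst'[OF lborel_pair.integrable_product_swap[OF segment_integrable[OF assms, of y]]]
 by (simp add: segment_mean_def [abs_def])

lemma segment_mean_test:
 assumes f: "integ f" and w: "w \<in> bmeas borel" "\<And>x. \<bar>w x\<bar> \<le> B"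
 shows "(LL x. w x * segment_mean y f x)
   = (LL t. ind {0..1} t * (LL x. w x * f (x + t *\<^sub>R y)))"
proof -
 have [measurable]: "f \<in> bmeas borel" using f by simp
 note w(1)[measurable]
 have "integrable (lborel \<Otimes>\<^sub>M lborel) (\<lambda>(t, x). w x * (ind {0..1::real} t * f (x + t *\<^sub>R y)))"
  by (rule Bintegrable_bound[OF integrable_mult_right[OF segment_integrable[OF f, of y], of B]])
   (auto simp: abs_mult split_beta intro!: AE_I2 mult_mono order_trans[OF w(2) abs_ge_self])
 from lborel_pair.Fubini_integral[OF this]
 have "(LL x. w x * segment_mean y f x) = (LL t. LL x. w x * (ind {0..1::real} t * f (x + t *\<^sub>R y)))"
  by (simp add: segment_mean_def)
 also have "\<dots> = (LL t. ind {0..1} t * (LL x. w x * f (x + t *\<^sub>R y)))"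
  by (subst integral_mult_right_zero[symmetric]) (simp add: mult.left_commute)
 finally show ?thesis .
qed

lemma test_function_segment:
 assumes "test_function S \<psi>"
 shows "\<psi> x - \<psi> (x - y) = (LL t. ind {0..1::real} t * fder \<psi> (x - t *\<^sub>R y) y)"
proof -
 let ?D = "\<lambda>z. fder \<psi> z y"
 have "((\<lambda>t. - \<psi> (x - t *\<^sub>R y)) has_real_derivative ?D (x - t *\<^sub>R y)) (at t)" for t
 proof -
  have 1: "((\<lambda>t. \<psi> (x - t *\<^sub>R y)) has_derivative (\<lambda>h. fder \<psi> (x - t *\<^sub>R y) (- (h *\<^sub>R y)))) (at t)"
   by (rule has_derivative_compose[OF _ test_functionD(5)[OF assms]]) (auto intro!: derivative_eq_intros)
  have 2: "fder \<psi> (x - t *\<^sub>R y) (- (h *\<^sub>R y)) = - (?D (x - t *\<^sub>R y) * h)" for h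
   using has_derivative_linear[OF test_functionD(5)[OF assms]] by (simp add: linear_neg linear_scale)
  have "((\<lambda>t. \<psi> (x - t *\<^sub>R y)) has_real_derivative - ?D (x - t *\<^sub>R y)) (at t)"
   unfolding has_field_derivative_def by (rule has_derivative_eq_rhs[OF 1]) (simp add: 2 fun_eq_iff)
  from DERIV_minus[OF this] show ?thesis by simp
 qed
 moreover have "isCont (\<lambda>t. ?D (x - t *\<^sub>R y)) t" for t
 proof -
  have "isCont ?D z" for z
   using test_functionD(2)[OF test_function_directional_deriv[OF assms, of y]] continuous_on_eq_continuous_at by blast
  then show ?thesis by (intro isCont_o2[where g="?D" and f="\<lambda>t. x - t *\<^sub>R y"] continuous_intros)
 qed
 ultimately have "(LL t. ?D (x - t *\<^sub>R y) * ind {0..1} t) = - \<psi> (x - 1 *\<^sub>R y) - - \<psi> (x - 0 *\<^sub>R y)"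
  by (intro integral_FTC_Icc_real) auto
 then show ?thesis by (simp add: mult.commute)
qed

text \<open>The function psi(x) - psi(x - y) is the directional derivative in direction y of the test function
that averages psi over the segment from x - y to x, so the definition of the weak derivative applies to
it.\<close>
lemma wd_translation_test:
 assumes f: "wd X y f g" and \<psi>: "test_function V \<psi>"
  and seg: "\<And>x t. x \<in> V ==> 0 \<le> t ==> t \<le> 1 ==> x + t *\<^sub>R y \<in> X"
 shows "(LL x. \<psi> x * f (x + y)) - (LL x. \<psi> x * f x)
  = (LL t. ind {0..1} t * (LL x. \<psi> x * g (x + t *\<^sub>R y)))"
proof -
 let ?D = "\<lambda>z. fder \<psi> z y"
 note if' = wdD(1)[OF f] and ig = wdD(2)[OF f]
 note [measurable] = wdD(4,5)[OF f] test_functionD(3)[OF \<psi>] test_functionD(3)[OF test_function_directional_deriv[OF \<psi>, of y]]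
 obtain B where B: "\<And>x. \<bar>?D x\<bar> \<le> B"
  using test_function_bounded[OF test_function_directional_deriv[OF \<psi>, of y]] by blast
 have shift: "(LL x. u (x - z) * f x) = (LL x. u x * f (x + z))"
  if [measurable]: "u \<in> bmeas borel" for u z
  using integral_translate[of "\<lambda>x. u (x - z) * f x" z] by simp
 have shiftg: "(LL x. u (x - z) * g x) = (LL x. u x * g (x + z))"
  if [measurable]: "u \<in> bmeas borel" for u z
  using integral_translate[of "\<lambda>x. u (x - z) * g x" z] by simp
 have int: "integrable (lborel \<Otimes>\<^sub>M lborel) (\<lambda>(t, x). ?D (x - t *\<^sub>R y) * (ind {0..1::real} t * f x))"
  using segment_integrable[OF if', of 0]
  by (intro Bintegrable_bound[OF integrable_mult_right[OF segment_integrable[OF if', of 0], of B]])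
   (auto simp: abs_mult split_beta intro!: AE_I2 mult_mono order_trans[OF B abs_ge_self])
 have i1: "integ (\<lambda>x. \<psi> x * f x)" using test_mult_integrable[OF \<psi> if'] .
 have i2: "integ (\<lambda>x. \<psi> (x - y) * f x)"
  using integrable_translate[OF test_mult_integrable[OF \<psi> integrable_translate[OF if', of y]], of "-y"] by simp
 have "(LL x. \<psi> x * f x) - (LL x. \<psi> x * f (x + y))
   = (LL x. (\<psi> x - \<psi> (x - y)) * f x)"
  using i1 i2 by (simp add: left_diff_distrib shift)
 also have "\<dots> = (LL x. LL t. ?D (x - t *\<^sub>R y) * (ind {0..1} t * f x))"
  unfolding test_function_segment[OF \<psi>] by (simp add: mult_ac flip: integral_mult_left_zero)
 also have "\<dots> = (LL t. LL x. ?D (x - t *\<^sub>R y) * (ind {0..1} t * f x))"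
  using lborel_pair.Fubini_integral[OF int] by simp
 also have "\<dots> = (LL t. ind {0..1} t * (LL x. ?D (x - t *\<^sub>R y) * f x))"
  by (simp add: mult.left_commute)
 also have "\<dots> = (LL t. ind {0..1} t * - (LL x. \<psi> x * g (x + t *\<^sub>R y)))"
 proof (rule Bintegral_cong[OF refl])
  fix t :: real
  show "ind {0..1} t * (LL x. ?D (x - t *\<^sub>R y) * f x)
   = ind {0..1} t * - (LL x. \<psi> x * g (x + t *\<^sub>R y))"
  proof (cases "t \<in> {0..1}")
   case True
   have t: "test_function X (\<lambda>x. \<psi> (x - t *\<^sub>R y))"
    by (rule test_function_translate[OF \<psi>]) (use seg True in auto)
   have "(LL x. ?D (x - t *\<^sub>R y) * f x) = - (LL x. \<psi> (x - t *\<^sub>R y) * g x)"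
    using wdD(3)[OF f t] by (simp add: frechet_derivative_translate[OF test_functionD(1)[OF \<psi>]])
   then show ?thesis by (simp add: shiftg)
  qed auto
 qed
 finally show ?thesis by simp
qed

lemma wd_translation_AE:
 assumes f: "wd X y f g" and V: "open V" "bounded V"
  and seg: "\<And>x t. x \<in> V ==> 0 \<le> t ==> t \<le> 1 ==> x + t *\<^sub>R y \<in> X"
 shows "AE x in lborel. x \<in> V --> f (x + y) - f x = segment_mean y g x"
proof -
 note if' = wdD(1)[OF f] and ig = wdD(2)[OF f]
 have "AE x in lborel. x \<in> V --> f (x + y) - f x - segment_mean y g x = 0"
 proof (rule AE_zero_if_test_zero[OF V])
  show "integ (\<lambda>x. f (x + y) - f x - segment_mean y g x)"
   using if' integrable_translate[OF if', of y] integrable_segment_mean[OF ig] by auto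
  fix \<psi> assume \<psi>: "test_function V \<psi>"
  obtain B where B: "\<And>x. \<bar>\<psi> x\<bar> \<le> B" using test_function_bounded[OF \<psi>] by blast
  show "(LL x. \<psi> x * (f (x + y) - f x - segment_mean y g x)) = 0"
   using wd_translation_test[OF f \<psi> seg] segment_mean_test[OF ig test_functionD(3)[OF \<psi>] B, of y]
    test_mult_integrable[OF \<psi>] if' integrable_translate[OF if', of y] integrable_segment_mean[OF ig]
   by (simp add: right_diff_distrib)
 qed
 then show ?thesis by eventually_elim auto
qed

text \<open>The distance is at most the average over t of the L^1 distances between f and its translates by t
h n, and these tend to zero.\<close>
lemma segment_mean_L1_converges:
 fixes f :: "'a::euclidean_space => real"
 assumes f: "integ f" and h: "h ----> 0"
 shows "(\<lambda>n. LL x. \<bar>segment_mean (h n) f x - f x\<bar>) ----> 0"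
proof -
 have [measurable]: "f \<in> bmeas borel" using f by simp
 define \<omega> where "\<omega> y = (LL x. \<bar>f (x + y) - f x\<bar>)" for y
 have \<omega>_meas: "(\<lambda>t::real. \<omega> (t *\<^sub>R y)) \<in> bmeas borel" for y
  unfolding \<omega>_def by measurable
 have \<omega>_le: "\<bar>\<omega> y\<bar> \<le> 2 * (LL x. \<bar>f x\<bar>)" for y
 proof -
  have "\<omega> y \<le> (LL x. \<bar>f (x + y)\<bar> + \<bar>f x\<bar>)"
   unfolding \<omega>_def using f integrable_translate[OF f, of y] by (intro integral_mono) auto
  also have "\<dots> = 2 * (LL x. \<bar>f x\<bar>)"
   using f integrable_translate[OF f, of y] integral_translate[of "\<lambda>x. \<bar>f x\<bar>" y] by simp
  finally show ?thesis by (simp add: \<omega>_def)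
 qed
 have le: "(LL x. \<bar>segment_mean y f x - f x\<bar>) \<le> (LL t. ind {0..1} t * \<omega> (t *\<^sub>R y))" for y
 proof -
  have int: "integrable (lborel \<Otimes>\<^sub>M lborel) (\<lambda>(t, x). ind {0..1::real} t * \<bar>f (x + t *\<^sub>R y) - f x\<bar>)"
   using Bintegrable_diff[OF segment_integrable[OF f, of y] segment_integrable[OF f, of 0]]
   by (rule Bintegrable_bound) (auto simp: split_beta abs_mult simp flip: right_diff_distrib)
  have int': "integrable (lborel \<Otimes>\<^sub>M lborel) (\<lambda>(x, t). ind {0..1::real} t * \<bar>f (x + t *\<^sub>R y) - f x\<bar>)"
   using lborel_pair.integrable_product_swap[OF int] by (simp add: split_beta)
  have intx: "AE x in lborel. integ (\<lambda>t. ind {0..1::real} t * \<bar>f (x + t *\<^sub>R y) - f x\<bar>)"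
   using lborel_pair.AE_integrable_fst'[OF int'] by simp
  have intx2: "AE x in lborel. integ (\<lambda>t. ind {0..1::real} t * f (x + t *\<^sub>R y))"
   using lborel_pair.AE_integrable_fst'[OF lborel_pair.integrable_product_swap[OF segment_integrable[OF f, of y]]] by simp
  have "(LL x. \<bar>segment_mean y f x - f x\<bar>)
    \<le> (LL x. LL t. ind {0..1} t * \<bar>f (x + t *\<^sub>R y) - f x\<bar>)"
  proof (rule integral_mono_AE)
   show "integ (\<lambda>x. \<bar>segment_mean y f x - f x\<bar>)"
    using f integrable_segment_mean[OF f] by auto
   show "integ (\<lambda>x. LL t. ind {0..1} t * \<bar>f (x + t *\<^sub>R y) - f x\<bar>)"
    using lborel_pair.integrable_fst'[OF int'] by simp
   show "AE x in lborel. \<bar>segment_mean y f x - f x\<bar> \<le> (LL t. ind {0..1} t * \<bar>f (x + t *\<^sub>R y) - f x\<bar>)"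
    using intx intx2
   proof eventually_elim
    case (elim x)
    have "(LL t. ind {0..1::real} t * f x) = f x" by simp
    then have "segment_mean y f x - f x = (LL t. ind {0..1} t * f (x + t *\<^sub>R y) - ind {0..1} t * f x)"
     using elim by (subst Bintegral_diff) (auto simp: segment_mean_def)
    also have "\<bar>\<dots>\<bar> \<le> (LL t. \<bar>ind {0..1} t * f (x + t *\<^sub>R y) - ind {0..1} t * f x\<bar>)"
     by (rule integral_abs_bound)
    also have "\<dots> = (LL t. ind {0..1} t * \<bar>f (x + t *\<^sub>R y) - f x\<bar>)"
     by (simp add: abs_mult flip: right_diff_distrib)
    finally show ?case .
   qed
  qed
  also have "\<dots> = (LL t. LL x. ind {0..1} t * \<bar>f (x + t *\<^sub>R y) - f x\<bar>)"
   using lborel_pair.Fubini_integral[OF int] by simp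
  finally show ?thesis by (simp add: \<omega>_def)
 qed
 have lim: "(\<lambda>n. LL t. ind {0..1} t * \<omega> (t *\<^sub>R h n)) ----> (LINT t|(lborel::real measure). (0::real))"
 proof (rule integral_dominated_convergence[where w="\<lambda>t. ind {0..1} t * (2 * (LL x. \<bar>f x\<bar>))"])
  show "integ (\<lambda>t. ind {0..1::real} t * (2 * (LL x. \<bar>f x\<bar>)))"
   by (intro integrable_mult_left) (simp add: integrable_real_indicator)
  show "AE t in lborel. norm (ind {0..1} t * \<omega> (t *\<^sub>R h n)) \<le> ind {0..1::real} t * (2 * (LL x. \<bar>f x\<bar>))" for n
   using \<omega>_le by (auto simp: abs_mult intro!: AE_I2 mult_left_mono)
  have "(\<lambda>n. \<omega> (t *\<^sub>R h n)) ----> 0" for t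
   unfolding \<omega>_def by (rule L1_translation_continuous[OF f]) (use tendsto_scaleR[OF tendsto_const h] in simp)
  then show "AE t in lborel. (\<lambda>n. ind {0..1} t * \<omega> (t *\<^sub>R h n)) ----> 0"
   by (intro AE_I2 tendsto_mult_right_zero)
  show "(\<lambda>t. ind {0..1} t * \<omega> (t *\<^sub>R h n)) \<in> bmeas lborel" for n
   using \<omega>_meas[of "h n"] by measurable
 qed simp
 show ?thesis
  by (rule tendsto_sandwich[OF _ _ tendsto_const lim[simplified]])
    (use le in \<open>auto intro!: always_eventually\<close>)
qed

text \<open>The difference quotients are bounded by the maximum of the derivative, so dominated convergence
applies.\<close>
lemma test_difference_quotient:
 fixes u :: "'a::euclidean_space => real"
 assumes u: "integ u" and \<phi>: "test_function S \<phi>"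
  and h: "h ----> 0" "\<And>n. h n > 0"
 shows "(\<lambda>n. LL x. (\<phi> (x - h n *\<^sub>R i) - \<phi> x) / h n * u x) ----> - (LL x. fder \<phi> x i * u x)"
proof -
 let ?D = "\<lambda>x. fder \<phi> x i"
 note [measurable] = test_functionD(3)[OF \<phi>] test_functionD(3)[OF test_function_directional_deriv[OF \<phi>]]
 have [measurable]: "u \<in> bmeas borel" using u by simp
 obtain B where B: "B > 0" "\<And>x. \<bar>?D x\<bar> \<le> B"
  using test_function_bounded[OF test_function_directional_deriv[OF \<phi>, of i]] by blast
 have bnd: "\<bar>(\<phi> (x - s *\<^sub>R i) - \<phi> x) / s\<bar> \<le> B" if "s > 0" for x s
 proof -
  have D: "fder \<phi> z (s *\<^sub>R i) = s * ?D z" for z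
   using linear_scale[OF has_derivative_linear[OF test_functionD(5)[OF \<phi>]]] by simp
  have i1: "integ (\<lambda>t. ind {0..1::real} t * (s * B))"
   by (intro integrable_mult_left) (simp add: integrable_real_indicator)
  have "\<bar>\<phi> x - \<phi> (x - s *\<^sub>R i)\<bar> \<le> (LL t. \<bar>ind {0..1::real} t * (s * ?D (x - t *\<^sub>R (s *\<^sub>R i)))\<bar>)"
   unfolding test_function_segment[OF \<phi>] D by (rule integral_abs_bound)
  also have "\<dots> \<le> (LL t. ind {0..1::real} t * (s * B))"
  proof (rule integral_mono[OF _ i1])
   show "integ (\<lambda>t. \<bar>ind {0..1::real} t * (s * ?D (x - t *\<^sub>R (s *\<^sub>R i)))\<bar>)"
    by (rule Bintegrable_bound[OF i1])
     (use B that in \<open>auto simp: abs_mult intro!: AE_I2 mult_left_mono order_trans[OF B(2) abs_ge_self]\<close>)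
   show "\<bar>ind {0..1::real} t * (s * ?D (x - t *\<^sub>R (s *\<^sub>R i)))\<bar> \<le> ind {0..1} t * (s * B)" for t
    using B that by (auto simp: abs_mult intro!: mult_left_mono)
  qed
  also have "\<dots> = s * B" by simp
  finally show ?thesis using that by (simp add: field_simps abs_minus_commute)
 qed
 have "(\<lambda>n. LL x. (\<phi> (x - h n *\<^sub>R i) - \<phi> x) / h n * u x) ----> (LL x. - ?D x * u x)"
 proof (rule integral_dominated_convergence[where w="\<lambda>x. B * \<bar>u x\<bar>"])
  show "AE x in lborel. norm ((\<phi> (x - h n *\<^sub>R i) - \<phi> x) / h n * u x) \<le> B * \<bar>u x\<bar>" for n
   unfolding real_norm_def abs_mult by (intro AE_I2 mult_right_mono bnd h abs_ge_zero)
  show "AE x in lborel. (\<lambda>n. (\<phi> (x - h n *\<^sub>R i) - \<phi> x) / h n * u x) ----> - ?D x * u x"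
  proof (intro AE_I2 tendsto_mult_right)
   fix x
   have 1: "((\<lambda>t. \<phi> (x - t *\<^sub>R i)) has_derivative (\<lambda>s. fder \<phi> (x - 0 *\<^sub>R i) (- (s *\<^sub>R i)))) (at 0)"
    by (rule has_derivative_compose[OF _ test_functionD(5)[OF \<phi>]]) (auto intro!: derivative_eq_intros)
   have 2: "fder \<phi> (x - 0 *\<^sub>R i) (- (s *\<^sub>R i)) = - ?D x * s" for s
    using has_derivative_linear[OF test_functionD(5)[OF \<phi>]] by (simp add: linear_neg linear_scale)
   have "((\<lambda>t. \<phi> (x - t *\<^sub>R i)) has_real_derivative - ?D x) (at 0)"
    unfolding has_field_derivative_def by (rule has_derivative_eq_rhs[OF 1]) (simp only: 2 fun_eq_iff simp_thms)
   then have "((\<lambda>t. (\<phi> (x - t *\<^sub>R i) - \<phi> x) / t) \<longlongrightarrow> - ?D x) (at 0)"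
    by (simp add: DERIV_def)
   moreover have "filterlim h (at 0) sequentially"
    by (rule filterlim_atI[OF h(1)]) (use h(2) in \<open>auto intro!: always_eventually simp: less_le\<close>)
   ultimately show "(\<lambda>n. (\<phi> (x - h n *\<^sub>R i) - \<phi> x) / h n) ----> - ?D x"
    by (rule filterlim_compose)
  qed
 qed (use u in auto)
 then show ?thesis by simp
qed

text \<open>A translation does not change the integral, so the difference quotients of a test function have
integral zero; the indicator of a large ball plays the role of the constant 1.\<close>
lemma integral_deriv_test_zero:
 assumes \<phi>: "test_function S \<phi>"
 shows "(LL x. fder \<phi> x i) = 0"
proof -
 obtain K where K: "compact K" "\<And>x. x \<notin> K ==> \<phi> x = 0"
  using \<phi> unfolding test_function_def by blast
 obtain R where R: "R > 0" "K \<subseteq> ball 0 R"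
  using bounded_subset_ballD[OF compact_imp_bounded[OF K(1)], of 0] by blast
 let ?u = "ind (ball 0 (R + norm i)) :: 'a => real"
 define h where "h n = inverse (real (Suc n))" for n
 have h: "h ----> 0" "\<And>n. h n > 0" "\<And>n. h n \<le> 1"
  using LIMSEQ_inverse_real_of_nat by (auto simp: h_def[abs_def] field_simps)
 have z: "\<phi> x * ?u x = \<phi> x" "\<phi> (x - h n *\<^sub>R i) * ?u x = \<phi> (x - h n *\<^sub>R i)" for x n
 proof -
  have "norm x < R + norm i" if "x \<in> K"
  proof -
   have "norm x < R" using R that by auto
   then show ?thesis using norm_ge_zero[of i] by linarith
  qed
  then show "\<phi> x * ?u x = \<phi> x" using K(2)[of x] by (auto simp: indicator_def)
  have "norm x < R + norm i" if "x - h n *\<^sub>R i \<in> K"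
  proof -
   have "norm (x - h n *\<^sub>R i) < R" using R that by auto
   moreover have "norm x \<le> norm (x - h n *\<^sub>R i) + norm (h n *\<^sub>R i)"
    using norm_triangle_ineq[of "x - h n *\<^sub>R i" "h n *\<^sub>R i"] by simp
   moreover have "norm (h n *\<^sub>R i) \<le> norm i" using h(2)[of n] h(3)[of n] by (simp add: mult_left_le_one_le)
   ultimately show ?thesis by linarith
  qed
  then show "\<phi> (x - h n *\<^sub>R i) * ?u x = \<phi> (x - h n *\<^sub>R i)"
   using K(2)[of "x - h n *\<^sub>R i"] by (auto simp: indicator_def)
 qed
 have "integ ?u" using emeasure_lborel_ball_finite[of "0::'a"] by (auto intro: integrable_real_indicator)
 from test_difference_quotient[OF this \<phi> h(1,2), of i]
 have "(\<lambda>n. LL x. (\<phi> (x - h n *\<^sub>R i) - \<phi> x) / h n * ?u x) ----> - (LL x. fder \<phi> x i * ?u x)" .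
 moreover have "(LL x. (\<phi> (x - h n *\<^sub>R i) - \<phi> x) / h n * ?u x) = 0" for n
 proof -
  have "(LL x. (\<phi> (x - h n *\<^sub>R i) - \<phi> x) / h n * ?u x) = (LL x. (\<phi> (x - h n *\<^sub>R i) - \<phi> x) / h n)"
  proof (rule Bintegral_cong[OF refl])
   fix x
   have "(\<phi> (x - h n *\<^sub>R i) - \<phi> x) * ?u x = \<phi> (x - h n *\<^sub>R i) - \<phi> x"
    unfolding left_diff_distrib z ..
   then show "(\<phi> (x - h n *\<^sub>R i) - \<phi> x) / h n * ?u x = (\<phi> (x - h n *\<^sub>R i) - \<phi> x) / h n"
    by (simp only: times_divide_eq_left)
  qed
  moreover have "(LL x. (\<phi> (x - h n *\<^sub>R i) - \<phi> x)) = 0"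
   using test_function_integrable[OF \<phi>] integrable_translate[OF test_function_integrable[OF \<phi>], of "- (h n *\<^sub>R i)"]
    integral_translate[OF test_functionD(3)[OF \<phi>], of "- (h n *\<^sub>R i)"] by simp
  ultimately show ?thesis by simp
 qed
 ultimately have "(\<lambda>n. 0) ----> - (LL x. fder \<phi> x i * ?u x)"
  by (simp only:)
 then have "(LL x. fder \<phi> x i * ?u x) = 0"
  unfolding LIMSEQ_const_iff by linarith
 moreover have "fder \<phi> x i * ?u x = fder \<phi> x i" for x
 proof (cases "x \<in> K")
  case True
  then have "norm x < R" using R by auto
  then have "norm x < R + norm i" using norm_ge_zero[of i] by linarith
  then show ?thesis by (simp add: indicator_def)
 next
  case False
  have "fder \<phi> x = (\<lambda>h. 0)"
   by (rule frechet_derivative_zero_outside[of K]) (use K compact_imp_closed False in auto)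
  then show ?thesis by simp
 qed
 ultimately show ?thesis by simp
qed

text \<open>For a test function, the product with f has compact support, so the integral of its derivative
vanishes.\<close>
lemma wd_smooth:
 fixes f :: "'a::euclidean_space => real"
 assumes f: "smooth_on UNIV f" and X: "open X" "bounded X" and i: "i \<in> Basis"
 shows "wd X i (\<lambda>x. ind X x * f x) (\<lambda>x. ind X x * fder f x i)"
proof -
 have int: "integ (\<lambda>x. ind X x * g x)" if g: "continuous_on UNIV g" for g :: "'a => real"
 proof -
  have c: "compact (closure X)" using X by (simp add: compact_closure)
  have "integ (\<lambda>x. ind (closure X) x *\<^sub>R g x)"
   using borel_integrable_compact[OF c continuous_on_subset[OF g]] by simp
  then have "integ (\<lambda>x. ind X x * (ind (closure X) x *\<^sub>R g x))"
   using X by (intro integrable_bounded_mult[where B=1]) auto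
  moreover have "ind X x * (ind (closure X) x *\<^sub>R g x) = ind X x * g x" for x
   using closure_subset[of X] by (auto simp: indicator_def)
  ultimately show ?thesis by (simp only:)
 qed
 note cf = smooth_on_continuous[OF f] smooth_on_continuous[OF smooth_on_deriv[OF f i]]
 show ?thesis unfolding wd_def
 proof (intro conjI allI impI int cf)
  fix \<phi> assume \<phi>: "test_function X \<phi>"
  have t: "test_function X (\<lambda>x. \<phi> x * f x)" by (rule test_function_mult[OF \<phi> f])
  have d: "fder (\<lambda>x. \<phi> x * f x) x i
   = \<phi> x * fder f x i + fder \<phi> x i * f x" for x
   using frechet_derivative_at[OF has_derivative_mult[OF test_functionD(5)[OF \<phi>] smooth_onD[OF open_UNIV f UNIV_I]], of x]
   by (metis (no_types, lifting))
  have z: "\<phi> x * (ind X x * c) = \<phi> x * c" "fder \<phi> x i * (ind X x * c) = fder \<phi> x i * c" for x c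
   using test_functionD(4)[OF \<phi>, of x] test_functionD(4)[OF test_function_deriv[OF \<phi> i], of x] by (auto simp: indicator_def)
  have i1: "integ (\<lambda>x. \<phi> x * fder f x i)"
   using test_mult_integrable[OF \<phi> int[OF cf(2)]] by (simp add: z)
  have i2: "integ (\<lambda>x. fder \<phi> x i * f x)"
   using test_mult_integrable[OF test_function_deriv[OF \<phi> i] int[OF cf(1)]] by (simp add: z)
  show "(LL x. fder \<phi> x i * (ind X x * f x)) = - (LL x. \<phi> x * (ind X x * fder f x i))"
   unfolding z using integral_deriv_test_zero[OF t, of i] i1 i2 by (simp add: d)
 qed
qed

section \<open>The product rule\<close>

lemma integral_bounded_mult_converges:
 fixes u :: "nat => 'a::euclidean_space => real"
 assumes "\<And>n. integ (u n)" "integ v"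
  and "(\<lambda>n. LL x. \<bar>u n x - v x\<bar>) ----> 0"
  and w: "\<And>n. w n \<in> bmeas borel" "\<And>n x. \<bar>w n x\<bar> \<le> B"
 shows "(\<lambda>n. (LL x. w n x * u n x) - (LL x. w n x * v x)) ----> 0"
proof -
 have B: "B \<ge> 0" using w(2)[of 0 undefined] by linarith
 have "\<bar>(LL x. w n x * u n x) - (LL x. w n x * v x)\<bar> \<le> B * (LL x. \<bar>u n x - v x\<bar>)" for n
 proof -
  note i = integrable_bounded_mult[OF _ w(1) w(2)]
  have "(LL x. w n x * u n x) - (LL x. w n x * v x) = (LL x. w n x * (u n x - v x))"
   using assms(1)[of n] assms(2) i by (simp add: right_diff_distrib)
  also have "\<bar>\<dots>\<bar> \<le> (LL x. \<bar>w n x * (u n x - v x)\<bar>)" by (rule integral_abs_bound)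
  also have "\<dots> \<le> (LL x. B * \<bar>u n x - v x\<bar>)"
  proof (rule integral_mono)
   show "integ (\<lambda>x. \<bar>w n x * (u n x - v x)\<bar>)"
    by (intro integrable_abs i Bintegrable_diff assms)
   show "integ (\<lambda>x. B * \<bar>u n x - v x\<bar>)"
    by (intro integrable_mult_right integrable_abs Bintegrable_diff assms)
  qed (use w(2) in \<open>auto simp: abs_mult intro!: mult_right_mono\<close>)
  finally show ?thesis by simp
 qed
 then show ?thesis
  by (intro Lim_null_comparison[OF _ tendsto_mult_right_zero[OF assms(3), of B]] always_eventually) auto
qed

text \<open>The discrete product rule (fg)(x + h) - (fg)(x) = g(x + h) (f(x + h) - f(x)) + f(x) (g(x + h) -
g(x)) is tested with phi. The differences of f and g are h times segment means of their derivatives, which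
converge in L^1; the boundedness of f and g allows the passage to the limit, except for the shift in g(x + h),
which is moved to the other factors by a translation.\<close>
lemma wd_mult:
 assumes f: "wd X i f f'" and g: "wd X i g g'" and X: "open X"
  and fB: "\<And>x. \<bar>f x\<bar> \<le> B" and gB: "\<And>x. \<bar>g x\<bar> \<le> B"
 shows "wd X i (\<lambda>x. f x * g x) (\<lambda>x. f x * g' x + g x * f' x)"
 unfolding wd_def
proof (intro conjI allI impI)
 note [measurable] = wdD(4,5)[OF f] wdD(4,5)[OF g]
 show ifg: "integ (\<lambda>x. f x * g x)"
  using integrable_bounded_mult[OF wdD(1)[OF g] wdD(4)[OF f] fB] .
 have ifg': "integ (\<lambda>x. f x * g' x)"
  using integrable_bounded_mult[OF wdD(2)[OF g] wdD(4)[OF f] fB] .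
 have igf': "integ (\<lambda>x. g x * f' x)"
  using integrable_bounded_mult[OF wdD(2)[OF f] wdD(4)[OF g] gB] .
 show "integ (\<lambda>x. f x * g' x + g x * f' x)" using ifg' igf' by simp
 fix \<phi> assume \<phi>: "test_function X \<phi>"
 note [measurable] = test_functionD(3)[OF \<phi>]
 obtain K where K: "compact K" "K \<subseteq> X" "\<And>x. x \<notin> K ==> \<phi> x = 0"
  using \<phi> unfolding test_function_def by blast
 obtain e where e: "e > 0" "(\<Union>x\<in>K. ball x e) \<subseteq> X"
  using compact_subset_open_imp_ball_epsilon_subset[OF K(1) X K(2)] by blast
 define V where "V = (\<Union>x\<in>K. ball x (e / 2))"
 have V: "open V" "bounded V" "K \<subseteq> V"
 proof -
  show "open V" unfolding V_def by blast
  show "K \<subseteq> V" unfolding V_def using e by force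
  obtain R where "K \<subseteq> ball 0 R" using bounded_subset_ballD[OF compact_imp_bounded[OF K(1)]] by blast
  then have "V \<subseteq> ball 0 (R + e)"
  proof -
   have "norm y < R + e" if "x \<in> K" "dist x y < e / 2" for x y
   proof -
    have "norm x < R" using that \<open>K \<subseteq> ball 0 R\<close> by auto
    moreover have "norm y \<le> norm x + dist x y"
     using norm_triangle_sub[of y x] by (simp add: dist_norm norm_minus_commute)
    ultimately show ?thesis using that e by linarith
   qed
   then show ?thesis unfolding V_def by auto
  qed
  then show "bounded V" using bounded_subset bounded_ball by blast
 qed
 obtain Bp where Bp: "Bp > 0" "\<And>x. \<bar>\<phi> x\<bar> \<le> Bp" using test_function_bounded[OF \<phi>] by blast
 \<comment> \<open>The steps are so short that all segments from points of V stay within distance e of the support of phi, hence in the domain.\<close>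
 define h where "h n = e / (2 * (norm i + 1)) * inverse (real (Suc n))" for n
 have hpos: "h n > 0" for n
  using e by (auto simp: h_def intro!: mult_pos_pos divide_pos_pos add_nonneg_pos)
 have h0: "h ----> 0"
  unfolding h_def by (rule tendsto_mult_right_zero[OF LIMSEQ_inverse_real_of_nat])
 then have hi0: "(\<lambda>n. h n *\<^sub>R i) ----> 0" "(\<lambda>n. - (h n *\<^sub>R i)) ----> 0"
  using tendsto_scaleR[OF h0 tendsto_const[of i]] tendsto_minus[OF tendsto_scaleR[OF h0 tendsto_const[of i]]] by auto
 have hs: "norm (t *\<^sub>R (h n *\<^sub>R i)) < e / 2" if "0 \<le> t" "t \<le> 1" for t n
 proof -
  have "h n \<le> e / (2 * (norm i + 1))"
   using e unfolding h_def by (intro mult_right_le_one_le) (auto simp: field_simps intro!: divide_nonneg_nonneg add_nonneg_nonneg)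
  then have "h n * norm i \<le> e / (2 * (norm i + 1)) * norm i" by (intro mult_right_mono) auto
  also have "\<dots> < e / 2"
  proof -
   have "0 < norm i + 1" by (intro add_nonneg_pos) auto
   then show ?thesis using e by (simp add: field_simps)
  qed
  finally have "h n * norm i < e / 2" .
  moreover have "t * (h n * norm i) \<le> h n * norm i" using that hpos[of n] by (intro mult_left_le_one_le) auto
  moreover have "norm (t *\<^sub>R (h n *\<^sub>R i)) = t * (h n * norm i)" using that hpos[of n] by simp
  ultimately show ?thesis by linarith
 qed
 have seg: "x + t *\<^sub>R (h n *\<^sub>R i) \<in> X" if xV: "x \<in> V" and t01: "0 \<le> t" "t \<le> 1" for x t n
 proof -
  obtain z where z: "z \<in> K" "dist z x < e / 2" using xV unfolding V_def by auto
  have "dist z (x + t *\<^sub>R (h n *\<^sub>R i)) \<le> dist z x + norm (t *\<^sub>R (h n *\<^sub>R i))"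
   using dist_triangle[of z "x + t *\<^sub>R (h n *\<^sub>R i)" x] by (simp add: dist_norm)
  then have "x + t *\<^sub>R (h n *\<^sub>R i) \<in> ball z e" using z(2) hs[OF t01, of n] by simp
  then show ?thesis using e z by blast
 qed
 have quot: "AE x in lborel. x \<in> V --> (v (x + h n *\<^sub>R i) - v x) / h n = segment_mean (h n *\<^sub>R i) v' x"
  if "wd X i v v'" for v v' n
 proof -
  have "AE x in lborel. x \<in> V --> v (x + h n *\<^sub>R i) - v x = segment_mean (h n *\<^sub>R i) (\<lambda>x. h n * v' x) x"
   by (rule wd_translation_AE[OF wd_scale_direction[OF that, of "h n"] V(1,2)]) (rule seg)
 then show ?thesis
 proof eventually_elim
  case (elim x)
  have "segment_mean (h n *\<^sub>R i) (\<lambda>x. h n * v' x) x = h n * segment_mean (h n *\<^sub>R i) v' x"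
   unfolding segment_mean_def by (simp add: mult.left_commute)
  then show ?case using elim hpos[of n] by (auto simp: field_simps)
 qed
 qed
 have \<phi>V: "\<phi> x = 0" if "x \<notin> V" for x using K(3)[of x] that V(3) by blast
 have split: "(LL x. \<phi> x * (f (x + h n *\<^sub>R i) * g (x + h n *\<^sub>R i) - f x * g x) / h n)
  = (LL x. (\<phi> x * g (x + h n *\<^sub>R i)) * segment_mean (h n *\<^sub>R i) f' x)
   + (LL x. (\<phi> x * f x) * segment_mean (h n *\<^sub>R i) g' x)" for n
 proof -
  note [measurable] = borel_measurable_integrable[OF integrable_segment_mean[OF wdD(2)[OF f], of "h n *\<^sub>R i"]]
   borel_measurable_integrable[OF integrable_segment_mean[OF wdD(2)[OF g], of "h n *\<^sub>R i"]]
  have b: "\<bar>\<phi> x * g (x + h n *\<^sub>R i)\<bar> \<le> Bp * B" "\<bar>\<phi> x * f x\<bar> \<le> Bp * B" for x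
   using Bp gB fB by (auto simp: abs_mult intro!: mult_mono)
  have "(LL x. \<phi> x * (f (x + h n *\<^sub>R i) * g (x + h n *\<^sub>R i) - f x * g x) / h n)
   = (LL x. (\<phi> x * g (x + h n *\<^sub>R i)) * segment_mean (h n *\<^sub>R i) f' x + (\<phi> x * f x) * segment_mean (h n *\<^sub>R i) g' x)"
  proof (rule integral_cong_AE)
   show "AE x in lborel. \<phi> x * (f (x + h n *\<^sub>R i) * g (x + h n *\<^sub>R i) - f x * g x) / h n
     = (\<phi> x * g (x + h n *\<^sub>R i)) * segment_mean (h n *\<^sub>R i) f' x + (\<phi> x * f x) * segment_mean (h n *\<^sub>R i) g' x"
    using quot[OF f, of n] quot[OF g, of n]
   proof eventually_elim
    case (elim x)
    show ?case
    proof (cases "x \<in> V")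
     case True
     then have "segment_mean (h n *\<^sub>R i) f' x = (f (x + h n *\<^sub>R i) - f x) / h n"
      "segment_mean (h n *\<^sub>R i) g' x = (g (x + h n *\<^sub>R i) - g x) / h n" using elim by auto
     then show ?thesis by (simp only:) (use hpos[of n] in \<open>simp add: field_simps\<close>)
    qed (simp add: \<phi>V)
   qed
  qed measurable
  also have "\<dots> = (LL x. (\<phi> x * g (x + h n *\<^sub>R i)) * segment_mean (h n *\<^sub>R i) f' x)
   + (LL x. (\<phi> x * f x) * segment_mean (h n *\<^sub>R i) g' x)"
   by (intro Bintegral_add integrable_bounded_mult[OF _ _ b(1)] integrable_bounded_mult[OF _ _ b(2)]
     integrable_segment_mean wdD(2)[OF f] wdD(2)[OF g]) measurable
  finally show ?thesis .
 qed
 have b: "\<bar>\<phi> x * g y\<bar> \<le> Bp * B" "\<bar>\<phi> x * f y\<bar> \<le> Bp * B" for x y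
  using Bp gB fB by (auto simp: abs_mult intro!: mult_mono)
 have lim2: "(\<lambda>n. (LL x. (\<phi> x * f x) * segment_mean (h n *\<^sub>R i) g' x)) ----> (LL x. (\<phi> x * f x) * g' x)"
 proof -
  have "(\<lambda>n. (LL x. (\<phi> x * f x) * segment_mean (h n *\<^sub>R i) g' x) - (LL x. (\<phi> x * f x) * g' x)) ----> 0"
   by (rule integral_bounded_mult_converges[OF integrable_segment_mean wdD(2)[OF g] segment_mean_L1_converges _ b(2)])
    (use wdD(2)[OF g] hi0 in auto)
  then show ?thesis by (rule LIM_zero_cancel)
 qed
 have lim1: "(\<lambda>n. (LL x. (\<phi> x * g (x + h n *\<^sub>R i)) * segment_mean (h n *\<^sub>R i) f' x)) ----> (LL x. \<phi> x * f' x * g x)"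
 proof -
  have 1: "(\<lambda>n. (LL x. (\<phi> x * g (x + h n *\<^sub>R i)) * segment_mean (h n *\<^sub>R i) f' x)
    - (LL x. (\<phi> x * g (x + h n *\<^sub>R i)) * f' x)) ----> 0"
   by (rule integral_bounded_mult_converges[OF integrable_segment_mean wdD(2)[OF f] segment_mean_L1_converges _ b(1)])
    (use wdD(2)[OF f] hi0 in auto)
  define u where "u x = \<phi> x * f' x" for x
  have u: "integ u" unfolding u_def by (rule test_mult_integrable[OF \<phi> wdD(2)[OF f]])
  have [measurable]: "u \<in> bmeas borel" using u by simp
  have eq: "(LL x. (\<phi> x * g (x + h n *\<^sub>R i)) * f' x) = (LL x. g x * u (x + - (h n *\<^sub>R i)))" for n
   using integral_translate[of "\<lambda>x. g x * u (x + - (h n *\<^sub>R i))" "h n *\<^sub>R i"] by (simp add: u_def mult_ac)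
  have "(\<lambda>n. (LL x. g x * u (x + - (h n *\<^sub>R i))) - (LL x. g x * u x)) ----> 0"
   by (rule integral_bounded_mult_converges[OF integrable_translate u L1_translation_continuous _ gB])
    (use u hi0 in auto)
  then have 2: "(\<lambda>n. (LL x. (\<phi> x * g (x + h n *\<^sub>R i)) * f' x)) ----> (LL x. g x * u x)"
   unfolding eq by (rule LIM_zero_cancel)
  from tendsto_add[OF 1 2] show ?thesis by (simp add: u_def mult_ac)
 qed
 have lhs: "(LL x. \<phi> x * (f (x + h n *\<^sub>R i) * g (x + h n *\<^sub>R i) - f x * g x) / h n)
   = (LL x. (\<phi> (x - h n *\<^sub>R i) - \<phi> x) / h n * (f x * g x))" for n
 proof -
  let ?F = "\<lambda>x. f x * g x"
  have i1: "integ (\<lambda>x. \<phi> x * ?F x)" using test_mult_integrable[OF \<phi> ifg] .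
  have i2: "integ (\<lambda>x. \<phi> x * ?F (x + h n *\<^sub>R i))" using test_mult_integrable[OF \<phi> integrable_translate[OF ifg]] .
  have i3: "integ (\<lambda>x. \<phi> (x - h n *\<^sub>R i) * ?F x)"
   using integrable_translate[OF i2, of "- (h n *\<^sub>R i)"] by simp
  have e: "(LL x. \<phi> (x - h n *\<^sub>R i) * ?F x) = (LL x. \<phi> x * ?F (x + h n *\<^sub>R i))"
   using integral_translate[of "\<lambda>x. \<phi> (x - h n *\<^sub>R i) * ?F x" "h n *\<^sub>R i"] by simp
  have "(LL x. \<phi> x * (?F (x + h n *\<^sub>R i) - ?F x) / h n) = ((LL x. \<phi> x * ?F (x + h n *\<^sub>R i)) - (LL x. \<phi> x * ?F x)) / h n"
   using i1 i2 by (simp add: right_diff_distrib)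
  also have "\<dots> = ((LL x. \<phi> (x - h n *\<^sub>R i) * ?F x) - (LL x. \<phi> x * ?F x)) / h n"
   by (simp only: e)
  also have "\<dots> = (LL x. (\<phi> (x - h n *\<^sub>R i) * ?F x - \<phi> x * ?F x) / h n)"
   using i1 i3 by simp
  also have "\<dots> = (LL x. (\<phi> (x - h n *\<^sub>R i) - \<phi> x) / h n * ?F x)"
   by (simp add: left_diff_distrib)
  finally show ?thesis .
 qed
 have "(\<lambda>n. LL x. (\<phi> (x - h n *\<^sub>R i) - \<phi> x) / h n * (f x * g x)) ----> - (LL x. fder \<phi> x i * (f x * g x))"
  by (rule test_difference_quotient[OF ifg \<phi> h0 hpos])
 moreover have "(\<lambda>n. LL x. (\<phi> (x - h n *\<^sub>R i) - \<phi> x) / h n * (f x * g x)) ---->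
   (LL x. \<phi> x * f' x * g x) + (LL x. (\<phi> x * f x) * g' x)"
  unfolding lhs[symmetric] split by (rule tendsto_add[OF lim1 lim2])
 ultimately have "- (LL x. fder \<phi> x i * (f x * g x)) = (LL x. \<phi> x * f' x * g x) + (LL x. (\<phi> x * f x) * g' x)"
  by (rule LIMSEQ_unique)
 also have "\<dots> = (LL x. \<phi> x * (f x * g' x + g x * f' x))"
  using test_mult_integrable[OF \<phi> ifg'] test_mult_integrable[OF \<phi> igf']
  by (simp add: distrib_left mult_ac)
 finally show "(LL x. fder \<phi> x i * (f x * g x)) = - (LL x. \<phi> x * (f x * g' x + g x * f' x))"
  by simp
qed

section \<open>The Morrey embedding\<close>

text \<open>The two summands dominate a when a is at most s and when it is larger, respectively.\<close>
lemma young_powr: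
 fixes a s q :: real
 assumes "a \<ge> 0" "s > 0" "q > 1" shows "a \<le> s + a powr q * s powr (1 - q)"
proof (cases "a \<le> s")
 case True
 then show ?thesis using assms by (intro add_increasing2) auto
next
 case False
 then have "a powr (1 - q) \<le> s powr (1 - q)" using assms by (intro powr_mono2') auto
 then have "a powr q * a powr (1 - q) \<le> a powr q * s powr (1 - q)" by (intro mult_left_mono) auto
 moreover have "a powr q * a powr (1 - q) = a" using False assms by (simp flip: powr_add)
 ultimately show ?thesis using assms by linarith
qed

lemma ennreal_integral_abs_le:
 fixes h :: "'a => real"
 assumes "h \<in> bmeas M"
 shows "en \<bar>LINT x|M. h x\<bar> \<le> (\<integral>\<^sup>+x. en \<bar>h x\<bar> \<partial>M)"
proof (cases "integrable M h")
 case True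
 from integral_norm_bound_ennreal[OF this] show ?thesis by simp
qed (simp add: not_integrable_integral_eq)

lemma nn_integral_scale_translate:
 fixes H :: "'a::euclidean_space => ennreal"
 assumes [measurable]: "H \<in> bmeas borel" and t: "t > 0"
 shows "(NN y. H (x + t *\<^sub>R y)) = en (t powr - real DIM('a)) * (NN y. H y)"
proof -
 have "(NN y. H y) = (\<integral>\<^sup>+y. H y \<partial>density (distr lborel borel (\<lambda>y. x + t *\<^sub>R y)) (\<lambda>_. \<bar>t\<bar> ^ DIM('a)))"
  using t by (subst lborel_affine[of t x]) auto
 also have "\<dots> = en (t ^ DIM('a)) * (NN y. H (x + t *\<^sub>R y))"
  using t by (simp add: nn_integral_density nn_integral_distr nn_integral_cmult)
 finally have "en (t powr - real DIM('a)) * (NN y. H y)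
   = (en (t powr - real DIM('a)) * en (t ^ DIM('a))) * (NN y. H (x + t *\<^sub>R y))"
  by (simp add: mult.assoc)
 also have "en (t powr - real DIM('a)) * en (t ^ DIM('a)) = 1"
 proof -
  have "t powr - real DIM('a) * t ^ DIM('a) = 1"
   using t by (simp add: powr_realpow[symmetric] powr_minus field_simps)
  then show ?thesis using t by (subst ennreal_mult[symmetric]) auto
 qed
 finally show ?thesis by simp
qed

text \<open>For each t the inner average is estimated by \<open>young_powr\<close> with s = t^(- n / q), n
being the dimension: with this choice both summands are of the order t^(- n / q) after rescaling, and the
condition q > n makes this integrable at 0.\<close>
lemma cone_average_bound:
 fixes G :: "'a::euclidean_space => real" and q :: real
 assumes q: "q > DIM('a)" and [measurable]: "G \<in> bmeas borel" and G: "\<And>x. 0 \<le> G x"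
  and M: "(NN x. en (G x powr q)) \<le> en M" "M \<ge> 0"
  and [measurable]: "B \<in> sets borel" and B: "emeasure lborel B = en b" "b \<ge> 0"
 shows "(NN t. ind {0..1::real} t * (NN y. ind B y * en (G (x + t *\<^sub>R y))))
   \<le> en ((b + M) / (1 - DIM('a) / q))"
proof -
 let ?n = "real DIM('a)"
 have q1: "q > 1" using q DIM_positive[where 'a='a] by linarith
 have inner: "(NN y. ind B y * en (G (x + t *\<^sub>R y))) \<le> en ((b + M) * t powr (- (?n / q)))"
  if t: "t > 0" for t
 proof -
  define s where "s = t powr (- (?n / q))"
  have s: "s > 0" using t by (simp add: s_def)
  have "(NN y. ind B y * en (G (x + t *\<^sub>R y)))
   \<le> (NN y. en s * ind B y + en (s powr (1 - q)) * en (G (x + t *\<^sub>R y) powr q))"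
  proof (rule nn_integral_mono)
   fix y
   have "G (x + t *\<^sub>R y) \<le> s + s powr (1 - q) * G (x + t *\<^sub>R y) powr q"
    using young_powr[OF G[of "x + t *\<^sub>R y"] s q1] by (simp add: mult.commute)
   then have "en (G (x + t *\<^sub>R y)) \<le> en s + en (s powr (1 - q)) * en (G (x + t *\<^sub>R y) powr q)"
    using s by (simp add: ennreal_leI flip: ennreal_mult'' ennreal_plus)
   then show "ind B y * en (G (x + t *\<^sub>R y)) \<le> en s * ind B y + en (s powr (1 - q)) * en (G (x + t *\<^sub>R y) powr q)"
    by (auto simp: indicator_def)
  qed
  also have "\<dots> = en s * emeasure lborel B + en (s powr (1 - q)) * (NN y. en (G (x + t *\<^sub>R y) powr q))"
   by (simp add: nn_integral_add nn_integral_cmult)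
  also have "(NN y. en (G (x + t *\<^sub>R y) powr q)) = en (t powr - ?n) * (NN y. en (G y powr q))"
   by (rule nn_integral_scale_translate[OF _ t]) measurable
  also have "en s * emeasure lborel B + en (s powr (1 - q)) * (en (t powr - ?n) * (NN y. en (G y powr q)))
    \<le> en s * en b + en (s powr (1 - q)) * (en (t powr - ?n) * en M)"
   using M B by (intro add_mono mult_left_mono) auto
  also have "\<dots> = en (s * b + (s powr (1 - q) * t powr - ?n) * M)"
   using s B M by (simp add: mult.assoc flip: ennreal_mult'' ennreal_plus)
  also have "s powr (1 - q) * t powr - ?n = s"
  proof -
   have "- (?n / q) * (1 - q) + - ?n = - (?n / q)" using q1 by (simp add: field_simps)
   then show ?thesis unfolding s_def powr_powr by (simp flip: powr_add)
  qed
  finally show ?thesis by (simp add: s_def algebra_simps)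
 qed
 have a: "- (?n / q) > - 1" using q q1 by simp
 have "(NN t. ind {0..1::real} t * (NN y. ind B y * en (G (x + t *\<^sub>R y))))
   \<le> (NN t. en (b + M) * en (ind {0..1} t * t powr (- (?n / q))))"
 proof (rule nn_integral_mono_AE)
  show "AE t in lborel. ind {0..1::real} t * (NN y. ind B y * en (G (x + t *\<^sub>R y)))
   \<le> en (b + M) * en (ind {0..1} t * t powr (- (?n / q)))"
   using AE_lborel_singleton[of "0::real"]
  proof eventually_elim
   case (elim t)
   show ?case
   proof (cases "t \<in> {0..1}")
    case True
    then have "t > 0" using elim by auto
    from inner[OF this] show ?thesis using True M B by (simp add: ennreal_mult)
   qed simp
  qed
 qed
 also have "\<dots> = en (b + M) * (NN t. en (ind {0..1} t * t powr (- (?n / q))))"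
  by (rule nn_integral_cmult) measurable
 also have "(NN t. en (ind {0..1} t * t powr (- (?n / q)))) = en (1 / (1 - ?n / q))"
  using nn_integral_has_integral_lebesgue[OF _ has_integral_powr_from_0[OF a, of 1]] by simp
 also have "en (b + M) * en (1 / (1 - ?n / q)) = en ((b + M) * (1 / (1 - ?n / q)))"
  using M B q q1 by (intro ennreal_mult[symmetric]) auto
 also have "(b + M) * (1 / (1 - ?n / q)) = (b + M) / (1 - ?n / q)" by simp
 finally show ?thesis .
qed

lemma ennreal_abs_mult_bound:
 fixes J :: "'a => real"
 assumes "J \<in> bmeas M" "\<And>t. en \<bar>J t\<bar> \<le> H t"
 shows "en \<bar>LINT t|M. J t\<bar> \<le> (\<integral>\<^sup>+t. H t \<partial>M)"
 using ennreal_integral_abs_le[OF assms(1)] nn_integral_mono[of M "\<lambda>t. en \<bar>J t\<bar>" H] assms(2)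
 by (meson order_trans)

text \<open>The value that the averaging argument in the next lemma produces; it depends on f only through the
bound M.\<close>
definition morrey_const :: "'a::euclidean_space => real => real => real => real" where
 "morrey_const e \<kappa> q M = (measure lborel (ball e \<kappa>) + M) * (1 + (norm e + \<kappa>) / (1 - DIM('a) / q)) / measure lborel (ball e \<kappa>)"

text \<open>The inequality f(x) \<le> |f(x + y)| + (mean of |y| |grad f| over the segment from x to x + y) is
averaged over y in a ball such that the segments stay in the domain. To avoid statements at single points, f
is replaced by its integral against a nonnegative test function.\<close>
lemma morrey_test_bound:
 fixes f :: "'a::euclidean_space => real" and q :: real
 assumes q: "q > DIM('a)" and wd: "\<And>j. j \<in> Basis ==> wd X j f (g j)"
  and cone: "\<And>x y t. x \<in> V ==> y \<in> ball e \<kappa> ==> 0 \<le> t ==> t \<le> 1 ==> x + t *\<^sub>R y \<in> X" and \<kappa>: "\<kappa> > 0"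
  and M: "(NN x. en (\<bar>f x\<bar> powr q)) \<le> en M" "M \<ge> 0"
    "(NN x. en ((\<Sum>j\<in>Basis. \<bar>g j x\<bar>) powr q)) \<le> en M"
  and \<psi>: "test_function V \<psi>" "\<And>x. 0 \<le> \<psi> x"
 shows "(LL x. \<psi> x * f x) \<le> morrey_const e \<kappa> q M * (LL x. \<psi> x)"
proof -
 let ?n = "real DIM('a)"
 define B where "B = ball e \<kappa>"
 have Bm[measurable]: "B \<in> sets borel" by (simp add: B_def)
 define b where "b = measure lborel B"
 have b: "emeasure lborel B = en b" "b > 0"
 proof -
  have fin: "emeasure lborel B < \<infinity>" unfolding B_def using emeasure_lborel_ball_finite by blast
  then show "emeasure lborel B = en b" unfolding b_def by (intro emeasure_eq_ennreal_measure) auto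
  have "emeasure lborel B \<noteq> 0"
  proof
   assume "emeasure lborel B = 0"
   then have "B \<in> null_sets lborel" by (simp add: null_sets_def Bm)
   then have "negligible B" by (simp add: negligible_iff_null_sets null_sets_completionI)
   moreover have "\<not> negligible B" unfolding B_def using \<kappa> by (intro open_not_negligible) auto
   ultimately show False by blast
  qed
  with \<open>emeasure lborel B = en b\<close> show "b > 0" by (auto simp: ennreal_eq_0_iff)
 qed
 obtain j0 :: 'a where j0: "j0 \<in> Basis" using nonempty_Basis by blast
 note if' = wdD(1)[OF wd[OF j0]]
 have [measurable]: "f \<in> bmeas borel" using if' by simp
 have gm[measurable]: "g j \<in> bmeas borel" if "j \<in> Basis" for j using wdD(5)[OF wd[OF that]] .
 note [measurable] = test_functionD(3)[OF \<psi>(1)]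
 define G where "G x = (\<Sum>j\<in>Basis. \<bar>g j x\<bar>)" for x
 have Gm[measurable]: "G \<in> bmeas borel" unfolding G_def
  by (intro borel_measurable_sum borel_measurable_abs gm)
 have G0: "0 \<le> G x" for x by (simp add: G_def sum_nonneg)
 define R where "R = norm e + \<kappa>"
 have R: "R \<ge> 0" using \<kappa> by (simp add: R_def)
 have pos: "0 \<le> (LL x. \<psi> x)" using \<psi>(2) by (intro Bintegral_nonneg) auto
 have \<psi>int: "(NN x. en (\<psi> x)) = en (LL x. \<psi> x)"
  using test_function_integrable[OF \<psi>(1)] \<psi>(2) by (intro nn_integral_eq_integral) auto
 have one: "en (LL x. \<psi> x * f x)
   \<le> (NN x. en (\<psi> x) * en \<bar>f (x + y)\<bar>)
    + en R * (NN t. ind {0..1::real} t * (NN x. en (\<psi> x) * en (G (x + t *\<^sub>R y))))"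
  if y: "y \<in> B" for y
 proof -
  define gy where "gy x = (\<Sum>j\<in>Basis. (y \<bullet> j) * g j x)" for x
  have wy: "wd X y f gy" unfolding gy_def by (rule wd_direction[OF wd])
  have [measurable]: "gy \<in> bmeas borel" using wdD(5)[OF wy] .
  have ny: "norm y \<le> R" unfolding R_def
  proof -
   have "norm y \<le> norm e + dist e y" using norm_triangle_sub[of y e] by (simp add: dist_norm norm_minus_commute)
   then show "norm y \<le> norm e + \<kappa>" using y by (simp add: B_def)
  qed
  have gyle: "\<bar>gy x\<bar> \<le> R * G x" for x
  proof -
   have "\<bar>gy x\<bar> \<le> (\<Sum>j\<in>Basis. \<bar>(y \<bullet> j) * g j x\<bar>)" unfolding gy_def by (rule sum_abs)
   also have "\<dots> \<le> (\<Sum>j\<in>Basis. R * \<bar>g j x\<bar>)"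
    unfolding abs_mult using ny by (intro sum_mono mult_right_mono) (auto intro: order_trans[OF Basis_le_norm])
   finally show ?thesis by (simp add: G_def sum_distrib_left)
  qed
  define J where "J t = ind {0..1::real} t * (LL x. \<psi> x * gy (x + t *\<^sub>R y))" for t
  have [measurable]: "J \<in> bmeas borel" unfolding J_def by measurable
  have "(LL x. \<psi> x * f x) = (LL x. \<psi> x * f (x + y)) - (LL t. J t)"
   using wd_translation_test[OF wy \<psi>(1) cone] y unfolding J_def B_def by (simp add: algebra_simps)
  then have "(LL x. \<psi> x * f x) \<le> \<bar>LL x. \<psi> x * f (x + y)\<bar> + \<bar>LL t. J t\<bar>"
   by linarith
  then have "en (LL x. \<psi> x * f x) \<le> en \<bar>LL x. \<psi> x * f (x + y)\<bar> + en \<bar>LL t. J t\<bar>"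
   by (simp add: ennreal_leI flip: ennreal_plus)
  also have "\<dots> \<le> (NN x. en (\<psi> x) * en \<bar>f (x + y)\<bar>)
    + (NN t. en R * (ind {0..1::real} t * (NN x. en (\<psi> x) * en (G (x + t *\<^sub>R y)))))"
  proof (intro add_mono ennreal_abs_mult_bound)
   show "en \<bar>\<psi> x * f (x + y)\<bar> \<le> en (\<psi> x) * en \<bar>f (x + y)\<bar>" for x
    using \<psi>(2)[of x] by (simp add: abs_mult ennreal_mult')
   fix t
   have "en \<bar>LL x. \<psi> x * gy (x + t *\<^sub>R y)\<bar>
    \<le> (NN x. en R * (en (\<psi> x) * en (G (x + t *\<^sub>R y))))"
   proof (intro ennreal_abs_mult_bound)
    fix x
    have "\<bar>\<psi> x * gy (x + t *\<^sub>R y)\<bar> \<le> R * (\<psi> x * G (x + t *\<^sub>R y))"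
     using mult_left_mono[OF gyle \<psi>(2)] \<psi>(2)[of x] by (simp add: abs_mult mult.left_commute)
    then show "en \<bar>\<psi> x * gy (x + t *\<^sub>R y)\<bar> \<le> en R * (en (\<psi> x) * en (G (x + t *\<^sub>R y)))"
     using R \<psi>(2) G0 by (simp add: ennreal_leI flip: ennreal_mult)
   qed measurable
   also have "\<dots> = en R * (NN x. en (\<psi> x) * en (G (x + t *\<^sub>R y)))"
    by (rule nn_integral_cmult) measurable
   finally show "en \<bar>J t\<bar> \<le> en R * (ind {0..1::real} t * (NN x. en (\<psi> x) * en (G (x + t *\<^sub>R y))))"
    by (cases "t \<in> {0..1}") (auto simp: J_def)
  qed measurable
  also have "(NN t. en R * (ind {0..1::real} t * (NN x. en (\<psi> x) * en (G (x + t *\<^sub>R y)))))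
   = en R * (NN t. ind {0..1::real} t * (NN x. en (\<psi> x) * en (G (x + t *\<^sub>R y))))"
   by (rule nn_integral_cmult) measurable
  finally show ?thesis .
 qed
 have q1: "q > 1" using q DIM_positive[where 'a='a] by linarith
 define c where "c = 1 - ?n / q"
 have c: "c > 0" using q q1 by (simp add: c_def)
 have t1: "(NN y. ind B y * (NN x. en (\<psi> x) * en \<bar>f (x + y)\<bar>))
  \<le> en (b + M) * en (LL x. \<psi> x)"
 proof -
  have "(NN y. ind B y * (NN x. en (\<psi> x) * en \<bar>f (x + y)\<bar>))
   = (NN y. (NN x. ind B y * (en (\<psi> x) * en \<bar>f (x + y)\<bar>)))"
   by (subst nn_integral_cmult) auto
  also have "\<dots> = (NN x. (NN y. ind B y * (en (\<psi> x) * en \<bar>f (x + y)\<bar>)))"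
   by (rule lborel_pair.Fubini') measurable
  also have "\<dots> = (NN x. en (\<psi> x) * (NN y. ind B y * en \<bar>f (x + y)\<bar>))"
  proof (rule nn_integral_cong)
   fix x
   have "(NN y. ind B y * (en (\<psi> x) * en \<bar>f (x + y)\<bar>))
    = (NN y. en (\<psi> x) * (ind B y * en \<bar>f (x + y)\<bar>))"
    by (simp add: mult.left_commute)
   also have "\<dots> = en (\<psi> x) * (NN y. ind B y * en \<bar>f (x + y)\<bar>)"
    by (rule nn_integral_cmult) measurable
   finally show "(NN y. ind B y * (en (\<psi> x) * en \<bar>f (x + y)\<bar>))
    = en (\<psi> x) * (NN y. ind B y * en \<bar>f (x + y)\<bar>)" .
  qed
  also have "\<dots> \<le> (NN x. en (\<psi> x) * en (b + M))"
  proof (intro nn_integral_mono mult_left_mono)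
   fix x
   have "(NN y. ind B y * en \<bar>f (x + y)\<bar>) \<le> (NN y. ind B y + en (\<bar>f (x + y)\<bar> powr q))"
   proof (rule nn_integral_mono)
    fix y
    have "\<bar>f (x + y)\<bar> \<le> 1 + \<bar>f (x + y)\<bar> powr q" using young_powr[OF abs_ge_zero zero_less_one q1] by simp
    then have "en \<bar>f (x + y)\<bar> \<le> 1 + en (\<bar>f (x + y)\<bar> powr q)"
     by (simp add: ennreal_leI flip: ennreal_1 ennreal_plus)
    then show "ind B y * en \<bar>f (x + y)\<bar> \<le> ind B y + en (\<bar>f (x + y)\<bar> powr q)"
     by (auto simp: indicator_def)
   qed
   also have "\<dots> = en b + (NN y. en (\<bar>f (x + y)\<bar> powr q))"
    by (simp add: nn_integral_add b)
   also have "(NN y. en (\<bar>f (x + y)\<bar> powr q)) = (NN y. en (\<bar>f y\<bar> powr q))"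
    using nn_integral_translate[of "\<lambda>y. en (\<bar>f y\<bar> powr q)" x] by (simp add: add.commute)
   also have "en b + \<dots> \<le> en b + en M" using M by (intro add_mono) auto
   finally show "(NN y. ind B y * en \<bar>f (x + y)\<bar>) \<le> en (b + M)"
    using b M by simp
  qed simp
  also have "\<dots> = en (b + M) * en (LL x. \<psi> x)"
   by (simp add: nn_integral_multc \<psi>int mult.commute)
  finally show ?thesis .
 qed
 have t2: "(NN y. ind B y * (NN t. ind {0..1::real} t * (NN x. en (\<psi> x) * en (G (x + t *\<^sub>R y)))))
   \<le> en ((b + M) / c) * en (LL x. \<psi> x)"
 proof -
  let ?F = "\<lambda>y t x. ind B y * (ind {0..1::real} t * (en (\<psi> x) * en (G (x + t *\<^sub>R y))))"
  have "(NN y. ind B y * (NN t. ind {0..1::real} t * (NN x. en (\<psi> x) * en (G (x + t *\<^sub>R y)))))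
   = (NN y. NN t. NN x. ?F y t x)"
   by (simp add: nn_integral_cmult)
  also have "\<dots> = (NN y. NN x. NN t. ?F y t x)"
   by (rule nn_integral_cong, rule lborel_pair.Fubini') measurable
  also have "\<dots> = (NN x. NN y. NN t. ?F y t x)"
   by (rule lborel_pair.Fubini') measurable
  also have "\<dots> = (NN x. NN t. NN y. ?F y t x)"
   by (rule nn_integral_cong, rule lborel_pair.Fubini') measurable
  also have "\<dots> = (NN x. en (\<psi> x) * (NN t. ind {0..1::real} t * (NN y. ind B y * en (G (x + t *\<^sub>R y)))))"
  proof (rule nn_integral_cong)
   fix x
   have "(NN y. ?F y t x)
    = (NN y. (en (\<psi> x) * ind {0..1} t) * (ind B y * en (G (x + t *\<^sub>R y))))" for t
    by (simp add: mult_ac)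
   moreover have "(NN y. (en (\<psi> x) * ind {0..1} t) * (ind B y * en (G (x + t *\<^sub>R y))))
    = (en (\<psi> x) * ind {0..1} t) * (NN y. ind B y * en (G (x + t *\<^sub>R y)))" for t
    by (rule nn_integral_cmult) measurable
   ultimately have "(NN t. NN y. ?F y t x)
    = (NN t. en (\<psi> x) * (ind {0..1} t * (NN y. ind B y * en (G (x + t *\<^sub>R y)))))"
    by (simp add: mult.assoc)
   also have "\<dots> = en (\<psi> x) * (NN t. ind {0..1::real} t * (NN y. ind B y * en (G (x + t *\<^sub>R y))))"
    by (rule nn_integral_cmult) measurable
   finally show "(NN t. NN y. ?F y t x)
    = en (\<psi> x) * (NN t. ind {0..1::real} t * (NN y. ind B y * en (G (x + t *\<^sub>R y))))" .
  qed
  also have "\<dots> \<le> (NN x. en (\<psi> x) * en ((b + M) / c))"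
   unfolding c_def
   by (intro nn_integral_mono mult_left_mono cone_average_bound[OF q Gm G0 _ M(2) _ b(1)]) (use M(3) b(2) in \<open>auto simp: G_def\<close>)
  also have "\<dots> = en ((b + M) / c) * en (LL x. \<psi> x)"
   by (simp add: nn_integral_multc \<psi>int mult.commute)
  finally show ?thesis .
 qed
 have "en b * en (LL x. \<psi> x * f x) = (NN y. ind B y * en (LL x. \<psi> x * f x))"
  by (simp add: nn_integral_multc b)
 also have "\<dots> \<le> (NN y. ind B y * (NN x. en (\<psi> x) * en \<bar>f (x + y)\<bar>)
   + en R * (ind B y * (NN t. ind {0..1::real} t * (NN x. en (\<psi> x) * en (G (x + t *\<^sub>R y))))))"
  using one by (intro nn_integral_mono) (auto simp: indicator_def)
 also have "\<dots> = (NN y. ind B y * (NN x. en (\<psi> x) * en \<bar>f (x + y)\<bar>))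
   + en R * (NN y. ind B y * (NN t. ind {0..1::real} t * (NN x. en (\<psi> x) * en (G (x + t *\<^sub>R y)))))"
  by (subst nn_integral_add) (auto simp: nn_integral_cmult)
 also have "\<dots> \<le> en (b + M) * en (LL x. \<psi> x) + en R * (en ((b + M) / c) * en (LL x. \<psi> x))"
  by (intro add_mono mult_left_mono t1 t2) auto
 also have "\<dots> = en ((b + M) * (LL x. \<psi> x) + R * ((b + M) / c * (LL x. \<psi> x)))"
  using b M c R pos by (simp flip: ennreal_mult ennreal_plus)
 finally have "en (b * (LL x. \<psi> x * f x)) \<le> en ((b + M) * (LL x. \<psi> x) + R * ((b + M) / c * (LL x. \<psi> x)))"
  using b by (simp add: ennreal_mult')
 then have "b * (LL x. \<psi> x * f x) \<le> (b + M) * (LL x. \<psi> x) + R * ((b + M) / c * (LL x. \<psi> x))"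
  using b M c R pos by (subst (asm) ennreal_le_iff) auto
 then show ?thesis using b(2) c
  unfolding morrey_const_def B_def[symmetric] b_def[symmetric] R_def[symmetric] c_def[symmetric]
  by (simp add: field_simps)
qed

lemma morrey_local:
 fixes f :: "'a::euclidean_space => real" and q :: real
 assumes q: "q > DIM('a)" and wd: "\<And>j. j \<in> Basis ==> wd X j f (g j)"
  and V: "open V" "bounded V"
  and cone: "\<And>x y t. x \<in> V ==> y \<in> ball e \<kappa> ==> 0 \<le> t ==> t \<le> 1 ==> x + t *\<^sub>R y \<in> X" and \<kappa>: "\<kappa> > 0"
  and M: "(NN x. en (\<bar>f x\<bar> powr q)) \<le> en M" "M \<ge> 0"
    "(NN x. en ((\<Sum>j\<in>Basis. \<bar>g j x\<bar>) powr q)) \<le> en M"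
 shows "AE x in lborel. x \<in> V --> \<bar>f x\<bar> \<le> morrey_const e \<kappa> q M"
proof -
 let ?C = "morrey_const e \<kappa> q M"
 obtain j0 :: 'a where j0: "j0 \<in> Basis" using nonempty_Basis by blast
 note if' = wdD(1)[OF wd[OF j0]]
 have V': "emeasure lborel V < \<infinity>"
  using emeasure_bounded_finite[OF V(2)] V(1) by simp
 have iV: "integ (\<lambda>x. ?C * ind V x)"
  using V V' by (intro integrable_mult_right) (auto intro: integrable_real_indicator)
 have half: "AE x in lborel. x \<in> V --> 0 \<le> ?C * ind V x - s * f x" if s: "s = 1 \<or> s = -1" for s
 proof (rule AE_nonneg_if_test_nonneg[OF V])
  show "integ (\<lambda>x. ?C * ind V x - s * f x)" using iV if' by auto
  fix \<psi> assume \<psi>: "test_function V \<psi>" "\<And>x. 0 \<le> \<psi> x"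
  have "(LL x. \<psi> x * (s * f x)) \<le> ?C * (LL x. \<psi> x)"
   by (rule morrey_test_bound[OF q wd_cmult[OF wd] cone \<kappa> _ M(2) _ \<psi>])
    (use s M in \<open>auto simp: abs_mult\<close>)
  moreover have "(LL x. \<psi> x * (?C * ind V x)) = ?C * (LL x. \<psi> x)"
  proof -
   have "\<psi> x * (?C * ind V x) = ?C * \<psi> x" for x
    using test_functionD(4)[OF \<psi>(1), of x] by (auto simp: indicator_def)
   then have "(LL x. \<psi> x * (?C * ind V x)) = (LL x. ?C * \<psi> x)"
    by (simp only:)
   then show ?thesis by simp
  qed
  moreover have "integ (\<lambda>x. \<psi> x * (?C * ind V x))" "integ (\<lambda>x. \<psi> x * (s * f x))"
   using test_mult_integrable[OF \<psi>(1)] iV if' by auto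
  ultimately show "0 \<le> (LL x. \<psi> x * (?C * ind V x - s * f x))"
   by (simp add: right_diff_distrib)
 qed
 show ?thesis using half[of 1, simplified] half[of "-1", simplified]
  by eventually_elim (auto simp: indicator_def)
qed

section \<open>Boundary charts and the cone property\<close>

lemma gradient_derivative:
 fixes d :: "real^3 => real"
 assumes "open U" "smooth_on U d" "z \<in> U"
 shows "(d has_derivative (\<lambda>h. gradient d z \<bullet> h)) (at z)"
proof -
 let ?D = "fder d z"
 have D: "(d has_derivative ?D) (at z)" by (rule smooth_onD[OF assms])
 have "?D h = gradient d z \<bullet> h" for h
 proof -
  have "?D h = (\<Sum>j\<in>Basis. (h \<bullet> j) *\<^sub>R ?D j)" by (rule linear_basis_expansion[OF has_derivative_linear[OF D]])
  also have "\<dots> = (\<Sum>i\<in>UNIV. h $ i * ?D (axis i 1))"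
   by (simp add: Basis_vec_def sum.UNION_disjoint axis_eq_axis inner_axis)
  also have "\<dots> = gradient d z \<bullet> h" by (simp add: gradient_def inner_vec_def mult.commute)
  finally show ?thesis .
 qed
 then have "?D = (\<lambda>h. gradient d z \<bullet> h)" by auto
 with D show ?thesis by simp
qed

lemma smooth_on_gradient:
 assumes "open U" "smooth_on U d" shows "smooth_on U (\<lambda>z. gradient d z $ i)" "continuous_on U (gradient d)"
proof -
 have i: "axis i (1::real) \<in> Basis" for i :: 3 by (simp add: axis_in_Basis_iff)
 show s: "smooth_on U (\<lambda>z. gradient d z $ i)" for i
  using smooth_on_deriv[OF assms(2) i[of i]] by (simp add: gradient_def)
 then show "continuous_on U (gradient d)"
  using smooth_on_continuous[OF s] continuous_on_vec_lambda[of U "\<lambda>i z. gradient d z $ i"] by simp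
qed

text \<open>The gradient of a local defining function is continuous and does not vanish.\<close>
lemma boundary_chart:
 assumes "smooth_bounded_domain X" "x0 \<in> frontier X"
 obtains U d a R where "local_defining_function X x0 U d" "R > 0" "a \<noteq> 0" "cball x0 (2 * R) \<subseteq> U"
  "\<And>z. z \<in> cball x0 (2 * R) ==> norm (gradient d z - a) \<le> norm a / 4"
proof -
 obtain U d where Ud: "local_defining_function X x0 U d"
  using assms unfolding smooth_bounded_domain_def by blast
 then have U: "open U" "x0 \<in> U" and d: "smooth_on U d" and ne: "gradient d x0 \<noteq> 0"
  unfolding local_defining_function_def by auto
 let ?a = "gradient d x0"
 have "continuous_on U (gradient d)" by (rule smooth_on_gradient(2)[OF U(1) d])
 then have "isCont (gradient d) x0" using U continuous_on_eq_continuous_at by blast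
 then obtain r where r: "r > 0" "\<And>z. dist z x0 < r ==> dist (gradient d z) ?a < norm ?a / 4"
  using ne unfolding continuous_at_eps_delta by (metis divide_pos_pos zero_less_norm_iff zero_less_numeral)
 obtain s where s: "s > 0" "cball x0 s \<subseteq> U" using U open_contains_cball by blast
 define R where "R = min s (r / 2) / 2"
 have R: "R > 0" "2 * R \<le> s" "2 * R < r" using r s by (auto simp: R_def)
 show ?thesis
 proof (rule that[OF Ud R(1) ne])
  show "cball x0 (2 * R) \<subseteq> U" using s R by auto
  show "norm (gradient d z - ?a) \<le> norm ?a / 4" if "z \<in> cball x0 (2 * R)" for z
  proof -
   have "dist z x0 < r" using that R by (auto simp: dist_commute)
   from r(2)[OF this] show ?thesis by (simp add: dist_norm)
  qed
 qed
qed

lemma defining_function_derivative_along: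
 fixes d :: "real^3 => real"
 assumes "open U" "smooth_on U d" "x + t *\<^sub>R y \<in> U"
 shows "((\<lambda>t. d (x + t *\<^sub>R y)) has_real_derivative (gradient d (x + t *\<^sub>R y) \<bullet> y)) (at t)"
proof -
 have "((\<lambda>t. d (x + t *\<^sub>R y)) has_derivative (\<lambda>s. gradient d (x + t *\<^sub>R y) \<bullet> (s *\<^sub>R y))) (at t)"
  by (rule has_derivative_compose[of "\<lambda>t. x + t *\<^sub>R y" "\<lambda>s. s *\<^sub>R y" t UNIV, OF _ gradient_derivative[OF assms]])
   (auto intro!: derivative_eq_intros)
 then show ?thesis unfolding has_field_derivative_def
  by (rule has_derivative_eq_rhs) (auto simp: fun_eq_iff mult.commute)
qed

text \<open>Near a boundary point the local defining function decreases in all directions close to - a, where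
a is the gradient there, so short segments in these directions stay inside.\<close>
lemma cone_condition:
 assumes X: "smooth_bounded_domain X" and x0: "x0 \<in> closure X"
 shows "\<exists>W e \<kappa>. open W \<and> x0 \<in> W \<and> \<kappa> > 0 \<and>
   (\<forall>x\<in>X \<inter> W. \<forall>y\<in>ball e \<kappa>. \<forall>t. 0 \<le> t \<and> t \<le> 1 --> x + t *\<^sub>R y \<in> X)"
proof (cases "x0 \<in> X")
 case True
 have "open X" using X by (simp add: smooth_bounded_domain_def)
 then obtain r where r: "r > 0" "ball x0 r \<subseteq> X" using True open_contains_ball by blast
 show ?thesis
 proof (intro exI conjI ballI allI impI)
  show "open (ball x0 (r / 2))" "x0 \<in> ball x0 (r / 2)" "r / 2 > 0" using r by auto
  fix x y t assume "x \<in> X \<inter> ball x0 (r / 2)" "y \<in> ball (0::real^3) (r / 2)" "0 \<le> t \<and> t \<le> (1::real)"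
  then have "dist x0 x < r / 2" "norm y < r / 2" "0 \<le> t" "t \<le> 1" by auto
  moreover have "norm (t *\<^sub>R y) \<le> norm y" using \<open>0 \<le> t\<close> \<open>t \<le> 1\<close> by (simp add: mult_left_le_one_le)
  moreover have "dist x0 (x + t *\<^sub>R y) \<le> dist x0 x + norm (t *\<^sub>R y)"
   using dist_triangle[of x0 "x + t *\<^sub>R y" x] by (simp add: dist_norm)
  ultimately have "x + t *\<^sub>R y \<in> ball x0 r" by simp
  then show "x + t *\<^sub>R y \<in> X" using r by blast
 qed
next
 case False
 have "open X" using X by (simp add: smooth_bounded_domain_def)
 then have "x0 \<in> frontier X" using x0 False by (simp add: frontier_def interior_open)
 from boundary_chart[OF X this] obtain U d a R where ldf: "local_defining_function X x0 U d"
  and R: "R > 0" "a \<noteq> 0" "cball x0 (2 * R) \<subseteq> U"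
  and g: "\<And>z. z \<in> cball x0 (2 * R) ==> norm (gradient d z - a) \<le> norm a / 4" by metis
 then have U: "open U" and d: "smooth_on U d" and inX: "X \<inter> U = {y \<in> U. d y < 0}"
  unfolding local_defining_function_def by auto
 define e where "e = (- (R / (2 * norm a))) *\<^sub>R a"
 have ne: "norm e = R / 2" using R by (simp add: e_def)
 have ae: "a \<bullet> e = - (norm a * (R / 2))" using R by (simp add: e_def dot_square_norm power2_eq_square)
 show ?thesis
 proof (intro exI conjI ballI allI impI)
  show "open (ball x0 R)" "x0 \<in> ball x0 R" "R / 8 > 0" using R by auto
  fix x y t assume x: "x \<in> X \<inter> ball x0 R" and y: "y \<in> ball e (R / 8)" and t: "0 \<le> t \<and> t \<le> (1::real)"
  have ye: "norm (y - e) < R / 8" using y by (simp add: dist_norm norm_minus_commute)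
  have ny: "norm y < R" using norm_triangle_sub[of y e] ne ye R by linarith
  have inb: "x + s *\<^sub>R y \<in> cball x0 (2 * R)" if "0 \<le> s" "s \<le> 1" for s
  proof -
   have "norm (s *\<^sub>R y) \<le> norm y" using that by (simp add: mult_left_le_one_le)
   moreover have "dist x0 (x + s *\<^sub>R y) \<le> dist x0 x + norm (s *\<^sub>R y)"
    using dist_triangle[of x0 "x + s *\<^sub>R y" x] by (simp add: dist_norm)
   ultimately show ?thesis using x ny by auto
  qed
  have neg: "gradient d z \<bullet> y \<le> 0" if "z \<in> cball x0 (2 * R)" for z
  proof -
   have "gradient d z \<bullet> y = a \<bullet> e + a \<bullet> (y - e) + (gradient d z - a) \<bullet> y"
    by (simp add: inner_diff_left inner_diff_right)
   moreover have "a \<bullet> (y - e) \<le> norm a * (R / 8)"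
    using norm_cauchy_schwarz[of a "y - e"] ye by (meson less_imp_le mult_left_mono norm_ge_zero order_trans)
   moreover have "(gradient d z - a) \<bullet> y \<le> norm a / 4 * R"
    using norm_cauchy_schwarz[of "gradient d z - a" y] mult_mono[OF g[OF that] less_imp_le[OF ny]]
    by (meson norm_ge_zero order_trans divide_nonneg_nonneg zero_le_numeral)
   moreover have "0 \<le> norm a * R" using R by simp
   ultimately show ?thesis unfolding ae by simp
  qed
  have "d (x + t *\<^sub>R y) \<le> d (x + 0 *\<^sub>R y)"
  proof (rule DERIV_nonpos_imp_nonincreasing[of 0 t "\<lambda>s. d (x + s *\<^sub>R y)"])
   show "0 \<le> t" using t by simp
   fix s assume s: "0 \<le> s" "s \<le> t"
   then have "x + s *\<^sub>R y \<in> cball x0 (2 * R)" using inb t by auto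
   then show "\<exists>D. ((\<lambda>s. d (x + s *\<^sub>R y)) has_real_derivative D) (at s) \<and> D \<le> 0"
    using defining_function_derivative_along[OF U d] neg R(3) by blast
  qed
  moreover have "x \<in> U" using inb[of 0] R(3) by auto
  then have "d x < 0" using x inX by blast
  moreover have "x + t *\<^sub>R y \<in> U" using inb[of t] t R(3) by blast
  ultimately have "x + t *\<^sub>R y \<in> {y \<in> U. d y < 0}" by simp
  then show "x + t *\<^sub>R y \<in> X" unfolding inX[symmetric] by simp
 qed
qed

definition Lq_norm :: "real => ('a::euclidean_space => real) => real" where
 "Lq_norm q f = (LL x. \<bar>f x\<bar> powr q) powr (1 / q)"

lemma Lq_normalized:
 fixes f :: "'a::euclidean_space => real"
 assumes "integ (\<lambda>x. \<bar>f x\<bar> powr q)" "Lq_norm q f \<le> N" "N > 0" "q > 0"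
 shows "(NN x. en (\<bar>1 / N * f x\<bar> powr q)) \<le> 1"
proof -
 have I: "0 \<le> (LL x. \<bar>f x\<bar> powr q)" by (intro Bintegral_nonneg) auto
 have "(LL x. \<bar>f x\<bar> powr q) = Lq_norm q f powr q"
  using I assms(4) by (simp add: Lq_norm_def powr_powr)
 also have "\<dots> \<le> N powr q" using assms by (intro powr_mono2) (auto simp: Lq_norm_def)
 finally have le: "(LL x. \<bar>f x\<bar> powr q) \<le> N powr q" .
 have eq: "\<bar>1 / N * f x\<bar> powr q = \<bar>f x\<bar> powr q / N powr q" for x
  using assms by (simp add: abs_mult powr_divide)
 have "(NN x. en (\<bar>1 / N * f x\<bar> powr q)) = en (LL x. \<bar>f x\<bar> powr q / N powr q)"
  unfolding eq by (rule nn_integral_eq_integral) (use assms in auto)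
 also have "\<dots> \<le> 1" using le assms by (simp add: divide_le_eq_1)
 finally show ?thesis .
qed

text \<open>Each summand is at most the largest one.\<close>
lemma sum_powr_le:
 fixes a :: "'i => real"
 assumes "finite I" "\<And>i. i \<in> I ==> 0 \<le> a i" "q \<ge> 0"
 shows "(\<Sum>i\<in>I. a i) powr q \<le> real (card I) powr q * (\<Sum>i\<in>I. a i powr q)"
proof (cases "I = {}")
 case False
 define m where "m = Max (a ` I)"
 have m: "m \<in> a ` I" "\<And>i. i \<in> I ==> a i \<le> m" using assms False by (auto simp: m_def)
 then obtain k where k: "k \<in> I" "m = a k" by blast
 have "(\<Sum>i\<in>I. a i) \<le> real (card I) * m" using sum_bounded_above[of I a m] m(2) by simp
 then have "(\<Sum>i\<in>I. a i) powr q \<le> (real (card I) * m) powr q"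
  using assms by (intro powr_mono2) (auto intro: sum_nonneg)
 also have "\<dots> = real (card I) powr q * a k powr q" using assms k by (simp add: powr_mult)
 also have "\<dots> \<le> real (card I) powr q * (\<Sum>i\<in>I. a i powr q)"
  using assms k by (intro mult_left_mono member_le_sum) auto
 finally show ?thesis .
qed simp

text \<open>Finitely many of the neighbourhoods in \<open>cone_condition\<close> cover the closure of the
domain. The local bound is not homogeneous in f, so it is applied to f / N, where N exceeds the sum of the
norms.\<close>
theorem morrey:
 assumes X: "smooth_bounded_domain X" and q: "q > 3"
 obtains C where "C \<ge> 0"
  "\<And>f g. (\<And>j. j \<in> Basis ==> wd X j f (g j)) ==> integ (\<lambda>x. \<bar>f x\<bar> powr q) ==>
   (\<And>j. j \<in> Basis ==> integ (\<lambda>x. \<bar>g j x\<bar> powr q)) ==>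
   AE x in lborel. x \<in> X --> \<bar>f x\<bar> \<le> C * (Lq_norm q f + (\<Sum>j\<in>Basis. Lq_norm q (g j)))"
proof -
 have o: "open X" and bd: "bounded X" using X by (auto simp: smooth_bounded_domain_def)
 have "\<forall>z\<in>closure X. \<exists>p. open (fst p) \<and> z \<in> fst p \<and> snd (snd p) > 0 \<and>
   (\<forall>x\<in>X \<inter> fst p. \<forall>y\<in>ball (fst (snd p)) (snd (snd p)). \<forall>t. 0 \<le> t \<and> t \<le> 1 --> x + t *\<^sub>R y \<in> X)"
  using cone_condition[OF X] by simp
 then obtain p where p: "\<And>z. z \<in> closure X ==> open (fst (p z)) \<and> z \<in> fst (p z) \<and> snd (snd (p z)) > 0 \<and>
   (\<forall>x\<in>X \<inter> fst (p z). \<forall>y\<in>ball (fst (snd (p z))) (snd (snd (p z))). \<forall>t. 0 \<le> t \<and> t \<le> 1 --> x + t *\<^sub>R y \<in> X)"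
  by metis
 have "compact (closure X)" using bd by (simp add: compact_closure)
 then obtain S where S: "S \<subseteq> closure X" "finite S" "closure X \<subseteq> (\<Union>z\<in>S. fst (p z))"
  by (rule compactE_image[of _ "closure X" "\<lambda>z. fst (p z)"]) (use p in auto)
 \<comment> \<open>After normalization the two integrals in the local bound are at most 1 and 3^q * 3, since there are three derivatives.\<close>
 define M where "M = max 1 (3 powr q * 3)"
 define c where "c z = morrey_const (fst (snd (p z))) (snd (snd (p z))) q M" for z
 define C where "C = (\<Sum>z\<in>S. \<bar>c z\<bar>)"
 show ?thesis
 proof
  show C0: "C \<ge> 0" by (simp add: C_def sum_nonneg)
  fix f :: "real^3 => real" and g
  assume wd: "\<And>j. j \<in> Basis ==> wd X j f (g j)" and fq: "integ (\<lambda>x. \<bar>f x\<bar> powr q)"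
   and gq: "\<And>j. j \<in> Basis ==> integ (\<lambda>x. \<bar>g j x\<bar> powr q)"
  let ?N = "Lq_norm q f + (\<Sum>j\<in>Basis. Lq_norm q (g j))"
  have nn: "0 \<le> Lq_norm q h" for h :: "real^3 => real" by (simp add: Lq_norm_def)
  have gm: "g j \<in> bmeas borel" if "j \<in> Basis" for j using wdD(5)[OF wd[OF that]] .
  have main: "AE x in lborel. x \<in> X --> \<bar>f x\<bar> \<le> C * N" if N: "N > 0" "?N \<le> N" for N
  proof -
   have le: "Lq_norm q f \<le> N" "\<And>j. j \<in> Basis ==> Lq_norm q (g j) \<le> N"
   proof -
    have s: "0 \<le> (\<Sum>j\<in>Basis. Lq_norm q (g j))" by (intro sum_nonneg nn)
    then show "Lq_norm q f \<le> N" using N by linarith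
    fix j :: "real^3" assume "j \<in> Basis"
    then have "Lq_norm q (g j) \<le> (\<Sum>j\<in>Basis. Lq_norm q (g j))" by (intro member_le_sum nn) auto
    then show "Lq_norm q (g j) \<le> N" using N nn[of f] by linarith
   qed
   have f1: "(NN x. en (\<bar>1 / N * f x\<bar> powr q)) \<le> en M"
    using Lq_normalized[OF fq le(1) N(1)] q by (simp add: M_def max_def ennreal_leI order_trans flip: ennreal_1)
   have "(NN x. en ((\<Sum>j\<in>Basis. \<bar>1 / N * g j x\<bar>) powr q))
     \<le> (NN x. en (3 powr q) * (\<Sum>j\<in>Basis. en (\<bar>1 / N * g j x\<bar> powr q)))"
   proof (rule nn_integral_mono)
    fix x
    have "(\<Sum>j\<in>Basis. \<bar>1 / N * g j x\<bar>) powr q \<le> 3 powr q * (\<Sum>j\<in>Basis. \<bar>1 / N * g j x\<bar> powr q)"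
     using sum_powr_le[of "Basis :: (real^3) set" "\<lambda>j. \<bar>1 / N * g j x\<bar>" q] q by simp
    then have "en ((\<Sum>j\<in>Basis. \<bar>1 / N * g j x\<bar>) powr q) \<le> en (3 powr q * (\<Sum>j\<in>Basis. \<bar>1 / N * g j x\<bar> powr q))"
     by (rule ennreal_leI)
    also have "\<dots> = en (3 powr q) * en (\<Sum>j\<in>Basis. \<bar>1 / N * g j x\<bar> powr q)"
     by (intro ennreal_mult sum_nonneg powr_ge_zero)
    also have "en (\<Sum>j\<in>Basis. \<bar>1 / N * g j x\<bar> powr q) = (\<Sum>j\<in>Basis. en (\<bar>1 / N * g j x\<bar> powr q))"
     by (rule sum_ennreal[symmetric]) (rule powr_ge_zero)
    finally show "en ((\<Sum>j\<in>Basis. \<bar>1 / N * g j x\<bar>) powr q) \<le> en (3 powr q) * (\<Sum>j\<in>Basis. en (\<bar>1 / N * g j x\<bar> powr q))" .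
   qed
   also have "\<dots> = en (3 powr q) * (\<Sum>j\<in>Basis. (NN x. en (\<bar>1 / N * g j x\<bar> powr q)))"
   proof -
    have m: "(\<lambda>x. en (\<bar>1 / N * g j x\<bar> powr q)) \<in> bmeas lborel" if "j \<in> Basis" for j
     using gm[OF that] by simp
    show ?thesis
     by (subst nn_integral_cmult[OF borel_measurable_sum[OF m]], assumption, subst nn_integral_sum[OF m]) auto
   qed
   also have "\<dots> \<le> en (3 powr q) * (\<Sum>j\<in>(Basis::(real^3) set). 1)"
    using q by (intro mult_left_mono sum_mono Lq_normalized[OF gq le(2) N(1)]) auto
   also have "\<dots> = en (3 powr q * 3)" by (simp add: ennreal_mult')
   also have "\<dots> \<le> en M" by (simp add: M_def ennreal_leI)
   finally have g1: "(NN x. en ((\<Sum>j\<in>Basis. \<bar>1 / N * g j x\<bar>) powr q)) \<le> en M" .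
   have loc: "AE x in lborel. x \<in> X \<inter> fst (p z) --> \<bar>1 / N * f x\<bar> \<le> c z" if "z \<in> S" for z
   proof -
    have pz: "open (fst (p z)) \<and> z \<in> fst (p z) \<and> snd (snd (p z)) > 0 \<and>
     (\<forall>x\<in>X \<inter> fst (p z). \<forall>y\<in>ball (fst (snd (p z))) (snd (snd (p z))). \<forall>t. 0 \<le> t \<and> t \<le> 1 --> x + t *\<^sub>R y \<in> X)"
     using p that S(1) by blast
    show ?thesis unfolding c_def
    proof (rule morrey_local[of q X])
     show "real DIM(real^3) < q" using q by simp
     show "wd X j (\<lambda>x. 1 / N * f x) (\<lambda>x. 1 / N * g j x)" if "j \<in> Basis" for j
      by (rule wd_cmult[OF wd[OF that]])
     show "open (X \<inter> fst (p z))" "bounded (X \<inter> fst (p z))" using pz o bd by auto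
     show "0 < snd (snd (p z))" using pz by blast
     show "0 \<le> M" by (simp add: M_def)
     show "x + t *\<^sub>R y \<in> X" if "x \<in> X \<inter> fst (p z)" "y \<in> ball (fst (snd (p z))) (snd (snd (p z)))" "0 \<le> t" "t \<le> 1" for x y t
      using pz that by blast
    qed (use f1 g1 in auto)
   qed
   have "AE x in lborel. \<forall>z\<in>S. x \<in> X \<inter> fst (p z) --> \<bar>1 / N * f x\<bar> \<le> c z"
    using loc by (intro AE_finite_allI S(2))
   then show ?thesis
   proof (rule AE_mp, intro AE_I2 impI)
    fix x assume all: "\<forall>z\<in>S. x \<in> X \<inter> fst (p z) --> \<bar>1 / N * f x\<bar> \<le> c z" and x: "x \<in> X"
    obtain z where z: "z \<in> S" "x \<in> fst (p z)" using S(3) x closure_subset by blast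
    have "\<bar>1 / N * f x\<bar> \<le> \<bar>c z\<bar>" using all x z by force
    also have "\<bar>c z\<bar> \<le> C" unfolding C_def using S(2) z(1) by (intro member_le_sum) auto
    finally show "\<bar>f x\<bar> \<le> C * N" using N(1) by (simp add: abs_mult field_simps)
   qed
  qed
  have N0: "0 \<le> ?N" by (intro add_nonneg_nonneg sum_nonneg nn)
  have "AE x in lborel. \<forall>n::nat. x \<in> X --> \<bar>f x\<bar> \<le> C * (?N + inverse (real (Suc n)))"
   unfolding AE_all_countable using main N0 by (auto intro!: main add_nonneg_pos)
  then show "AE x in lborel. x \<in> X --> \<bar>f x\<bar> \<le> C * ?N"
  proof (rule AE_mp, intro AE_I2 impI)
   fix x assume all: "\<forall>n::nat. x \<in> X --> \<bar>f x\<bar> \<le> C * (?N + inverse (real (Suc n)))" and x: "x \<in> X"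
   have "(\<lambda>n. C * (?N + inverse (real (Suc n)))) ----> C * (?N + 0)"
    by (intro tendsto_intros LIMSEQ_inverse_real_of_nat)
   then show "\<bar>f x\<bar> \<le> C * ?N" using all x by (intro LIMSEQ_le_const) auto
  qed
 qed
qed

section \<open>Metric outer measures\<close>

lemma outer_measure_space_facts:
 fixes H :: "'a set => ennreal"
 assumes H: "outer_measure_space UNIV H"
 shows "H {} = 0" "\<And>A B. A \<subseteq> B ==> H A \<le> H B" "\<And>A. H (\<Union>i::nat. A i) \<le> (\<Sum>i. H (A i))"
  "\<And>A B. H (A \<union> B) \<le> H A + H B"
proof -
 show H0: "H {} = 0" and mono: "\<And>A B. A \<subseteq> B ==> H A \<le> H B"
  using H by (auto simp: outer_measure_space_def positive_def increasing_def)
 show csub: "H (\<Union>i::nat. A i) \<le> (\<Sum>i. H (A i))" for A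
 proof -
  have "H (\<Union>i. disjointed A i) \<le> (\<Sum>i. H (disjointed A i))"
   using H disjoint_family_disjointed[of A]
   by (auto simp: outer_measure_space_def countably_subadditive_def)
  also have "\<dots> \<le> (\<Sum>i. H (A i))"
   by (intro suminf_le mono disjointed_subset) auto
  finally show ?thesis by (simp add: UN_disjointed_eq)
 qed
 show "H (A \<union> B) \<le> H A + H B" for A B
 proof -
  have "(\<Union>n::nat. (if n = 0 then A else if n = 1 then B else {})) = A \<union> B" by (auto split: if_splits)
  then show ?thesis
   using csub[of "\<lambda>n. if n = 0 then A else if n = 1 then B else {}"]
    suminf_finite[of "{0,1::nat}" "\<lambda>n. H (if n = 0 then A else if n = 1 then B else {})"] H0 by auto
 qed
qed

text \<open>Induction over the number of sets: the next set has positive distance from the union of the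
previous ones.\<close>
lemma separated_union_sum:
 fixes H :: "'a::metric_space set => ennreal"
 assumes H0: "H {} = 0"
  and metric: "\<And>A B r. r > 0 ==> (\<And>a b. a \<in> A ==> b \<in> B ==> r \<le> dist a b) ==> H A + H B \<le> H (A \<union> B)"
  and sep: "\<And>k::nat. \<exists>r>0. \<forall>a\<in>(\<Union>j<k. R j). \<forall>b\<in>R k. r \<le> dist a b"
 shows "(\<Sum>k<m. H (R k)) \<le> H (\<Union>k<m. R k)"
proof (induction m)
 case 0
 then show ?case by (simp add: H0)
next
 case (Suc m)
 obtain r where r: "r > 0" "\<forall>a\<in>(\<Union>j<m. R j). \<forall>b\<in>R m. r \<le> dist a b" using sep by blast
 have "(\<Sum>k<Suc m. H (R k)) \<le> H (\<Union>k<m. R k) + H (R m)" using Suc by (simp add: add_right_mono)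
 also have "\<dots> \<le> H ((\<Union>k<m. R k) \<union> R m)" by (rule metric[OF r(1)]) (use r(2) in auto)
 also have "(\<Union>k<m. R k) \<union> R m = (\<Union>k<Suc m. R k)" by (auto simp: less_Suc_eq)
 finally show ?case .
qed

lemma suminf_tail_tendsto_0:
 fixes s :: "nat => ennreal"
 assumes "(\<Sum>k. s k) < \<infinity>"
 shows "(\<lambda>n. \<Sum>k. s (k + n)) ----> 0"
proof -
 have fin: "s k < \<infinity>" for k using ennreal_suminf_lessD[OF assms] by simp
 define r where "r k = enn2real (s k)" for k
 have sr: "s k = en (r k)" and r0: "0 \<le> r k" for k using fin[of k] by (auto simp: r_def)
 have sum: "summable r"
  using assms r0 by (intro summable_suminf_not_top) (auto simp: sr)
 have "(\<Sum>k. s (k + n)) = en (suminf r - (\<Sum>i<n. r i))" for n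
  using sum r0 suminf_minus_initial_segment[OF sum, of n] summable_ignore_initial_segment[OF sum, of n]
  by (simp add: sr suminf_ennreal2)
 moreover have "(\<lambda>n. suminf r - (\<Sum>i<n. r i)) ----> suminf r - suminf r"
  by (intro tendsto_intros summable_LIMSEQ sum)
 then have "(\<lambda>n. en (suminf r - (\<Sum>i<n. r i))) ----> ennreal 0"
  by (intro tendsto_ennrealI) simp
 ultimately show ?thesis by simp
qed

text \<open>The classical criterion of Caratheodory. The sets D n of points of E with distance at least 1 / (n
+ 1) from C exhaust E - C and are separated from C. The layers D (n + 1) - D n with indices of equal parity
are separated from each other, so the sum of their measures is finite and its tails tend to zero.\<close>
lemma metric_outer_measure_closed:
 fixes H :: "'a::metric_space set => ennreal"
 assumes H: "outer_measure_space UNIV H"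
  and metric: "\<And>A B r. r > 0 ==> (\<And>a b. a \<in> A ==> b \<in> B ==> r \<le> dist a b) ==> H A + H B \<le> H (A \<union> B)"
  and C: "closed C"
 shows "H (E \<inter> C) + H (E - C) \<le> H E"
proof (cases "C = {} \<or> H E = \<infinity>")
 case True
 have "H {} = 0" using H by (simp add: outer_measure_space_def positive_def)
 then show ?thesis using True by auto
next
 case False
 note H0 = outer_measure_space_facts(1)[OF H] and mono = outer_measure_space_facts(2)[OF H]
  and csub = outer_measure_space_facts(3)[OF H] and sub2 = outer_measure_space_facts(4)[OF H]
 have dist_le: "infdist x C - infdist y C \<le> dist x y" for x y
  using infdist_triangle[of x C y] by simp
 define q where "q n = 1 / real (Suc n)" for n
 have q: "q n > 0" "q (Suc n) < q n" for n by (auto simp: q_def field_simps)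
 have qmono: "q n \<le> q m" if "m \<le> n" for m n using that by (simp add: q_def field_simps)
 define D where "D n = {x \<in> E. q n \<le> infdist x C}" for n
 define R where "R n = D (Suc n) - D n" for n
 have finE: "H E < \<infinity>" using False by (simp add: top.not_eq_extremum)
 have sepsum: "(\<Sum>k. H (R (2 * k + p))) \<le> H E" for p
 proof -
  have "(\<Sum>k<m. H (R (2 * k + p))) \<le> H E" for m
  proof -
   have "(\<Sum>k<m. H (R (2 * k + p))) \<le> H (\<Union>k<m. R (2 * k + p))"
   proof (rule separated_union_sum[OF H0 metric])
    fix k :: nat
    have sepd: "r \<le> dist a b" if "a \<in> R (2 * j + p)" "j < k" "b \<in> R (2 * k + p)" "r = q (2 * k + p - 1) - q (2 * k + p)" for a b j r
    proof -
     have "q (2 * k + p - 1) \<le> q (Suc (2 * j + p))" using that by (intro qmono) auto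
     also have "\<dots> \<le> infdist a C" using that by (auto simp: R_def D_def)
     finally have "q (2 * k + p - 1) \<le> infdist a C" .
     moreover have "infdist b C \<le> q (2 * k + p)" using that by (auto simp: R_def D_def)
     ultimately show ?thesis using dist_le[of a b] that by linarith
    qed
    show "\<exists>r>0. \<forall>a\<in>(\<Union>j<k. R (2 * j + p)). \<forall>b\<in>R (2 * k + p). r \<le> dist a b"
    proof (cases "k = 0")
     case False
     then have "q (2 * k + p - 1) - q (2 * k + p) > 0" using q(2)[of "2 * k + p - 1"] by simp
     moreover have "\<forall>a\<in>(\<Union>j<k. R (2 * j + p)). \<forall>b\<in>R (2 * k + p). q (2 * k + p - 1) - q (2 * k + p) \<le> dist a b"
      using sepd[OF _ _ _ refl] by blast
     ultimately show ?thesis by blast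
    qed (auto intro: exI[of _ 1])
   qed
   also have "\<dots> \<le> H E" by (intro mono) (auto simp: R_def D_def)
   finally show ?thesis .
  qed
  then show ?thesis by (intro suminf_le_const) auto
 qed
 have "(\<Sum>k. H (R k)) < \<infinity>"
 proof -
  have "(\<Sum>k<m. H (R k)) \<le> H E + H E" for m
  proof -
   have "(\<Sum>k<m. H (R k)) \<le> (\<Sum>k<2 * m. H (R k))" by (intro sum_mono2) auto
   also have "\<dots> = (\<Sum>k<m. H (R (2 * k + 0))) + (\<Sum>k<m. H (R (2 * k + 1)))"
    by (induction m) (auto simp: algebra_simps)
   also have "\<dots> \<le> H E + H E"
    using sepsum[of 0] sepsum[of 1] by (intro add_mono order_trans[OF sum_le_suminf]) auto
   finally show ?thesis .
  qed
  then have "(\<Sum>k. H (R k)) \<le> H E + H E" by (intro suminf_le_const) auto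
  also have "\<dots> < \<infinity>" using finE by simp
  finally show ?thesis .
 qed
 note tail = suminf_tail_tendsto_0[OF this]
 have bound: "H (E \<inter> C) + H (E - C) \<le> H E + (\<Sum>k. H (R (k + n)))" for n
 proof -
  have "E - C \<subseteq> D n \<union> (\<Union>k. R (k + n))"
  proof
   fix x assume x: "x \<in> E - C"
   have "infdist x C > 0" using x C False by (metis DiffD2 in_closed_iff_infdist_zero infdist_nonneg less_le)
   then obtain N where "inverse (real (Suc N)) < infdist x C" using reals_Archimedean by blast
   then have N: "x \<in> D N" using x by (auto simp: D_def q_def inverse_eq_divide)
   show "x \<in> D n \<union> (\<Union>k. R (k + n))"
   proof (cases "x \<in> D n")
    case False
    define j where "j = (LEAST j. x \<in> D j)"
    have j: "x \<in> D j" unfolding j_def using N by (rule LeastI)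
    have "j > n"
    proof (rule ccontr)
     assume "\<not> n < j"
     then have "q n \<le> q j" by (intro qmono) auto
     then show False using j False by (auto simp: D_def)
    qed
    then obtain i where i: "j = Suc i" "n \<le> i" by (metis Suc_le_D Suc_le_mono less_eq_Suc_le)
    have "x \<notin> D i" using i not_less_Least[of i "\<lambda>j. x \<in> D j"] by (simp add: j_def)
    then have "x \<in> R ((i - n) + n)" using i j by (simp add: R_def)
    then show ?thesis by blast
   qed simp
  qed
  then have "H (E - C) \<le> H (D n \<union> (\<Union>k. R (k + n)))" by (rule mono)
  also have "\<dots> \<le> H (D n) + (\<Sum>k. H (R (k + n)))" by (rule order_trans[OF sub2 add_left_mono[OF csub]])
  finally have "H (E \<inter> C) + H (E - C) \<le> (H (E \<inter> C) + H (D n)) + (\<Sum>k. H (R (k + n)))"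
   by (simp add: add.assoc add_left_mono)
  also have "H (E \<inter> C) + H (D n) \<le> H (E \<inter> C \<union> D n)"
  proof (rule metric[OF q(1)[of n]])
   fix a b assume "a \<in> E \<inter> C" "b \<in> D n"
   then show "q n \<le> dist a b" using dist_le[of b a] by (auto simp: D_def dist_commute)
  qed
  also have "H (E \<inter> C \<union> D n) \<le> H E" by (intro mono) (auto simp: D_def)
  finally show ?thesis by (simp add: add_right_mono)
 qed
 have "(\<lambda>n. H E + (\<Sum>k. H (R (k + n)))) ----> H E + 0" by (intro tendsto_add tendsto_const tail)
 then show ?thesis using bound by (intro LIMSEQ_le_const[of _ "H E"]) auto
qed

text \<open>The measurable sets in the sense of Caratheodory form a sigma-algebra, which contains the closed
sets.\<close>
lemma metric_outer_measure_space_borel: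
 fixes H :: "'a::metric_space set => ennreal"
 assumes H: "outer_measure_space UNIV H"
  and metric: "\<And>A B r. r > 0 ==> (\<And>a b. a \<in> A ==> b \<in> B ==> r \<le> dist a b) ==> H A + H B \<le> H (A \<union> B)"
 shows "measure_space UNIV (sets borel) H"
proof -
 interpret P: sigma_algebra "UNIV :: 'a set" UNIV
  using sigma_algebra_Pow[of "UNIV :: 'a set"] by simp
 note sub2 = outer_measure_space_facts(4)[OF H]
 let ?L = "lambda_system (UNIV::'a set) UNIV H"
 have ms: "measure_space UNIV ?L H" using P.caratheodory_lemma[OF H] .
 have closed: "C \<in> ?L" if "closed C" for C
 proof -
  have "H (x \<inter> C) + H (x - C) = H x" for x
  proof (rule antisym)
   show "H (x \<inter> C) + H (x - C) \<le> H x" by (rule metric_outer_measure_closed[OF H metric that])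
   show "H x \<le> H (x \<inter> C) + H (x - C)" using sub2[of "x \<inter> C" "x - C"] by (simp add: Int_Diff_Un)
  qed
  then show ?thesis by (simp add: P.lambda_system_eq)
 qed
 have "sigma_algebra UNIV ?L" using ms by (simp add: measure_space_def)
 then have "sigma_sets UNIV {C. closed C} \<subseteq> ?L"
  using closed by (intro sigma_algebra.sigma_sets_subset) auto
 then have "sets borel \<subseteq> ?L" by (simp add: borel_eq_closed)
 moreover have "sigma_algebra UNIV (sets borel :: 'a set set)" using sets.sigma_algebra_axioms[of borel] by simp
 ultimately show ?thesis using measure_down[OF ms] by blast
qed

section \<open>The two-dimensional Hausdorff measure\<close>

definition fine_cover :: "real => (real^3) set => (nat => (real^3) set) set" where
 "fine_cover \<delta> S = {A. S \<subseteq> (\<Union>n. A n) \<and> (\<forall>n. bounded (A n) \<and> diameter (A n) \<le> \<delta>)}"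

definition cover_area :: "(nat => (real^3) set) => ennreal" where
 "cover_area A = (\<Sum>n. en (pi / 4 * (diameter (A n))\<^sup>2))"

definition hausdorff2_delta :: "real => (real^3) set => ennreal" where
 "hausdorff2_delta \<delta> S = (INF A\<in>fine_cover \<delta> S. cover_area A)"

lemma hausdorff2_outer_eq: "hausdorff2_outer S = (SUP \<delta>\<in>{0<..}. hausdorff2_delta \<delta> S)"
 unfolding hausdorff2_outer_def hausdorff2_delta_def fine_cover_def cover_area_def ..

lemma hausdorff2_delta_le: "\<delta> > 0 ==> hausdorff2_delta \<delta> S \<le> hausdorff2_outer S"
 unfolding hausdorff2_outer_eq by (rule SUP_upper) simp

lemma hausdorff2_delta_antimono: "\<delta> \<le> \<delta>' ==> hausdorff2_delta \<delta>' S \<le> hausdorff2_delta \<delta> S"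
 unfolding hausdorff2_delta_def
 by (rule INF_superset_mono) (auto simp: fine_cover_def intro: order_trans)

lemma hausdorff2_delta_mono: "S \<subseteq> T ==> hausdorff2_delta \<delta> S \<le> hausdorff2_delta \<delta> T"
 unfolding hausdorff2_delta_def by (rule INF_superset_mono) (auto simp: fine_cover_def)

lemma hausdorff2_delta_empty: assumes "\<delta> > 0" shows "hausdorff2_delta \<delta> {} = 0"
proof -
 have "hausdorff2_delta \<delta> {} \<le> cover_area (\<lambda>_. {})"
  unfolding hausdorff2_delta_def by (rule INF_lower) (use assms in \<open>auto simp: fine_cover_def\<close>)
 also have "\<dots> = 0" by (simp add: cover_area_def)
 finally show ?thesis by simp
qed

text \<open>Covers of the S i with error e / 2^(i + 1) are enumerated as one cover of the union.\<close>
lemma hausdorff2_delta_Union: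
 assumes "\<delta> > 0"
 shows "hausdorff2_delta \<delta> (\<Union>i. S i) \<le> (\<Sum>i. hausdorff2_delta \<delta> (S i))"
proof (cases "(\<Sum>i. hausdorff2_delta \<delta> (S i)) = \<infinity>")
 case False
 have fin: "hausdorff2_delta \<delta> (S i) < \<infinity>" for i
  using ennreal_suminf_lessD[of "\<lambda>i. hausdorff2_delta \<delta> (S i)" \<infinity>] False by (auto simp: top.not_eq_extremum)
 show ?thesis
 proof (rule ennreal_le_epsilon)
  fix e :: real assume "e > 0"
  have "\<exists>A. A \<in> fine_cover \<delta> (S i) \<and> cover_area A \<le> hausdorff2_delta \<delta> (S i) + en (e * (1/2) ^ Suc i)" for i
  proof -
   have "hausdorff2_delta \<delta> (S i) < hausdorff2_delta \<delta> (S i) + en (e * (1/2) ^ Suc i)"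
    using fin[of i] \<open>e > 0\<close> by (simp add: ennreal_add_left_cancel_less[of _ 0, simplified])
   then have "\<exists>A\<in>fine_cover \<delta> (S i). cover_area A < hausdorff2_delta \<delta> (S i) + en (e * (1/2) ^ Suc i)"
    by (subst (asm) (1) hausdorff2_delta_def) (simp add: INF_less_iff)
   then show ?thesis by (meson less_imp_le)
  qed
  then obtain B where B: "\<And>i. B i \<in> fine_cover \<delta> (S i)"
   "\<And>i. cover_area (B i) \<le> hausdorff2_delta \<delta> (S i) + en (e * (1/2) ^ Suc i)" by metis
  define A where "A k = B (fst (prod_decode k)) (snd (prod_decode k))" for k
  have A: "A \<in> fine_cover \<delta> (\<Union>i. S i)"
  proof -
   have "x \<in> (\<Union>n. A n)" if x: "x \<in> S i" for x i
   proof -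
    obtain n where "x \<in> B i n" using B(1)[of i] x by (auto simp: fine_cover_def)
    then have "x \<in> A (prod_encode (i, n))" by (simp add: A_def)
    then show ?thesis by blast
   qed
   then show ?thesis using B(1) by (auto simp: fine_cover_def A_def)
  qed
  have "hausdorff2_delta \<delta> (\<Union>i. S i) \<le> cover_area A"
   unfolding hausdorff2_delta_def by (rule INF_lower[OF A])
  also have "\<dots> = (\<Sum>i. cover_area (B i))"
  proof -
   define f where "f p = en (pi / 4 * (diameter (B (fst p) (snd p)))\<^sup>2)" for p
   have "(\<Sum>k. f (prod_decode k)) = (\<Sum>i. cover_area (B i))"
    by (rule suminf_ennreal_2dimen) (simp only: cover_area_def f_def fst_conv snd_conv)
   then show ?thesis by (simp only: cover_area_def[of A] A_def f_def)
  qed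
  also have "\<dots> \<le> (\<Sum>i. hausdorff2_delta \<delta> (S i) + en (e * (1/2) ^ Suc i))"
   by (intro suminf_le B(2)) auto
  also have "\<dots> = (\<Sum>i. hausdorff2_delta \<delta> (S i)) + (\<Sum>i. en (e * (1/2) ^ Suc i))"
   by (rule suminf_add[symmetric]) auto
  also have "(\<Sum>i. en (e * (1/2) ^ Suc i)) = en e"
  proof -
   have "(\<lambda>i. e * (1/2) ^ Suc i) sums (e * 1)" by (intro sums_mult power_half_series)
   then show ?thesis using \<open>e > 0\<close> by (subst suminf_ennreal2) (auto simp: sums_iff)
  qed
  finally show "hausdorff2_delta \<delta> (\<Union>i. S i) \<le> (\<Sum>i. hausdorff2_delta \<delta> (S i)) + en e" .
 qed
qed simp

text \<open>A set of diameter below r meets at most one of A and B, so a fine cover of the union splits into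
two.\<close>
lemma hausdorff2_delta_separated:
 assumes r: "r > 0" "\<And>a b. a \<in> A ==> b \<in> B ==> r \<le> dist a b" and \<delta>: "0 < \<delta>" "\<delta> < r"
 shows "hausdorff2_delta \<delta> A + hausdorff2_delta \<delta> B \<le> hausdorff2_delta \<delta> (A \<union> B)"
 unfolding hausdorff2_delta_def[of \<delta> "A \<union> B"]
proof (rule INF_greatest)
 fix C assume C: "C \<in> fine_cover \<delta> (A \<union> B)"
 define CA where "CA n = (if C n \<inter> A = {} then {} else C n)" for n
 define CB where "CB n = (if C n \<inter> B = {} then {} else C n)" for n
 have cA: "CA \<in> fine_cover \<delta> A" and cB: "CB \<in> fine_cover \<delta> B"
 proof -
  have "x \<in> (\<Union>n. CA n)" if xA: "x \<in> A" for x
  proof -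
   obtain n where "x \<in> C n" using C xA by (auto simp: fine_cover_def)
   then have "x \<in> CA n" using xA by (auto simp: CA_def)
   then show ?thesis by blast
  qed
  then show "CA \<in> fine_cover \<delta> A" using C \<delta> by (auto simp: fine_cover_def CA_def)
  have "x \<in> (\<Union>n. CB n)" if xB: "x \<in> B" for x
  proof -
   obtain n where "x \<in> C n" using C xB by (auto simp: fine_cover_def)
   then have "x \<in> CB n" using xB by (auto simp: CB_def)
   then show ?thesis by blast
  qed
  then show "CB \<in> fine_cover \<delta> B" using C \<delta> by (auto simp: fine_cover_def CB_def)
 qed
 have one: "C n \<inter> A = {} \<or> C n \<inter> B = {}" for n
 proof (rule ccontr)
  assume "\<not> ?thesis"
  then obtain a b where ab: "a \<in> C n" "a \<in> A" "b \<in> C n" "b \<in> B" by blast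
  have "dist a b \<le> diameter (C n)" using C ab by (intro diameter_bounded_bound) (auto simp: fine_cover_def)
  also have "\<dots> \<le> \<delta>" using C by (auto simp: fine_cover_def)
  finally show False using r(2)[OF ab(2,4)] \<delta> by linarith
 qed
 have "hausdorff2_delta \<delta> A + hausdorff2_delta \<delta> B \<le> cover_area CA + cover_area CB"
  unfolding hausdorff2_delta_def by (intro add_mono INF_lower cA cB)
 also have "\<dots> = (\<Sum>n. en (pi / 4 * (diameter (CA n))\<^sup>2) + en (pi / 4 * (diameter (CB n))\<^sup>2))"
  unfolding cover_area_def by (rule suminf_add) auto
 also have "\<dots> \<le> cover_area C"
  unfolding cover_area_def using one by (intro suminf_le) (auto simp: CA_def CB_def)
 finally show "hausdorff2_delta \<delta> A + hausdorff2_delta \<delta> B \<le> cover_area C" .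
qed

lemma outer_measure_space_hausdorff2: "outer_measure_space UNIV hausdorff2_outer"
 unfolding outer_measure_space_def
proof (intro conjI)
 show "positive UNIV hausdorff2_outer"
  by (simp add: positive_def hausdorff2_outer_eq hausdorff2_delta_empty)
 show "increasing UNIV hausdorff2_outer"
  unfolding increasing_def hausdorff2_outer_eq by (auto intro!: SUP_mono hausdorff2_delta_mono)
 show "countably_subadditive UNIV hausdorff2_outer"
  unfolding countably_subadditive_def
 proof (intro allI impI)
  fix S :: "nat => (real^3) set"
  show "hausdorff2_outer (\<Union>i. S i) \<le> (\<Sum>i. hausdorff2_outer (S i))"
   unfolding hausdorff2_outer_eq[of "\<Union>i. S i"]
  proof (rule SUP_least)
   fix \<delta> :: real assume "\<delta> \<in> {0<..}"
   then have "hausdorff2_delta \<delta> (\<Union>i. S i) \<le> (\<Sum>i. hausdorff2_delta \<delta> (S i))"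
    by (intro hausdorff2_delta_Union) auto
   also have "\<dots> \<le> (\<Sum>i. hausdorff2_outer (S i))"
    using \<open>\<delta> \<in> {0<..}\<close> by (intro suminf_le hausdorff2_delta_le) auto
   finally show "hausdorff2_delta \<delta> (\<Union>i. S i) \<le> (\<Sum>i. hausdorff2_outer (S i))" .
  qed
 qed
qed

lemma hausdorff2_separated:
 assumes r: "r > 0" "\<And>a b. a \<in> A ==> b \<in> B ==> r \<le> dist a b"
 shows "hausdorff2_outer A + hausdorff2_outer B \<le> hausdorff2_outer (A \<union> B)"
proof -
 have 1: "hausdorff2_delta \<delta> A + hausdorff2_delta \<delta>' B \<le> hausdorff2_outer (A \<union> B)" if "\<delta> > 0" "\<delta>' > 0" for \<delta> \<delta>'
 proof -
  define \<eta> where "\<eta> = min (min \<delta> \<delta>') (r / 2)"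
  have \<eta>: "0 < \<eta>" "\<eta> < r" "\<eta> \<le> \<delta>" "\<eta> \<le> \<delta>'" using r that by (auto simp: \<eta>_def)
  have "hausdorff2_delta \<delta> A + hausdorff2_delta \<delta>' B \<le> hausdorff2_delta \<eta> A + hausdorff2_delta \<eta> B"
   by (intro add_mono hausdorff2_delta_antimono \<eta>)
  also have "\<dots> \<le> hausdorff2_delta \<eta> (A \<union> B)" by (rule hausdorff2_delta_separated[OF r \<eta>(1,2)])
  also have "\<dots> \<le> hausdorff2_outer (A \<union> B)" by (rule hausdorff2_delta_le[OF \<eta>(1)])
  finally show ?thesis .
 qed
 have ne: "({0<..} :: real set) \<noteq> {}" using greaterThan_non_empty by blast
 have 2: "hausdorff2_delta \<delta> A + hausdorff2_outer B \<le> hausdorff2_outer (A \<union> B)" if "\<delta> > 0" for \<delta>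
  unfolding hausdorff2_outer_eq[of B]
  by (subst ennreal_SUP_add_right[OF ne]) (intro SUP_least 1; use that in auto)
 show ?thesis
  unfolding hausdorff2_outer_eq[of A]
  by (subst ennreal_SUP_add_left[OF ne, symmetric]) (intro SUP_least 2; auto)
qed

definition hausdorff2_measure :: "(real^3) measure" where
 "hausdorff2_measure = measure_of UNIV (sets borel) hausdorff2_outer"

lemma hausdorff2_measure:
 shows "space hausdorff2_measure = UNIV" "sets hausdorff2_measure = sets borel"
  "A \<in> sets borel ==> emeasure hausdorff2_measure A = hausdorff2_outer A"
proof -
 have sig: "sigma_sets UNIV (sets borel) = (sets borel :: (real^3) set set)"
  using sets.sigma_sets_eq[of "borel :: (real^3) measure"] by simp
 show "space hausdorff2_measure = UNIV" "sets hausdorff2_measure = sets borel"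
  using sig by (auto simp: hausdorff2_measure_def space_measure_of_conv sets_measure_of)
 have ms: "measure_space UNIV (sets borel) hausdorff2_outer"
  by (rule metric_outer_measure_space_borel[OF outer_measure_space_hausdorff2 hausdorff2_separated])
 then show "A \<in> sets borel ==> emeasure hausdorff2_measure A = hausdorff2_outer A"
  unfolding hausdorff2_measure_def using sig
  by (intro emeasure_measure_of_sigma) (auto simp: measure_space_def)
qed

lemma surface_measure_eq: "surface_measure X = restrict_space hausdorff2_measure (frontier X)"
 by (simp add: surface_measure_def hausdorff2_measure_def)

section \<open>Volume of cylinders over a surface\<close>

text \<open>The tube is covered by cubes of edge length 4 h centred at points of the segment whose parameters
are h apart, for h slightly above D, since D may be zero.\<close>
lemma segment_tube_volume:
 fixes a e :: "real^3"
 assumes e: "norm e \<le> 1" and L: "L > 0" and D: "D \<ge> 0"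
 defines "Q \<equiv> {x + y |x y. x \<in> (\<lambda>s. a - s *\<^sub>R e) ` {0..L} \<and> y \<in> cball 0 D}"
 shows "Q \<in> sets borel" "emeasure lborel Q \<le> en (64 * (L * D\<^sup>2 + D ^ 3))"
proof -
 have "compact ((\<lambda>s. a - s *\<^sub>R e) ` {0..L})" by (intro compact_continuous_image continuous_intros) auto
 from compact_sums[OF this compact_cball[of 0 D]] have "compact Q" unfolding Q_def .
 then show Qb: "Q \<in> sets borel" by (simp add: compact_imp_closed)
 have le: "emeasure lborel Q \<le> en (64 * (L * h\<^sup>2 + h ^ 3))" if h: "h > D" for h
 proof -
  define z where "z k = a - (real k * h) *\<^sub>R e" for k
  define S :: "real^3" where "S = (\<Sum>i\<in>Basis. (2 * h) *\<^sub>R i)"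
  have S: "S \<bullet> j = 2 * h" if "j \<in> Basis" for j
   unfolding S_def using that by (simp add: inner_sum_left_Basis)
  define B where "B k = cbox (z k - S) (z k + S)" for k
  have h0: "h > 0" using h D by linarith
  define m where "m = nat \<lfloor>L / h\<rfloor>"
  have sub: "Q \<subseteq> (\<Union>k\<in>{..m}. B k)"
  proof
   fix p assume "p \<in> Q"
   then obtain s y where p: "p = a - s *\<^sub>R e + y" "0 \<le> s" "s \<le> L" "norm y \<le> D" unfolding Q_def by auto
   define k where "k = nat \<lfloor>s / h\<rfloor>"
   have k: "real k * h \<le> s" "s < real k * h + h"
   proof -
    have "real k = of_int \<lfloor>s / h\<rfloor>" using p h0 by (simp add: k_def)
    then have "real k \<le> s / h" "s / h < real k + 1" by linarith+
    then show "real k * h \<le> s" "s < real k * h + h" using h0 by (simp_all add: field_simps)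
   qed
   have "norm (p - z k) \<le> 2 * h"
   proof -
    have "p - z k = y - (s - real k * h) *\<^sub>R e" by (simp add: p z_def algebra_simps)
    then have "norm (p - z k) \<le> norm y + norm ((s - real k * h) *\<^sub>R e)" by (metis norm_triangle_ineq4)
    also have "norm ((s - real k * h) *\<^sub>R e) \<le> h * 1" using k e mult_mono[of "s - real k * h" h "norm e" 1] h0 by simp
    finally show ?thesis using p h by linarith
   qed
   then have "\<bar>(p - z k) \<bullet> i\<bar> \<le> 2 * h" if "i \<in> Basis" for i
    using Basis_le_norm[OF that, of "p - z k"] by linarith
   then have "p \<in> B k" by (auto simp: B_def mem_box inner_diff_left inner_add_left abs_le_iff S algebra_simps)
   moreover have "k \<le> m" unfolding k_def m_def using p h0 by (intro nat_mono floor_mono divide_right_mono) auto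
   ultimately show "p \<in> (\<Union>k\<in>{..m}. B k)" by blast
  qed
  have vol: "emeasure lborel (B k) = en (64 * h ^ 3)" for k
  proof -
   have i: "(z k + S - (z k - S)) \<bullet> j = 4 * h" if "j \<in> Basis" for j
    using S[OF that] by (simp only: inner_diff_left inner_add_left)
   have "emeasure lborel (B k) = en (\<Prod>j\<in>Basis. (z k + S - (z k - S)) \<bullet> j)"
    unfolding B_def using h0 by (intro emeasure_lborel_cbox) (simp add: inner_diff_left inner_add_left S)
   also have "(\<Prod>j\<in>Basis. (z k + S - (z k - S)) \<bullet> j) = (\<Prod>j\<in>(Basis::(real^3) set). 4 * h)"
    by (rule prod.cong[OF refl i])
   finally have "emeasure lborel (B k) = en (\<Prod>j\<in>(Basis::(real^3) set). 4 * h)" .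
   then show ?thesis by (simp add: power_mult_distrib)
  qed
  have "emeasure lborel Q \<le> emeasure lborel (\<Union>k\<in>{..m}. B k)"
   by (intro emeasure_mono sub) (auto simp: B_def)
  also have "\<dots> \<le> (\<Sum>k\<in>{..m}. emeasure lborel (B k))"
   by (intro emeasure_subadditive_finite) (auto simp: B_def)
  also have "\<dots> = en (real (Suc m) * (64 * h ^ 3))"
   unfolding vol by (simp add: ennreal_of_nat_eq_real_of_nat ennreal_mult' del: of_nat_Suc)
  also have "\<dots> \<le> en (64 * (L * h\<^sup>2 + h ^ 3))"
  proof (intro ennreal_leI)
   have "real m \<le> L / h" unfolding m_def using L h0 by (simp add: of_nat_nat)
   then have "real m * h \<le> L" using h0 by (simp add: field_simps)
   then have "real m * h * h\<^sup>2 \<le> L * h\<^sup>2" by (intro mult_right_mono) auto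
   then show "real (Suc m) * (64 * h ^ 3) \<le> 64 * (L * h\<^sup>2 + h ^ 3)"
    by (simp add: algebra_simps power2_eq_square power3_eq_cube)
  qed
  finally show ?thesis .
 qed
 have "((\<lambda>h. en (64 * (L * h\<^sup>2 + h ^ 3))) \<longlongrightarrow> en (64 * (L * D\<^sup>2 + D ^ 3))) (at_right D)"
  by (intro tendsto_ennrealI tendsto_intros)
 then show "emeasure lborel Q \<le> en (64 * (L * D\<^sup>2 + D ^ 3))"
  by (rule tendsto_lowerbound) (use le in \<open>auto simp: eventually_at_right_less intro!: eventually_mono[OF eventually_at_right_less]\<close>)
qed

text \<open>Cover the base A by sets of diameter at most L. The part of T above one of them lies in a tube
around a segment of length L whose radius D is the diameter, and since D \<le> L its volume is at most 64 (L
D^2 + D^3) \<le> 128 L D^2 = 512 / pi L (pi / 4 D^2), the last factor being the contribution to the area of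
the cover.\<close>
lemma cylinder_volume_le_hausdorff2:
 fixes e :: "real^3"
 assumes e: "norm e \<le> 1" and L: "L > 0" and T: "T \<in> sets borel"
  and sub: "\<And>x. x \<in> T ==> \<exists>s. 0 \<le> s \<and> s \<le> L \<and> x + s *\<^sub>R e \<in> A"
 shows "emeasure lborel T \<le> en (512 / pi * L) * hausdorff2_outer A"
proof -
 have "emeasure lborel T \<le> en (512 / pi * L) * cover_area C" if C: "C \<in> fine_cover L A" for C
 proof -
  define a where "a n = (SOME x. x \<in> C n)" for n
  define D where "D n = diameter (C n)" for n
  have D: "0 \<le> D n" "D n \<le> L" for n using C by (auto simp: D_def fine_cover_def diameter_ge_0)
  define Q where "Q n = {x + y |x y. x \<in> (\<lambda>s. a n - s *\<^sub>R e) ` {0..L} \<and> y \<in> cball 0 (D n)}" for n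
  have Q: "Q n \<in> sets borel" "emeasure lborel (Q n) \<le> en (64 * (L * (D n)\<^sup>2 + D n ^ 3))" for n
   unfolding Q_def by (rule segment_tube_volume[OF e L D(1)])+
  have "T \<subseteq> (\<Union>n. Q n)"
  proof
   fix x assume "x \<in> T"
   then obtain s where s: "0 \<le> s" "s \<le> L" "x + s *\<^sub>R e \<in> A" using sub by blast
   then obtain n where n: "x + s *\<^sub>R e \<in> C n" using C by (auto simp: fine_cover_def)
   then have "a n \<in> C n" unfolding a_def by (rule someI)
   then have "dist (x + s *\<^sub>R e) (a n) \<le> D n"
    unfolding D_def using C n by (intro diameter_bounded_bound) (auto simp: fine_cover_def)
   then have "x = (a n - s *\<^sub>R e) + (x + s *\<^sub>R e - a n)" "norm (x + s *\<^sub>R e - a n) \<le> D n"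
    by (auto simp: dist_norm)
   moreover have "a n - s *\<^sub>R e \<in> (\<lambda>s. a n - s *\<^sub>R e) ` {0..L}" using s by auto
   ultimately have "x \<in> Q n" unfolding Q_def by (intro CollectI exI conjI) auto
   then show "x \<in> (\<Union>n. Q n)" by blast
  qed
  then have "emeasure lborel T \<le> emeasure lborel (\<Union>n. Q n)"
   using Q(1) by (intro emeasure_mono) auto
  also have "\<dots> \<le> (\<Sum>n. emeasure lborel (Q n))"
   using Q(1) by (intro emeasure_subadditive_countably) auto
  also have "\<dots> \<le> (\<Sum>n. en (512 / pi * L) * en (pi / 4 * (diameter (C n))\<^sup>2))"
  proof (intro suminf_le allI)
   fix n
   have "64 * (L * (D n)\<^sup>2 + D n ^ 3) \<le> 64 * (L * (D n)\<^sup>2 + L * (D n)\<^sup>2)"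
    using D[of n] by (simp add: power3_eq_cube power2_eq_square mult_right_mono mult.assoc)
   also have "\<dots> = 512 / pi * L * (pi / 4 * (D n)\<^sup>2)" by simp
   finally have "en (64 * (L * (D n)\<^sup>2 + D n ^ 3)) \<le> en (512 / pi * L * (pi / 4 * (D n)\<^sup>2))"
    by (rule ennreal_leI)
   also have "\<dots> = en (512 / pi * L) * en (pi / 4 * (diameter (C n))\<^sup>2)"
    unfolding D_def using L by (intro ennreal_mult) auto
   finally show "emeasure lborel (Q n) \<le> en (512 / pi * L) * en (pi / 4 * (diameter (C n))\<^sup>2)"
    using Q(2)[of n] by (rule order_trans[rotated])
  qed auto
  also have "\<dots> = en (512 / pi * L) * cover_area C"
   unfolding cover_area_def by (rule ennreal_suminf_cmult)
  finally show ?thesis .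
 qed
 then have le: "emeasure lborel T \<le> en (512 / pi * L) * cover_area C" if "C \<in> fine_cover L A" for C
  using that by blast
 define c where "c = en (512 / pi * L)"
 obtain c' where inv: "c' * c = 1"
 proof
  show "en (1 / (512 / pi * L)) * c = 1" unfolding c_def using L by (subst ennreal_mult[symmetric]) auto
 qed
 have "c' * emeasure lborel T \<le> hausdorff2_delta L A"
  unfolding hausdorff2_delta_def
 proof (rule INF_greatest)
  fix C assume "C \<in> fine_cover L A"
  from mult_left_mono[OF le[OF this] zero_le, of c', folded c_def]
  have "c' * emeasure lborel T \<le> (c' * c) * cover_area C" by (simp only: mult.assoc)
  then show "c' * emeasure lborel T \<le> cover_area C" by (simp only: inv mult_1)
 qed
 from mult_left_mono[OF this zero_le, of c]
 have "(c' * c) * emeasure lborel T \<le> c * hausdorff2_delta L A"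
  by (simp only: mult_ac)
 then have "emeasure lborel T \<le> en (512 / pi * L) * hausdorff2_delta L A"
  by (simp only: inv mult_1 flip: c_def)
 also have "\<dots> \<le> en (512 / pi * L) * hausdorff2_outer A"
  by (intro mult_left_mono hausdorff2_delta_le L) auto
 finally show ?thesis .
qed

section \<open>The outward normal\<close>

text \<open>If the unit gradients p1, p2 were different, then v = p2 - p1 would point into the domain
according to the first function and out of it according to the second one.\<close>
lemma sgn_gradient_unique:
 fixes X :: "(real^3) set"
 assumes 1: "local_defining_function X x U1 d1" and 2: "local_defining_function X x U2 d2"
  and x: "x \<in> frontier X"
 shows "sgn (gradient d1 x) = sgn (gradient d2 x)"
proof (rule ccontr)
 let ?a = "gradient d1 x" and ?b = "gradient d2 x"
 assume ne: "sgn ?a \<noteq> sgn ?b"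
 have U1: "open U1" "x \<in> U1" "smooth_on U1 d1" "?a \<noteq> 0" "X \<inter> U1 = {y \<in> U1. d1 y < 0}" "d1 x = 0"
  using 1 x unfolding local_defining_function_def by auto
 have U2: "open U2" "x \<in> U2" "smooth_on U2 d2" "?b \<noteq> 0" "X \<inter> U2 = {y \<in> U2. d2 y < 0}" "d2 x = 0"
  using 2 x unfolding local_defining_function_def by auto
 define c where "c = sgn ?a \<bullet> sgn ?b"
 have pp: "sgn ?a \<bullet> sgn ?a = 1" "sgn ?b \<bullet> sgn ?b = 1"
  using U1(4) U2(4) by (simp_all add: dot_square_norm norm_sgn)
 have "0 < (norm (sgn ?a - sgn ?b))\<^sup>2" using ne by simp
 also have "\<dots> = 2 - 2 * c"
  unfolding power2_norm_eq_inner inner_diff_left inner_diff_right pp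
  by (simp add: c_def inner_commute[of "sgn ?b"])
 finally have c: "c < 1" by simp
 have cb: "sgn ?b \<bullet> sgn ?a = c" by (simp add: c_def inner_commute)
 define v where "v = sgn ?b - sgn ?a"
 have sa: "?a = norm ?a *\<^sub>R sgn ?a" and sb: "?b = norm ?b *\<^sub>R sgn ?b" using U1(4) U2(4) by (simp_all add: sgn_div_norm)
 have "?a \<bullet> v = norm ?a * (c - 1)"
  by (subst sa) (simp add: v_def inner_diff_right c_def pp algebra_simps)
 then have av: "?a \<bullet> v < 0" using c U1(4) by (simp add: mult_less_0_iff)
 have "?b \<bullet> v = norm ?b * (1 - c)"
  by (subst sb) (simp add: v_def inner_diff_right pp cb algebra_simps)
 then have bv: "?b \<bullet> v > 0" using c U2(4) by simp
 have D1: "((\<lambda>t. d1 (x + t *\<^sub>R v)) has_real_derivative (?a \<bullet> v)) (at 0)"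
  using defining_function_derivative_along[OF U1(1,3), of x 0 v] U1(2) by simp
 have D2: "((\<lambda>t. d2 (x + t *\<^sub>R v)) has_real_derivative (?b \<bullet> v)) (at 0)"
  using defining_function_derivative_along[OF U2(1,3), of x 0 v] U2(2) by simp
 obtain s1 where s1: "s1 > 0" "\<And>h. h > 0 ==> h < s1 ==> d1 (x + h *\<^sub>R v) < 0"
  using DERIV_neg_dec_right[OF D1 av] U1(6) by auto
 obtain s2 where s2: "s2 > 0" "\<And>h. h > 0 ==> h < s2 ==> 0 < d2 (x + h *\<^sub>R v)"
  using DERIV_pos_inc_right[OF D2 bv] U2(6) by auto
 have "open (U1 \<inter> U2)" "x \<in> U1 \<inter> U2" using U1 U2 by auto
 then obtain r where r: "r > 0" "ball x r \<subseteq> U1 \<inter> U2" using open_contains_ball by blast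
 have nv: "norm v + 1 > 0" by (intro add_nonneg_pos) auto
 define r' where "r' = r / (norm v + 1)"
 have r': "r' > 0" using r nv by (simp add: r'_def)
 define h where "h = min (min s1 s2) r' / 2"
 have h: "h > 0" "h < s1" "h < s2" "h < r / (norm v + 1)"
  using s1(1) s2(1) r' unfolding r'_def[symmetric] by (auto simp: h_def)
 then have "h * (norm v + 1) < r" using nv by (simp add: field_simps)
 then have "h * norm v < r" using h(1) by (simp add: algebra_simps)
 then have "x + h *\<^sub>R v \<in> ball x r" using h(1) by (simp add: dist_norm)
 then have "x + h *\<^sub>R v \<in> U1" "x + h *\<^sub>R v \<in> U2" using r by auto
 then have "x + h *\<^sub>R v \<in> X \<inter> U1" using U1(5) s1(2)[OF h(1,2)] by blast
 then have "d2 (x + h *\<^sub>R v) < 0" using U2(5) \<open>x + h *\<^sub>R v \<in> U2\<close> by blast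
 then show False using s2(2)[OF h(1,3)] by linarith
qed

lemma outward_normal_eq:
 assumes "local_defining_function X x U d" "x \<in> frontier X"
 shows "outward_normal X x = sgn (gradient d x)"
 unfolding outward_normal_def
proof (rule the_equality)
 show "\<exists>U' \<psi>. local_defining_function X x U' \<psi> \<and> sgn (gradient d x) = sgn (gradient \<psi> x)"
  using assms(1) by blast
 show "n = sgn (gradient d x)" if "\<exists>U \<psi>. local_defining_function X x U \<psi> \<and> n = sgn (gradient \<psi> x)" for n
  using that sgn_gradient_unique[OF _ assms(1) assms(2)] by blast
qed

section \<open>The strip below a boundary chart\<close>

text \<open>A chart in which the gradient of the defining function is nearly constant. The larger ball leaves
room for moving points of the ball of radius R by at most R.\<close>
locale chart =
 fixes X :: "(real^3) set" and x0 U d a R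
 assumes ldf: "local_defining_function X x0 U d" and R: "R > 0" and a: "a \<noteq> 0"
  and sub: "cball x0 (2 * R) \<subseteq> U"
  and grad_close: "\<And>z. z \<in> cball x0 (2 * R) ==> norm (gradient d z - a) \<le> norm a / 4"
begin

lemma U: "open U" "x0 \<in> U" "smooth_on U d" "X \<inter> U = {y \<in> U. d y < 0}" "frontier X \<inter> U = {y \<in> U. d y = 0}"
 using ldf unfolding local_defining_function_def by auto

definition e :: "real^3" where "e = sgn a"
text \<open>A lower bound for the derivative of the defining function in direction e.\<close>
definition m :: real where "m = 3 / 4 * norm a"

lemma e: "norm e = 1" using a by (simp add: e_def norm_sgn)
lemma m: "m > 0" using a by (simp add: m_def)

lemma grad_e: "z \<in> cball x0 (2 * R) ==> m \<le> gradient d z \<bullet> e"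
proof -
 assume z: "z \<in> cball x0 (2 * R)"
 have "gradient d z \<bullet> e = a \<bullet> e + (gradient d z - a) \<bullet> e" by (simp add: inner_diff_left)
 moreover have "a \<bullet> e = norm a" using a by (simp add: e_def sgn_div_norm dot_square_norm power2_eq_square)
 moreover have "\<bar>(gradient d z - a) \<bullet> e\<bar> \<le> norm a / 4"
  using Cauchy_Schwarz_ineq2[of "gradient d z - a" e] grad_close[OF z] e by simp
 ultimately show ?thesis by (simp add: m_def)
qed

lemma grad_norm: "z \<in> cball x0 (2 * R) ==> norm (gradient d z) \<le> 2 * norm a"
 using grad_close[of z] norm_triangle_sub[of "gradient d z" a] norm_ge_zero[of a] by linarith

lemma shift_in: "x \<in> ball x0 R ==> 0 \<le> s ==> s \<le> R ==> x + s *\<^sub>R e \<in> ball x0 (2 * R)"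
proof -
 assume "x \<in> ball x0 R" "0 \<le> s" "s \<le> R"
 moreover have "dist x0 (x + s *\<^sub>R e) \<le> dist x0 x + norm (s *\<^sub>R e)"
  using dist_triangle[of x0 "x + s *\<^sub>R e" x] by (simp add: dist_norm)
 ultimately show ?thesis using e by simp
qed

lemma shift_in': "x \<in> ball x0 R ==> 0 \<le> s ==> s \<le> R ==> x + s *\<^sub>R e \<in> cball x0 (2 * R) \<and> x + s *\<^sub>R e \<in> U"
 using shift_in[of x s] sub ball_subset_cball by blast

text \<open>The derivative of d in direction e is at least m throughout the larger ball.\<close>
lemma d_increase:
 assumes x: "x \<in> ball x0 R" and st: "0 \<le> s" "s \<le> t" "t \<le> R"
 shows "m * (t - s) \<le> d (x + t *\<^sub>R e) - d (x + s *\<^sub>R e)"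
proof -
 have "d (x + s *\<^sub>R e) - m * s \<le> d (x + t *\<^sub>R e) - m * t"
 proof (rule DERIV_nonneg_imp_nondecreasing[of s t "\<lambda>r. d (x + r *\<^sub>R e) - m * r"])
  fix r assume r: "s \<le> r" "r \<le> t"
  then have z: "x + r *\<^sub>R e \<in> cball x0 (2 * R)" "x + r *\<^sub>R e \<in> U" using shift_in'[OF x, of r] st by auto
  have "((\<lambda>r. d (x + r *\<^sub>R e) - m * r) has_real_derivative (gradient d (x + r *\<^sub>R e) \<bullet> e - m * 1)) (at r)"
   by (intro DERIV_diff DERIV_cmult DERIV_ident defining_function_derivative_along[OF U(1,3) z(2)])
  then show "\<exists>y. ((\<lambda>r. d (x + r *\<^sub>R e) - m * r) has_real_derivative y) (at r) \<and> 0 \<le> y"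
   using grad_e[OF z(1)] by fastforce
 qed (use st in auto)
 then show ?thesis by (simp add: algebra_simps)
qed

lemma d_cont: "continuous_on U d" using smooth_on_continuous[OF U(3)] .

lemma open_shift: "0 \<le> s ==> s \<le> R ==> open T ==> open {x \<in> ball x0 R. d (x + s *\<^sub>R e) \<in> T}"
proof -
 assume s: "0 \<le> s" "s \<le> R" and T: "open T"
 have "continuous_on (ball x0 R) (\<lambda>x. d (x + s *\<^sub>R e))"
  by (rule continuous_on_compose2[OF d_cont]) (use shift_in' s in \<open>auto intro!: continuous_intros\<close>)
 from continuous_open_preimage[OF this open_ball T]
 show ?thesis by (simp add: vimage_def Int_def)
qed

text \<open>The cutoffs used below vary where the defining function lies between - 2 eps and - eps. The bound 3 eps leaves a margin.\<close>
definition strip :: "real => (real^3) set" where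
 "strip eps = {x \<in> ball x0 R. - (3 * eps) < d x \<and> d x < 0}"

definition strip2 :: "real => (real^3) set" where
 "strip2 eps = {x \<in> ball x0 (2 * R). - (3 * eps) < d x \<and> d x < 0}"

text \<open>The defining function increases at rate m at least, so that along a segment of this length it grows by 4 eps, and a point of the strip is carried across the boundary.\<close>
definition len :: "real => real" where "len eps = 4 * eps / m"

lemma strip_open: "open (strip eps)"
 using open_shift[of 0 "{- (3 * eps)<..<0}"] R by (simp add: strip_def)

lemma strip2_borel: "strip2 eps \<in> sets borel"
proof -
 have "continuous_on (ball x0 (2 * R)) d"
  by (rule continuous_on_subset[OF d_cont]) (use sub ball_subset_cball in blast)
 from continuous_open_preimage[OF this open_ball, of "{- (3 * eps)<..<0}"]
 have "open (strip2 eps)" by (simp add: vimage_def Int_def strip2_def)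
 then show ?thesis by simp
qed

lemma strip2_sub: "strip2 eps \<subseteq> X"
 using U(4) sub ball_subset_cball unfolding strip2_def by blast

lemma strip_sub: "strip eps \<subseteq> strip2 eps" using R by (auto simp: strip_def strip2_def)

text \<open>The distance to the boundary in direction e. The value 0 outside the strip makes the function measurable on the whole space.\<close>
definition \<tau> :: "real => real^3 => real" where
 "\<tau> eps x = (if x \<in> strip eps then THE s. 0 \<le> s \<and> s \<le> len eps \<and> d (x + s *\<^sub>R e) = 0 else 0)"

definition foot :: "real => real^3 => real^3" where
 "foot eps x = x + \<tau> eps x *\<^sub>R e"

context
 fixes eps :: real
 assumes eps: "eps > 0" and lenR: "len eps \<le> R"
begin

lemma len0: "len eps > 0" using eps m by (simp add: len_def)

lemma \<tau>:
 assumes x: "x \<in> strip eps"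
 shows "0 \<le> \<tau> eps x" "\<tau> eps x \<le> len eps" "d (x + \<tau> eps x *\<^sub>R e) = 0"
proof -
 have xb: "x \<in> ball x0 R" and dx: "- (3 * eps) < d x" "d x < 0" using x by (auto simp: strip_def)
 have "\<exists>s. 0 \<le> s \<and> s \<le> len eps \<and> d (x + s *\<^sub>R e) = 0"
 proof (rule IVT')
  show "d (x + 0 *\<^sub>R e) \<le> 0" using dx by simp
  have "m * (len eps - 0) \<le> d (x + len eps *\<^sub>R e) - d (x + 0 *\<^sub>R e)"
   using d_increase[OF xb _ _ lenR, of 0] len0 by simp
  then show "0 \<le> d (x + len eps *\<^sub>R e)" using dx m eps by (simp add: len_def)
  show "continuous_on {0..len eps} (\<lambda>s. d (x + s *\<^sub>R e))"
   by (rule continuous_on_compose2[OF d_cont]) (use shift_in'[OF xb] lenR in \<open>auto intro!: continuous_intros\<close>)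
 qed (use len0 in simp)
 then obtain s where s: "0 \<le> s" "s \<le> len eps" "d (x + s *\<^sub>R e) = 0" by blast
 have uniq: "t = s" if t: "0 \<le> t \<and> t \<le> len eps \<and> d (x + t *\<^sub>R e) = 0" for t
 proof -
  have "m * \<bar>t - s\<bar> \<le> 0"
   using d_increase[OF xb, of s t] d_increase[OF xb, of t s] s t lenR by (cases "s \<le> t") auto
  then show ?thesis using m by (simp add: mult_le_0_iff)
 qed
 have "(THE s. 0 \<le> s \<and> s \<le> len eps \<and> d (x + s *\<^sub>R e) = 0) = s"
  by (rule the_equality) (use s in blast, rule uniq)
 then have "\<tau> eps x = s" unfolding \<tau>_def using x by simp
 then show "0 \<le> \<tau> eps x" "\<tau> eps x \<le> len eps" "d (x + \<tau> eps x *\<^sub>R e) = 0" using s by auto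
qed

lemma \<tau>_greater_iff:
 assumes x: "x \<in> strip eps" and s: "0 \<le> s" "s \<le> len eps"
 shows "s < \<tau> eps x \<longleftrightarrow> d (x + s *\<^sub>R e) < 0"
proof -
 have xb: "x \<in> ball x0 R" using x by (simp add: strip_def)
 show ?thesis
 proof
  assume "s < \<tau> eps x"
  then show "d (x + s *\<^sub>R e) < 0"
   using d_increase[OF xb s(1), of "\<tau> eps x"] \<tau>[OF x] lenR m mult_pos_pos[of m "\<tau> eps x - s"] by linarith
 next
  assume ds: "d (x + s *\<^sub>R e) < 0"
  show "s < \<tau> eps x"
  proof (rule ccontr)
   assume ge: "\<not> s < \<tau> eps x"
   then have "0 \<le> m * (s - \<tau> eps x)" using m by (intro mult_nonneg_nonneg) auto
   then show False using d_increase[OF xb \<tau>(1)[OF x], of s] \<tau>[OF x] lenR s ds ge by linarith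
  qed
 qed
qed

lemma \<tau>_measurable: "\<tau> eps \<in> bmeas borel"
 unfolding borel_measurable_iff_greater
proof
 fix c :: real
 consider "c < 0" | "0 \<le> c" "c \<le> len eps" | "c > len eps" by linarith
 then show "{x \<in> space borel. c < \<tau> eps x} \<in> sets borel"
 proof cases
  case 1
  have "0 \<le> \<tau> eps x" for x using \<tau>(1)[of x] by (cases "x \<in> strip eps") (auto simp: \<tau>_def)
  then have "{x \<in> space borel. c < \<tau> eps x} = UNIV" using 1 by (force intro: less_le_trans)
  then show ?thesis by simp
 next
  case 2
  have "{x \<in> space borel. c < \<tau> eps x} = strip eps \<inter> {x \<in> ball x0 R. d (x + c *\<^sub>R e) \<in> {..<0}}"
   using \<tau>_greater_iff[OF _ 2] 2 by (auto simp: strip_def) (auto simp: \<tau>_def strip_def split: if_splits)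
  moreover have "open \<dots>" using 2 lenR by (intro open_Int strip_open open_shift) auto
  ultimately show ?thesis by simp
 next
  case 3
  have "\<tau> eps x \<le> len eps" for x using \<tau>(2)[of x] len0 by (cases "x \<in> strip eps") (auto simp: \<tau>_def)
  then have "{x \<in> space borel. c < \<tau> eps x} = {}" using 3 by (force dest: less_le_trans)
  then show ?thesis by simp
 qed
qed

lemma foot_measurable: "foot eps \<in> bmeas borel"
 unfolding foot_def using \<tau>_measurable by measurable

lemma foot:
 assumes x: "x \<in> strip eps"
 shows "foot eps x \<in> frontier X" "foot eps x \<in> cball x0 (2 * R)"
proof -
 have "foot eps x \<in> cball x0 (2 * R) \<and> foot eps x \<in> U"
  unfolding foot_def by (rule shift_in') (use x \<tau>[OF x] lenR in \<open>auto simp: strip_def\<close>)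
 then show "foot eps x \<in> frontier X" "foot eps x \<in> cball x0 (2 * R)"
  using U(5) \<tau>(3)[OF x] by (auto simp: foot_def)
qed

text \<open>For the indicator of a set A, the left-hand side is the volume of the points whose foot lies in A,
and these form a cylinder of height \<open>len eps\<close> over a part of the boundary; general functions
follow by monotone approximation.\<close>
lemma strip_foot_integral_le:
 assumes F: "F \<in> bmeas borel"
 shows "(NN x. ind (strip eps) x * F (foot eps x))
   \<le> en (512 / pi * len eps) * (\<integral>\<^sup>+x. F x \<partial>surface_measure X)"
proof -
 note [measurable] = foot_measurable
 have [measurable]: "strip eps \<in> sets borel" using strip_open by simp
 let ?N = "hausdorff2_measure"
 have mN: "f \<in> bmeas ?N \<longleftrightarrow> f \<in> bmeas borel" for f :: "real^3 => ennreal"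
  using measurable_cong_sets[OF hausdorff2_measure(2) refl] by blast
 have fr: "frontier X \<inter> space ?N \<in> sets ?N" by (simp add: hausdorff2_measure)
 have surf: "(\<integral>\<^sup>+x. f x \<partial>surface_measure X) = (\<integral>\<^sup>+x. f x * ind (frontier X) x \<partial>?N)" for f
  unfolding surface_measure_eq by (rule nn_integral_restrict_space[OF fr])
 have fi: "ind (frontier X) \<in> bmeas borel" by simp
 from F have "(NN x. ind (strip eps) x * F (foot eps x))
   \<le> en (512 / pi * len eps) * (\<integral>\<^sup>+x. F x * ind (frontier X) x \<partial>?N)"
 proof (induction rule: borel_measurable_induct)
  case (cong f g)
  then show ?case by simp
 next
  case (set A)
  then have [measurable]: "A \<in> sets borel" by simp
  have "(NN x. ind (strip eps) x * ind A (foot eps x)) = (NN x. ind {x \<in> strip eps. foot eps x \<in> A} x)"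
   by (intro nn_integral_cong) (auto simp: indicator_def)
  also have "\<dots> = emeasure lborel {x \<in> strip eps. foot eps x \<in> A}" by (rule nn_integral_indicator) measurable
  also have "\<dots> \<le> en (512 / pi * len eps) * hausdorff2_outer (A \<inter> frontier X)"
  proof (rule cylinder_volume_le_hausdorff2)
   show "norm e \<le> 1" "len eps > 0" using e len0 by auto
   show "{x \<in> strip eps. foot eps x \<in> A} \<in> sets borel" by measurable
   show "\<exists>s\<ge>0. s \<le> len eps \<and> x + s *\<^sub>R e \<in> A \<inter> frontier X" if "x \<in> {x \<in> strip eps. foot eps x \<in> A}" for x
    using that foot(1)[of x] \<tau>(1,2)[of x] unfolding foot_def by blast
  qed
  also have "hausdorff2_outer (A \<inter> frontier X) = (\<integral>\<^sup>+x. ind A x * ind (frontier X) x \<partial>?N)"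
   by (subst indicator_inter_arith[symmetric], subst nn_integral_indicator) (auto simp: hausdorff2_measure)
  finally show ?case .
 next
  case (mult f c)
  note [measurable] = mult(2)
  have "(NN x. ind (strip eps) x * (c * f (foot eps x))) = c * (NN x. ind (strip eps) x * f (foot eps x))"
   by (subst nn_integral_cmult[symmetric]) (auto simp: mult.left_commute)
  also have "\<dots> \<le> c * (en (512 / pi * len eps) * (\<integral>\<^sup>+x. f x * ind (frontier X) x \<partial>?N))"
   by (intro mult_left_mono mult) auto
  also have "\<dots> = en (512 / pi * len eps) * (\<integral>\<^sup>+x. c * (f x * ind (frontier X) x) \<partial>?N)"
   using mult(2) fi by (subst nn_integral_cmult) (auto simp: mN mult.left_commute)
  finally show ?case by (simp add: mult.assoc)
 next
  case (add g f)
  note [measurable] = add.hyps(1,3)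
  have "(NN x. ind (strip eps) x * (f (foot eps x) + g (foot eps x)))
   = (NN x. ind (strip eps) x * f (foot eps x)) + (NN x. ind (strip eps) x * g (foot eps x))"
   by (subst nn_integral_add[symmetric]) (auto simp: distrib_left)
  also have "\<dots> \<le> en (512 / pi * len eps) * (\<integral>\<^sup>+x. f x * ind (frontier X) x \<partial>?N)
    + en (512 / pi * len eps) * (\<integral>\<^sup>+x. g x * ind (frontier X) x \<partial>?N)"
   by (intro add_mono add.IH)
  also have "\<dots> = en (512 / pi * len eps) * (\<integral>\<^sup>+x. (f x + g x) * ind (frontier X) x \<partial>?N)"
   unfolding distrib_left[symmetric] distrib_right using fi
   by (subst nn_integral_add) (auto simp: mN)
  finally show ?case .
 next
  case (seq Us)
  note [measurable] = seq(1)
  have "(NN x. ind (strip eps) x * (SUP i. Us i) (foot eps x)) = (NN x. (SUP i. ind (strip eps) x * Us i (foot eps x)))"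
   by (simp add: SUP_mult_left_ennreal image_comp)
  also have "\<dots> = (SUP i. NN x. ind (strip eps) x * Us i (foot eps x))"
   by (rule nn_integral_monotone_convergence_SUP)
    (use seq(3) in \<open>auto simp: incseq_def le_fun_def intro!: mult_left_mono\<close>)
  also have "\<dots> \<le> en (512 / pi * len eps) * (\<integral>\<^sup>+x. (SUP i. Us i) x * ind (frontier X) x \<partial>?N)"
  proof (rule SUP_least)
   fix i
   have "(NN x. ind (strip eps) x * Us i (foot eps x)) \<le> en (512 / pi * len eps) * (\<integral>\<^sup>+x. Us i x * ind (frontier X) x \<partial>?N)"
    by (rule seq.IH)
   also have "\<dots> \<le> en (512 / pi * len eps) * (\<integral>\<^sup>+x. (SUP i. Us i) x * ind (frontier X) x \<partial>?N)"
    by (intro mult_left_mono nn_integral_mono mult_right_mono) (auto intro: SUP_upper)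
   finally show "(NN x. ind (strip eps) x * Us i (foot eps x)) \<le> \<dots>" .
  qed
  finally show ?case .
 qed
 then show ?thesis by (simp only: surf)
qed

text \<open>The fundamental theorem of calculus on the segment from x to its foot, which lies in the wider
strip except for its endpoint.\<close>
lemma normal_field_segment_bound:
 fixes w w' :: "real^3 => real"
 assumes x: "x \<in> strip eps"
  and der: "\<And>z. z \<in> U ==> ((\<lambda>s. w (z + s *\<^sub>R e)) has_real_derivative w' z) (at 0)"
  and cont: "continuous_on U w'" and P: "\<And>z. z \<in> cball x0 (2 * R) ==> \<bar>w' z\<bar> \<le> P z"
 shows "en \<bar>w x\<bar> \<le> en \<bar>w (foot eps x)\<bar>
   + (NN s. ind {0..len eps} s * (ind (strip2 eps) (x + s *\<^sub>R e) * en (P (x + s *\<^sub>R e))))"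
proof -
 let ?t = "\<tau> eps x"
 have xb: "x \<in> ball x0 R" and dx: "- (3 * eps) < d x" using x by (auto simp: strip_def)
 note t = \<tau>[OF x]
 have inU: "x + s *\<^sub>R e \<in> U" "x + s *\<^sub>R e \<in> cball x0 (2 * R)" "x + s *\<^sub>R e \<in> ball x0 (2 * R)"
  if "0 \<le> s" "s \<le> ?t" for s
  using shift_in'[OF xb, of s] shift_in[OF xb, of s] that t lenR by auto
 have d1: "((\<lambda>s. w (x + s *\<^sub>R e)) has_vector_derivative w' (x + s *\<^sub>R e)) (at s within {0..?t})"
  if "0 \<le> s" "s \<le> ?t" for s
 proof -
  have "((\<lambda>r. w (x + s *\<^sub>R e + r *\<^sub>R e)) has_real_derivative w' (x + s *\<^sub>R e)) (at (s + - s))"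
   using der[OF inU(1)[OF that]] by simp
  from this[unfolded DERIV_shift]
  have "((\<lambda>r. w (x + s *\<^sub>R e + (r + - s) *\<^sub>R e)) has_real_derivative w' (x + s *\<^sub>R e)) (at s)" .
  then have "((\<lambda>s. w (x + s *\<^sub>R e)) has_real_derivative w' (x + s *\<^sub>R e)) (at s)"
   by (simp add: algebra_simps)
  then show ?thesis
   using has_real_derivative_iff_has_vector_derivative has_vector_derivative_at_within by blast
 qed
 have c1: "continuous_on {0..?t} (\<lambda>s. w' (x + s *\<^sub>R e))"
  by (rule continuous_on_compose2[OF cont]) (use inU in \<open>auto intro!: continuous_intros\<close>)
 have ftc: "(LL s. ind {0..?t} s *\<^sub>R w' (x + s *\<^sub>R e)) = w (x + ?t *\<^sub>R e) - w (x + 0 *\<^sub>R e)"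
  by (rule integral_FTC_Icc[OF t(1) d1 c1])
 have int: "integ (\<lambda>s. ind {0..?t} s *\<^sub>R w' (x + s *\<^sub>R e))"
  by (rule borel_integrable_compact[OF _ c1]) simp
 have "\<bar>w x\<bar> \<le> \<bar>w (foot eps x)\<bar> + \<bar>LL s. ind {0..?t} s *\<^sub>R w' (x + s *\<^sub>R e)\<bar>"
  unfolding ftc foot_def by simp
 then have "en \<bar>w x\<bar> \<le> en \<bar>w (foot eps x)\<bar> + en \<bar>LL s. ind {0..?t} s *\<^sub>R w' (x + s *\<^sub>R e)\<bar>"
  by (simp add: ennreal_leI flip: ennreal_plus)
 also have "en \<bar>LL s. ind {0..?t} s *\<^sub>R w' (x + s *\<^sub>R e)\<bar>
   \<le> (NN s. en \<bar>ind {0..?t} s *\<^sub>R w' (x + s *\<^sub>R e)\<bar>)"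
  by (rule ennreal_integral_abs_le) (use int in auto)
 also have "\<dots> \<le> (NN s. ind {0..len eps} s * (ind (strip2 eps) (x + s *\<^sub>R e) * en (P (x + s *\<^sub>R e))))"
 proof (rule nn_integral_mono_AE)
  show "AE s in lborel. en \<bar>ind {0..?t} s *\<^sub>R w' (x + s *\<^sub>R e)\<bar>
   \<le> ind {0..len eps} s * (ind (strip2 eps) (x + s *\<^sub>R e) * en (P (x + s *\<^sub>R e)))"
   using AE_lborel_singleton[of ?t]
  proof eventually_elim
   case (elim s)
   show ?case
   proof (cases "s \<in> {0..?t}")
    case True
    then have s: "0 \<le> s" "s < ?t" "s \<le> len eps" using elim t by auto
    have "d (x + s *\<^sub>R e) < 0" using \<tau>_greater_iff[OF x s(1,3)] s by simp
    moreover have "m * (s - 0) \<le> d (x + s *\<^sub>R e) - d (x + 0 *\<^sub>R e)"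
     using d_increase[OF xb, of 0 s] s lenR by simp
    then have "d x \<le> d (x + s *\<^sub>R e)" using mult_nonneg_nonneg[OF less_imp_le[OF m] s(1)] by simp
    ultimately have "x + s *\<^sub>R e \<in> strip2 eps" using inU(3)[of s] s dx by (auto simp: strip2_def)
    then show ?thesis using True s P[OF inU(2)[of s]] by (simp add: ennreal_leI)
   qed simp
  qed
 qed
 finally show ?thesis by (simp add: add_left_mono)
qed

text \<open>The segment bound is integrated over the strip; exchanging the integrals, each point of the wider
strip is counted with total weight at most \<open>len eps\<close>.\<close>
lemma normal_field_strip_bound:
 fixes w w' :: "real^3 => real"
 assumes der: "\<And>z. z \<in> U ==> ((\<lambda>s. w (z + s *\<^sub>R e)) has_real_derivative w' z) (at 0)"
  and cont: "continuous_on U w'" and P: "\<And>z. z \<in> cball x0 (2 * R) ==> \<bar>w' z\<bar> \<le> P z"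
  and Pm: "P \<in> bmeas borel" and F: "F \<in> bmeas borel"
  and Fw: "\<And>z. z \<in> frontier X \<inter> cball x0 (2 * R) ==> ennreal \<bar>w z\<bar> \<le> F z"
 shows "(NN x. ind (strip eps) x * en \<bar>w x\<bar>)
   \<le> (NN x. ind (strip eps) x * F (foot eps x))
    + en (len eps) * (NN x. ind (strip2 eps) x * en (P x))"
proof -
 note [measurable] = foot_measurable Pm F strip2_borel
 have [measurable]: "strip eps \<in> sets borel" using strip_open by simp
 let ?G = "\<lambda>z. ind (strip2 eps) z * en (P z)"
 have "(NN x. ind (strip eps) x * en \<bar>w x\<bar>)
  \<le> (NN x. ind (strip eps) x * F (foot eps x) + (NN s. ind {0..len eps} s * ?G (x + s *\<^sub>R e)))"
 proof (rule nn_integral_mono)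
  fix x
  show "ind (strip eps) x * en \<bar>w x\<bar>
   \<le> ind (strip eps) x * F (foot eps x) + (NN s. ind {0..len eps} s * ?G (x + s *\<^sub>R e))"
  proof (cases "x \<in> strip eps")
   case True
   have "en \<bar>w (foot eps x)\<bar> \<le> F (foot eps x)" using Fw foot[OF True] by blast
   then show ?thesis using normal_field_segment_bound[OF True der cont P] True
    by (auto intro: order_trans add_right_mono)
  qed simp
 qed
 also have "\<dots> = (NN x. ind (strip eps) x * F (foot eps x)) + (NN x. (NN s. ind {0..len eps} s * ?G (x + s *\<^sub>R e)))"
  by (rule nn_integral_add) measurable
 also have "(NN x. (NN s. ind {0..len eps} s * ?G (x + s *\<^sub>R e)))
   = (NN s. (NN x. ind {0..len eps} s * ?G (x + s *\<^sub>R e)))"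
  by (rule lborel_pair.Fubini') measurable
 also have "\<dots> = (NN s. ind {0..len eps} s * (NN x. ?G x))"
 proof (rule nn_integral_cong)
  fix s
  have "(NN x. ind {0..len eps} s * ?G (x + s *\<^sub>R e)) = ind {0..len eps} s * (NN x. ?G (x + s *\<^sub>R e))"
   by (rule nn_integral_cmult) measurable
  also have "(NN x. ?G (x + s *\<^sub>R e)) = (NN x. ?G x)"
   by (rule nn_integral_translate) measurable
  finally show "(NN x. ind {0..len eps} s * ?G (x + s *\<^sub>R e)) = ind {0..len eps} s * (NN x. ?G x)" .
 qed
 also have "\<dots> = en (len eps) * (NN x. ?G x)"
  using len0 by (subst nn_integral_multc) auto
 finally show ?thesis .
qed

end

text \<open>The normal component of v, up to the factor |gradient d|, extended to a neighbourhood of the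
boundary.\<close>
definition normal_comp :: "(3 => real^3 => real) => real^3 => real" where
 "normal_comp v z = (\<Sum>i\<in>UNIV. gradient d z $ i * v i z)"

lemma normal_comp_bound:
 assumes "z \<in> cball x0 (2 * R)" shows "\<bar>normal_comp v z\<bar> \<le> 2 * norm a * (\<Sum>i\<in>UNIV. \<bar>v i z\<bar>)"
proof -
 have "\<bar>normal_comp v z\<bar> \<le> (\<Sum>i\<in>UNIV. \<bar>gradient d z $ i * v i z\<bar>)" unfolding normal_comp_def by (rule sum_abs)
 also have "\<dots> \<le> (\<Sum>i\<in>UNIV. 2 * norm a * \<bar>v i z\<bar>)"
  unfolding abs_mult using grad_norm[OF assms] component_le_norm_cart[of "gradient d z"]
  by (intro sum_mono mult_right_mono) (auto intro: order_trans)
 finally show ?thesis by (simp add: sum_distrib_left)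
qed

text \<open>The product rule for gradient d . v in direction e; gradient d and its derivative are bounded on
the compact ball.\<close>
lemma normal_field_constant:
 obtains C where "C \<ge> 0" and "\<And>v. (\<And>i. smooth_on UNIV (v i)) ==>
  \<exists>w'. (\<forall>z\<in>U. ((\<lambda>s. normal_comp v (z + s *\<^sub>R e)) has_real_derivative w' z) (at 0)) \<and> continuous_on U w' \<and>
   (\<forall>z\<in>cball x0 (2 * R). \<bar>w' z\<bar> \<le> C * (\<Sum>i\<in>UNIV. \<bar>v i z\<bar> + (\<Sum>j\<in>Basis. \<bar>fder (v i) z j\<bar>)))"
proof -
 define \<gamma> where "\<gamma> i z = gradient d z $ i" for i z
 have \<gamma>: "smooth_on U (\<gamma> i)" for i using smooth_on_gradient(1)[OF U(1,3), of i] by (simp add: \<gamma>_def[abs_def])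
 define \<gamma>e where "\<gamma>e i z = (\<Sum>j\<in>Basis. (e \<bullet> j) * fder (\<gamma> i) z j)" for i z
 have \<gamma>ec: "continuous_on U (\<gamma>e i)" for i unfolding \<gamma>e_def
  by (intro continuous_on_sum continuous_on_mult continuous_on_const smooth_on_continuous smooth_on_deriv \<gamma>)
 have "\<exists>B. \<forall>z\<in>cball x0 (2 * R). \<bar>\<gamma>e i z\<bar> \<le> B" for i
 proof -
  have "compact (\<gamma>e i ` cball x0 (2 * R))"
   by (rule compact_continuous_image[OF continuous_on_subset[OF \<gamma>ec sub] compact_cball])
  from compact_imp_bounded[OF this] show ?thesis by (auto simp: bounded_iff)
 qed
 then obtain B where B: "\<And>i z. z \<in> cball x0 (2 * R) ==> \<bar>\<gamma>e i z\<bar> \<le> B i" by metis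
 define C where "C = (\<Sum>i\<in>UNIV. \<bar>B i\<bar>) + 2 * norm a"
 have BC: "\<bar>\<gamma>e i z\<bar> \<le> C" if "z \<in> cball x0 (2 * R)" for i z
 proof -
  have "\<bar>B i\<bar> \<le> (\<Sum>i\<in>UNIV. \<bar>B i\<bar>)" by (intro member_le_sum) auto
  then show ?thesis using B[OF that, of i] norm_ge_zero[of a] unfolding C_def by linarith
 qed
 have \<gamma>C: "\<bar>\<gamma> i z\<bar> \<le> C" if "z \<in> cball x0 (2 * R)" for i z
 proof -
  have "0 \<le> (\<Sum>i\<in>UNIV. \<bar>B i\<bar>)" by (intro sum_nonneg) auto
  then show ?thesis using grad_norm[OF that] component_le_norm_cart[of "gradient d z" i] unfolding C_def \<gamma>_def by linarith
 qed
 have along: "((\<lambda>s. f (z + s *\<^sub>R e)) has_real_derivative (\<Sum>j\<in>Basis. (e \<bullet> j) * fder f z j)) (at 0)"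
  if "open S" "smooth_on S f" "z \<in> S" for f :: "real^3 => real" and S z
 proof -
  let ?D = "fder f z"
  have D: "(f has_derivative ?D) (at (z + 0 *\<^sub>R e))" using smooth_onD[OF that] by simp
  have 1: "((\<lambda>s. f (z + s *\<^sub>R e)) has_derivative (\<lambda>s. ?D (s *\<^sub>R e))) (at 0)"
   by (rule has_derivative_compose[of "\<lambda>s. z + s *\<^sub>R e" "\<lambda>s. s *\<^sub>R e" 0 UNIV, OF _ D]) (auto intro!: derivative_eq_intros)
  have 2: "?D (s *\<^sub>R e) = (\<Sum>j\<in>Basis. (e \<bullet> j) * ?D j) * s" for s
   using has_derivative_linear[OF D] by (simp add: linear_scale linear_basis_expansion[of ?D e])
  show ?thesis unfolding has_field_derivative_def
   by (rule has_derivative_eq_rhs[OF 1]) (simp only: 2 fun_eq_iff simp_thms)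
 qed
 show ?thesis
 proof
  show "C \<ge> 0" using sum_nonneg[of UNIV "\<lambda>i. \<bar>B i\<bar>"] by (simp add: C_def)
  fix v :: "3 => real^3 => real" assume v: "\<And>i. smooth_on UNIV (v i)"
  define ve where "ve i z = (\<Sum>j\<in>Basis. (e \<bullet> j) * fder (v i) z j)" for i z
  have vec: "continuous_on UNIV (ve i)" for i unfolding ve_def
   by (intro continuous_on_sum continuous_on_mult continuous_on_const smooth_on_continuous smooth_on_deriv v)
  define w' where "w' z = (\<Sum>i\<in>UNIV. \<gamma>e i z * v i z + ve i z * \<gamma> i z)" for z
  have "((\<lambda>s. normal_comp v (z + s *\<^sub>R e)) has_real_derivative w' z) (at 0)" if z: "z \<in> U" for z
  proof -
   have "((\<lambda>s. \<Sum>i\<in>UNIV. \<gamma> i (z + s *\<^sub>R e) * v i (z + s *\<^sub>R e)) has_real_derivative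
     (\<Sum>i\<in>UNIV. \<gamma>e i z * v i (z + 0 *\<^sub>R e) + ve i z * \<gamma> i (z + 0 *\<^sub>R e))) (at 0)"
    unfolding \<gamma>e_def ve_def
    by (intro DERIV_sum DERIV_mult along[OF U(1) \<gamma> z] along[OF open_UNIV v UNIV_I])
   then show ?thesis by (simp add: normal_comp_def \<gamma>_def w'_def)
  qed
  moreover have "continuous_on U w'" unfolding w'_def
   by (intro continuous_on_sum continuous_on_add continuous_on_mult \<gamma>ec smooth_on_continuous[OF \<gamma>]
     continuous_on_subset[OF vec] continuous_on_subset[OF smooth_on_continuous[OF v]]) auto
  moreover have "\<bar>w' z\<bar> \<le> C * (\<Sum>i\<in>UNIV. \<bar>v i z\<bar> + (\<Sum>j\<in>Basis. \<bar>fder (v i) z j\<bar>))"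
   if z: "z \<in> cball x0 (2 * R)" for z
  proof -
   have ve: "\<bar>ve i z\<bar> \<le> (\<Sum>j\<in>Basis. \<bar>fder (v i) z j\<bar>)" for i
   proof -
    have "\<bar>ve i z\<bar> \<le> (\<Sum>j\<in>Basis. \<bar>(e \<bullet> j) * fder (v i) z j\<bar>)" unfolding ve_def by (rule sum_abs)
    also have "\<dots> \<le> (\<Sum>j\<in>Basis. \<bar>fder (v i) z j\<bar>)"
     unfolding abs_mult using Basis_le_norm[of _ e] e by (intro sum_mono mult_left_le_one_le) auto
    finally show ?thesis .
   qed
   have "\<bar>w' z\<bar> \<le> (\<Sum>i\<in>UNIV. \<bar>\<gamma>e i z * v i z + ve i z * \<gamma> i z\<bar>)" unfolding w'_def by (rule sum_abs)
   also have "\<dots> \<le> (\<Sum>i\<in>UNIV. C * (\<bar>v i z\<bar> + (\<Sum>j\<in>Basis. \<bar>fder (v i) z j\<bar>)))"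
   proof (rule sum_mono)
    fix i :: 3
    have "\<bar>\<gamma>e i z * v i z\<bar> \<le> C * \<bar>v i z\<bar>" using BC[OF z, of i] by (simp add: abs_mult mult_right_mono)
    moreover have "\<bar>ve i z * \<gamma> i z\<bar> \<le> (\<Sum>j\<in>Basis. \<bar>fder (v i) z j\<bar>) * C"
     unfolding abs_mult using ve[of i] \<gamma>C[OF z, of i] by (intro mult_mono) auto
    ultimately show "\<bar>\<gamma>e i z * v i z + ve i z * \<gamma> i z\<bar> \<le> C * (\<bar>v i z\<bar> + (\<Sum>j\<in>Basis. \<bar>fder (v i) z j\<bar>))"
     using abs_triangle_ineq[of "\<gamma>e i z * v i z" "ve i z * \<gamma> i z"] by (simp add: distrib_left mult.commute)
   qed
   finally show ?thesis by (simp add: sum_distrib_left)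
  qed
  ultimately show "\<exists>w'. (\<forall>z\<in>U. ((\<lambda>s. normal_comp v (z + s *\<^sub>R e)) has_real_derivative w' z) (at 0)) \<and> continuous_on U w' \<and>
   (\<forall>z\<in>cball x0 (2 * R). \<bar>w' z\<bar> \<le> C * (\<Sum>i\<in>UNIV. \<bar>v i z\<bar> + (\<Sum>j\<in>Basis. \<bar>fder (v i) z j\<bar>)))"
   by blast
 qed
qed

end

section \<open>Fields with vanishing normal trace\<close>

text \<open>The scalar counterpart of \<open>has_trace\<close>, where G i j stands for the derivative of u i
in direction j. The norms in the interior are only those of L^1, which suffices for the divergence
theorem.\<close>
definition zero_normal_trace :: "(real^3) set => (3 => real^3 => real) => (3 => real^3 => real^3 => real) => bool" where
 "zero_normal_trace X u G \<longleftrightarrow> (\<exists>v g. (\<forall>n i. smooth_on UNIV (v n i)) \<and> g \<in> bmeas (surface_measure X) \<and>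
   (\<forall>i. (\<lambda>n::nat. LL x. ind X x * \<bar>v n i x - u i x\<bar>) ----> 0) \<and>
   (\<forall>i. \<forall>j\<in>Basis. (\<lambda>n. LL x. ind X x * \<bar>fder (v n i) x j - G i j x\<bar>) ----> 0) \<and>
   (\<lambda>n. \<integral>\<^sup>+x. en ((norm ((\<chi> i. v n i x) - g x))\<^sup>2) \<partial>surface_measure X) ----> 0 \<and>
   (AE x in surface_measure X. g x \<bullet> outward_normal X x = 0))"

lemma abs_le_square_over:
 fixes w \<kappa> :: real
 assumes "\<kappa> > 0" shows "\<bar>w\<bar> \<le> \<kappa> + 1 / \<kappa> * w\<^sup>2"
proof (cases "\<bar>w\<bar> \<le> \<kappa>")
 case True
 have "0 \<le> 1 / \<kappa> * w\<^sup>2" using assms by simp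
 then show ?thesis using True by linarith
next
 case False
 then have "\<bar>w\<bar> * \<kappa> \<le> \<bar>w\<bar> * \<bar>w\<bar>" by (intro mult_left_mono) auto
 then have "\<bar>w\<bar> \<le> 1 / \<kappa> * w\<^sup>2" using assms by (simp add: field_simps power2_eq_square)
 then show ?thesis using assms by linarith
qed

context chart
begin

lemma normal_comp_measurable:
 assumes "\<And>i. v i \<in> bmeas borel"
 shows "(\<lambda>z. ind (cball x0 (2 * R)) z * normal_comp v z) \<in> bmeas borel"
proof -
 have "(\<lambda>z. ind (cball x0 (2 * R)) z *\<^sub>R (gradient d z $ i)) \<in> bmeas borel" for i
  using continuous_on_subset[OF smooth_on_continuous[OF smooth_on_gradient(1)[OF U(1,3), of i]] sub]
  by (intro borel_measurable_continuous_on_indicator) auto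
 then have "(\<lambda>z. \<Sum>i\<in>UNIV. (ind (cball x0 (2 * R)) z *\<^sub>R (gradient d z $ i)) * v i z) \<in> bmeas borel"
  using assms by (intro borel_measurable_sum borel_measurable_times)
 moreover have "(\<Sum>i\<in>UNIV. (ind (cball x0 (2 * R)) z *\<^sub>R (gradient d z $ i)) * v i z) = ind (cball x0 (2 * R)) z * normal_comp v z" for z
  by (simp add: normal_comp_def sum_distrib_left mult.assoc)
 ultimately show ?thesis by simp
qed

lemma normal_comp_on_surface:
 assumes g: "AE x in surface_measure X. g x \<bullet> outward_normal X x = 0"
 shows "AE z in surface_measure X. z \<in> cball x0 (2 * R) -->
  (normal_comp v z)\<^sup>2 \<le> (2 * norm a)\<^sup>2 * (norm ((\<chi> i. v i z) - g z))\<^sup>2"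
proof (rule AE_mp[OF g], intro AE_I2 impI)
 fix z assume z: "z \<in> space (surface_measure X)" and gz: "g z \<bullet> outward_normal X z = 0"
  and zc: "z \<in> cball x0 (2 * R)"
 have zf: "z \<in> frontier X" using z by (simp add: surface_measure_eq space_restrict_space)
 have zU: "z \<in> U" using zc sub by blast
 have "local_defining_function X z U d" using ldf zU unfolding local_defining_function_def by blast
 then have "outward_normal X z = sgn (gradient d z)" using zf by (rule outward_normal_eq)
 moreover have "gradient d z \<noteq> 0" using ldf zU unfolding local_defining_function_def by blast
 ultimately have "gradient d z \<bullet> g z = 0" using gz by (simp add: sgn_div_norm inner_commute)
 then have "normal_comp v z = gradient d z \<bullet> ((\<chi> i. v i z) - g z)"
  by (simp add: normal_comp_def inner_diff_right) (simp add: inner_vec_def)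
 then have "\<bar>normal_comp v z\<bar> \<le> norm (gradient d z) * norm ((\<chi> i. v i z) - g z)"
  using Cauchy_Schwarz_ineq2 by metis
 also have "\<dots> \<le> 2 * norm a * norm ((\<chi> i. v i z) - g z)" by (intro mult_right_mono grad_norm[OF zc]) auto
 finally have "\<bar>normal_comp v z\<bar>\<^sup>2 \<le> (2 * norm a * norm ((\<chi> i. v i z) - g z))\<^sup>2" by (intro power_mono) auto
 then show "(normal_comp v z)\<^sup>2 \<le> (2 * norm a)\<^sup>2 * (norm ((\<chi> i. v i z) - g z))\<^sup>2"
  by (simp add: power_mult_distrib)
qed

lemma strip_finite: "emeasure lborel (strip eps) < \<infinity>"
proof -
 have "emeasure lborel (strip eps) \<le> emeasure lborel (ball x0 R)" by (intro emeasure_mono) (auto simp: strip_def)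
 also have "\<dots> < \<infinity>" by (rule emeasure_lborel_ball_finite)
 finally show ?thesis .
qed

text \<open>The density of the W^{1,1} norm.\<close>
definition energy :: "(3 => real^3 => real) => (3 => real^3 => real^3 => real) => real^3 => real" where
 "energy u G z = (\<Sum>i\<in>UNIV. \<bar>u i z\<bar> + (\<Sum>j\<in>Basis. \<bar>G i j z\<bar>))"

lemma energy_nonneg: "0 \<le> energy u G z" by (auto simp: energy_def intro!: sum_nonneg add_nonneg_nonneg)

lemma energy_triangle:
 "energy v H z \<le> energy u G z + energy (\<lambda>i z. v i z - u i z) (\<lambda>i j z. H i j z - G i j z) z"
proof -
 have t: "\<bar>p\<bar> \<le> \<bar>q\<bar> + \<bar>p - q\<bar>" for p q :: real by linarith
 have s: "(\<Sum>j\<in>Basis. \<bar>H i j z\<bar>) \<le> (\<Sum>j\<in>Basis. \<bar>G i j z\<bar>) + (\<Sum>j\<in>Basis. \<bar>H i j z - G i j z\<bar>)" for i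
  unfolding sum.distrib[symmetric] by (intro sum_mono t)
 show ?thesis unfolding energy_def sum.distrib[of _ _ "UNIV :: 3 set", symmetric]
 proof (rule sum_mono)
  fix i :: 3
  show "\<bar>v i z\<bar> + (\<Sum>j\<in>Basis. \<bar>H i j z\<bar>) \<le> \<bar>u i z\<bar> + (\<Sum>j\<in>Basis. \<bar>G i j z\<bar>) + (\<bar>v i z - u i z\<bar> + (\<Sum>j\<in>Basis. \<bar>H i j z - G i j z\<bar>))"
   using t[of "v i z" "u i z"] s[of i] by linarith
 qed
qed

text \<open>For smooth v, the normal component in the strip is the one at the foot plus at most the integral
of its derivative along the segment. The first part is estimated in L^2 of the boundary by the distance of v
from the trace g, whose normal component is zero; \<open>abs_le_square_over\<close> turns the L^1 norm into a
square at the price of a small constant kappa. The limit of v towards u removes the boundary term for fixed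
kappa, and then kappa tends to 0.\<close>
lemma flux_through_strip:
 assumes eps: "eps > 0" "len eps \<le> R" and o: "open X" "bounded X"
  and C: "C \<ge> 0" "\<And>v. (\<And>i. smooth_on UNIV (v i)) ==>
   \<exists>w'. (\<forall>z\<in>U. ((\<lambda>s. normal_comp v (z + s *\<^sub>R e)) has_real_derivative w' z) (at 0)) \<and> continuous_on U w' \<and>
    (\<forall>z\<in>cball x0 (2 * R). \<bar>w' z\<bar> \<le> C * energy v (\<lambda>i j z. fder (v i) z j) z)"
  and u: "\<And>i. integ (u i)" and G: "\<And>i j. j \<in> Basis ==> integ (G i j)"
  and tr: "zero_normal_trace X u G"
 shows "(NN x. ind (strip eps) x * en \<bar>normal_comp u x\<bar>)
   \<le> en (C * len eps) * (NN x. ind (strip2 eps) x * en (energy u G x))"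
proof -
 have Xb[measurable]: "X \<in> sets borel" using o by simp
 have [measurable]: "strip eps \<in> sets borel" using strip_open by simp
 note [measurable] = strip2_borel foot_measurable[OF eps]
 obtain v g where v: "\<And>n i. smooth_on UNIV (v n i)" and gm: "g \<in> bmeas (surface_measure X)"
  and l1: "\<And>i. (\<lambda>n::nat. LL x. ind X x * \<bar>v n i x - u i x\<bar>) ----> 0"
  and l2: "\<And>i j. j \<in> Basis ==> (\<lambda>n. LL x. ind X x * \<bar>fder (v n i) x j - G i j x\<bar>) ----> 0"
  and l3: "(\<lambda>n. \<integral>\<^sup>+x. en ((norm ((\<chi> i. v n i x) - g x))\<^sup>2) \<partial>surface_measure X) ----> 0"
  and g: "AE x in surface_measure X. g x \<bullet> outward_normal X x = 0"
  using tr unfolding zero_normal_trace_def by blast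
 define H where "H n i j z = fder (v n i) z j" for n i j z
 define S where "S n = (\<integral>\<^sup>+x. en ((norm ((\<chi> i. v n i x) - g x))\<^sup>2) \<partial>surface_measure X)" for n
 have vc: "continuous_on UNIV (v n i)" for n i using smooth_on_continuous[OF v] .
 have vm[measurable]: "v n i \<in> bmeas borel" for n i using vc by (rule borel_measurable_continuous_onI)
 have vgm: "(\<lambda>x. (\<chi> i. v n i x) - g x) \<in> bmeas (surface_measure X)" for n
 proof -
  have "(\<lambda>x. \<chi> i. v n i x) \<in> bmeas borel"
   by (intro borel_measurable_continuous_onI continuous_on_vec_lambda vc)
  then have "(\<lambda>x. \<chi> i. v n i x) \<in> bmeas hausdorff2_measure"
   using measurable_cong_sets[OF hausdorff2_measure(2) refl] by blast
  then show ?thesis unfolding surface_measure_eq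
   by (rule borel_measurable_diff[OF measurable_restrict_space1 gm[unfolded surface_measure_eq]])
 qed
 have Hc: "continuous_on UNIV (H n i j)" if "j \<in> Basis" for n i j
  unfolding H_def using smooth_on_continuous[OF smooth_on_deriv[OF v that]] .
 have Hm: "H n i j \<in> bmeas borel" if "j \<in> Basis" for n i j
  using Hc[OF that] by (rule borel_measurable_continuous_onI)
 have um[measurable]: "u i \<in> bmeas borel" for i using u[of i] by simp
 have Gm: "G i j \<in> bmeas borel" if "j \<in> Basis" for i j using G[OF that, of i] by simp
 have intc: "integ (\<lambda>x. ind X x * f x)" if "continuous_on UNIV f" for f :: "real^3 => real"
 proof -
  have c: "compact (closure X)" using o by (simp add: compact_closure)
  have "integ (\<lambda>x. ind (closure X) x *\<^sub>R f x)"
   using borel_integrable_compact[OF c continuous_on_subset[OF that]] by simp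
  then have "integ (\<lambda>x. ind X x * (ind (closure X) x *\<^sub>R f x))"
   using o by (intro integrable_bounded_mult[where B=1]) auto
  moreover have "ind X x * (ind (closure X) x *\<^sub>R f x) = ind X x * f x" for x
   using closure_subset[of X] by (auto simp: indicator_def)
  ultimately show ?thesis by (simp only:)
 qed
 have intu: "integ (\<lambda>x. ind X x * f x)" if "integ f" for f :: "real^3 => real"
  by (rule integrable_bounded_mult[OF that, where B=1]) auto
 define D1 where "D1 n i x = ind X x * \<bar>v n i x - u i x\<bar>" for n i x
 define D2 where "D2 n i j x = ind X x * \<bar>H n i j x - G i j x\<bar>" for n i j x
 have D1i: "integ (D1 n i)" for n i
 proof -
  have "integ (\<lambda>x. \<bar>ind X x * v n i x - ind X x * u i x\<bar>)"
   by (intro integrable_abs Bintegrable_diff intc intu vc u)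
  moreover have "\<bar>ind X x * v n i x - ind X x * u i x\<bar> = D1 n i x" for x
   by (auto simp: D1_def indicator_def)
  ultimately show ?thesis by (simp add: fun_eq_iff[symmetric])
 qed
 have D2i: "integ (D2 n i j)" if "j \<in> Basis" for n i j
 proof -
  have "integ (\<lambda>x. \<bar>ind X x * H n i j x - ind X x * G i j x\<bar>)"
   by (intro integrable_abs Bintegrable_diff intc intu Hc G that)
  moreover have "\<bar>ind X x * H n i j x - ind X x * G i j x\<bar> = D2 n i j x" for x
   by (auto simp: D2_def indicator_def)
  ultimately show ?thesis by (simp add: fun_eq_iff[symmetric])
 qed
 define \<delta> where "\<delta> n = (\<Sum>i\<in>UNIV. (LL x. D1 n i x) + (\<Sum>j\<in>Basis. LL x. D2 n i j x))" for n
 have \<delta>0: "\<delta> ----> 0"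
 proof -
  have "\<delta> ----> (\<Sum>i\<in>(UNIV::3 set). 0 + (\<Sum>j\<in>(Basis::(real^3) set). 0))"
   unfolding \<delta>_def D1_def D2_def H_def by (intro tendsto_intros l1 l2)
  then show ?thesis by simp
 qed
 let ?E = "\<lambda>n z. energy (\<lambda>i z. v n i z - u i z) (\<lambda>i j z. H n i j z - G i j z) z"
 have Em: "energy u G \<in> bmeas borel" unfolding energy_def
  by (intro borel_measurable_sum borel_measurable_add borel_measurable_abs um Gm)
 have Enm: "(\<lambda>z. energy (v n) (H n) z) \<in> bmeas borel" for n unfolding energy_def
  by (intro borel_measurable_sum borel_measurable_add borel_measurable_abs vm Hm)
 have Ediff: "(\<lambda>z. ?E n z) \<in> bmeas borel" for n unfolding energy_def
  by (intro borel_measurable_sum borel_measurable_add borel_measurable_abs borel_measurable_diff vm Hm um Gm)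
 have Eint: "(NN x. ind A x * en (?E n x)) \<le> en (\<delta> n)" if A: "A \<subseteq> X" for n A
 proof -
  have Di: "integ (\<lambda>x. \<Sum>i\<in>UNIV. D1 n i x + (\<Sum>j\<in>Basis. D2 n i j x))"
   by (intro Bintegrable_sum Bintegrable_add D1i D2i)
  have nn: "0 \<le> (\<Sum>i\<in>UNIV. D1 n i x + (\<Sum>j\<in>Basis. D2 n i j x))" for x
   by (intro sum_nonneg add_nonneg_nonneg) (auto simp: D1_def D2_def)
  have "(NN x. ind A x * en (?E n x))
    \<le> (NN x. en (\<Sum>i\<in>UNIV. D1 n i x + (\<Sum>j\<in>Basis. D2 n i j x)))"
  proof (rule nn_integral_mono)
   fix x
   show "ind A x * en (?E n x) \<le> en (\<Sum>i\<in>UNIV. D1 n i x + (\<Sum>j\<in>Basis. D2 n i j x))"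
   proof (cases "x \<in> A")
    case True
    then have "x \<in> X" using A by blast
    then show ?thesis using True by (simp add: energy_def D1_def D2_def)
   qed simp
  qed
  also have "\<dots> = en (LL x. (\<Sum>i\<in>UNIV. D1 n i x + (\<Sum>j\<in>Basis. D2 n i j x)))"
   by (rule nn_integral_eq_integral[OF Di]) (use nn in auto)
  also have "(LL x. (\<Sum>i\<in>UNIV. D1 n i x + (\<Sum>j\<in>Basis. D2 n i j x))) = \<delta> n"
   unfolding \<delta>_def using D1i D2i
   by (subst Bintegral_sum) (auto intro!: sum.cong simp: Bintegral_sum)
  finally show ?thesis .
 qed
 let ?Q = "NN x. ind (strip2 eps) x * en (energy u G x)"
 let ?K = "(2 * norm a)\<^sup>2"
 define L where "L = 512 / pi * len eps"
 have main: "(NN x. ind (strip eps) x * en \<bar>normal_comp u x\<bar>)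
   \<le> (en \<kappa> * emeasure lborel (strip eps) + en (1 / \<kappa>) * (en L * (en ?K * S n)))
    + (en (len eps) * (en C * (?Q + en (\<delta> n))) + en (2 * norm a) * en (\<delta> n))"
  if \<kappa>: "\<kappa> > 0" for \<kappa> n
 proof -
  let ?w = "normal_comp (v n)"
  define f where "f z = ind (cball x0 (2 * R)) z * ?w z" for z
  have fm[measurable]: "f \<in> bmeas borel" unfolding f_def by (rule normal_comp_measurable) simp
  define F where "F z = en \<kappa> + en (1 / \<kappa>) * en ((f z)\<^sup>2)" for z
  have Fm[measurable]: "F \<in> bmeas borel" unfolding F_def by measurable
  obtain w' where w': "\<And>z. z \<in> U ==> ((\<lambda>s. ?w (z + s *\<^sub>R e)) has_real_derivative w' z) (at 0)" "continuous_on U w'"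
   "\<And>z. z \<in> cball x0 (2 * R) ==> \<bar>w' z\<bar> \<le> C * energy (v n) (H n) z"
   using C(2)[of "v n", OF v] unfolding H_def by blast
  have "(NN x. ind (strip eps) x * en \<bar>?w x\<bar>)
   \<le> (NN x. ind (strip eps) x * F (foot eps x))
    + en (len eps) * (NN x. ind (strip2 eps) x * en (C * energy (v n) (H n) x))"
  proof (rule normal_field_strip_bound[OF eps w' _ Fm])
   show "(\<lambda>z. C * energy (v n) (H n) z) \<in> bmeas borel" using Enm by simp
   fix z assume z: "z \<in> frontier X \<inter> cball x0 (2 * R)"
   have "en \<bar>?w z\<bar> \<le> en (\<kappa> + 1 / \<kappa> * (?w z)\<^sup>2)" by (intro ennreal_leI abs_le_square_over \<kappa>)
   also have "\<dots> = F z" using z \<kappa> by (simp add: F_def f_def ennreal_mult' del: times_divide_eq_left)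
   finally show "en \<bar>?w z\<bar> \<le> F z" .
  qed
  also have "(NN x. ind (strip eps) x * F (foot eps x))
    \<le> en \<kappa> * emeasure lborel (strip eps) + en (1 / \<kappa>) * (en L * (en ?K * S n))"
  proof -
   have "(NN x. ind (strip eps) x * F (foot eps x))
    = (NN x. en \<kappa> * ind (strip eps) x + en (1 / \<kappa>) * (ind (strip eps) x * en ((f (foot eps x))\<^sup>2)))"
    by (intro nn_integral_cong) (auto simp: F_def indicator_def)
   also have "\<dots> = en \<kappa> * emeasure lborel (strip eps) + en (1 / \<kappa>) * (NN x. ind (strip eps) x * en ((f (foot eps x))\<^sup>2))"
    by (subst nn_integral_add) (auto simp: nn_integral_cmult)
   also have "(NN x. ind (strip eps) x * en ((f (foot eps x))\<^sup>2)) \<le> en L * (\<integral>\<^sup>+x. en ((f x)\<^sup>2) \<partial>surface_measure X)"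
    unfolding L_def by (rule strip_foot_integral_le[OF eps]) measurable
   also have "(\<integral>\<^sup>+x. en ((f x)\<^sup>2) \<partial>surface_measure X) \<le> (\<integral>\<^sup>+x. en ?K * en ((norm ((\<chi> i. v n i x) - g x))\<^sup>2) \<partial>surface_measure X)"
   proof (rule nn_integral_mono_AE)
    show "AE x in surface_measure X. en ((f x)\<^sup>2) \<le> en ?K * en ((norm ((\<chi> i. v n i x) - g x))\<^sup>2)"
     using normal_comp_on_surface[OF g, of "v n"]
    proof eventually_elim
     case (elim z)
     show ?case
     proof (cases "z \<in> cball x0 (2 * R)")
      case True
      then have "(f z)\<^sup>2 \<le> ?K * (norm ((\<chi> i. v n i z) - g z))\<^sup>2" using elim by (simp add: f_def)
      from ennreal_leI[OF this] show ?thesis by (simp add: ennreal_mult)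
     qed (simp add: f_def)
    qed
   qed
   also have "\<dots> = en ?K * S n"
    unfolding S_def by (rule nn_integral_cmult) (use vgm in measurable)
   finally show ?thesis by (simp add: add_left_mono mult_left_mono)
  qed
  also have "(NN x. ind (strip2 eps) x * en (C * energy (v n) (H n) x)) \<le> en C * (?Q + en (\<delta> n))"
  proof -
   have "(NN x. ind (strip2 eps) x * en (C * energy (v n) (H n) x))
    \<le> (NN x. en C * (ind (strip2 eps) x * en (energy u G x) + ind (strip2 eps) x * en (?E n x)))"
   proof (rule nn_integral_mono)
    fix x
    have "C * energy (v n) (H n) x \<le> C * (energy u G x + ?E n x)" by (intro mult_left_mono energy_triangle C)
    then have "en (C * energy (v n) (H n) x) \<le> en (C * (energy u G x + ?E n x))" by (rule ennreal_leI)
    also have "\<dots> = en C * (en (energy u G x) + en (?E n x))"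
     using C(1) energy_nonneg by (simp add: ennreal_mult)
    finally show "ind (strip2 eps) x * en (C * energy (v n) (H n) x)
      \<le> en C * (ind (strip2 eps) x * en (energy u G x) + ind (strip2 eps) x * en (?E n x))"
     by (auto simp: indicator_def)
   qed
   also have "\<dots> = en C * (?Q + (NN x. ind (strip2 eps) x * en (?E n x)))"
    using Em Ediff by (simp add: nn_integral_cmult nn_integral_add)
   also have "\<dots> \<le> en C * (?Q + en (\<delta> n))" by (intro mult_left_mono add_left_mono Eint strip2_sub) auto
   finally show ?thesis .
  qed
  finally have 1: "(NN x. ind (strip eps) x * en \<bar>?w x\<bar>) \<le>
    en \<kappa> * emeasure lborel (strip eps) + en (1 / \<kappa>) * (en L * (en ?K * S n))
    + en (len eps) * (en C * (?Q + en (\<delta> n)))" by (simp add: add_mono mult_left_mono)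
  have sc: "x \<in> cball x0 (2 * R)" if "x \<in> strip eps" for x using that R by (auto simp: strip_def)
  have "(NN x. ind (strip eps) x * en \<bar>normal_comp u x\<bar>)
   \<le> (NN x. ind (strip eps) x * en \<bar>f x\<bar> + en (2 * norm a) * (ind (strip eps) x * en (?E n x)))"
  proof (rule nn_integral_mono)
   fix x
   show "ind (strip eps) x * en \<bar>normal_comp u x\<bar>
    \<le> ind (strip eps) x * en \<bar>f x\<bar> + en (2 * norm a) * (ind (strip eps) x * en (?E n x))"
   proof (cases "x \<in> strip eps")
    case True
    have diff: "normal_comp (\<lambda>i z. v n i z - u i z) x = f x - normal_comp u x"
     using sc[OF True] by (simp add: normal_comp_def f_def right_diff_distrib sum_subtractf)
    have "\<bar>normal_comp u x\<bar> \<le> \<bar>f x\<bar> + \<bar>f x - normal_comp u x\<bar>" by linarith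
    also have "\<bar>f x - normal_comp u x\<bar> \<le> 2 * norm a * (\<Sum>i\<in>UNIV. \<bar>v n i x - u i x\<bar>)"
     unfolding diff[symmetric] by (rule normal_comp_bound[OF sc[OF True]])
    also have "\<dots> \<le> 2 * norm a * ?E n x"
     unfolding energy_def by (intro mult_left_mono sum_mono) (auto intro!: sum_nonneg)
    finally have "en \<bar>normal_comp u x\<bar> \<le> en (\<bar>f x\<bar> + 2 * norm a * ?E n x)" by (simp add: ennreal_leI)
    also have "\<dots> = en \<bar>f x\<bar> + en (2 * norm a) * en (?E n x)"
     using energy_nonneg by (simp add: ennreal_mult' mult_nonneg_nonneg)
    finally show ?thesis using True by simp
   qed simp
  qed
  also have "\<dots> = (NN x. ind (strip eps) x * en \<bar>f x\<bar>) + en (2 * norm a) * (NN x. ind (strip eps) x * en (?E n x))"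
   using Ediff by (subst nn_integral_add) (auto simp: nn_integral_cmult)
  also have "(NN x. ind (strip eps) x * en \<bar>f x\<bar>) = (NN x. ind (strip eps) x * en \<bar>?w x\<bar>)"
  proof (rule nn_integral_cong)
   fix x
   show "ind (strip eps) x * en \<bar>f x\<bar> = ind (strip eps) x * en \<bar>?w x\<bar>"
    using sc[of x] by (cases "x \<in> strip eps") (auto simp: f_def)
  qed
  also have "\<dots> + en (2 * norm a) * (NN x. ind (strip eps) x * en (?E n x))
    \<le> (en \<kappa> * emeasure lborel (strip eps) + en (1 / \<kappa>) * (en L * (en ?K * S n))
    + en (len eps) * (en C * (?Q + en (\<delta> n)))) + en (2 * norm a) * en (\<delta> n)"
   using strip_sub strip2_sub by (intro add_mono 1 mult_left_mono Eint) auto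
  finally show ?thesis by (simp add: add.assoc)
 qed
 have Ed: "(\<lambda>n. en (\<delta> n)) ----> 0" using tendsto_ennrealI[OF \<delta>0] by simp
 have S0: "S ----> 0" using l3 by (simp add: S_def[abs_def])
 have c0: "(\<lambda>n. en c * f n) ----> 0" if "f ----> 0" for c :: real and f :: "nat => ennreal"
  using ennreal_tendsto_cmult[OF _ that, of "en c"] by simp
 have step: "(NN x. ind (strip eps) x * en \<bar>normal_comp u x\<bar>)
   \<le> en \<kappa> * emeasure lborel (strip eps) + en (len eps) * (en C * ?Q)" if \<kappa>: "\<kappa> > 0" for \<kappa>
 proof -
  have cQ: "(\<lambda>n. en (len eps) * (en C * (?Q + en (\<delta> n)))) ----> en (len eps) * (en C * ?Q)"
   unfolding distrib_left
   using tendsto_add[OF tendsto_const c0[OF c0[OF Ed]], of "en (len eps) * (en C * ?Q)" "len eps" C] by simp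
  have "(\<lambda>n. (en \<kappa> * emeasure lborel (strip eps) + en (1 / \<kappa>) * (en L * (en ?K * S n)))
    + (en (len eps) * (en C * (?Q + en (\<delta> n))) + en (2 * norm a) * en (\<delta> n)))
    ----> (en \<kappa> * emeasure lborel (strip eps) + 0) + (en (len eps) * (en C * ?Q) + 0)"
   by (intro tendsto_add tendsto_const cQ c0 S0 Ed)
  from LIMSEQ_le_const[OF this] show ?thesis using main[OF \<kappa>] by simp
 qed
 obtain V where V: "emeasure lborel (strip eps) = en V" "V \<ge> 0"
  using strip_finite[of eps] by (cases "emeasure lborel (strip eps)") auto
 have "(NN x. ind (strip eps) x * en \<bar>normal_comp u x\<bar>) \<le> en (len eps) * (en C * ?Q)"
 proof (rule ennreal_le_epsilon)
  fix r :: real assume r: "r > 0"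
  have "en (r / (V + 1)) * en V \<le> en r"
   using V r by (simp add: field_simps flip: ennreal_mult)
  then show "(NN x. ind (strip eps) x * en \<bar>normal_comp u x\<bar>) \<le> en (len eps) * (en C * ?Q) + en r"
  proof -
   have "(NN x. ind (strip eps) x * en \<bar>normal_comp u x\<bar>)
    \<le> en (r / (V + 1)) * en V + en (len eps) * (en C * ?Q)"
    using step[of "r / (V + 1)"] r V by simp
   also have "\<dots> \<le> en r + en (len eps) * (en C * ?Q)"
    by (rule add_right_mono) fact
   finally show ?thesis by (simp only: add.commute)
  qed
 qed
 also have "\<dots> = en (C * len eps) * ?Q"
  using C(1) len0[OF eps] by (simp add: ennreal_mult mult_ac)
 finally show ?thesis .
qed

text \<open>The length of the segments is of the order of eps, so that after division by eps there remains the
W^{1,1} norm of u on a strip that shrinks to the empty set.\<close>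
lemma flux_limit:
 assumes o: "open X" "bounded X"
  and u: "\<And>i. integ (u i)" and G: "\<And>i j. j \<in> Basis ==> integ (G i j)"
  and tr: "zero_normal_trace X u G"
  and eps: "\<And>n. eps n > 0" "\<And>n. len (eps n) \<le> R" "eps ----> 0"
 shows "(\<lambda>n. en (1 / eps n) * (NN x. ind (strip (eps n)) x * en \<bar>normal_comp u x\<bar>)) ----> 0"
proof -
 obtain C where C: "C \<ge> 0" "\<And>v. (\<And>i. smooth_on UNIV (v i)) ==>
   \<exists>w'. (\<forall>z\<in>U. ((\<lambda>s. normal_comp v (z + s *\<^sub>R e)) has_real_derivative w' z) (at 0)) \<and> continuous_on U w' \<and>
    (\<forall>z\<in>cball x0 (2 * R). \<bar>w' z\<bar> \<le> C * energy v (\<lambda>i j z. fder (v i) z j) z)"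
 proof -
  show thesis
  proof (rule normal_field_constant)
   fix C assume "C \<ge> 0" and *: "\<And>v. (\<And>i. smooth_on UNIV (v i)) ==>
    \<exists>w'. (\<forall>z\<in>U. ((\<lambda>s. normal_comp v (z + s *\<^sub>R e)) has_real_derivative w' z) (at 0)) \<and> continuous_on U w' \<and>
    (\<forall>z\<in>cball x0 (2 * R). \<bar>w' z\<bar> \<le> C * (\<Sum>i\<in>UNIV. \<bar>v i z\<bar> + (\<Sum>j\<in>Basis. \<bar>fder (v i) z j\<bar>)))"
   show thesis by (rule that[OF \<open>C \<ge> 0\<close>]) (unfold energy_def, rule *)
  qed
 qed
 note flux = flux_through_strip[OF eps(1,2) o C u G tr]
 have Ei: "integ (energy u G)"
  unfolding energy_def [abs_def]
  by (intro Bintegrable_sum Bintegrable_add integrable_abs u G)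
 define Q where "Q n = (NN x. ind (strip2 (eps n)) x * en (energy u G x))" for n
 have Qe: "Q n = en (LL x. ind (strip2 (eps n)) x * energy u G x)" for n
 proof -
  have "Q n = (NN x. en (ind (strip2 (eps n)) x * energy u G x))"
   unfolding Q_def by (intro nn_integral_cong) (auto simp: indicator_def)
  also have "\<dots> = en (LL x. ind (strip2 (eps n)) x * energy u G x)"
   using integrable_bounded_mult[OF Ei, of "ind (strip2 (eps n))" 1] strip2_borel energy_nonneg
   by (intro nn_integral_eq_integral) auto
  finally show ?thesis .
 qed
 have "(\<lambda>n. LL x. ind (strip2 (eps n)) x * energy u G x) ----> (LINT x|(lborel::(real^3) measure). (0::real))"
 proof (rule integral_dominated_convergence[where w="energy u G"])
  show "AE x in lborel. norm (ind (strip2 (eps n)) x * energy u G x) \<le> energy u G x" for n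
   using energy_nonneg by (auto simp: indicator_def intro!: AE_I2)
  show "AE x in lborel. (\<lambda>n. ind (strip2 (eps n)) x * energy u G x) ----> 0"
  proof (intro AE_I2 tendsto_eventually)
   fix x
   show "\<forall>\<^sub>F n in sequentially. ind (strip2 (eps n)) x * energy u G x = 0"
   proof (cases "d x < 0")
    case True
    have "\<forall>\<^sub>F n in sequentially. eps n < - d x / 3" using eps(3) True by (intro order_tendstoD) auto
    then show ?thesis by eventually_elim (auto simp: strip2_def indicator_def)
   qed (auto simp: strip2_def)
  qed
  show "(\<lambda>x. ind (strip2 (eps n)) x * energy u G x) \<in> bmeas lborel" for n
   using Ei strip2_borel by auto
 qed (use Ei in auto)
 then have "(\<lambda>n. en (4 * C / m * (LL x. ind (strip2 (eps n)) x * energy u G x))) ----> en (4 * C / m * 0)"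
  by (intro tendsto_ennrealI tendsto_mult tendsto_const) simp
 then have lim: "(\<lambda>n. en (4 * C / m * (LL x. ind (strip2 (eps n)) x * energy u G x))) ----> 0"
  by simp
 have le: "en (1 / eps n) * (NN x. ind (strip (eps n)) x * en \<bar>normal_comp u x\<bar>)
   \<le> en (4 * C / m * (LL x. ind (strip2 (eps n)) x * energy u G x))" for n
 proof -
  let ?L = "LL x. ind (strip2 (eps n)) x * energy u G x"
  have L0: "0 \<le> ?L"
   using energy_nonneg by (intro Bintegral_nonneg) auto
  have l0: "0 \<le> C * len (eps n)" using C(1) len0[OF eps(1,2), of n] by simp
  have "en (1 / eps n) * (en (C * len (eps n)) * Q n) = en (1 / eps n) * en (C * len (eps n) * ?L)"
   unfolding Qe by (simp only: ennreal_mult[OF l0 L0])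
  also have "\<dots> = en (1 / eps n * (C * len (eps n) * ?L))"
   using eps(1)[of n] by (intro ennreal_mult[symmetric] mult_nonneg_nonneg[OF l0 L0]) simp
  also have "1 / eps n * (C * len (eps n) * ?L) = 4 * C / m * ?L"
   using eps(1)[of n] by (simp add: len_def)
  finally have "en (1 / eps n) * (en (C * len (eps n)) * Q n) = en (4 * C / m * ?L)" .
  then show ?thesis using mult_left_mono[OF flux[of n], of "en (1 / eps n)"] by (simp add: Q_def)
 qed
 show ?thesis
  by (rule tendsto_sandwich[OF _ always_eventually[OF allI[OF le]] tendsto_const lim]) simp
qed

end

lemma deriv_smooth_step_bound:
 obtains B where "B \<ge> 0" "\<And>x. \<bar>deriv smooth_step x\<bar> \<le> B" "\<And>x. x < 0 \<or> x > 1 ==> deriv smooth_step x = 0"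
proof -
 have z: "deriv smooth_step x = 0" if "x < 0 \<or> x > 1" for x
 proof (cases "x < 0")
  case True
  have "(smooth_step has_real_derivative 0) (at x)"
   by (rule has_field_derivative_transform_within_open[where f="\<lambda>_. 0" and S="{..<0}"])
    (use True smooth_step_0 in auto)
  then show ?thesis by (rule DERIV_imp_deriv)
 next
  case False
  have "(smooth_step has_real_derivative 0) (at x)"
   by (rule has_field_derivative_transform_within_open[where f="\<lambda>_. 1" and S="{1<..}"])
    (use False that smooth_step_1 in auto)
  then show ?thesis by (rule DERIV_imp_deriv)
 qed
 have "compact (deriv smooth_step ` {0..1})"
  by (rule compact_continuous_image[OF continuous_on_subset[OF deriv_smooth_step_cont]]) auto
 then obtain B where B: "B > 0" "\<And>y. y \<in> deriv smooth_step ` {0..1} ==> norm y \<le> B"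
  using compact_imp_bounded bounded_pos by metis
 have "\<bar>deriv smooth_step x\<bar> \<le> B" for x
  using B z[of x] by (cases "x < 0 \<or> x > 1") auto
 then show ?thesis using that[of B] B(1) z by auto
qed

section \<open>The divergence theorem for fields tangent to the boundary\<close>

text \<open>The integral of div (chi' F) over the domain, if Gd i is the derivative of F i in direction
i.\<close>
definition flux_pairing :: "(real^3) set => (3 => real^3 => real) => (3 => real^3 => real) => (real^3 => real) => real" where
 "flux_pairing X F Gd \<chi>' = (LL x. ind X x *
   (\<chi>' x * (\<Sum>i\<in>UNIV. Gd i x) + (\<Sum>i\<in>UNIV. fder \<chi>' x (axis i 1) * F i x)))"

lemma flux_pairing_interior:
 assumes wd: "\<And>i. wd X (axis i 1) (F i) (Gd i)" and t: "test_function X \<phi>"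
 shows "flux_pairing X F Gd \<phi> = 0"
proof -
 have "ind X x * (\<phi> x * (\<Sum>i\<in>UNIV. Gd i x) + (\<Sum>i\<in>UNIV. fder \<phi> x (axis i 1) * F i x))
   = (\<Sum>i\<in>UNIV. \<phi> x * Gd i x + fder \<phi> x (axis i 1) * F i x)" for x
  using test_functionD(4)[OF t, of x] test_functionD(4)[OF test_function_directional_deriv[OF t], of x]
  by (auto simp: indicator_def sum.distrib sum_distrib_left)
 then have "flux_pairing X F Gd \<phi> = (LL x. (\<Sum>i\<in>UNIV. \<phi> x * Gd i x + fder \<phi> x (axis i 1) * F i x))"
  unfolding flux_pairing_def by (simp only:)
 also have "\<dots> = (\<Sum>i\<in>UNIV. (LL x. \<phi> x * Gd i x) + (LL x. fder \<phi> x (axis i 1) * F i x))"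
  using test_mult_integrable[OF t wdD(2)[OF wd]] test_mult_integrable[OF test_function_directional_deriv[OF t] wdD(1)[OF wd]]
  by (subst Bintegral_sum) auto
 also have "\<dots> = 0" using wdD(3)[OF wd t] by simp
 finally show ?thesis .
qed

context chart
begin

text \<open>Multiply phi by a cutoff zeta n that vanishes for d \<ge> - eps n and is 1 for d \<le> - 2 eps n.
The product is a test function of the domain, so its pairing vanishes; it differs from the pairing with zeta n
times the integrand by a term that contains the derivative of the cutoff, is bounded by 1 / eps n times the
normal component of u in the strip, and so tends to zero.\<close>
lemma flux_pairing_boundary:
 assumes o: "open X" "bounded X"
  and u: "\<And>i. integ (u i)" and G: "\<And>i j. j \<in> Basis ==> integ (G i j)"
  and tr: "zero_normal_trace X u G"
  and wd: "\<And>i. wd X (axis i 1) (F i) (Gd i)"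
  and F: "\<And>i x. F i x = h x * u i x" and hM: "\<And>x. \<bar>h x\<bar> \<le> M"
  and \<phi>: "smooth_on UNIV \<phi>" and K: "compact K" "K \<subseteq> ball x0 R" "\<And>x. x \<notin> K ==> \<phi> x = 0"
 shows "flux_pairing X F Gd \<phi> = 0"
proof -
 have M0: "M \<ge> 0" using hM[of undefined] by linarith
 have KU: "K \<subseteq> U"
 proof
  fix x assume "x \<in> K"
  then have "x \<in> ball x0 R" using K by blast
  then have "x \<in> cball x0 (2 * R)" using R by auto
  then show "x \<in> U" using sub by blast
 qed
 have t\<phi>: "test_function UNIV \<phi>" unfolding test_function_def using \<phi> K by blast
 obtain B\<phi> where B\<phi>: "B\<phi> > 0" "\<And>x. \<bar>\<phi> x\<bar> \<le> B\<phi>" using test_function_bounded[OF t\<phi>] by blast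
 obtain BS where BS: "BS \<ge> 0" "\<And>x. \<bar>deriv smooth_step x\<bar> \<le> BS" "\<And>x. x < 0 \<or> x > 1 ==> deriv smooth_step x = 0"
  using deriv_smooth_step_bound by metis
 \<comment> \<open>The factor makes the segments at most R long, as the chart requires.\<close>
 define eps where "eps n = (m * R / 4) * inverse (real (Suc n))" for n
 have eps: "eps n > 0" "len (eps n) \<le> R" for n
 proof -
  show "eps n > 0" using m R by (simp add: eps_def)
  have "len (eps n) = R * inverse (real (Suc n))" using m by (simp add: len_def eps_def)
  also have "\<dots> \<le> R * 1" using R by (intro mult_left_mono) (auto simp: field_simps)
  finally show "len (eps n) \<le> R" by simp
 qed
 have eps0: "eps ----> 0" unfolding eps_def by (rule tendsto_mult_right_zero[OF LIMSEQ_inverse_real_of_nat])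
 define \<zeta> where "\<zeta> n x = (if x \<in> U then smooth_step (- (1 / eps n) * d x - 1) else 0)" for n x
 define \<theta> where "\<theta> n x = \<phi> x * \<zeta> n x" for n x
 define S' where "S' n x = deriv smooth_step (- (1 / eps n) * d x - 1)" for n x
 have \<zeta>01: "0 \<le> \<zeta> n x" "\<zeta> n x \<le> 1" for n x using smooth_step_bounds by (auto simp: \<zeta>_def)
 have \<zeta>pos: "x \<in> U \<and> d x \<le> - eps n" if "\<zeta> n x \<noteq> 0" for n x
 proof -
  have xU: "x \<in> U" using that by (auto simp: \<zeta>_def split: if_splits)
  have "\<not> - (1 / eps n) * d x - 1 \<le> 0" using that smooth_step_0 xU by (auto simp: \<zeta>_def)
  then have "1 < - d x / eps n" by simp
  then have "eps n < - d x" using eps(1)[of n] by (simp add: field_simps)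
  then show ?thesis using xU by simp
 qed
 have tt: "test_function X (\<theta> n)" for n
  unfolding test_function_def
 proof (intro conjI exI[of _ "{x \<in> K. d x \<le> - eps n}"] allI impI)
  have "smooth_on U (\<lambda>x. - (1 / eps n) * d x - 1)"
   by (intro smooth_on_diff smooth_on_mult smooth_on_const U)
  then have "smooth_on U (\<lambda>x. smooth_step (- (1 / eps n) * d x - 1))"
   by (rule smooth_on_compose[OF U(1) open_UNIV _ smooth_on_smooth_step]) simp
  then have "smooth_on U (\<zeta> n)" by (rule smooth_on_cong[OF U(1)]) (simp add: \<zeta>_def)
  then have 1: "smooth_on U (\<theta> n)" unfolding \<theta>_def
   by (intro smooth_on_mult[OF U(1) smooth_on_subset[OF \<phi> subset_UNIV]])
  have "open (- K)" using K compact_imp_closed by blast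
  then have 2: "smooth_on (- K) (\<theta> n)"
   by (rule smooth_on_cong[OF _ smooth_on_const[of _ 0]]) (simp add: \<theta>_def K)
  have "U \<union> - K = UNIV" using KU by blast
  then show "smooth_on UNIV (\<theta> n)" using smooth_on_Un[OF U(1) \<open>open (- K)\<close> 1 2] by simp
  have "closed (K \<inter> d -` {.. - eps n})"
   using continuous_closed_preimage[OF continuous_on_subset[OF d_cont KU] compact_imp_closed[OF K(1)] closed_atMost] .
  then have "compact (K \<inter> d -` {.. - eps n})" using K(1) by (meson compact_Int_closed compact_eq_bounded_closed bounded_subset inf_le1)
  moreover have "K \<inter> d -` {.. - eps n} = {x \<in> K. d x \<le> - eps n}" by auto
  ultimately show "compact {x \<in> K. d x \<le> - eps n}" by simp
  show "{x \<in> K. d x \<le> - eps n} \<subseteq> X"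
  proof
   fix x assume "x \<in> {x \<in> K. d x \<le> - eps n}"
   then have "x \<in> {y \<in> U. d y < 0}" using KU eps(1)[of n] by auto
   then show "x \<in> X" unfolding U(4)[symmetric] by simp
  qed
  show "\<theta> n x = 0" if "x \<notin> {x \<in> K. d x \<le> - eps n}" for x
   using that \<zeta>pos[of n x] K(3)[of x] by (auto simp: \<theta>_def)
 qed
 have der: "fder (\<theta> n) x (axis i 1)
   = \<zeta> n x * fder \<phi> x (axis i 1) - (1 / eps n) * \<phi> x * S' n x * gradient d x $ i" for n x i
 proof (cases "x \<in> U")
  case True
  have D1: "((\<lambda>x. - (1 / eps n) * d x - 1) has_derivative (\<lambda>v. - (1 / eps n) * (gradient d x \<bullet> v))) (at x)"
   using gradient_derivative[OF U(1,3) True] eps(1)[of n] by (auto intro!: derivative_eq_intros)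
  have D2: "((\<lambda>x. smooth_step (- (1 / eps n) * d x - 1)) has_derivative (\<lambda>v. S' n x * (- (1 / eps n) * (gradient d x \<bullet> v)))) (at x)"
   unfolding S'_def
   by (rule has_derivative_compose[OF D1 smooth_step_has_derivative[unfolded has_field_derivative_def]])
  have D3: "((\<lambda>x. \<phi> x * smooth_step (- (1 / eps n) * d x - 1)) has_derivative
    (\<lambda>v. \<phi> x * (S' n x * (- (1 / eps n) * (gradient d x \<bullet> v))) + fder \<phi> x v * smooth_step (- (1 / eps n) * d x - 1))) (at x)"
   by (rule has_derivative_mult[OF smooth_onD[OF open_UNIV \<phi> UNIV_I] D2])
  have "(\<theta> n has_derivative
    (\<lambda>v. \<phi> x * (S' n x * (- (1 / eps n) * (gradient d x \<bullet> v))) + fder \<phi> x v * smooth_step (- (1 / eps n) * d x - 1))) (at x)"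
   by (rule has_derivative_transform_within_open[OF D3 U(1) True]) (simp add: \<theta>_def \<zeta>_def)
  from frechet_derivative_at[OF this, symmetric] show ?thesis
   using True by (simp add: \<zeta>_def inner_axis algebra_simps)
 next
  case False
  then have "x \<notin> K" using KU by blast
  have "fder (\<theta> n) x = (\<lambda>h. 0)" "fder \<phi> x = (\<lambda>h. 0)"
   by (rule frechet_derivative_zero_outside[of K]; use K compact_imp_closed \<open>x \<notin> K\<close> in \<open>auto simp: \<theta>_def\<close>)+
  then show ?thesis using K(3)[OF \<open>x \<notin> K\<close>] by simp
 qed
 define A where "A x = \<phi> x * (\<Sum>i\<in>UNIV. Gd i x) + (\<Sum>i\<in>UNIV. fder \<phi> x (axis i 1) * F i x)" for x
 define T where "T n x = (\<Sum>i\<in>UNIV. fder (\<theta> n) x (axis i 1) * F i x + \<theta> n x * Gd i x)" for n x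
 note iGd = wdD(2)[OF wd] and iF = wdD(1)[OF wd]
 have Ai: "integ A"
 proof -
  have "integ (\<lambda>x. \<Sum>i\<in>UNIV. \<phi> x * Gd i x + fder \<phi> x (axis i 1) * F i x)"
   by (intro Bintegrable_sum Bintegrable_add test_mult_integrable[OF t\<phi> iGd]
     test_mult_integrable[OF test_function_directional_deriv[OF t\<phi>] iF])
  moreover have "(\<Sum>i\<in>UNIV. \<phi> x * Gd i x + fder \<phi> x (axis i 1) * F i x) = A x" for x
   by (simp add: A_def sum.distrib sum_distrib_left)
  ultimately show ?thesis by (simp add: fun_eq_iff[symmetric])
 qed
 have Ti: "integ (T n)" for n
  unfolding T_def [abs_def]
  by (intro Bintegrable_sum Bintegrable_add test_mult_integrable[OF tt iGd]
     test_mult_integrable[OF test_function_directional_deriv[OF tt] iF])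
 have T0: "(LL x. T n x) = 0" for n
 proof -
  have "(LL x. T n x) = (\<Sum>i\<in>UNIV. (LL x. fder (\<theta> n) x (axis i 1) * F i x) + (LL x. \<theta> n x * Gd i x))"
   unfolding T_def
   using test_mult_integrable[OF tt iGd] test_mult_integrable[OF test_function_directional_deriv[OF tt] iF]
   by (subst Bintegral_sum) auto
  then show ?thesis using wdD(3)[OF wd tt] by simp
 qed
 have Tsplit: "T n x = \<zeta> n x * A x - (1 / eps n) * \<phi> x * S' n x * h x * normal_comp u x" for n x
 proof -
  have "T n x = (\<Sum>i\<in>UNIV. \<zeta> n x * (\<phi> x * Gd i x + fder \<phi> x (axis i 1) * F i x)
    - ((1 / eps n) * \<phi> x * S' n x * h x) * (gradient d x $ i * u i x))"
   unfolding T_def der by (intro sum.cong refl) (simp add: \<theta>_def F algebra_simps)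
  also have "\<dots> = \<zeta> n x * A x - (1 / eps n) * \<phi> x * S' n x * h x * normal_comp u x"
   by (simp add: sum_subtractf sum.distrib sum_distrib_left A_def normal_comp_def distrib_left)
  finally show ?thesis .
 qed
 have \<zeta>m: "\<zeta> n \<in> bmeas borel" for n
 proof -
  have "(\<lambda>x. ind U x *\<^sub>R smooth_step (- (1 / eps n) * d x - 1)) \<in> bmeas borel"
  proof (rule borel_measurable_continuous_on_indicator)
   show "continuous_on U (\<lambda>x. smooth_step (- (1 / eps n) * d x - 1))"
    by (rule continuous_on_compose2[OF smooth_on_continuous[OF smooth_on_smooth_step]])
     (use eps(1)[of n] in \<open>auto intro!: continuous_intros d_cont\<close>)
  qed (use U in auto)
  moreover have "ind U x *\<^sub>R smooth_step (- (1 / eps n) * d x - 1) = \<zeta> n x" for x by (simp add: \<zeta>_def)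
  ultimately show ?thesis by (simp add: fun_eq_iff[symmetric])
 qed
 have \<zeta>A: "integ (\<lambda>x. \<zeta> n x * A x)" for n
  using \<zeta>01[of n] by (intro integrable_bounded_mult[OF Ai \<zeta>m, where B=1]) auto
 define Bn where "Bn n x = \<zeta> n x * A x - T n x" for n x
 have Bi: "integ (Bn n)" for n unfolding Bn_def [abs_def] using \<zeta>A Ti by auto
 have \<zeta>int: "(LL x. \<zeta> n x * A x) = (LL x. Bn n x)" for n
  unfolding Bn_def using \<zeta>A[of n] Ti[of n] T0[of n] by simp
 have Bbound: "en \<bar>Bn n x\<bar> \<le> en (B\<phi> * BS * M) * (en (1 / eps n) * (ind (strip (eps n)) x * en \<bar>normal_comp u x\<bar>))" for n x
 proof (cases "x \<in> strip (eps n)")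
  case True
  have "\<bar>Bn n x\<bar> = (\<bar>\<phi> x\<bar> * \<bar>S' n x\<bar> * \<bar>h x\<bar>) * ((1 / eps n) * \<bar>normal_comp u x\<bar>)"
   unfolding Bn_def Tsplit using eps(1)[of n] by (simp add: abs_mult)
  also have "\<dots> \<le> (B\<phi> * BS * M) * ((1 / eps n) * \<bar>normal_comp u x\<bar>)"
   using B\<phi> BS hM M0 eps(1)[of n] by (intro mult_right_mono mult_mono) (auto simp: S'_def)
  finally have "en \<bar>Bn n x\<bar> \<le> en ((B\<phi> * BS * M) * ((1 / eps n) * \<bar>normal_comp u x\<bar>))" by (rule ennreal_leI)
  also have "\<dots> = en (B\<phi> * BS * M) * (en (1 / eps n) * en \<bar>normal_comp u x\<bar>)"
  proof -
   have p: "0 \<le> B\<phi> * BS * M" "0 \<le> 1 / eps n" "0 \<le> 1 / eps n * \<bar>normal_comp u x\<bar>"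
    using B\<phi>(1) BS(1) M0 eps(1)[of n] by auto
   show ?thesis unfolding ennreal_mult[OF p(1,3)] ennreal_mult[OF p(2) abs_ge_zero] ..
  qed
  finally show ?thesis using True by simp
 next
  case False
  have "\<phi> x * S' n x = 0"
  proof (rule ccontr)
   assume *: "\<phi> x * S' n x \<noteq> 0"
   then have "x \<in> K" using K(3) by fastforce
   have "\<not> (- (1 / eps n) * d x - 1 < 0 \<or> - (1 / eps n) * d x - 1 > 1)" using * BS(3) by (auto simp: S'_def)
   then have "1 \<le> - d x / eps n" "- d x / eps n \<le> 2" by auto
   then have "eps n \<le> - d x" "- d x \<le> 2 * eps n" using eps(1)[of n] by (auto simp: field_simps)
   then have "x \<in> strip (eps n)" unfolding strip_def using \<open>x \<in> K\<close> K(2) eps(1)[of n] by auto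
   then show False using False by blast
  qed
  then have "Bn n x = 0" unfolding Bn_def Tsplit by auto
  then show ?thesis by simp
 qed
 have um[measurable]: "u i \<in> bmeas borel" for i using u[of i] by simp
 have nm: "(\<lambda>x. ind (strip (eps n)) x * en \<bar>normal_comp u x\<bar>) \<in> bmeas borel" for n
 proof -
  have "ind (strip (eps n)) x * en \<bar>normal_comp u x\<bar> = ind (strip (eps n)) x * en \<bar>ind (cball x0 (2 * R)) x * normal_comp u x\<bar>" for x
   using R by (auto simp: indicator_def strip_def)
  moreover have "(\<lambda>x. ind (strip (eps n)) x * en \<bar>ind (cball x0 (2 * R)) x * normal_comp u x\<bar>) \<in> bmeas borel"
  proof -
   note [measurable] = normal_comp_measurable[of u, OF um]
   have [measurable]: "strip (eps n) \<in> sets borel" using strip_open by simp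
   show ?thesis by measurable
  qed
  ultimately show ?thesis by simp
 qed
 have "(\<lambda>n. LL x. Bn n x) ----> 0"
 proof -
  have le: "en \<bar>LL x. Bn n x\<bar> \<le> en (B\<phi> * BS * M) * (en (1 / eps n) * (NN x. ind (strip (eps n)) x * en \<bar>normal_comp u x\<bar>))" for n
  proof -
   have "en \<bar>LL x. Bn n x\<bar> \<le> (NN x. en (B\<phi> * BS * M) * (en (1 / eps n) * (ind (strip (eps n)) x * en \<bar>normal_comp u x\<bar>)))"
    by (rule ennreal_abs_mult_bound[OF _ Bbound]) (use Bi in auto)
   also have "\<dots> = en (B\<phi> * BS * M) * (en (1 / eps n) * (NN x. ind (strip (eps n)) x * en \<bar>normal_comp u x\<bar>))"
    using nm[of n] by (subst nn_integral_cmult, simp, subst nn_integral_cmult) auto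
   finally show ?thesis .
  qed
  have "(\<lambda>n. en (B\<phi> * BS * M) * (en (1 / eps n) * (NN x. ind (strip (eps n)) x * en \<bar>normal_comp u x\<bar>))) ----> en (B\<phi> * BS * M) * 0"
   by (rule ennreal_tendsto_cmult[OF _ flux_limit[OF o u G tr eps eps0]]) simp
  then have "(\<lambda>n. en \<bar>LL x. Bn n x\<bar>) ----> ennreal 0"
   by (intro tendsto_sandwich[OF _ always_eventually[OF allI[OF le]] tendsto_const]) auto
  then have "(\<lambda>n. \<bar>LL x. Bn n x\<bar>) ----> 0"
   by (subst (asm) tendsto_ennreal_iff) auto
  then show ?thesis by (rule tendsto_rabs_zero_cancel)
 qed
 moreover have "(\<lambda>n. LL x. \<zeta> n x * A x) ----> (LL x. ind X x * A x)"
 proof (rule integral_dominated_convergence[where w="\<lambda>x. \<bar>A x\<bar>"])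
  show "integ (\<lambda>x. \<bar>A x\<bar>)" using Ai by simp
  show "AE x in lborel. norm (\<zeta> n x * A x) \<le> \<bar>A x\<bar>" for n
   using \<zeta>01[of n] by (auto simp: abs_mult intro!: AE_I2 mult_left_le_one_le)
  show "AE x in lborel. (\<lambda>n. \<zeta> n x * A x) ----> ind X x * A x"
  proof (intro AE_I2)
   fix x
   show "(\<lambda>n. \<zeta> n x * A x) ----> ind X x * A x"
   proof (cases "x \<in> U")
    case False
    then have "x \<notin> K" using KU by blast
    then have "fder \<phi> x = (\<lambda>h. 0)"
     by (intro frechet_derivative_zero_outside[of K]) (use K compact_imp_closed in auto)
    then have "A x = 0" using K(3)[OF \<open>x \<notin> K\<close>] by (simp add: A_def)
    then show ?thesis by simp
   next
    case True
    show ?thesis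
    proof (cases "d x < 0")
     case dneg: True
     then have xX: "x \<in> X" using True U(4) by blast
     have "\<forall>\<^sub>F n in sequentially. eps n < - d x / 2" using eps0 dneg by (intro order_tendstoD) auto
     then have "\<forall>\<^sub>F n in sequentially. \<zeta> n x * A x = ind X x * A x"
     proof eventually_elim
      case (elim n)
      then have "2 \<le> - d x / eps n" using eps(1)[of n] by (simp add: field_simps)
      then have "\<zeta> n x = 1" using True by (simp add: \<zeta>_def smooth_step_1)
      then show ?case using xX by simp
     qed
     then show ?thesis by (rule tendsto_eventually)
    next
     case dpos: False
     then have "x \<notin> X" using True U(4) by blast
     moreover have "\<zeta> n x = 0" for n using \<zeta>pos[of n x] eps(1)[of n] dpos by force
     ultimately show ?thesis by simp
    qed
   qed
  qed
  show "(\<lambda>x. ind X x * A x) \<in> bmeas lborel" using Ai o by auto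
  show "(\<lambda>x. \<zeta> n x * A x) \<in> bmeas lborel" for n using \<zeta>A by auto
 qed
 ultimately have "(LL x. ind X x * A x) = 0"
  unfolding \<zeta>int by (metis LIMSEQ_unique)
 then show ?thesis by (simp add: flux_pairing_def A_def)
qed

end

text \<open>The pairing with the constant 1 has to vanish. It is not changed when a function Phi is replaced
by (1 - b) Phi, where b is a bump for which the pairing is known to vanish, and after finitely many such steps
Phi is zero on the whole domain. This replaces a partition of unity.\<close>
theorem divergence_theorem_tangent:
 assumes X: "smooth_bounded_domain X"
  and u: "\<And>i. integ (u i)" and G: "\<And>i j. j \<in> Basis ==> integ (G i j)"
  and tr: "zero_normal_trace X u G"
  and wd: "\<And>i. wd X (axis i 1) (F i) (Gd i)"
  and F: "\<And>i x. F i x = h x * u i x" and hM: "\<And>x. \<bar>h x\<bar> \<le> M"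
 shows "(LL x. ind X x * (\<Sum>i\<in>UNIV. Gd i x)) = 0"
proof -
 let ?I = "flux_pairing X F Gd"
 have o: "open X" "bounded X" using X by (auto simp: smooth_bounded_domain_def)
 have loc: "\<exists>b r. r > 0 \<and> smooth_on UNIV b \<and> (\<forall>x\<in>ball z r. b x = 1) \<and> (\<forall>\<eta>. smooth_on UNIV \<eta> --> ?I (\<lambda>x. b x * \<eta> x) = 0)"
  if z: "z \<in> closure X" for z
 proof (cases "z \<in> X")
  case True
  then obtain r where r: "r > 0" "cball z r \<subseteq> X" using o open_contains_cball by blast
  obtain b where b: "smooth_on UNIV b" "\<And>x. x \<in> cball z (r / 2) ==> b x = (1::real)" "\<And>x. x \<notin> cball z (2 * (r / 2)) ==> b x = 0"
   using ball_bump[of "r / 2" z] r by (metis half_gt_zero)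
  have "test_function X b" unfolding test_function_def
   using b r by (intro conjI exI[of _ "cball z r"]) auto
  then have "?I (\<lambda>x. b x * \<eta> x) = 0" if "smooth_on UNIV \<eta>" for \<eta>
   using that by (intro flux_pairing_interior[OF wd] test_function_mult)
  then show ?thesis using b r by (intro exI[of _ b] exI[of _ "r / 2"]) auto
 next
  case False
  then have "z \<in> frontier X" using z o by (simp add: frontier_def interior_open)
  from boundary_chart[OF X this] obtain U d a R where "local_defining_function X z U d" "R > 0" "a \<noteq> 0" "cball z (2 * R) \<subseteq> U"
   "\<And>y. y \<in> cball z (2 * R) ==> norm (gradient d y - a) \<le> norm a / 4" by metis
  then interpret chart X z U d a R by unfold_locales auto
  obtain b where b: "smooth_on UNIV b" "\<And>x. x \<in> cball z (R / 4) ==> b x = (1::real)" "\<And>x. x \<notin> cball z (2 * (R / 4)) ==> b x = 0"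
   using ball_bump[of "R / 4" z] R by (metis divide_pos_pos zero_less_numeral)
  have "?I (\<lambda>x. b x * \<eta> x) = 0" if "smooth_on UNIV \<eta>" for \<eta>
  proof (rule flux_pairing_boundary[OF o u G tr wd F hM])
   show "smooth_on UNIV (\<lambda>x. b x * \<eta> x)" using b that by (intro smooth_on_mult) auto
   show "compact (cball z (R / 2))" "cball z (R / 2) \<subseteq> ball z R" using R by auto
   show "b x * \<eta> x = 0" if "x \<notin> cball z (R / 2)" for x using b(3)[of x] that by simp
  qed
  then show ?thesis using b R by (intro exI[of _ b] exI[of _ "R / 4"]) auto
 qed
 have "\<forall>z\<in>closure X. \<exists>p. snd p > 0 \<and> smooth_on UNIV (fst p) \<and> (\<forall>x\<in>ball z (snd p). fst p x = 1) \<and>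
  (\<forall>\<eta>. smooth_on UNIV \<eta> --> ?I (\<lambda>x. fst p x * \<eta> x) = 0)" (is "\<forall>z\<in>_. \<exists>p. ?P z p")
 proof
  fix z assume "z \<in> closure X"
  from loc[OF this] obtain b r where "r > 0 \<and> smooth_on UNIV b \<and> (\<forall>x\<in>ball z r. b x = 1) \<and> (\<forall>\<eta>. smooth_on UNIV \<eta> --> ?I (\<lambda>x. b x * \<eta> x) = 0)"
   by blast
  then show "\<exists>p. ?P z p" by (intro exI[of _ "(b, r)"]) simp
 qed
 from bchoice[OF this] obtain p where p: "\<forall>z\<in>closure X. ?P z (p z)" by (rule exE)
 define b where "b z = fst (p z)" for z
 define r where "r z = snd (p z)" for z
 have br: "\<And>z. z \<in> closure X ==> r z > 0" "\<And>z. z \<in> closure X ==> smooth_on UNIV (b z)"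
  "\<And>z x. z \<in> closure X ==> x \<in> ball z (r z) ==> b z x = 1"
  "\<And>z \<eta>. z \<in> closure X ==> smooth_on UNIV \<eta> ==> ?I (\<lambda>x. b z x * \<eta> x) = 0"
  using p unfolding b_def r_def by blast+
 have "compact (closure X)" using o by (simp add: compact_closure)
 then obtain S where S: "S \<subseteq> closure X" "finite S" "closure X \<subseteq> (\<Union>z\<in>S. ball z (r z))"
  by (rule compactE_image[of _ "closure X" "\<lambda>z. ball z (r z)"]) (use br(1) in force)+
 have int: "integ (\<lambda>x. ind X x * (f x * v x))" if f: "continuous_on UNIV f" and v: "integ v" for f v :: "real^3 => real"
 proof -
  have "compact (f ` closure X)"
   by (rule compact_continuous_image[OF continuous_on_subset[OF f subset_UNIV] \<open>compact (closure X)\<close>])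
  then obtain B where B: "B > 0" "\<And>y. y \<in> f ` closure X ==> norm y \<le> B" using compact_imp_bounded bounded_pos by metis
  have [measurable]: "f \<in> bmeas borel" "X \<in> sets borel" using f o by (auto intro: borel_measurable_continuous_onI)
  have "\<bar>ind X x * f x\<bar> \<le> B" for x using B closure_subset[of X] by (auto simp: indicator_def)
  then have "integ (\<lambda>x. (ind X x * f x) * v x)" by (intro integrable_bounded_mult[OF v]) auto
  then show ?thesis by (simp add: mult.assoc)
 qed
 have step: "?I (\<lambda>x. \<Phi> x - b z x * \<Phi> x) = ?I \<Phi>" if \<Phi>: "smooth_on UNIV \<Phi>" and z: "z \<in> closure X" for \<Phi> z
 proof -
  let ?D = "\<lambda>\<phi> x. ind X x * (\<phi> x * (\<Sum>i\<in>UNIV. Gd i x) + (\<Sum>i\<in>UNIV. fder \<phi> x (axis i 1) * F i x))"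
  have Di: "integ (?D \<phi>)" if \<phi>: "smooth_on UNIV \<phi>" for \<phi>
  proof -
   have ax: "axis i (1::real) \<in> Basis" for i :: 3 by (simp add: axis_in_Basis_iff)
   have "integ (\<lambda>x. (\<Sum>i\<in>UNIV. ind X x * (\<phi> x * Gd i x)) + (\<Sum>i\<in>UNIV. ind X x * (fder \<phi> x (axis i 1) * F i x)))"
    by (intro Bintegrable_add Bintegrable_sum int smooth_on_continuous[OF \<phi>]
     smooth_on_continuous[OF smooth_on_deriv[OF \<phi> ax]] wdD(1)[OF wd] wdD(2)[OF wd])
   then show ?thesis by (simp add: sum_distrib_left distrib_left)
  qed
  have b\<Phi>: "smooth_on UNIV (\<lambda>x. b z x * \<Phi> x)" by (intro smooth_on_mult br(2)[OF z] \<Phi>) simp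
  have E: "fder (\<lambda>x. \<Phi> x - b z x * \<Phi> x) x = (\<lambda>v. fder \<Phi> x v - fder (\<lambda>x. b z x * \<Phi> x) x v)" for x
   by (rule frechet_derivative_at[symmetric, OF has_derivative_diff[OF smooth_onD[OF open_UNIV \<Phi> UNIV_I] smooth_onD[OF open_UNIV b\<Phi> UNIV_I]]])
  have alg: "w * ((p - q) * c + (p' - q')) = w * (p * c + p') - w * (q * c + q')" for w p q c p' q' :: real
   by (simp add: algebra_simps)
  have "?D (\<lambda>x. \<Phi> x - b z x * \<Phi> x) x = ?D \<Phi> x - ?D (\<lambda>x. b z x * \<Phi> x) x" for x
   unfolding E left_diff_distrib sum_subtractf
   unfolding left_diff_distrib[symmetric] by (rule alg)
  then have "?I (\<lambda>x. \<Phi> x - b z x * \<Phi> x) = (LL x. ?D \<Phi> x - ?D (\<lambda>x. b z x * \<Phi> x) x)"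
   unfolding flux_pairing_def by (simp only:)
  also have "\<dots> = ?I \<Phi> - ?I (\<lambda>x. b z x * \<Phi> x)"
   unfolding flux_pairing_def by (rule Bintegral_diff[OF Di[OF \<Phi>] Di[OF b\<Phi>]])
  finally show ?thesis using br(4)[OF z \<Phi>] by simp
 qed
 have "\<exists>\<Phi>. smooth_on UNIV \<Phi> \<and> ?I \<Phi> = ?I (\<lambda>_. 1) \<and> (\<forall>x\<in>(\<Union>z\<in>S. ball z (r z)). \<Phi> x = 0)"
  using S(2,1)
 proof induction
  case empty
  show ?case by (rule exI[of _ "\<lambda>_. 1"]) (simp add: smooth_on_const)
 next
  case (insert z S)
  then obtain \<Phi> where \<Phi>: "smooth_on UNIV \<Phi>" "?I \<Phi> = ?I (\<lambda>_. 1)" "\<forall>x\<in>(\<Union>z\<in>S. ball z (r z)). \<Phi> x = 0" by auto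
  have z: "z \<in> closure X" using insert by simp
  have "smooth_on UNIV (\<lambda>x. \<Phi> x - b z x * \<Phi> x)" by (intro smooth_on_diff smooth_on_mult \<Phi> br(2)[OF z]) auto
  moreover have "?I (\<lambda>x. \<Phi> x - b z x * \<Phi> x) = ?I (\<lambda>_. 1)" using step[OF \<Phi>(1) z] \<Phi>(2) by simp
  moreover have "\<forall>x\<in>(\<Union>z\<in>insert z S. ball z (r z)). \<Phi> x - b z x * \<Phi> x = 0" using \<Phi>(3) br(3)[OF z] by auto
  ultimately show ?case by blast
 qed
 then obtain \<Phi> where \<Phi>: "smooth_on UNIV \<Phi>" "?I \<Phi> = ?I (\<lambda>_. 1)" "\<And>x. x \<in> (\<Union>z\<in>S. ball z (r z)) ==> \<Phi> x = 0" by blast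
 have "?I \<Phi> = (LINT x|(lborel::(real^3) measure). (0::real))"
  unfolding flux_pairing_def
 proof (rule Bintegral_cong[OF refl])
  fix x :: "real^3"
  show "ind X x * (\<Phi> x * (\<Sum>i\<in>UNIV. Gd i x) + (\<Sum>i\<in>UNIV. fder \<Phi> x (axis i 1) * F i x)) = 0"
  proof (cases "x \<in> X")
   case True
   then have x: "x \<in> (\<Union>z\<in>S. ball z (r z))" using S(3) closure_subset by blast
   have "fder \<Phi> x = (\<lambda>h. 0)"
    by (rule frechet_derivative_zero_outside[of "- (\<Union>z\<in>S. ball z (r z))"]) (use \<Phi>(3) x in auto)
   then show ?thesis using \<Phi>(3)[OF x] by simp
  qed simp
 qed
 then have "?I (\<lambda>_. 1) = 0" using \<Phi>(2) by simp
 then show ?thesis by (simp add: flux_pairing_def)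
qed

section \<open>Borel representatives\<close>

lemma AE_lebesgue_on_iff:
 fixes X :: "'a::euclidean_space set"
 assumes "X \<in> sets borel"
 shows "(AE x in leb X. P x) \<longleftrightarrow> (AE x in lborel. x \<in> X --> P x)"
proof -
 have "X \<inter> space lebesgue \<in> sets lebesgue" using assms by simp
 then show ?thesis by (simp add: AE_restrict_space_iff AE_completion_iff)
qed

text \<open>A Borel function on the whole space that vanishes outside and agrees with f almost everywhere on
the domain. It makes the results for \<open>wd\<close> available for classes of functions that are only
Lebesgue measurable on the domain.\<close>
definition represents :: "'a::euclidean_space set => ('a => real) => ('a => real) => bool" where
 "represents X f' f \<longleftrightarrow> f' \<in> bmeas borel \<and> (\<forall>x. x \<notin> X --> f' x = 0) \<and>
   (AE x in lborel. x \<in> X --> f' x = f x)"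

lemma represents_exists:
 fixes f :: "'a::euclidean_space => real"
 assumes X: "X \<in> sets borel" and f: "f \<in> bmeas (leb X)"
 shows "\<exists>f'. represents X f' f"
proof -
 have "(\<lambda>x. if x \<in> X then f x else 0) \<in> bmeas lebesgue"
  using X f by (simp add: borel_measurable_if)
 from completion_ex_borel_measurable_real[OF this] obtain g where g: "g \<in> bmeas borel"
  "AE x in lborel. (if x \<in> X then f x else 0) = g x" by auto
 have "represents X (\<lambda>x. ind X x * g x) f"
  unfolding represents_def using g X by (auto elim!: eventually_mono)
 then show ?thesis by blast
qed

lemma represents_integral:
 fixes f :: "'a::euclidean_space => real"
 assumes X: "X \<in> sets borel" and f: "f \<in> bmeas (leb X)" and r: "represents X f' f"
 shows "integrable (leb X) f \<longleftrightarrow> integ f'"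
  "(LINT x|leb X. f x) = (LL x. f' x)"
proof -
 have X': "X \<inter> space lebesgue \<in> sets lebesgue" using X by simp
 have m: "(\<lambda>x. ind X x *\<^sub>R f x) \<in> bmeas lebesgue"
  using borel_measurable_restrict_space_iff[OF X', of f] f by simp
 have f'm: "f' \<in> bmeas lborel" using r by (simp add: represents_def)
 have m': "f' \<in> bmeas lebesgue" using f'm by (rule measurable_completion)
 have "AE x in lborel. ind X x *\<^sub>R f x = f' x"
  using r unfolding represents_def by (auto elim!: eventually_mono simp: indicator_def)
 then have ae: "AE x in lebesgue. ind X x *\<^sub>R f x = f' x" by (rule AE_completion)
 show "integrable (leb X) f \<longleftrightarrow> integ f'"
  unfolding integrable_restrict_space[OF X']
  using integrable_cong_AE[OF m m' ae] integrable_completion[OF f'm] by simp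
 show "(LINT x|leb X. f x) = (LL x. f' x)"
  unfolding integral_restrict_space[OF X']
  using integral_cong_AE[OF m m' ae] integral_completion[OF f'm] by simp
qed

lemma represents_mult:
 assumes "represents X f' f" "\<phi> \<in> bmeas borel"
 shows "represents X (\<lambda>x. \<phi> x * f' x) (\<lambda>x. \<phi> x * f x)"
 using assms unfolding represents_def by (auto elim!: eventually_mono)

lemma borel_imp_lebesgue_on:
 fixes f :: "'a::euclidean_space => 'b::euclidean_space"
 assumes "f \<in> bmeas borel" shows "f \<in> bmeas (leb X)"
 using assms by (intro measurable_restrict_space1 measurable_completion) simp

section \<open>Weak derivatives and their representatives\<close>

lemma locally_integrable_measurable:
 assumes "open X" "locally_integrable X f"
 shows "f \<in> bmeas (leb X)"
proof -
 obtain C where C: "\<And>n. compact (C n)" "\<And>n. C n \<subseteq> X" "\<And>n. C n \<subseteq> interior (C (Suc n))" "\<Union>(range C) = X"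
  "\<And>K. [|compact K; K \<subseteq> X|] ==> \<exists>N. \<forall>n\<ge>N. K \<subseteq> C n"
  by (rule open_Union_compact_subsets[OF assms(1)]) (rule that)
 show ?thesis
 proof (rule borel_measurable_LIMSEQ_metric)
  show "(\<lambda>x. ind (C n) x *\<^sub>R f x) \<in> bmeas (leb X)" for n
  proof -
   have "f absolutely_integrable_on C n" using assms(2) C(1,2)[of n] unfolding locally_integrable_def by blast
   then have "(\<lambda>x. ind (C n) x *\<^sub>R f x) \<in> bmeas lebesgue"
    unfolding set_integrable_def by (rule borel_measurable_integrable)
   then show ?thesis by (rule measurable_restrict_space1)
  qed
  fix x assume "x \<in> space (leb X)"
  then have "{x} \<subseteq> X" by (simp add: space_restrict_space)
  from C(5)[OF _ this] obtain N where "\<forall>n\<ge>N. {x} \<subseteq> C n" by auto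
  then have "\<forall>\<^sub>F n in sequentially. ind (C n) x *\<^sub>R f x = f x"
   unfolding eventually_sequentially by (intro exI[of _ N]) auto
  then show "(\<lambda>n. ind (C n) x *\<^sub>R f x) ----> f x" by (rule tendsto_eventually)
 qed
qed

lemma integrable_imp_locally_integrable:
 assumes X: "X \<in> sets borel" and f: "integrable (leb X) f"
 shows "locally_integrable X f"
 unfolding locally_integrable_def
proof (intro allI impI)
 fix K assume K: "compact K \<and> K \<subseteq> X"
 have "f absolutely_integrable_on X"
  using f X unfolding set_integrable_def by (simp add: integrable_restrict_space)
 then show "f absolutely_integrable_on K"
  by (rule set_integrable_subset) (use K in \<open>auto simp: compact_imp_closed\<close>)
qed

lemma AE_components_eq:
 fixes f g :: "'a => 'b::euclidean_space"
 assumes "\<And>b. b \<in> Basis ==> AE x in M. f x \<bullet> b = g x \<bullet> b" shows "AE x in M. f x = g x"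
proof -
 have "AE x in M. \<forall>b\<in>Basis. f x \<bullet> b = g x \<bullet> b" by (intro AE_finite_allI assms) auto
 then show ?thesis by eventually_elim (auto intro: euclidean_eqI)
qed

lemma test_mult_integrable_loc:
 assumes o: "open X" and f: "locally_integrable X f" and \<phi>: "test_function X \<phi>"
 shows "integrable (leb X) (\<lambda>x. \<phi> x *\<^sub>R f x)"
proof -
 have X: "X \<in> sets borel" using o by simp
 obtain K where K: "compact K" "K \<subseteq> X" "\<And>x. x \<notin> K ==> \<phi> x = 0"
  using \<phi> unfolding test_function_def by blast
 obtain B where B: "\<And>x. \<bar>\<phi> x\<bar> \<le> B" using test_function_bounded[OF \<phi>] by blast
 have fK: "integrable lebesgue (\<lambda>x. ind K x *\<^sub>R f x)"
  using f K unfolding locally_integrable_def set_integrable_def by blast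
 have \<phi>m: "\<phi> \<in> bmeas lebesgue" using test_functionD(3)[OF \<phi>] by (intro measurable_completion) simp
 have "integrable lebesgue (\<lambda>x. \<phi> x *\<^sub>R (ind K x *\<^sub>R f x))"
 proof (rule Bintegrable_bound[OF integrable_scaleR_right[OF fK, of B]])
  show "(\<lambda>x. \<phi> x *\<^sub>R (ind K x *\<^sub>R f x)) \<in> bmeas lebesgue"
   by (rule borel_measurable_scaleR[OF \<phi>m borel_measurable_integrable[OF fK]])
  have "\<bar>\<phi> x\<bar> * norm (ind K x *\<^sub>R f x) \<le> \<bar>B\<bar> * norm (ind K x *\<^sub>R f x)" for x
   by (intro mult_right_mono order_trans[OF B abs_ge_self]) auto
  then show "AE x in lebesgue. norm (\<phi> x *\<^sub>R (ind K x *\<^sub>R f x)) \<le> norm (B *\<^sub>R (ind K x *\<^sub>R f x))"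
   by (intro AE_I2) (simp only: norm_scaleR)
 qed
 moreover have "\<phi> x *\<^sub>R (ind K x *\<^sub>R f x) = ind X x *\<^sub>R (\<phi> x *\<^sub>R f x)" for x
  using K by (cases "x \<in> K") (auto simp: indicator_def)
 ultimately have "integrable lebesgue (\<lambda>x. ind X x *\<^sub>R (\<phi> x *\<^sub>R f x))" by (simp only:)
 then show ?thesis using X by (subst integrable_restrict_space) auto
qed

text \<open>The functions are only locally integrable, so the difference is multiplied by a cutoff that equals
1 on a compact subset; the subsets exhaust the domain.\<close>
lemma weak_deriv_unique:
 fixes f :: "'a::euclidean_space => 'b::euclidean_space"
 assumes o: "open X" and 1: "weak_deriv X i f g1" and 2: "weak_deriv X i f g2"
 shows "AE x in leb X. g1 x = g2 x"
proof (rule AE_components_eq)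
 fix b :: 'b assume b: "b \<in> Basis"
 have X: "X \<in> sets borel" using o by simp
 have l: "locally_integrable X g1" "locally_integrable X g2" using 1 2 by (auto simp: weak_deriv_def)
 define k where "k x = (g1 x - g2 x) \<bullet> b" for x
 have km: "k \<in> bmeas (leb X)"
  unfolding k_def using locally_integrable_measurable[OF o l(1)] locally_integrable_measurable[OF o l(2)] by measurable
 then obtain k' where k': "represents X k' k" using represents_exists[OF X] by blast
 have [measurable]: "k' \<in> bmeas borel" using k' by (simp add: represents_def)
 have test: "(LL x. \<phi> x * k' x) = 0" "integ (\<lambda>x. \<phi> x * k' x)" if \<phi>: "test_function X \<phi>" for \<phi>
 proof -
  have i: "integrable (leb X) (\<lambda>x. \<phi> x *\<^sub>R g1 x)" "integrable (leb X) (\<lambda>x. \<phi> x *\<^sub>R g2 x)"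
   using test_mult_integrable_loc[OF o _ \<phi>] l by auto
  have "(LINT x|leb X. \<phi> x *\<^sub>R g1 x) = (LINT x|leb X. \<phi> x *\<^sub>R g2 x)"
   using 1 2 \<phi> unfolding weak_deriv_def by (metis neg_equal_iff_equal)
  then have "(LINT x|leb X. (\<phi> x *\<^sub>R g1 x - \<phi> x *\<^sub>R g2 x)) \<bullet> b = 0" using i by simp
  moreover have "(LINT x|leb X. (\<phi> x *\<^sub>R g1 x - \<phi> x *\<^sub>R g2 x) \<bullet> b) = (LINT x|leb X. (\<phi> x *\<^sub>R g1 x - \<phi> x *\<^sub>R g2 x)) \<bullet> b"
   using i by (intro integral_inner_left) auto
  ultimately have z: "(LINT x|leb X. \<phi> x * k x) = 0"
   by (simp add: k_def inner_diff_left right_diff_distrib)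
  have "integrable (leb X) (\<lambda>x. (\<phi> x *\<^sub>R g1 x - \<phi> x *\<^sub>R g2 x) \<bullet> b)" using i by (intro integrable_inner_left) auto
  then have ik: "integrable (leb X) (\<lambda>x. \<phi> x * k x)"
   by (simp add: k_def inner_diff_left right_diff_distrib)
  have r: "represents X (\<lambda>x. \<phi> x * k' x) (\<lambda>x. \<phi> x * k x)" by (rule represents_mult[OF k' test_functionD(3)[OF \<phi>]])
  show "(LL x. \<phi> x * k' x) = 0" "integ (\<lambda>x. \<phi> x * k' x)"
   using represents_integral[OF X _ r] z ik by auto
 qed
 obtain C where C: "\<And>n. compact (C n)" "\<And>n. C n \<subseteq> X" "\<And>n. C n \<subseteq> interior (C (Suc n))" "\<Union>(range C) = X"
  "\<And>K. [|compact K; K \<subseteq> X|] ==> \<exists>N. \<forall>n\<ge>N. K \<subseteq> C n"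
  by (rule open_Union_compact_subsets[OF o]) (rule that)
 have "AE x in lborel. x \<in> interior (C n) --> k' x = 0" for n
 proof -
  obtain c where c: "test_function X c" "\<And>x. x \<in> C n ==> c x = 1"
   using compact_cutoff[OF C(1) o C(2)] by metis
  have "AE x in lborel. x \<in> interior (C n) --> c x * k' x = 0"
  proof (rule AE_zero_if_test_zero)
   show "open (interior (C n))" "bounded (interior (C n))"
    using C(1)[of n] bounded_subset[OF compact_imp_bounded interior_subset] by auto
   show "integ (\<lambda>x. c x * k' x)" by (rule test(2)[OF c(1)])
   fix \<psi> assume \<psi>: "test_function (interior (C n)) \<psi>"
   then have "test_function X \<psi>"
    by (rule test_function_mono) (use C(2) interior_subset in blast)
   from test_function_mult[OF this test_functionD(1)[OF c(1)]] have "(LL x. (\<psi> x * c x) * k' x) = 0" by (rule test(1))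
   then show "(LL x. \<psi> x * (c x * k' x)) = 0" by (simp add: mult.assoc)
  qed
  then show ?thesis using c(2) interior_subset[of "C n"] by (auto elim!: eventually_mono)
 qed
 then have "AE x in lborel. \<forall>n. x \<in> interior (C n) --> k' x = 0" unfolding AE_all_countable by blast
 moreover have "AE x in lborel. x \<in> X --> k' x = k x" using k' by (simp add: represents_def)
 ultimately have "AE x in lborel. x \<in> X --> g1 x \<bullet> b = g2 x \<bullet> b"
 proof eventually_elim
  case (elim x)
  show ?case
  proof
   assume x: "x \<in> X"
   then obtain n where "x \<in> C n" using C(4) by blast
   then have "x \<in> interior (C (Suc n))" using C(3) by blast
   then have "k' x = 0" using elim by blast
   then show "g1 x \<bullet> b = g2 x \<bullet> b" using elim x by (simp add: k_def inner_diff_left)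
  qed
 qed
 then show "AE x in leb X. g1 x \<bullet> b = g2 x \<bullet> b" by (simp add: AE_lebesgue_on_iff[OF X])
qed

lemma weak_deriv_cong_AE:
 assumes o: "open X" and w: "weak_deriv X i f g" and f': "locally_integrable X f'"
  and ae: "AE x in leb X. f x = f' x" and i: "i \<in> Basis"
 shows "weak_deriv X i f' g"
 unfolding weak_deriv_def
proof (intro conjI allI impI f')
 show "locally_integrable X g" using w by (simp add: weak_deriv_def)
 have lf: "locally_integrable X f" using w by (simp add: weak_deriv_def)
 fix \<phi> assume \<phi>: "test_function X \<phi>"
 note d = test_function_deriv[OF \<phi> i]
 have "(LINT x|leb X. fder \<phi> x i *\<^sub>R f' x) = (LINT x|leb X. fder \<phi> x i *\<^sub>R f x)"
  using test_mult_integrable_loc[OF o f' d] test_mult_integrable_loc[OF o lf d] ae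
  by (intro integral_cong_AE) (auto elim!: eventually_mono)
 then show "(LINT x|leb X. fder \<phi> x i *\<^sub>R f' x) = - (LINT x|leb X. \<phi> x *\<^sub>R g x)"
  using w \<phi> by (simp add: weak_deriv_def)
qed

lemma wderiv_works:
 assumes "weak_deriv X i f g" shows "weak_deriv X i f (wderiv X i f)"
 unfolding wderiv_def using someI[of "weak_deriv X i f", OF assms] .

lemma wderiv_AE_eq:
 assumes "open X" "weak_deriv X i f g" shows "AE x in leb X. wderiv X i f x = g x"
 by (rule weak_deriv_unique[OF assms(1) wderiv_works[OF assms(2)] assms(2)])

section \<open>Lebesgue and Sobolev spaces on a bounded set\<close>

lemma Lp_iff: "f \<in> fst (Lp p X) \<longleftrightarrow> f \<in> bmeas (leb X) \<and> integrable (leb X) (\<lambda>x. norm (f x) powr p)"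
 by (simp add: Lp_def)

lemma Lp_norm: "snd (Lp p X) f = (LINT x|leb X. norm (f x) powr p) powr (1 / p)"
 by (simp add: Lp_def)

lemma Lp_norm_nonneg: "0 \<le> snd (Lp p X) f" by (simp add: Lp_norm)

lemma finite_measure_lebesgue_on_bounded:
 fixes X :: "'a::euclidean_space set"
 assumes "open X" "bounded X" shows "finite_measure (leb X)"
proof
 have "emeasure lborel X < \<infinity>" using emeasure_bounded_finite[OF assms(2)] assms(1) by simp
 then show "emeasure (leb X) (space (leb X)) \<noteq> \<infinity>"
  using assms(1) by (simp add: space_restrict_space emeasure_restrict_space)
qed

lemma Lp_cong_AE:
 assumes "f \<in> fst (Lp p X)" "f' \<in> bmeas (leb X)" "AE x in leb X. f x = f' x"
 shows "f' \<in> fst (Lp p X)" "snd (Lp p X) f' = snd (Lp p X) f"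
proof -
 have m: "(\<lambda>x. norm (f x) powr p) \<in> bmeas (leb X)" "(\<lambda>x. norm (f' x) powr p) \<in> bmeas (leb X)"
  using assms by (auto simp: Lp_iff)
 have ae: "AE x in leb X. norm (f x) powr p = norm (f' x) powr p" using assms(3) by eventually_elim simp
 show "f' \<in> fst (Lp p X)" using assms integrable_cong_AE[OF m ae] by (simp add: Lp_iff)
 show "snd (Lp p X) f' = snd (Lp p X) f" unfolding Lp_norm using integral_cong_AE[OF m ae] by simp
qed

lemma Lp_imp_integrable:
 assumes o: "open X" "bounded X" and q: "q > 1" and f: "f \<in> fst (Lp q X)"
 shows "integrable (leb X) f"
proof -
 interpret finite_measure "leb X" by (rule finite_measure_lebesgue_on_bounded[OF o])
 have "integrable (leb X) (\<lambda>x. 1 + norm (f x) powr q)" using f by (auto simp: Lp_iff)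
 then show ?thesis
  by (rule Bintegrable_bound)
   (use f q young_powr[OF norm_ge_zero zero_less_one] in \<open>auto simp: Lp_iff intro!: AE_I2\<close>)
qed

lemma Lp_norm_powr:
 assumes "q > 0" shows "snd (Lp q X) f powr q = (LINT x|leb X. norm (f x) powr q)"
proof -
 have "0 \<le> (LINT x|leb X. norm (f x) powr q)" by (intro Bintegral_nonneg) auto
 then show ?thesis using assms by (simp add: Lp_norm powr_powr)
qed

text \<open>The inequality \<open>young_powr\<close> is integrated, with s slightly above the norm, which may
be zero.\<close>
lemma L1_le_Lp:
 fixes X :: "'a::euclidean_space set"
 assumes o: "open X" "bounded X" and q: "q > 1"
 shows "\<exists>K\<ge>0. \<forall>f::'a => 'b::euclidean_space. f \<in> fst (Lp q X) --> (LINT x|leb X. norm (f x)) \<le> K * snd (Lp q X) f"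
proof (intro exI conjI allI impI)
 interpret finite_measure "leb X" by (rule finite_measure_lebesgue_on_bounded[OF o])
 let ?V = "measure (leb X) (space (leb X))"
 show "0 \<le> ?V + 1" by simp
 fix f :: "'a => 'b" assume f: "f \<in> fst (Lp q X)"
 let ?N = "snd (Lp q X) f"
 have fi: "integrable (leb X) (\<lambda>x. norm (f x))" using Lp_imp_integrable[OF o q f] by simp
 have main: "(LINT x|leb X. norm (f x)) \<le> s * ?V + s powr (1 - q) * ?N powr q" if s: "s > 0" for s
 proof -
  have fq: "integrable (leb X) (\<lambda>x. norm (f x) powr q)" using f by (simp add: Lp_iff)
  have "(LINT x|leb X. norm (f x)) \<le> (LINT x|leb X. s + norm (f x) powr q * s powr (1 - q))"
   using fi fq young_powr[OF norm_ge_zero s q] by (intro integral_mono) auto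
  also have "\<dots> = s * ?V + s powr (1 - q) * ?N powr q"
   using fq q by (simp add: Lp_norm_powr mult.commute)
  finally show ?thesis .
 qed
 have le: "(LINT x|leb X. norm (f x)) \<le> (?V + 1) * s" if s: "s > ?N" for s
 proof -
  have s0: "s > 0" using s Lp_norm_nonneg[of q X f] by linarith
  have "s powr (1 - q) * ?N powr q \<le> s powr (1 - q) * s powr q"
   using s q Lp_norm_nonneg by (intro mult_left_mono powr_mono2) auto
  also have "\<dots> = s" using s0 by (simp flip: powr_add)
  finally show ?thesis using main[OF s0] by (simp add: algebra_simps)
 qed
 have "((\<lambda>s. (?V + 1) * s) \<longlongrightarrow> (?V + 1) * ?N) (at_right ?N)" by (intro tendsto_intros)
 then show "(LINT x|leb X. norm (f x)) \<le> (?V + 1) * ?N"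
  by (rule tendsto_lowerbound) (use le in \<open>auto intro!: eventually_mono[OF eventually_at_right_less]\<close>)
qed

lemma sobolev_norm_nonneg: "0 \<le> sobolev_norm k p X f"
 by (induction k arbitrary: f) (auto intro!: add_nonneg_nonneg sum_nonneg Lp_norm_nonneg)

lemma sobolev_carrier_Lp: "f \<in> sobolev_carrier k p X ==> f \<in> fst (Lp p X)"
 by (cases k) auto

lemma Lp_norm_le_sobolev: "snd (Lp p X) f \<le> sobolev_norm k p X f"
 by (cases k) (auto intro!: sum_nonneg sobolev_norm_nonneg)

lemma sobolev_carrier_cong_AE:
 assumes o: "open X" and f: "f \<in> sobolev_carrier k p X" and f': "locally_integrable X f'"
  and ae: "AE x in leb X. f x = f' x"
 shows "f' \<in> sobolev_carrier k p X"
proof -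
 have "f' \<in> fst (Lp p X)"
  by (rule Lp_cong_AE[OF sobolev_carrier_Lp[OF f] locally_integrable_measurable[OF o f'] ae])
 moreover have "\<exists>g\<in>sobolev_carrier j p X. weak_deriv X i f' g"
  if "\<exists>g\<in>sobolev_carrier j p X. weak_deriv X i f g" "i \<in> Basis" for i j
  using that weak_deriv_cong_AE[OF o _ f' ae] by blast
 ultimately show ?thesis using f by (cases k) auto
qed

lemma sobolev_carrier_wderiv:
 assumes o: "open X" and f: "f \<in> sobolev_carrier (Suc k) p X" and i: "i \<in> Basis"
 shows "weak_deriv X i f (wderiv X i f)" "wderiv X i f \<in> sobolev_carrier k p X"
proof -
 obtain g where g: "g \<in> sobolev_carrier k p X" "weak_deriv X i f g" using f i by auto
 show w: "weak_deriv X i f (wderiv X i f)" by (rule wderiv_works[OF g(2)])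
 have "AE x in leb X. g x = wderiv X i f x" by (rule weak_deriv_unique[OF o g(2) w])
 then show "wderiv X i f \<in> sobolev_carrier k p X"
  using w by (intro sobolev_carrier_cong_AE[OF o g(1)]) (simp add: weak_deriv_def)
qed

section \<open>Passing between vector fields and scalar representatives\<close>

lemma weak_deriv_imp_wd:
 assumes o: "open X" "bounded X" and w: "weak_deriv X i f g" and i: "i \<in> Basis"
  and f: "integrable (leb X) f" and g: "integrable (leb X) g" and b: "b \<in> Basis"
  and f': "represents X f' (\<lambda>x. f x \<bullet> b)" and g': "represents X g' (\<lambda>x. g x \<bullet> b)"
 shows "wd X i f' g'"
 unfolding wd_def
proof (intro conjI allI impI)
 have X: "X \<in> sets borel" using o by simp
 have lf: "locally_integrable X f" "locally_integrable X g" using w by (auto simp: weak_deriv_def)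
 show "integ f'" using represents_integral(1)[OF X _ f'] f by auto
 show "integ g'" using represents_integral(1)[OF X _ g'] g by auto
 fix \<phi> assume \<phi>: "test_function X \<phi>"
 have eq: "(LL x. \<psi> x * h' x) = (LINT x|leb X. \<psi> x *\<^sub>R h x) \<bullet> b"
  if \<psi>: "test_function X \<psi>" and h: "locally_integrable X h" and r: "represents X h' (\<lambda>x. h x \<bullet> b)" for \<psi> h h'
 proof -
  have ih: "integrable (leb X) (\<lambda>x. \<psi> x *\<^sub>R h x)" by (rule test_mult_integrable_loc[OF o(1) h \<psi>])
  have r': "represents X (\<lambda>x. \<psi> x * h' x) (\<lambda>x. (\<psi> x *\<^sub>R h x) \<bullet> b)"
   using represents_mult[OF r test_functionD(3)[OF \<psi>]] by simp
  have "(LL x. \<psi> x * h' x) = (LINT x|leb X. (\<psi> x *\<^sub>R h x) \<bullet> b)"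
   using represents_integral(2)[OF X _ r'] borel_measurable_integrable[OF integrable_inner_left[OF ih, of b]] by simp
  also have "\<dots> = (LINT x|leb X. \<psi> x *\<^sub>R h x) \<bullet> b" by (rule integral_inner_left[OF ih])
  finally show ?thesis .
 qed
 show "(LL x. fder \<phi> x i * f' x) = - (LL x. \<phi> x * g' x)"
  unfolding eq[OF test_function_deriv[OF \<phi> i] lf(1) f'] eq[OF \<phi> lf(2) g']
  using w \<phi> by (simp add: weak_deriv_def)
qed

lemma wd_imp_weak_deriv:
 fixes f g :: "'a::euclidean_space => 'b::euclidean_space"
 assumes o: "open X" "bounded X" and i: "i \<in> Basis"
  and f: "f \<in> bmeas (leb X)" and g: "g \<in> bmeas (leb X)"
  and f': "\<And>b. b \<in> Basis ==> represents X (f' b) (\<lambda>x. f x \<bullet> b)"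
  and g': "\<And>b. b \<in> Basis ==> represents X (g' b) (\<lambda>x. g x \<bullet> b)"
  and w: "\<And>b. b \<in> Basis ==> wd X i (f' b) (g' b)"
 shows "weak_deriv X i f g"
proof -
 have X: "X \<in> sets borel" using o by simp
 have int: "integrable (leb X) h" if h: "h \<in> bmeas (leb X)"
  and r: "\<And>b. b \<in> Basis ==> represents X (h' b) (\<lambda>x. h x \<bullet> b)" and hi: "\<And>b. b \<in> Basis ==> integ (h' b)" for h :: "'a => 'b" and h'
 proof -
  have "integrable (leb X) (\<lambda>x. h x \<bullet> b)" if "b \<in> Basis" for b
   using represents_integral(1)[OF X _ r[OF that]] hi[OF that] h by auto
  then have "integrable (leb X) (\<lambda>x. \<Sum>b\<in>Basis. (h x \<bullet> b) *\<^sub>R b)" by auto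
  then show ?thesis by (simp add: euclidean_representation)
 qed
 have fi: "integrable (leb X) f" by (rule int[OF f f']) (use wdD(1)[OF w] in auto)
 have gi: "integrable (leb X) g" by (rule int[OF g g']) (use wdD(2)[OF w] in auto)
 note lf = integrable_imp_locally_integrable[OF X fi] and lg = integrable_imp_locally_integrable[OF X gi]
 have eq: "(LL x. \<psi> x * h' x) = (LINT x|leb X. \<psi> x *\<^sub>R h x) \<bullet> b"
  if \<psi>: "test_function X \<psi>" and h: "locally_integrable X h" and r: "represents X h' (\<lambda>x. h x \<bullet> b)" for \<psi> h h' and b :: 'b
 proof -
  have ih: "integrable (leb X) (\<lambda>x. \<psi> x *\<^sub>R h x)" by (rule test_mult_integrable_loc[OF o(1) h \<psi>])
  have r': "represents X (\<lambda>x. \<psi> x * h' x) (\<lambda>x. (\<psi> x *\<^sub>R h x) \<bullet> b)"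
   using represents_mult[OF r test_functionD(3)[OF \<psi>]] by simp
  have "(LL x. \<psi> x * h' x) = (LINT x|leb X. (\<psi> x *\<^sub>R h x) \<bullet> b)"
   using represents_integral(2)[OF X _ r'] borel_measurable_integrable[OF integrable_inner_left[OF ih, of b]] by simp
  also have "\<dots> = (LINT x|leb X. \<psi> x *\<^sub>R h x) \<bullet> b" by (rule integral_inner_left[OF ih])
  finally show ?thesis .
 qed
 show ?thesis unfolding weak_deriv_def
 proof (intro conjI allI impI lf lg)
  fix \<phi> assume \<phi>: "test_function X \<phi>"
  show "(LINT x|leb X. fder \<phi> x i *\<^sub>R f x) = - (LINT x|leb X. \<phi> x *\<^sub>R g x)"
  proof (rule euclidean_eqI)
   fix b :: 'b assume b: "b \<in> Basis"
   show "(LINT x|leb X. fder \<phi> x i *\<^sub>R f x) \<bullet> b = - (LINT x|leb X. \<phi> x *\<^sub>R g x) \<bullet> b"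
    using wdD(3)[OF w[OF b] \<phi>] unfolding eq[OF test_function_deriv[OF \<phi> i] lf f'[OF b]] eq[OF \<phi> lg g'[OF b]] by simp
  qed
 qed
qed

section \<open>Sup bounds from the Sobolev norm\<close>

text \<open>The product rule needs factors that are bounded at every point, so the exceptional null set is
removed by clipping.\<close>
lemma represents_clipped:
 fixes f :: "'a::euclidean_space => real"
 assumes X: "X \<in> sets borel" and f: "f \<in> bmeas (leb X)" and B: "B \<ge> 0"
  and b: "AE x in leb X. \<bar>f x\<bar> \<le> B"
 shows "\<exists>f'. represents X f' f \<and> (\<forall>x. \<bar>f' x\<bar> \<le> B)"
proof -
 obtain f' where f': "represents X f' f" using represents_exists[OF X f] by blast
 have "AE x in lborel. x \<in> X --> \<bar>f x\<bar> \<le> B" using b by (simp add: AE_lebesgue_on_iff[OF X])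
 moreover have "AE x in lborel. x \<in> X --> f' x = f x" using f' by (simp add: represents_def)
 ultimately have "AE x in lborel. x \<in> X --> max (- B) (min B (f' x)) = f x" by eventually_elim (auto simp: abs_le_iff)
 then have "represents X (\<lambda>x. max (- B) (min B (f' x))) f" using f' B by (auto simp: represents_def)
 moreover have "\<bar>max (- B) (min B (f' x))\<bar> \<le> B" for x using B by auto
 ultimately show ?thesis by blast
qed

lemma Lp_component_measurable:
 assumes "f \<in> fst (Lp q X)" shows "(\<lambda>x. f x \<bullet> b) \<in> bmeas (leb X)"
 using assms by (intro borel_measurable_inner) (auto simp: Lp_iff)

lemma Lq_norm_component_le:
 assumes X: "X \<in> sets borel" and f: "f \<in> fst (Lp q X)" and b: "b \<in> Basis" and q: "q > 0"
  and r: "represents X f' (\<lambda>x. f x \<bullet> b)"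
 shows "integ (\<lambda>x. \<bar>f' x\<bar> powr q)" "Lq_norm q f' \<le> snd (Lp q X) f"
proof -
 have [measurable]: "f \<in> bmeas (leb X)" using f by (simp add: Lp_iff)
 have le: "\<bar>f x \<bullet> b\<bar> powr q \<le> norm (f x) powr q" for x
  using Basis_le_norm[OF b, of "f x"] q by (intro powr_mono2) auto
 have i: "integrable (leb X) (\<lambda>x. norm (f x) powr q)" using f by (simp add: Lp_iff)
 have ib: "integrable (leb X) (\<lambda>x. \<bar>f x \<bullet> b\<bar> powr q)"
  by (rule Bintegrable_bound[OF i]) (use le in auto)
 have r': "represents X (\<lambda>x. \<bar>f' x\<bar> powr q) (\<lambda>x. \<bar>f x \<bullet> b\<bar> powr q)"
  using r by (auto simp: represents_def elim: eventually_mono)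
 note ri = represents_integral[OF X borel_measurable_integrable[OF ib] r']
 show "integ (\<lambda>x. \<bar>f' x\<bar> powr q)" using ri(1) ib by simp
 have "(LINT x|leb X. \<bar>f x \<bullet> b\<bar> powr q) \<le> (LINT x|leb X. norm (f x) powr q)"
  by (rule integral_mono[OF ib i le])
 moreover have "0 \<le> (LL x. \<bar>f' x\<bar> powr q)" by (intro Bintegral_nonneg) auto
 ultimately show "Lq_norm q f' \<le> snd (Lp q X) f"
  unfolding Lq_norm_def Lp_norm using q ri(2) by (intro powr_mono2) auto
qed

lemma sobolev_component_wd:
 assumes o: "open X" "bounded X" and q: "q > 1" and f: "f \<in> sobolev_carrier (Suc k) q X"
  and i: "i \<in> Basis" and b: "b \<in> Basis"
  and f': "represents X f' (\<lambda>x. f x \<bullet> b)" and g': "represents X g' (\<lambda>x. wderiv X i f x \<bullet> b)"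
 shows "wd X i f' g'"
 by (rule weak_deriv_imp_wd[OF o sobolev_carrier_wderiv(1)[OF o(1) f i] i
    Lp_imp_integrable[OF o q sobolev_carrier_Lp[OF f]]
    Lp_imp_integrable[OF o q sobolev_carrier_Lp[OF sobolev_carrier_wderiv(2)[OF o(1) f i]]] b f' g'])

lemma sobolev_sup_bound:
 assumes X: "smooth_bounded_domain X" and q: "q > 3"
 shows "\<exists>C\<ge>0. \<forall>f::real^3 => 'b::euclidean_space. f \<in> sobolev_carrier 1 q X -->
  (\<forall>b\<in>Basis. AE x in leb X. \<bar>f x \<bullet> b\<bar> \<le> C * sobolev_norm 1 q X f)"
proof (rule morrey[OF X q])
 fix C assume C: "C \<ge> 0" "\<And>f g. (\<And>j. j \<in> Basis ==> wd X j f (g j)) ==> integ (\<lambda>x. \<bar>f x\<bar> powr q) ==>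
   (\<And>j. j \<in> Basis ==> integ (\<lambda>x. \<bar>g j x\<bar> powr q)) ==>
   AE x in lborel. x \<in> X --> \<bar>f x\<bar> \<le> C * (Lq_norm q f + (\<Sum>j\<in>Basis. Lq_norm q (g j)))"
 have o: "open X" "bounded X" using X by (auto simp: smooth_bounded_domain_def)
 have bX: "X \<in> sets borel" using o by simp
 show ?thesis
 proof (intro exI[of _ C] conjI allI impI ballI C(1))
  fix f :: "real^3 => 'b" and b :: 'b assume f: "f \<in> sobolev_carrier 1 q X" and b: "b \<in> Basis"
  have f1: "f \<in> sobolev_carrier (Suc 0) q X" using f by simp
  note L = sobolev_carrier_Lp[OF f]
  have Ld: "wderiv X j f \<in> fst (Lp q X)" if "j \<in> Basis" for j
   using sobolev_carrier_wderiv(2)[OF o(1) f1 that] by simp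
  obtain f' where f': "represents X f' (\<lambda>x. f x \<bullet> b)" using represents_exists[OF bX Lp_component_measurable[OF L]] by blast
  have "\<forall>j\<in>Basis. \<exists>g. represents X g (\<lambda>x. wderiv X j f x \<bullet> b)"
   using represents_exists[OF bX Lp_component_measurable[OF Ld]] by blast
  then obtain g where g: "\<And>j. j \<in> Basis ==> represents X (g j) (\<lambda>x. wderiv X j f x \<bullet> b)"
   unfolding bchoice_iff by blast
  have q': "q > 1" "q > 0" using q by auto
  have "AE x in lborel. x \<in> X --> \<bar>f' x\<bar> \<le> C * (Lq_norm q f' + (\<Sum>j\<in>Basis. Lq_norm q (g j)))"
  proof (rule C(2))
   show "wd X j f' (g j)" if "j \<in> Basis" for j
    by (rule sobolev_component_wd[OF o q'(1) f1 that b f' g[OF that]])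
   show "integ (\<lambda>x. \<bar>f' x\<bar> powr q)" by (rule Lq_norm_component_le(1)[OF bX L b q'(2) f'])
   show "integ (\<lambda>x. \<bar>g j x\<bar> powr q)" if "j \<in> Basis" for j
    by (rule Lq_norm_component_le(1)[OF bX Ld[OF that] b q'(2) g[OF that]])
  qed
  moreover have "Lq_norm q f' + (\<Sum>j\<in>Basis. Lq_norm q (g j)) \<le> sobolev_norm 1 q X f"
   using Lq_norm_component_le(2)[OF bX L b q'(2) f'] Lq_norm_component_le(2)[OF bX Ld b q'(2) g]
   by (auto intro!: add_mono sum_mono)
  then have "C * (Lq_norm q f' + (\<Sum>j\<in>Basis. Lq_norm q (g j))) \<le> C * sobolev_norm 1 q X f"
   by (rule mult_left_mono) (rule C(1))
  moreover have "AE x in lborel. x \<in> X --> f' x = f x \<bullet> b" using f' by (simp add: represents_def)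
  ultimately show "AE x in leb X. \<bar>f x \<bullet> b\<bar> \<le> C * sobolev_norm 1 q X f"
   unfolding AE_lebesgue_on_iff[OF bX] by (auto elim!: eventually_elim2)
 qed
qed

lemma sobolev_carrier_Suc_subset: "f \<in> sobolev_carrier (Suc k) p X ==> f \<in> sobolev_carrier k p X"
proof (induction k arbitrary: f)
 case (Suc k)
 show ?case unfolding sobolev_carrier.simps(2)[of k]
 proof (intro CollectI conjI ballI)
  show "f \<in> fst (Lp p X)" by (rule sobolev_carrier_Lp[OF Suc.prems])
  fix i :: 'a assume "i \<in> Basis"
  then obtain g where "g \<in> sobolev_carrier (Suc k) p X" "weak_deriv X i f g" using Suc.prems unfolding sobolev_carrier.simps(2)[of "Suc k"] by blast
  then show "\<exists>g\<in>sobolev_carrier k p X. weak_deriv X i f g" using Suc.IH by blast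
 qed
qed simp

lemma wdiv_sup_bound:
 assumes X: "smooth_bounded_domain X" and q: "q > 3"
 shows "\<exists>C\<ge>0. \<forall>u. u \<in> sobolev_carrier 2 q X -->
  (AE x in leb X. \<bar>wdiv X u x\<bar> \<le> C * sobolev_norm 2 q X u)"
proof -
 have o: "open X" using X by (auto simp: smooth_bounded_domain_def)
 obtain C where C: "C \<ge> 0" "\<And>f::real^3 => real^3. f \<in> sobolev_carrier 1 q X ==>
  \<forall>b\<in>Basis. AE x in leb X. \<bar>f x \<bullet> b\<bar> \<le> C * sobolev_norm 1 q X f"
  using sobolev_sup_bound[OF X q, where 'b="real^3"] by blast
 show ?thesis
 proof (intro exI[of _ "3 * C"] conjI allI impI)
  show "0 \<le> 3 * C" using C(1) by simp
  fix u :: "real^3 => real^3" assume u: "u \<in> sobolev_carrier 2 q X"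
  have u2: "u \<in> sobolev_carrier (Suc 1) q X" using u by (simp add: numeral_2_eq_2)
  have n: "sobolev_norm 1 q X (wderiv X i u) \<le> sobolev_norm 2 q X u" if "i \<in> Basis" for i
  proof -
   have "sobolev_norm 1 q X (wderiv X i u) \<le> (\<Sum>i\<in>Basis. sobolev_norm 1 q X (wderiv X i u))"
    by (rule member_le_sum[OF that]) (auto simp: sobolev_norm_nonneg simp del: sobolev_norm.simps One_nat_def)
   also have "\<dots> \<le> sobolev_norm (Suc 1) q X u"
    using Lp_norm_nonneg[of q X u] by (subst sobolev_norm.simps(2)) linarith
   finally show ?thesis by (simp add: numeral_2_eq_2)
  qed
  have "AE x in leb X. \<forall>i\<in>UNIV. \<bar>wderiv X (axis i 1) u x $ i\<bar> \<le> C * sobolev_norm 2 q X u"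
  proof (rule AE_finite_allI)
   fix i :: 3
   have i: "axis i 1 \<in> (Basis :: (real^3) set)" by (simp add: axis_in_Basis_iff)
   have "AE x in leb X. \<bar>wderiv X (axis i 1) u x \<bullet> axis i 1\<bar> \<le> C * sobolev_norm 1 q X (wderiv X (axis i 1) u)"
    using C(2)[OF sobolev_carrier_wderiv(2)[OF o u2 i]] i by blast
   then show "AE x in leb X. \<bar>wderiv X (axis i 1) u x $ i\<bar> \<le> C * sobolev_norm 2 q X u"
    using mult_left_mono[OF n[OF i] C(1)] by (auto elim!: eventually_mono simp: inner_axis)
  qed simp
  then show "AE x in leb X. \<bar>wdiv X u x\<bar> \<le> 3 * C * sobolev_norm 2 q X u"
  proof eventually_elim
   case (elim x)
   have "\<bar>wdiv X u x\<bar> \<le> (\<Sum>i\<in>UNIV. \<bar>wderiv X (axis i 1) u x $ i\<bar>)" unfolding wdiv_def by (rule sum_abs)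
   also have "\<dots> \<le> (\<Sum>i\<in>(UNIV::3 set). C * sobolev_norm 2 q X u)" using elim by (intro sum_mono) auto
   finally show ?case by simp
  qed
 qed
qed

section \<open>Traces and the weak divergence theorem\<close>

lemma weak_deriv_diff:
 fixes f1 f2 :: "'a::euclidean_space => 'b::euclidean_space"
 assumes o: "open X" and 1: "weak_deriv X i f1 g1" and 2: "weak_deriv X i f2 g2"
 shows "weak_deriv X i (\<lambda>x. f1 x - f2 x) (\<lambda>x. g1 x - g2 x)"
 unfolding weak_deriv_def
proof (intro conjI allI impI)
 have l: "locally_integrable X f1" "locally_integrable X f2" "locally_integrable X g1" "locally_integrable X g2"
  using 1 2 by (auto simp: weak_deriv_def)
 have d: "locally_integrable X (\<lambda>x. a x - b x)" if "locally_integrable X a" "locally_integrable X b" for a b :: "'a => 'b"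
  using that unfolding locally_integrable_def by (blast intro: set_integral_diff(1))
 show "locally_integrable X (\<lambda>x. f1 x - f2 x)" "locally_integrable X (\<lambda>x. g1 x - g2 x)" by (intro d l)+
 fix \<phi> assume \<phi>: "test_function X \<phi>"
 note I = test_mult_integrable_loc[OF o _ \<phi>] test_mult_integrable_loc[OF o _ test_function_directional_deriv[OF \<phi>, of i]]
 show "(LINT x|leb X. fder \<phi> x i *\<^sub>R (f1 x - f2 x)) = - (LINT x|leb X. \<phi> x *\<^sub>R (g1 x - g2 x))"
  using I[OF l(1)] I[OF l(2)] I[OF l(3)] I[OF l(4)] 1 2 \<phi> by (simp add: weak_deriv_def scaleR_diff_right)
qed

lemma weak_deriv_smooth:
 fixes f :: "'a::euclidean_space => 'b::euclidean_space"
 assumes o: "open X" "bounded X" and f: "smooth_on UNIV f" and i: "i \<in> Basis"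
 shows "weak_deriv X i f (\<lambda>x. fder f x i)"
proof (rule wd_imp_weak_deriv[OF o i])
 have sb: "smooth_on UNIV (\<lambda>x. g x \<bullet> b)" if "smooth_on UNIV g" for g :: "'a => 'b" and b
  by (rule smooth_on_bounded_linear[OF open_UNIV bounded_linear_inner_left that])
 note d = smooth_on_deriv[OF f i]
 have m: "g \<in> bmeas borel" if "smooth_on UNIV g" for g :: "'a => 'c::euclidean_space"
  using smooth_on_continuous[OF that] by (rule borel_measurable_continuous_onI)
 show "f \<in> bmeas (leb X)" "(\<lambda>x. fder f x i) \<in> bmeas (leb X)"
  by (intro borel_imp_lebesgue_on m f d)+
 fix b :: 'b assume b: "b \<in> Basis"
 have fd: "fder (\<lambda>x. f x \<bullet> b) x i = fder f x i \<bullet> b" for x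
 proof -
  have "((\<lambda>x. f x \<bullet> b) has_derivative (\<lambda>h. fder f x h \<bullet> b)) (at x)"
   by (rule bounded_linear.has_derivative[OF bounded_linear_inner_left smooth_onD[OF open_UNIV f UNIV_I]])
  from frechet_derivative_at[OF this] show ?thesis by metis
 qed
 have [measurable]: "X \<in> sets borel" using o by simp
 have r: "represents X (\<lambda>x. ind X x * g x) g" if "g \<in> bmeas borel" for g :: "'a => real"
  using that unfolding represents_def by (auto intro!: AE_I2)
 show "represents X (\<lambda>x. ind X x * (f x \<bullet> b)) (\<lambda>x. f x \<bullet> b)" by (intro r m sb f)
 show "represents X (\<lambda>x. ind X x * (fder f x i \<bullet> b)) (\<lambda>x. fder f x i \<bullet> b)" by (intro r m sb d)
 show "wd X i (\<lambda>x. ind X x * (f x \<bullet> b)) (\<lambda>x. ind X x * (fder f x i \<bullet> b))"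
  using wd_smooth[OF sb[OF f] o i, of b] unfolding fd .
qed

lemma Lp_smooth:
 assumes o: "open X" "bounded X" and f: "continuous_on UNIV f" and p: "p > 0"
 shows "f \<in> fst (Lp p X)"
proof -
 interpret finite_measure "leb X" by (rule finite_measure_lebesgue_on_bounded[OF o])
 have "compact (f ` closure X)"
  by (rule compact_continuous_image[OF continuous_on_subset[OF f subset_UNIV]]) (use o in \<open>simp add: compact_closure\<close>)
 then obtain B where B: "\<And>x. x \<in> closure X ==> norm (f x) \<le> B"
  using compact_imp_bounded[of "f ` closure X"] unfolding bounded_iff by blast
 have m: "f \<in> bmeas (leb X)" using f by (intro borel_imp_lebesgue_on borel_measurable_continuous_onI)
 have "integrable (leb X) (\<lambda>x. norm (f x) powr p)"
 proof (rule integrable_const_bound[of _ "B powr p"])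
  show "AE x in leb X. norm (norm (f x) powr p) \<le> B powr p"
   using B p closure_subset by (intro AE_I2) (auto simp: space_restrict_space intro!: powr_mono2)
 qed (use m in auto)
 then show ?thesis using m by (simp add: Lp_iff)
qed

lemma Lp_diff:
 assumes "f \<in> fst (Lp p X)" "g \<in> fst (Lp p X)" and p: "p > 0" shows "(\<lambda>x. f x - g x) \<in> fst (Lp p X)"
proof -
 have m: "f \<in> bmeas (leb X)" "g \<in> bmeas (leb X)" using assms by (auto simp: Lp_iff)
 have "integrable (leb X) (\<lambda>x. 2 powr p * (norm (f x) powr p + norm (g x) powr p))" using assms by (auto simp: Lp_iff)
 then have "integrable (leb X) (\<lambda>x. norm (f x - g x) powr p)"
 proof (rule Bintegrable_bound)
  have "norm (f x - g x) powr p \<le> 2 powr p * (norm (f x) powr p + norm (g x) powr p)" for x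
  proof -
   have "norm (f x - g x) \<le> 2 * max (norm (f x)) (norm (g x))" using norm_triangle_ineq4[of "f x" "g x"] by linarith
   then have "norm (f x - g x) powr p \<le> (2 * max (norm (f x)) (norm (g x))) powr p" using p by (intro powr_mono2) auto
   also have "\<dots> = 2 powr p * max (norm (f x)) (norm (g x)) powr p" by (simp add: powr_mult)
   also have "\<dots> \<le> 2 powr p * (norm (f x) powr p + norm (g x) powr p)" by (intro mult_left_mono) (auto simp: max_def)
   finally show ?thesis .
  qed
  then show "AE x in leb X. norm (norm (f x - g x) powr p) \<le> norm (2 powr p * (norm (f x) powr p + norm (g x) powr p))"
   by (intro AE_I2) (auto simp: abs_of_nonneg)
 qed (use m in auto)
 then show ?thesis using m by (simp add: Lp_iff)
qed

lemma represents_LINT_abs_diff_le: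
 fixes f g :: "'a::euclidean_space => 'b::euclidean_space"
 assumes X: "X \<in> sets borel" and i: "integrable (leb X) (\<lambda>x. f x - g x)" and b: "b \<in> Basis"
  and f': "f' \<in> bmeas borel" "AE x in leb X. f' x = f x \<bullet> b"
  and g': "represents X g' (\<lambda>x. g x \<bullet> b)"
 shows "(LL x. ind X x * \<bar>f' x - g' x\<bar>) \<le> (LINT x|leb X. norm (f x - g x))"
proof -
 have ib: "integrable (leb X) (\<lambda>x. \<bar>(f x - g x) \<bullet> b\<bar>)" using i by auto
 have "represents X (\<lambda>x. ind X x * \<bar>f' x - g' x\<bar>) (\<lambda>x. \<bar>(f x - g x) \<bullet> b\<bar>)"
 proof -
  have "AE x in lborel. x \<in> X --> g' x = g x \<bullet> b" using g' by (simp add: represents_def)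
  moreover have "AE x in lborel. x \<in> X --> f' x = f x \<bullet> b" using f'(2) unfolding AE_lebesgue_on_iff[OF X] .
  ultimately have "AE x in lborel. x \<in> X --> ind X x * \<bar>f' x - g' x\<bar> = \<bar>(f x - g x) \<bullet> b\<bar>"
   by eventually_elim (auto simp: inner_diff_left)
  moreover have "(\<lambda>x. ind X x * \<bar>f' x - g' x\<bar>) \<in> bmeas borel"
  proof -
   have [measurable]: "g' \<in> bmeas borel" using g' by (simp add: represents_def)
   note [measurable] = f'(1) X
   show ?thesis by measurable
  qed
  ultimately show ?thesis unfolding represents_def by auto
 qed
 from represents_integral(2)[OF X borel_measurable_integrable[OF ib] this]
 have "(LL x. ind X x * \<bar>f' x - g' x\<bar>) = (LINT x|leb X. \<bar>(f x - g x) \<bullet> b\<bar>)" by simp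
 also have "\<dots> \<le> (LINT x|leb X. norm (f x - g x))"
  using i ib Basis_le_norm[OF b] by (intro integral_mono) auto
 finally show ?thesis .
qed

text \<open>The norm of H^1 contains the L^2 norms of the function and of its derivatives, and these dominate
the L^1 norms on a bounded domain.\<close>
lemma has_trace_imp_zero_normal_trace:
 assumes o: "open X" "bounded X" and tr: "has_trace X f g" and gn: "AE x in surface_measure X. g x \<bullet> outward_normal X x = 0"
  and u: "\<And>i. represents X (u i) (\<lambda>x. f x $ i)"
  and G: "\<And>i j. j \<in> Basis ==> represents X (G i j) (\<lambda>x. wderiv X j f x $ i)"
 shows "zero_normal_trace X u G"
proof -
 have bX: "X \<in> sets borel" using o by simp
 obtain \<phi> :: "nat => real^3 => real^3" where \<phi>: "\<And>n. smooth_on UNIV (\<phi> n)"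
  "(\<lambda>n. sobolev_norm 1 2 X (\<lambda>x. \<phi> n x - f x)) ----> 0"
  "(\<lambda>n. \<integral>\<^sup>+x. en ((norm (\<phi> n x - g x))\<^sup>2) \<partial>surface_measure X) ----> 0"
  and g: "g \<in> bmeas (surface_measure X)" and f: "f \<in> sobolev_carrier 1 2 X"
  using tr unfolding has_trace_def Wkp_def fst_conv snd_conv by blast
 have f1: "f \<in> sobolev_carrier (Suc 0) 2 X" using f by simp
 obtain K where K: "K \<ge> 0" "\<And>h::real^3 => real^3. h \<in> fst (Lp 2 X) ==> (LINT x|leb X. norm (h x)) \<le> K * snd (Lp 2 X) h"
  using L1_le_Lp[OF o, of 2, where 'b="real^3"] by auto
 define eps where "eps n = sobolev_norm 1 2 X (\<lambda>x. \<phi> n x - f x)" for n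
 have Keps: "(\<lambda>n. K * eps n) ----> 0" using tendsto_mult_left[OF \<phi>(2), of K] by (simp add: eps_def)
 note sc = smooth_on_continuous[OF \<phi>(1)]
 have c: "continuous_on UNIV h ==> h \<in> bmeas borel" for h :: "real^3 => real^3" by (rule borel_measurable_continuous_onI)
 have L: "(\<lambda>x. \<phi> n x - f x) \<in> fst (Lp 2 X)" for n
  by (rule Lp_diff[OF Lp_smooth[OF o sc] sobolev_carrier_Lp[OF f]]) simp_all
 have v0: "(LL x. ind X x * \<bar>\<phi> n x $ i - u i x\<bar>) \<le> K * eps n" for n i
 proof -
  have "(LL x. ind X x * \<bar>\<phi> n x $ i - u i x\<bar>) \<le> (LINT x|leb X. norm (\<phi> n x - f x))"
  proof (rule represents_LINT_abs_diff_le[OF bX Lp_imp_integrable[OF o _ L]])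
   show "axis i 1 \<in> (Basis :: (real^3) set)" by (simp add: axis_in_Basis_iff)
   show "(\<lambda>x. \<phi> n x $ i) \<in> bmeas borel" using borel_measurable_inner[OF c[OF sc[of n]] borel_measurable_const[of "axis i 1"]] by (simp add: inner_axis)
   show "represents X (u i) (\<lambda>x. f x \<bullet> axis i 1)" using u[of i] by (simp add: inner_axis)
  qed (auto simp: inner_axis)
  also have "\<dots> \<le> K * snd (Lp 2 X) (\<lambda>x. \<phi> n x - f x)" by (rule K(2)[OF L])
  also have "\<dots> \<le> K * eps n" unfolding eps_def by (intro mult_left_mono K(1) Lp_norm_le_sobolev)
  finally show ?thesis .
 qed
 have v1: "(LL x. ind X x * \<bar>fder (\<lambda>x. \<phi> n x $ i) x j - G i j x\<bar>) \<le> K * eps n"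
  if j: "j \<in> Basis" for n i j
 proof -
  let ?d = "\<lambda>x. fder (\<phi> n) x j"
  have fd: "fder (\<lambda>x. \<phi> n x $ i) x j = ?d x $ i" for x
  proof -
   have "((\<lambda>x. \<phi> n x $ i) has_derivative (\<lambda>h. fder (\<phi> n) x h $ i)) (at x)"
    by (rule bounded_linear.has_derivative[OF bounded_linear_vec_nth smooth_onD[OF open_UNIV \<phi>(1) UNIV_I]])
   from frechet_derivative_at[OF this] show ?thesis by metis
  qed
  have scd: "continuous_on UNIV ?d" by (rule smooth_on_continuous[OF smooth_on_deriv[OF \<phi>(1) j]])
  have Lw: "wderiv X j f \<in> fst (Lp 2 X)" using sobolev_carrier_wderiv(2)[OF o(1) f1 j] by simp
  have Ld: "(\<lambda>x. ?d x - wderiv X j f x) \<in> fst (Lp 2 X)"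
   by (rule Lp_diff[OF Lp_smooth[OF o scd] Lw]) simp_all
  have "weak_deriv X j (\<lambda>x. \<phi> n x - f x) (\<lambda>x. ?d x - wderiv X j f x)"
   by (rule weak_deriv_diff[OF o(1) weak_deriv_smooth[OF o \<phi>(1) j] sobolev_carrier_wderiv(1)[OF o(1) f1 j]])
  note wae = wderiv_AE_eq[OF o(1) this] and wm = wderiv_works[OF this]
  have wae': "AE x in leb X. ?d x - wderiv X j f x = wderiv X j (\<lambda>x. \<phi> n x - f x) x" using wae by eventually_elim simp
  have e: "snd (Lp 2 X) (wderiv X j (\<lambda>x. \<phi> n x - f x)) = snd (Lp 2 X) (\<lambda>x. ?d x - wderiv X j f x)"
   by (rule Lp_cong_AE(2)[OF Ld _ wae']) (use wm in \<open>auto simp: weak_deriv_def intro: locally_integrable_measurable[OF o(1)]\<close>)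
  have "(LL x. ind X x * \<bar>?d x $ i - G i j x\<bar>) \<le> (LINT x|leb X. norm (?d x - wderiv X j f x))"
  proof (rule represents_LINT_abs_diff_le[OF bX Lp_imp_integrable[OF o _ Ld]])
   show "axis i 1 \<in> (Basis :: (real^3) set)" by (simp add: axis_in_Basis_iff)
   show "(\<lambda>x. ?d x $ i) \<in> bmeas borel" using borel_measurable_inner[OF c[OF scd] borel_measurable_const[of "axis i 1"]] by (simp add: inner_axis)
   show "represents X (G i j) (\<lambda>x. wderiv X j f x \<bullet> axis i 1)" using G[OF j, of i] by (simp add: inner_axis)
  qed (auto simp: inner_axis)
  also have "\<dots> \<le> K * snd (Lp 2 X) (\<lambda>x. ?d x - wderiv X j f x)" by (rule K(2)[OF Ld])
  also have "\<dots> \<le> K * eps n"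
  proof (intro mult_left_mono K(1))
   have "snd (Lp 2 X) (wderiv X j (\<lambda>x. \<phi> n x - f x)) \<le> (\<Sum>j\<in>Basis. snd (Lp 2 X) (wderiv X j (\<lambda>x. \<phi> n x - f x)))"
    by (rule member_le_sum[OF j]) (auto simp: Lp_norm_nonneg)
   also have "\<dots> \<le> eps n" using Lp_norm_nonneg[of 2 X "\<lambda>x. \<phi> n x - f x"] by (simp add: eps_def)
   finally show "snd (Lp 2 X) (\<lambda>x. ?d x - wderiv X j f x) \<le> eps n" unfolding e .
  qed
  finally show ?thesis unfolding fd .
 qed
 have t: "a ----> 0" if "\<And>n. 0 \<le> a n" "\<And>n. a n \<le> K * eps n" for a :: "nat => real"
  by (rule tendsto_sandwich[OF _ _ tendsto_const Keps]) (use that in auto)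
 show ?thesis unfolding zero_normal_trace_def
 proof (intro exI[of _ "\<lambda>n i x. \<phi> n x $ i"] exI[of _ g] conjI allI ballI g gn)
  show "smooth_on UNIV (\<lambda>x. \<phi> n x $ i)" for n i by (rule smooth_on_bounded_linear[OF open_UNIV bounded_linear_vec_nth \<phi>(1)])
  show "(\<lambda>n. LL x. ind X x * \<bar>\<phi> n x $ i - u i x\<bar>) ----> 0" for i
   by (rule t[OF _ v0]) (auto intro!: Bintegral_nonneg)
  show "(\<lambda>n. LL x. ind X x * \<bar>fder (\<lambda>x. \<phi> n x $ i) x j - G i j x\<bar>) ----> 0"
   if "j \<in> Basis" for i j
   by (rule t[OF _ v1[OF that]]) (auto intro!: Bintegral_nonneg)
  show "(\<lambda>n. \<integral>\<^sup>+x. en ((norm ((\<chi> i. \<phi> n x $ i) - g x))\<^sup>2) \<partial>surface_measure X) ----> 0"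
   using \<phi>(3) by simp
 qed
qed

section \<open>The renormalized continuity equation\<close>

lemma poly_bounded_on:
 fixes p :: "real poly"
 shows "\<exists>K\<ge>0. \<forall>x. \<bar>x\<bar> \<le> B --> \<bar>poly p x\<bar> \<le> K"
proof -
 have "compact (poly p ` {-B..B})" by (rule compact_continuous_image) (auto intro: continuous_intros)
 then obtain K where K: "\<And>x. x \<in> {-B..B} ==> norm (poly p x) \<le> K"
  using compact_imp_bounded[of "poly p ` {-B..B}"] unfolding bounded_iff by blast
 have "\<bar>poly p x\<bar> \<le> max K 0" if "\<bar>x\<bar> \<le> B" for x using K[of x] that by (auto simp: abs_le_iff le_max_iff_disj)
 then show ?thesis by (intro exI[of _ "max K 0"]) simp
qed

text \<open>The chain rule for polynomials follows from the product rule by induction, since p(r) = a + r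
p1(r) when the constant coefficient a is split off.\<close>
lemma wd_poly:
 fixes r :: "'a::euclidean_space => real"
 assumes o: "open X" "bounded X" and i: "i \<in> Basis" and r: "wd X i r r'" and B: "\<And>x. \<bar>r x\<bar> \<le> B"
 shows "wd X i (\<lambda>x. ind X x * poly p (r x)) (\<lambda>x. ind X x * poly (pderiv p) (r x) * r' x)"
proof (induction p)
 case 0
 show ?case using wd_smooth[OF smooth_on_const[of UNIV 0] o i] by simp
next
 case (pCons a p)
 obtain K where K: "K \<ge> 0" "\<And>x. \<bar>x\<bar> \<le> B ==> \<bar>poly p x\<bar> \<le> K" using poly_bounded_on[of B p] by blast
 have fc: "fder (\<lambda>x. a) x i = 0" for x :: 'a
  using frechet_derivative_at[OF has_derivative_const[of a "at x"]] by metis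
 have "wd X i (\<lambda>x. ind X x * a) (\<lambda>x. ind X x * 0)"
  using wd_smooth[OF smooth_on_const[of UNIV a] o i] unfolding fc .
 moreover have "wd X i (\<lambda>x. r x * (ind X x * poly p (r x)))
   (\<lambda>x. r x * (ind X x * poly (pderiv p) (r x) * r' x) + ind X x * poly p (r x) * r' x)"
 proof (rule wd_mult[OF r pCons.IH o(1)])
  show "\<bar>r x\<bar> \<le> max B K" "\<bar>ind X x * poly p (r x)\<bar> \<le> max B K" for x
   using B[of x] K(1) K(2)[OF B[of x]] by (auto simp: indicator_def split: if_splits)
 qed
 ultimately have "wd X i (\<lambda>x. ind X x * a + r x * (ind X x * poly p (r x)))
   (\<lambda>x. ind X x * 0 + (r x * (ind X x * poly (pderiv p) (r x) * r' x) + ind X x * poly p (r x) * r' x))"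
  by (rule wd_add)
 then show ?case by (simp add: pderiv_pCons algebra_simps)
qed

text \<open>With D = p'(r) the product rule gives div (p(r) u) = D u . grad r + p(r) div u and p'(r) div (r u)
= D u . grad r + r D div u. The integral of the former vanishes by the divergence theorem; subtracting
eliminates the term with grad r. The divergence theorem applies because p(r) u is a bounded multiple of a
field with zero normal trace.\<close>
lemma renormalized_divergence:
 fixes p :: "real poly"
 assumes X: "smooth_bounded_domain X" and q: "q > 3"
  and r: "r \<in> sobolev_carrier 1 q X" and rB: "AE x in leb X. \<bar>r x\<bar> \<le> B"
  and u: "u \<in> sobolev_carrier 2 q X"
  and tr: "has_trace X u g" and gn: "AE x in surface_measure X. g x \<bullet> outward_normal X x = 0"
 shows "(LINT x|leb X. poly (pderiv p) (r x) * wdiv X (\<lambda>y. r y *\<^sub>R u y) x)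
  = - (LINT x|leb X. (poly p (r x) - r x * poly (pderiv p) (r x)) * wdiv X u x)"
  "(\<lambda>x. poly (pderiv p) (r x) * wdiv X (\<lambda>y. r y *\<^sub>R u y) x) \<in> bmeas (leb X)"
proof -
 have o: "open X" "bounded X" using X by (auto simp: smooth_bounded_domain_def)
 have bX[measurable]: "X \<in> sets borel" using o by simp
 have q1: "q > 1" using q by simp
 have ax: "axis i 1 \<in> (Basis :: (real^3) set)" for i by (simp add: axis_in_Basis_iff)
 have r1: "r \<in> sobolev_carrier (Suc 0) q X" using r by simp
 have u2: "u \<in> sobolev_carrier (Suc 1) q X" using u by (simp add: numeral_2_eq_2)
 then have u1: "u \<in> sobolev_carrier (Suc 0) q X" using sobolev_carrier_Suc_subset by auto
 have mr: "r \<in> bmeas (leb X)" using sobolev_carrier_Lp[OF r] by (simp add: Lp_iff)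
 have mu: "u \<in> bmeas (leb X)" using sobolev_carrier_Lp[OF u] by (simp add: Lp_iff)
 have mur: "(\<lambda>x. u x $ i) \<in> bmeas (leb X)" for i
  using borel_measurable_inner[OF mu borel_measurable_const[of "axis i 1"]] by (simp add: inner_axis)
 have mdr: "wderiv X j r \<in> bmeas (leb X)" if "j \<in> Basis" for j
  using sobolev_carrier_Lp[OF sobolev_carrier_wderiv(2)[OF o(1) r1 that]] by (simp add: Lp_iff)
 have mdu: "wderiv X j u \<in> bmeas (leb X)" if "j \<in> Basis" for j
  using sobolev_carrier_Lp[OF sobolev_carrier_wderiv(2)[OF o(1) u1 that]] by (simp add: Lp_iff)
 have mdui: "(\<lambda>x. wderiv X j u x $ i) \<in> bmeas (leb X)" if "j \<in> Basis" for i j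
  using borel_measurable_inner[OF mdu[OF that] borel_measurable_const[of "axis i 1"]] by (simp add: inner_axis)
 obtain C where C: "C \<ge> 0" "\<And>f::real^3 => real^3. f \<in> sobolev_carrier 1 q X ==>
  \<forall>b\<in>Basis. AE x in leb X. \<bar>f x \<bullet> b\<bar> \<le> C * sobolev_norm 1 q X f"
  using sobolev_sup_bound[OF X q, where 'b="real^3"] by blast
 define A where "A = max (max B 0) (C * sobolev_norm 1 q X u)"
 have A: "A \<ge> 0" by (simp add: A_def)
 have uA: "AE x in leb X. \<bar>u x $ i\<bar> \<le> A" for i
 proof -
  have "AE x in leb X. \<bar>u x \<bullet> axis i 1\<bar> \<le> C * sobolev_norm 1 q X u" using C(2) u1 ax by simp
  then show ?thesis by eventually_elim (simp add: A_def inner_axis)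
 qed
 have rA: "AE x in leb X. \<bar>r x\<bar> \<le> A" using rB by eventually_elim (simp add: A_def)
 obtain R where R: "represents X R r" "\<And>x. \<bar>R x\<bar> \<le> A" using represents_clipped[OF bX mr A rA] by blast
 have "\<forall>i. \<exists>U. represents X U (\<lambda>x. u x $ i) \<and> (\<forall>x. \<bar>U x\<bar> \<le> A)" using represents_clipped[OF bX mur A uA] by blast
 then obtain U where U: "\<And>i. represents X (U i) (\<lambda>x. u x $ i)" "\<And>i x. \<bar>U i x\<bar> \<le> A" unfolding choice_iff by blast
 have "\<forall>j\<in>Basis. \<exists>g. represents X g (wderiv X j r)" using represents_exists[OF bX mdr] by blast
 then obtain R' where R': "\<And>j. j \<in> Basis ==> represents X (R' j) (wderiv X j r)" unfolding bchoice_iff by blast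
 have "\<forall>i. \<forall>j\<in>Basis. \<exists>g. represents X g (\<lambda>x. wderiv X j u x $ i)" using represents_exists[OF bX mdui] by blast
 then obtain G where G: "\<And>i j. j \<in> Basis ==> represents X (G i j) (\<lambda>x. wderiv X j u x $ i)"
  unfolding bchoice_iff choice_iff by blast
 have wr: "wd X j R (R' j)" if "j \<in> Basis" for j
  by (rule sobolev_component_wd[OF o q1 r1 that, of 1]) (use R R'[OF that] in auto)
 have wu: "wd X j (U i) (G i j)" if "j \<in> Basis" for i j
  by (rule sobolev_component_wd[OF o q1 u1 that ax[of i]]) (use U(1)[of i] G[OF that, of i] in \<open>auto simp: inner_axis\<close>)
 have Rae: "AE x in lborel. x \<in> X --> R x = r x" using R by (simp add: represents_def)
 have R'ae: "AE x in lborel. x \<in> X --> R' j x = wderiv X j r x" if "j \<in> Basis" for j using R'[OF that] by (simp add: represents_def)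
 have Uae: "AE x in lborel. x \<in> X --> U i x = u x $ i" for i using U by (simp add: represents_def)
 have Gae: "AE x in lborel. x \<in> X --> G i j x = wderiv X j u x $ i" if "j \<in> Basis" for i j using G[OF that] by (simp add: represents_def)
 have wru: "wd X j (\<lambda>x. R x * U i x) (\<lambda>x. R x * G i j x + U i x * R' j x)" if "j \<in> Basis" for i j
  by (rule wd_mult[OF wr[OF that] wu[OF that] o(1) R(2) U(2)])
 \<comment> \<open>This identifies the weak derivative chosen by \<open>wderiv\<close> for the momentum with the one that the product rule gives.\<close>
 have wru': "weak_deriv X j (\<lambda>y. r y *\<^sub>R u y) (\<lambda>x. r x *\<^sub>R wderiv X j u x + wderiv X j r x *\<^sub>R u x)"
  if j: "j \<in> Basis" for j
 proof (rule wd_imp_weak_deriv[OF o j])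
  show "(\<lambda>y. r y *\<^sub>R u y) \<in> bmeas (leb X)" using mr mu by simp
  show "(\<lambda>x. r x *\<^sub>R wderiv X j u x + wderiv X j r x *\<^sub>R u x) \<in> bmeas (leb X)"
   using mr mu mdr[OF j] mdu[OF j] by simp
  fix b :: "real^3" assume "b \<in> Basis"
  then obtain i where b: "b = axis i 1" unfolding Basis_vec_def by auto
  let ?i = "SOME i. b = axis i (1::real)"
  have i: "b = axis ?i 1" using someI[of "\<lambda>i. b = axis i (1::real)", OF b] .
  show "wd X j (\<lambda>x. R x * U ?i x) (\<lambda>x. R x * G ?i j x + U ?i x * R' j x)" by (rule wru[OF j])
  show "represents X (\<lambda>x. R x * U ?i x) (\<lambda>x. (r x *\<^sub>R u x) \<bullet> b)"
   unfolding represents_def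
  proof (intro conjI)
   show "AE x in lborel. x \<in> X --> R x * U ?i x = (r x *\<^sub>R u x) \<bullet> b"
    using Rae Uae[of ?i] by eventually_elim (subst (2) i, simp add: inner_axis)
  qed (use R U(1)[of ?i] in \<open>auto simp: represents_def\<close>)
  show "represents X (\<lambda>x. R x * G ?i j x + U ?i x * R' j x) (\<lambda>x. (r x *\<^sub>R wderiv X j u x + wderiv X j r x *\<^sub>R u x) \<bullet> b)"
   unfolding represents_def
  proof (intro conjI)
   show "AE x in lborel. x \<in> X --> R x * G ?i j x + U ?i x * R' j x = (r x *\<^sub>R wderiv X j u x + wderiv X j r x *\<^sub>R u x) \<bullet> b"
    using Rae Uae[of ?i] R'ae[OF j] Gae[OF j, of ?i] by eventually_elim (subst (3) i, simp add: inner_axis inner_add_left)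
  qed (use R U(1)[of ?i] R'[OF j] G[OF j, of ?i] in \<open>auto simp: represents_def\<close>)
 qed
 note wm = wderiv_AE_eq[OF o(1) wru']
 have div_m: "AE x in lborel. x \<in> X --> wdiv X (\<lambda>y. r y *\<^sub>R u y) x = (\<Sum>i\<in>UNIV. R x * G i (axis i 1) x + U i x * R' (axis i 1) x)"
 proof -
  have "AE x in lborel. \<forall>i\<in>UNIV. x \<in> X --> wderiv X (axis i 1) (\<lambda>y. r y *\<^sub>R u y) x $ i = R x * G i (axis i 1) x + U i x * R' (axis i 1) x"
  proof (rule AE_finite_allI)
   fix i :: 3
   show "AE x in lborel. x \<in> X --> wderiv X (axis i 1) (\<lambda>y. r y *\<^sub>R u y) x $ i = R x * G i (axis i 1) x + U i x * R' (axis i 1) x"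
    using wm[OF ax[of i], unfolded AE_lebesgue_on_iff[OF bX]] Rae Uae[of i] R'ae[OF ax[of i]] Gae[OF ax[of i], of i]
    by eventually_elim auto
  qed simp
  then show ?thesis by eventually_elim (auto simp: wdiv_def)
 qed
 have div_u: "AE x in lborel. x \<in> X --> wdiv X u x = (\<Sum>i\<in>UNIV. G i (axis i 1) x)"
 proof -
  have "AE x in lborel. \<forall>i\<in>UNIV. x \<in> X --> wderiv X (axis i 1) u x $ i = G i (axis i 1) x"
  proof (rule AE_finite_allI)
   show "AE x in lborel. x \<in> X --> wderiv X (axis i 1) u x $ i = G i (axis i 1) x" for i
    using Gae[OF ax[of i], of i] by eventually_elim auto
  qed simp
  then show ?thesis by eventually_elim (auto simp: wdiv_def)
 qed
 define P where "P x = ind X x * poly p (R x)" for x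
 define D where "D x = ind X x * poly (pderiv p) (R x)" for x
 obtain K where K: "K \<ge> 0" "\<And>x. \<bar>x\<bar> \<le> A ==> \<bar>poly p x\<bar> \<le> K" using poly_bounded_on[of A p] by blast
 obtain K' where K': "K' \<ge> 0" "\<And>x. \<bar>x\<bar> \<le> A ==> \<bar>poly (pderiv p) x\<bar> \<le> K'" using poly_bounded_on[of A "pderiv p"] by blast
 have PB: "\<bar>P x\<bar> \<le> K" and DB: "\<bar>D x\<bar> \<le> K'" for x
  using K(1) K(2)[OF R(2)[of x]] K'(1) K'(2)[OF R(2)[of x]] by (auto simp: P_def D_def indicator_def)
 have wP: "wd X j P (\<lambda>x. D x * R' j x)" if "j \<in> Basis" for j
  using wd_poly[OF o that wr[OF that] R(2), of p] unfolding P_def D_def .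
 have wPu: "wd X (axis i 1) (\<lambda>x. P x * U i x) (\<lambda>x. P x * G i (axis i 1) x + U i x * (D x * R' (axis i 1) x))" for i
  by (rule wd_mult[OF wP[OF ax] wu[OF ax] o(1), of "max K A"]) (auto simp: le_max_iff_disj PB U(2))
 have cont: "continuous_on UNIV (poly s)" for s :: "real poly" by (intro continuous_intros)
 have [measurable]: "R \<in> bmeas borel" using R by (simp add: represents_def)
 have Ppm[measurable]: "(\<lambda>x. poly s (R x)) \<in> bmeas borel" for s :: "real poly"
  using measurable_compose[OF \<open>R \<in> bmeas borel\<close> borel_measurable_continuous_onI[OF cont]] .
 have [measurable]: "P \<in> bmeas borel" "D \<in> bmeas borel" unfolding P_def D_def by measurable
 define W where "W x = D x * (\<Sum>i\<in>UNIV. R x * G i (axis i 1) x + U i x * R' (axis i 1) x)" for x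
 define V where "V x = (P x - R x * D x) * (\<Sum>i\<in>UNIV. G i (axis i 1) x)" for x
 have z: "ind X x * (\<Sum>i\<in>UNIV. P x * G i (axis i 1) x + U i x * (D x * R' (axis i 1) x)) = W x + V x" for x
  by (cases "x \<in> X") (simp_all add: W_def V_def P_def D_def sum.distrib sum_distrib_left algebra_simps)
 have i0: "(LL x. W x + V x) = 0"
 proof -
  have "(LL x. ind X x * (\<Sum>i\<in>UNIV. P x * G i (axis i 1) x + U i x * (D x * R' (axis i 1) x))) = 0"
  proof (rule divergence_theorem_tangent[OF X _ _ has_trace_imp_zero_normal_trace[OF o tr gn U(1) G] wPu refl PB])
   show "integ (U i)" for i by (rule wdD(1)[OF wu[OF ax]])
   show "integ (G i j)" if "j \<in> Basis" for i j by (rule wdD(2)[OF wu[OF that]])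
  qed
  then show ?thesis unfolding z .
 qed
 have iW: "integ W" unfolding W_def
  by (rule integrable_bounded_mult[OF _ _ DB]) (use wdD(2)[OF wru[OF ax]] in auto)
 have iV: "integ V"
 proof -
  have "\<bar>P x - R x * D x\<bar> \<le> K + A * K'" for x
  proof -
   have "\<bar>R x * D x\<bar> \<le> A * K'" unfolding abs_mult by (rule mult_mono[OF R(2) DB]) (use A in auto)
   then show ?thesis using PB[of x] by linarith
  qed
  then show ?thesis unfolding V_def by (rule integrable_bounded_mult[rotated 2]) (use wdD(2)[OF wu[OF ax]] in auto)
 qed
 have rW: "represents X W (\<lambda>x. poly (pderiv p) (r x) * wdiv X (\<lambda>y. r y *\<^sub>R u y) x)" unfolding represents_def
 proof (intro conjI)
  show "AE x in lborel. x \<in> X --> W x = poly (pderiv p) (r x) * wdiv X (\<lambda>y. r y *\<^sub>R u y) x"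
   using Rae div_m by eventually_elim (auto simp: W_def D_def)
 qed (use iW in \<open>auto simp: W_def D_def dest: borel_measurable_integrable\<close>)
 have rV: "represents X V (\<lambda>x. (poly p (r x) - r x * poly (pderiv p) (r x)) * wdiv X u x)" unfolding represents_def
 proof (intro conjI)
  show "AE x in lborel. x \<in> X --> V x = (poly p (r x) - r x * poly (pderiv p) (r x)) * wdiv X u x"
   using Rae div_u by eventually_elim (auto simp: V_def P_def D_def)
 qed (use iV in \<open>auto simp: V_def P_def D_def dest: borel_measurable_integrable\<close>)
 note pm = measurable_compose[OF mr borel_measurable_continuous_onI[OF cont]]
 have wdm: "wdiv X (\<lambda>y. r y *\<^sub>R u y) \<in> bmeas (leb X)"
 proof -
  have "wderiv X j (\<lambda>y. r y *\<^sub>R u y) \<in> bmeas (leb X)" if j: "j \<in> Basis" for j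
   using wderiv_works[OF wru'[OF j]] locally_integrable_measurable[OF o(1)] unfolding weak_deriv_def by blast
  from borel_measurable_inner[OF this[OF ax] borel_measurable_const]
  have "(\<lambda>x. wderiv X (axis i 1) (\<lambda>y. r y *\<^sub>R u y) x \<bullet> axis i 1) \<in> bmeas (leb X)" for i .
  then show ?thesis unfolding wdiv_def inner_axis by (intro borel_measurable_sum) simp
 qed
 have wum: "wdiv X u \<in> bmeas (leb X)"
  unfolding wdiv_def using mdui[OF ax] by (intro borel_measurable_sum) auto
 show m: "(\<lambda>x. poly (pderiv p) (r x) * wdiv X (\<lambda>y. r y *\<^sub>R u y) x) \<in> bmeas (leb X)"
  using pm wdm by simp
 have m2: "(\<lambda>x. (poly p (r x) - r x * poly (pderiv p) (r x)) * wdiv X u x) \<in> bmeas (leb X)"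
  using pm wum mr by simp
 show "(LINT x|leb X. poly (pderiv p) (r x) * wdiv X (\<lambda>y. r y *\<^sub>R u y) x)
  = - (LINT x|leb X. (poly p (r x) - r x * poly (pderiv p) (r x)) * wdiv X u x)"
  using i0 iW iV represents_integral(2)[OF bX m rW] represents_integral(2)[OF bX m2 rV] by simp
qed

text \<open>Induction over the coefficients: the remainder of c + x p is a R + (b - a) R + p'(a) (b - a)^2, if
R is the one of p.\<close>
lemma poly_taylor_bound:
 fixes p :: "real poly"
 assumes M: "M \<ge> 0"
 shows "\<exists>C\<ge>0. \<forall>a b. \<bar>a\<bar> \<le> M --> \<bar>b\<bar> \<le> M --> \<bar>poly p b - poly p a - poly (pderiv p) a * (b - a)\<bar> \<le> C * (b - a)\<^sup>2"
proof (induction p)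
 case 0
 show ?case by (intro exI[of _ 0]) simp
next
 case (pCons c p)
 obtain C where C: "C \<ge> 0" "\<And>a b. \<bar>a\<bar> \<le> M ==> \<bar>b\<bar> \<le> M ==> \<bar>poly p b - poly p a - poly (pderiv p) a * (b - a)\<bar> \<le> C * (b - a)\<^sup>2"
  using pCons.IH by blast
 obtain K where K: "K \<ge> 0" "\<And>x. \<bar>x\<bar> \<le> M ==> \<bar>poly (pderiv p) x\<bar> \<le> K" using poly_bounded_on[of M "pderiv p"] by blast
 have "\<bar>poly (pCons c p) b - poly (pCons c p) a - poly (pderiv (pCons c p)) a * (b - a)\<bar> \<le> (3 * M * C + K) * (b - a)\<^sup>2"
  if a: "\<bar>a\<bar> \<le> M" and b: "\<bar>b\<bar> \<le> M" for a b
 proof -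
  define R where "R = poly p b - poly p a - poly (pderiv p) a * (b - a)"
  have R: "\<bar>R\<bar> \<le> C * (b - a)\<^sup>2" unfolding R_def by (rule C(2)[OF a b])
  have "poly (pCons c p) b - poly (pCons c p) a - poly (pderiv (pCons c p)) a * (b - a) = a * R + (b - a) * R + poly (pderiv p) a * (b - a)\<^sup>2"
   by (simp add: R_def pderiv_pCons algebra_simps power2_eq_square)
  moreover have "\<bar>a * R\<bar> \<le> M * (C * (b - a)\<^sup>2)" unfolding abs_mult using a R M by (intro mult_mono) auto
  moreover have "\<bar>(b - a) * R\<bar> \<le> 2 * M * (C * (b - a)\<^sup>2)" unfolding abs_mult using a b R M by (intro mult_mono) auto
  moreover have "\<bar>poly (pderiv p) a * (b - a)\<^sup>2\<bar> \<le> K * (b - a)\<^sup>2" unfolding abs_mult using K(2)[OF a] by (simp add: mult_right_mono)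
  ultimately show ?thesis by (simp add: algebra_simps)
 qed
 then show ?case using M C(1) K(1) by (intro exI[of _ "3 * M * C + K"]) auto
qed

section \<open>Differentiability in time of the density\<close>

text \<open>Products of test functions in time and in space are test functions on the cylinder.\<close>
lemma test_function_prod:
 fixes \<psi> :: "'a::euclidean_space => real"
 assumes \<theta>: "test_function A \<theta>" and \<psi>: "test_function B \<psi>"
 shows "test_function (A \<times> B) (\<lambda>z. \<theta> (fst z) * \<psi> (snd z))"
  "fder (\<lambda>z. \<theta> (fst z) * \<psi> (snd z)) (t, x) (1::real, 0) = fder \<theta> t 1 * \<psi> x"
proof -
 obtain K where K: "compact K" "K \<subseteq> A" "\<And>x. x \<notin> K ==> \<theta> x = 0" using \<theta> unfolding test_function_def by blast
 obtain L where L: "compact L" "L \<subseteq> B" "\<And>x. x \<notin> L ==> \<psi> x = 0" using \<psi> unfolding test_function_def by blast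
 have s: "smooth_on UNIV \<theta>" "smooth_on UNIV \<psi>" using assms by (auto simp: test_function_def)
 have "smooth_on UNIV (\<lambda>z::real \<times> 'a. \<theta> (fst z))" "smooth_on UNIV (\<lambda>z::real \<times> 'a. \<psi> (snd z))"
  by (rule smooth_on_compose[OF open_UNIV open_UNIV _ s(1)], rule smooth_on_linear[OF open_UNIV bounded_linear_fst], simp,
    rule smooth_on_compose[OF open_UNIV open_UNIV _ s(2)], rule smooth_on_linear[OF open_UNIV bounded_linear_snd], simp)
 then have "smooth_on UNIV (\<lambda>z. \<theta> (fst z) * \<psi> (snd z))" by (rule smooth_on_mult[OF open_UNIV])
 moreover have "\<theta> (fst z) * \<psi> (snd z) = 0" if "z \<notin> K \<times> L" for z using that K(3) L(3) by (cases z) auto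
 moreover have "K \<times> L \<subseteq> A \<times> B" using K L by auto
 ultimately show "test_function (A \<times> B) (\<lambda>z. \<theta> (fst z) * \<psi> (snd z))"
  using compact_Times[OF K(1) L(1)] unfolding test_function_def by blast
 have d\<theta>: "((\<lambda>z. \<theta> (fst z)) has_derivative (\<lambda>h. fder \<theta> t (fst h))) (at (t, x))"
  by (rule has_derivative_compose[OF has_derivative_fst[OF has_derivative_ident]])
   (use smooth_onD[OF open_UNIV s(1) UNIV_I] in simp)
 have d\<psi>: "((\<lambda>z. \<psi> (snd z)) has_derivative (\<lambda>h. fder \<psi> x (snd h))) (at (t, x))"
  by (rule has_derivative_compose[OF has_derivative_snd[OF has_derivative_ident]])
   (use smooth_onD[OF open_UNIV s(2) UNIV_I] in simp)
 have "fder \<psi> x 0 = 0" using linear_0[OF has_derivative_linear[OF smooth_onD[OF open_UNIV s(2) UNIV_I]]] .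
 then show "fder (\<lambda>z. \<theta> (fst z) * \<psi> (snd z)) (t, x) (1, 0) = fder \<theta> t 1 * \<psi> x"
  by (simp add: frechet_derivative_at[OF has_derivative_mult[OF d\<theta> d\<psi>], symmetric])
qed

lemma C_time_L1:
 fixes f :: "real => 'a::euclidean_space => 'b::euclidean_space"
 assumes o: "open X" "bounded X" and q: "q > 1" and f: "C_time T (Wkp k q X) f" and t: "t \<in> {0..T}"
 shows "((\<lambda>s. LINT x|leb X. norm (f s x - f t x)) \<longlongrightarrow> 0) (at t within {0..T})"
proof -
 obtain K where K: "K \<ge> 0" "\<And>h::'a => 'b. h \<in> fst (Lp q X) ==> (LINT x|leb X. norm (h x)) \<le> K * snd (Lp q X) h"
  using L1_le_Lp[OF o q, where 'b='b] by auto
 have L: "f s \<in> fst (Lp q X)" if "s \<in> {0..T}" for s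
  using f that sobolev_carrier_Lp unfolding C_time_def Wkp_def by fastforce
 have lim: "((\<lambda>s. sobolev_norm k q X (\<lambda>x. f s x - f t x)) \<longlongrightarrow> 0) (at t within {0..T})"
  using f t unfolding C_time_def Wkp_def by simp
 have le: "(LINT x|leb X. norm (f s x - f t x)) \<le> K * sobolev_norm k q X (\<lambda>x. f s x - f t x)" if "s \<in> {0..T}" for s
 proof -
  have "(LINT x|leb X. norm (f s x - f t x)) \<le> K * snd (Lp q X) (\<lambda>x. f s x - f t x)"
   using q by (intro K(2) Lp_diff L that t) simp
  also have "\<dots> \<le> K * sobolev_norm k q X (\<lambda>x. f s x - f t x)" by (intro mult_left_mono Lp_norm_le_sobolev K(1))
  finally show ?thesis .
 qed
 have "((\<lambda>s. K * sobolev_norm k q X (\<lambda>x. f s x - f t x)) \<longlongrightarrow> 0) (at t within {0..T})"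
  using tendsto_mult_left[OF lim, of K] by simp
 then show ?thesis
 proof (rule tendsto_sandwich[OF _ _ tendsto_const, rotated 2])
  show "\<forall>\<^sub>F s in at t within {0..T}. (LINT x|leb X. norm (f s x - f t x)) \<le> K * sobolev_norm k q X (\<lambda>x. f s x - f t x)"
   using le by (auto simp: eventually_at_filter)
 qed (auto intro!: always_eventually Bintegral_nonneg)
qed

lemma Wkp_0: "Wkp 0 q X = Lp q X" by (simp add: Wkp_def Lp_def fun_eq_iff)

lemma C_time_Lp:
 fixes f :: "real => 'a::euclidean_space => 'b::euclidean_space"
 assumes "C_time T (Wkp k q X) f" "t \<in> {0..T}" shows "f t \<in> fst (Lp q X)"
 using assms sobolev_carrier_Lp unfolding C_time_def Wkp_def by fastforce

lemma C_time_pairing_continuous: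
 fixes f :: "real => 'a::euclidean_space => real"
 assumes o: "open X" "bounded X" and q: "q > 1" and f: "C_time T (Wkp k q X) f"
  and w: "w \<in> bmeas (leb X)" "\<And>x. \<bar>w x\<bar> \<le> B"
 shows "continuous_on {0..T} (\<lambda>t. LINT x|leb X. w x * f t x)"
 unfolding continuous_on_def
proof (rule ballI, rule LIM_zero_cancel, rule Lim_null_comparison)
 fix t assume t: "t \<in> {0..T}"
 have i: "integrable (leb X) (f s)" if "s \<in> {0..T}" for s by (rule Lp_imp_integrable[OF o q C_time_Lp[OF f that]])
 have iw: "integrable (leb X) (\<lambda>x. w x * g x)" if "integrable (leb X) g" for g
  by (rule Bintegrable_bound[OF integrable_mult_right[OF integrable_abs[OF that], of B]])
   (use w borel_measurable_integrable[OF that] in \<open>auto simp: abs_mult intro!: mult_right_mono order_trans[OF w(2) abs_ge_self]\<close>)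
 show "((\<lambda>s. B * (LINT x|leb X. norm (f s x - f t x))) \<longlongrightarrow> 0) (at t within {0..T})"
  using tendsto_mult_left[OF C_time_L1[OF o q f t], of B] by simp
 have "norm ((LINT x|leb X. w x * f s x) - (LINT x|leb X. w x * f t x)) \<le> B * (LINT x|leb X. norm (f s x - f t x))"
  if s: "s \<in> {0..T}" for s
 proof -
  have d: "integrable (leb X) (\<lambda>x. f s x - f t x)" using i[OF s] i[OF t] by simp
  have "(LINT x|leb X. w x * f s x) - (LINT x|leb X. w x * f t x) = (LINT x|leb X. w x * (f s x - f t x))"
   using iw[OF i[OF s]] iw[OF i[OF t]] by (simp add: right_diff_distrib)
  also have "norm \<dots> \<le> (LINT x|leb X. norm (w x * (f s x - f t x)))" by (rule integral_norm_bound)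
  also have "\<dots> \<le> (LINT x|leb X. B * norm (f s x - f t x))"
   by (rule integral_mono[OF integrable_norm[OF iw[OF d]] integrable_mult_right[OF integrable_norm[OF d]]])
    (auto simp: abs_mult w(2) intro!: mult_right_mono)
  finally show ?thesis by simp
 qed
 then show "\<forall>\<^sub>F s in at t within {0..T}. norm ((LINT x|leb X. w x * f s x) - (LINT x|leb X. w x * f t x))
   \<le> B * (LINT x|leb X. norm (f s x - f t x))"
  by (auto simp: eventually_at_filter)
qed

text \<open>A nonempty open set is not a null set.\<close>
lemma continuous_AE_le_imp_le:
 fixes h :: "'a::euclidean_space => real"
 assumes V: "open V" and h: "continuous_on V h" and ae: "AE x in lborel. x \<in> V --> h x \<le> c" and x: "x \<in> V"
 shows "h x \<le> c"
proof (rule ccontr)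
 assume "\<not> h x \<le> c"
 define S where "S = {y \<in> V. c < h y}"
 have "open S" using continuous_open_preimage[OF h V open_greaterThan[of c]] by (simp add: S_def vimage_def Int_def)
 moreover have "x \<in> S" using x \<open>\<not> h x \<le> c\<close> by (simp add: S_def)
 ultimately have "S \<notin> null_sets lebesgue" using open_not_negligible[of S] negligible_iff_null_sets by blast
 moreover have "AE y in lborel. y \<notin> S" using ae by eventually_elim (auto simp: S_def)
 then have "S \<in> null_sets lborel" using \<open>open S\<close> AE_iff_null_sets[of S lborel] by simp
 ultimately show False using null_sets_completionI by blast
qed

lemma unit_interval_mean_bound:
 fixes h :: "real => real"
 assumes h: "continuous_on {0..1} h" and b: "\<And>s. s \<in> {0..1} ==> \<bar>h s - c\<bar> \<le> d"
 shows "\<bar>(LL s. ind {0..1} s * h s) - c\<bar> \<le> d"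
proof -
 have i: "integ (\<lambda>s. ind {0..1} s * g s)" if "continuous_on {0..1} g" for g :: "real => real"
  using borel_integrable_compact[OF compact_Icc that] by simp
 have one: "(LL s. ind {0..1::real} s * (e::real)) = e" for e by simp
 have "(LL s. ind {0..1} s * h s) - c = (LL s. ind {0..1} s * h s - ind {0..1} s * c)"
  using one[of c] Bintegral_diff[OF i[OF h] i[OF continuous_on_const[of _ c]]] by simp
 also have "\<bar>\<dots>\<bar> \<le> (LL s. \<bar>ind {0..1} s * h s - ind {0..1} s * c\<bar>)"
  using integral_norm_bound by simp
 also have "\<dots> \<le> (LL s. ind {0..1::real} s * d)"
  using i[OF h] i[OF continuous_on_const[of _ c]] i[OF continuous_on_const[of _ d]] b
  by (intro integral_mono) (auto simp: indicator_def)
 finally show ?thesis unfolding one .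
qed

text \<open>The part of the definition of strong solutions that concerns the regularity of the density in
time. The bound q > 2 makes the time derivative square integrable.\<close>
locale density_evolution =
 fixes X :: "'a::euclidean_space set" and T q :: real and \<rho> rt :: "real => 'a => real"
 assumes o: "open X" "bounded X" and q: "q > 2"
  and w: "weak_time_deriv T X \<rho> rt" and \<rho>: "C_time T (Wkp 1 q X) \<rho>" and rt: "C_time T (Wkp 0 q X) rt"
begin

lemma q1: "q > 1" using q by simp
lemma bX: "X \<in> sets borel" using o by simp

lemma integrable_density: "t \<in> {0..T} ==> integrable (leb X) (\<rho> t)"
 "t \<in> {0..T} ==> integrable (leb X) (rt t)"
 by (rule Lp_imp_integrable[OF o q1 C_time_Lp[OF \<rho>]], assumption, rule Lp_imp_integrable[OF o q1 C_time_Lp[OF rt]])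

text \<open>Testing the time derivative with products of functions of t and of x shows that the scalar
function of time obtained by pairing the density with psi has the paired time derivative as its weak
derivative.\<close>
lemma wd_pairing:
 assumes \<psi>: "test_function X \<psi>"
 shows "wd {0<..<T} 1 (\<lambda>t. ind {0<..<T} t * (LINT x|leb X. \<psi> x * \<rho> t x))
   (\<lambda>t. ind {0<..<T} t * (LINT x|leb X. \<psi> x * rt t x))"
 unfolding wd_def
proof (intro conjI allI impI)
 obtain B where B: "\<And>x. \<bar>\<psi> x\<bar> \<le> B" using test_function_bounded[OF \<psi>] by blast
 note m = borel_imp_lebesgue_on[OF test_functionD(3)[OF \<psi>], of X]
 note c\<rho> = C_time_pairing_continuous[OF o q1 \<rho> m B] and crt = C_time_pairing_continuous[OF o q1 rt m B]
 have int: "integ (\<lambda>t. ind {0<..<T} t * h t)" if h: "continuous_on {0..T} h" for h :: "real => real"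
 proof -
  have "integ (\<lambda>t. ind {0..T} t *\<^sub>R h t)" by (rule borel_integrable_compact[OF compact_Icc h])
  then have "integ (\<lambda>t. ind {0<..<T} t * (ind {0..T} t *\<^sub>R h t))"
   by (rule integrable_bounded_mult[where B=1]) auto
  then show ?thesis by (rule Bintegrable_cong[THEN iffD1, rotated 2]) (auto simp: indicator_def)
 qed
 show "integ (\<lambda>t. ind {0<..<T} t * (LINT x|leb X. \<psi> x * \<rho> t x))" by (rule int[OF c\<rho>])
 show "integ (\<lambda>t. ind {0<..<T} t * (LINT x|leb X. \<psi> x * rt t x))" by (rule int[OF crt])
 fix \<theta> assume \<theta>: "test_function {0<..<T} \<theta>"
 have z: "a t = 0" if "test_function {0<..<T} a" "t \<notin> {0<..<T}" for a :: "real => real" and t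
  using that unfolding test_function_def by blast
 have conv: "(LINT t|leb {0..T}. a t * h t) = (LL t. a t * (ind {0<..<T} t * h t))"
  if a: "test_function {0<..<T} a" and h: "continuous_on {0..T} h" for a h :: "real => real"
 proof (rule represents_integral(2))
  show "represents {0..T} (\<lambda>t. a t * (ind {0<..<T} t * h t)) (\<lambda>t. a t * h t)"
   unfolding represents_def
  proof (intro conjI)
   show "(\<lambda>t. a t * (ind {0<..<T} t * h t)) \<in> bmeas borel"
    using test_functionD(3)[OF a] borel_measurable_integrable[OF int[OF h]] by simp
   show "AE t in lborel. t \<in> {0..T} --> a t * (ind {0<..<T} t * h t) = a t * h t"
    using z[OF a] by (intro AE_I2) (auto simp: indicator_def)
  qed (auto simp: indicator_def)
  show "(\<lambda>t. a t * h t) \<in> bmeas (leb {0..T})"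
   using borel_imp_lebesgue_on[OF test_functionD(3)[OF a]] continuous_imp_measurable_on_sets_lebesgue[OF h] by auto
 qed simp
 note td = test_function_directional_deriv[OF \<theta>, of 1]
 note tp = test_function_prod[OF \<theta> \<psi>]
 have "(LL t. fder \<theta> t 1 * (ind {0<..<T} t * (LINT x|leb X. \<psi> x * \<rho> t x)))
   = (LINT t|leb {0..T}. fder \<theta> t 1 * (LINT x|leb X. \<psi> x * \<rho> t x))"
  by (rule conv[OF td c\<rho>, symmetric])
 also have "\<dots> = (LINT t|leb {0..T}. LINT x|leb X. fder (\<lambda>z. \<theta> (fst z) * \<psi> (snd z)) (t, x) (1, 0) *\<^sub>R \<rho> t x)"
  unfolding tp(2) real_scaleR_def mult.assoc integral_mult_right_zero ..
 also have "\<dots> = - (LINT t|leb {0..T}. LINT x|leb X. (\<theta> (fst (t, x)) * \<psi> (snd (t, x))) *\<^sub>R rt t x)"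
  using w tp(1) unfolding weak_time_deriv_def by blast
 also have "\<dots> = - (LINT t|leb {0..T}. \<theta> t * (LINT x|leb X. \<psi> x * rt t x))"
  by (simp add: mult.assoc)
 also have "\<dots> = - (LL t. \<theta> t * (ind {0<..<T} t * (LINT x|leb X. \<psi> x * rt t x)))"
  by (subst conv[OF \<theta> crt]) (rule refl)
 finally show "(LL t. fder \<theta> t 1 * (ind {0<..<T} t * (LINT x|leb X. \<psi> x * \<rho> t x)))
   = - (LL t. \<theta> t * (ind {0<..<T} t * (LINT x|leb X. \<psi> x * rt t x)))" .
qed

text \<open>In one dimension the translation formula expresses the increment of the pairing as y times the
mean of its derivative, which differs from the value at t by at most eta. This holds at almost every time, and
by continuity at t itself. The bound does not depend on psi, which is what allows the passage to the L^1 norm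
afterwards.\<close>
lemma pairing_increment:
 assumes \<psi>: "test_function X \<psi>" "\<And>x. \<bar>\<psi> x\<bar> \<le> 1"
  and r: "r > 0" "\<And>s. \<bar>s - t\<bar> < 2 * r ==> 0 < s \<and> s < T"
   "\<And>s. \<bar>s - t\<bar> < 2 * r ==> (LINT x|leb X. norm (rt s x - rt t x)) \<le> \<eta>"
  and y: "\<bar>y\<bar> < r"
 shows "(LINT x|leb X. \<psi> x * (\<rho> (t + y) x - \<rho> t x - y * rt t x)) \<le> \<bar>y\<bar> * \<eta>"
proof -
 define R where "R s = (LINT x|leb X. \<psi> x * \<rho> s x)" for s
 define G where "G s = (LINT x|leb X. \<psi> x * rt s x)" for s
 note m = borel_imp_lebesgue_on[OF test_functionD(3)[OF \<psi>(1)], of X]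
 have cR: "continuous_on {0..T} R" and cG: "continuous_on {0..T} G"
  unfolding R_def G_def by (rule C_time_pairing_continuous[OF o q1 \<rho> m \<psi>(2)], rule C_time_pairing_continuous[OF o q1 rt m \<psi>(2)])
 have iw: "integrable (leb X) (\<lambda>x. \<psi> x * g x)" if "integrable (leb X) g" for g
  using test_mult_integrable_loc[OF o(1) integrable_imp_locally_integrable[OF bX that] \<psi>(1)] by simp
 have tT: "0 < t" "t < T" using r(2)[of t] r(1) by auto
 have Gt: "\<bar>G s - G t\<bar> \<le> \<eta>" if s: "\<bar>s - t\<bar> < 2 * r" for s
 proof -
  have is': "integrable (leb X) (rt s)" "integrable (leb X) (rt t)"
   using r(2)[OF s] tT by (auto intro!: integrable_density(2))
  then have d: "integrable (leb X) (\<lambda>x. rt s x - rt t x)" by simp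
  have "G s - G t = (LINT x|leb X. \<psi> x * (rt s x - rt t x))"
   unfolding G_def using iw[OF is'(1)] iw[OF is'(2)] by (simp add: right_diff_distrib)
  also have "\<bar>\<dots>\<bar> \<le> (LINT x|leb X. norm (\<psi> x * (rt s x - rt t x)))" using integral_norm_bound[of "leb X" "\<lambda>x. \<psi> x * (rt s x - rt t x)"] by simp
  also have "\<dots> \<le> (LINT x|leb X. norm (rt s x - rt t x))"
   by (rule integral_mono[OF integrable_norm[OF iw[OF d]] integrable_norm[OF d]])
    (use \<psi>(2) in \<open>auto simp: abs_mult intro!: mult_left_le_one_le\<close>)
  finally show ?thesis using r(3)[OF s] by linarith
 qed
 define h where "h x = R (x + y) - R x - y * G t" for x
 have y2: "\<bar>y\<bar> < 2 * r" using y r(1) by linarith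
 have seg: "x + s * y \<in> {0<..<T}" "\<bar>x + s * y - t\<bar> < 2 * r" if "x \<in> ball t r" "0 \<le> s" "s \<le> 1" for x s
 proof -
  have "\<bar>s * y\<bar> \<le> \<bar>y\<bar>" using that by (simp add: abs_mult mult_left_le_one_le)
  then show "\<bar>x + s * y - t\<bar> < 2 * r" using that(1) y by (simp add: dist_real_def)
  from r(2)[OF this] show "x + s * y \<in> {0<..<T}" by simp
 qed
 have "wd {0<..<T} (y *\<^sub>R 1) (\<lambda>t. ind {0<..<T} t * R t) (\<lambda>t. y * (ind {0<..<T} t * G t))"
  unfolding R_def G_def by (rule wd_scale_direction[OF wd_pairing[OF \<psi>(1)]])
 then have wdy: "wd {0<..<T} y (\<lambda>t. ind {0<..<T} t * R t) (\<lambda>t. y * (ind {0<..<T} t * G t))" by simp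
 have "AE x in lborel. x \<in> ball t r --> ind {0<..<T} (x + y) * R (x + y) - ind {0<..<T} x * R x
   = segment_mean y (\<lambda>t. y * (ind {0<..<T} t * G t)) x"
  by (rule wd_translation_AE[OF wdy]) (use seg in auto)
 then have "AE x in lborel. x \<in> ball t r --> h x \<le> \<bar>y\<bar> * \<eta>"
 proof eventually_elim
  case (elim x)
  show ?case
  proof
   assume x: "x \<in> ball t r"
   have e: "segment_mean y (\<lambda>t. y * (ind {0<..<T} t * G t)) x = (LL s. ind {0..1} s * (y * G (x + s * y)))"
    unfolding segment_mean_def
   proof (rule Bintegral_cong[OF refl])
    fix s :: real
    show "ind {0..1} s * (y * (ind {0<..<T} (x + s *\<^sub>R y) * G (x + s *\<^sub>R y))) = ind {0..1} s * (y * G (x + s * y))"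
     using seg(1)[OF x, of s] by (cases "s \<in> {0..1}") auto
   qed
   have sub: "(\<lambda>s. x + s * y) ` {0..1} \<subseteq> {0..T}" using seg(1)[OF x] by fastforce
   have cc: "continuous_on {0..1} (\<lambda>s. y * G (x + s * y))"
    by (intro continuous_intros continuous_on_compose2[OF cG _ sub])
   have "\<bar>(LL s. ind {0..1} s * (y * G (x + s * y))) - y * G t\<bar> \<le> \<bar>y\<bar> * \<eta>"
   proof (rule unit_interval_mean_bound[OF cc])
    fix s :: real assume "s \<in> {0..1}"
    then have "\<bar>G (x + s * y) - G t\<bar> \<le> \<eta>" using Gt[OF seg(2)[OF x, of s]] by simp
    then show "\<bar>y * G (x + s * y) - y * G t\<bar> \<le> \<bar>y\<bar> * \<eta>"
     unfolding right_diff_distrib[symmetric] abs_mult by (rule mult_left_mono) simp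
   qed
   moreover have "h x = (LL s. ind {0..1} s * (y * G (x + s * y))) - y * G t"
    using elim x seg(1)[OF x, of 0] seg(1)[OF x, of 1] unfolding e h_def by simp
   ultimately show "h x \<le> \<bar>y\<bar> * \<eta>" by linarith
  qed
 qed
 moreover have "continuous_on (ball t r) h" unfolding h_def
 proof (intro continuous_intros)
  show "continuous_on (ball t r) (\<lambda>x. R (x + y))"
  proof -
   have "(\<lambda>x. x + y) ` ball t r \<subseteq> {0..T}" using seg(1)[of _ 1] by fastforce
   then show ?thesis by (intro continuous_on_compose2[OF cR] continuous_intros)
  qed
  show "continuous_on (ball t r) R" by (rule continuous_on_subset[OF cR]) (use seg(1)[of _ 0] in fastforce)
 qed
 ultimately have "h t \<le> \<bar>y\<bar> * \<eta>" by (intro continuous_AE_le_imp_le[of "ball t r"]) (use r(1) in auto)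
 moreover have "(LINT x|leb X. \<psi> x * (\<rho> (t + y) x - \<rho> t x - y * rt t x)) = h t"
 proof -
  have ty: "t + y \<in> {0..T}" "t \<in> {0..T}" using r(2)[of "t + y"] y2 tT by auto
  note i = iw[OF integrable_density(1)[OF ty(1)]] iw[OF integrable_density(1)[OF ty(2)]] iw[OF integrable_density(2)[OF ty(2)]]
  have e: "\<psi> x * (\<rho> (t + y) x - \<rho> t x - y * rt t x) = \<psi> x * \<rho> (t + y) x - \<psi> x * \<rho> t x - y * (\<psi> x * rt t x)" for x
   by (simp add: algebra_simps)
  show ?thesis unfolding e h_def R_def G_def using i by simp
 qed
 ultimately show ?thesis by simp
qed

text \<open>The increments of the pairings are bounded uniformly in the test function, so duality gives the
L^1 norm.\<close>
lemma density_differentiable_L1: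
 assumes t: "t \<in> {0<..<T}" and \<eta>: "\<eta> > 0"
 shows "\<exists>r>0. \<forall>y. \<bar>y\<bar> < r --> t + y \<in> {0<..<T} \<and> (LINT x|leb X. \<bar>\<rho> (t + y) x - \<rho> t x - y * rt t x\<bar>) \<le> \<bar>y\<bar> * \<eta>"
proof -
 have "((\<lambda>s. LINT x|leb X. norm (rt s x - rt t x)) \<longlongrightarrow> 0) (at t within {0..T})"
  by (rule C_time_L1[OF o q1 rt]) (use t in auto)
 then have "\<forall>\<^sub>F s in at t within {0..T}. (LINT x|leb X. norm (rt s x - rt t x)) < \<eta>"
  by (rule order_tendstoD) (rule \<eta>)
 then obtain d where d: "d > 0" "\<And>s. s \<in> {0..T} ==> s \<noteq> t ==> dist s t < d ==> (LINT x|leb X. norm (rt s x - rt t x)) < \<eta>"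
  unfolding eventually_at by blast
 define r where "r = min (d / 2) (min (t / 2) ((T - t) / 2))"
 have r: "r > 0" using d t by (simp add: r_def)
 have r_le: "2 * r \<le> t" "2 * r \<le> T - t" by (auto simp: r_def min_def)
 have r2: "0 < s \<and> s < T" if "\<bar>s - t\<bar> < 2 * r" for s using that r_le by (auto simp: abs_less_iff)
 have r3: "(LINT x|leb X. norm (rt s x - rt t x)) \<le> \<eta>" if s: "\<bar>s - t\<bar> < 2 * r" for s
 proof (cases "s = t")
  case False
  have "dist s t < d" using s unfolding r_def dist_real_def by linarith
  then show ?thesis using d(2)[of s] r2[OF s] False by simp
 qed (use \<eta> in simp)
 show ?thesis
 proof (intro exI[of _ r] conjI allI impI r)
  fix y assume y: "\<bar>y\<bar> < r"
  show ty: "t + y \<in> {0<..<T}" using r2[of "t + y"] y r by simp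
  define k where "k x = \<rho> (t + y) x - \<rho> t x - y * rt t x" for x
  have ik: "integrable (leb X) k" unfolding k_def
   using integrable_density[of "t + y"] integrable_density[of t] t ty by simp
  obtain k' where k': "represents X k' k" using represents_exists[OF bX borel_measurable_integrable[OF ik]] by blast
  have ik': "integ k'" using represents_integral(1)[OF bX borel_measurable_integrable[OF ik] k'] ik by simp
  have "(LL x. ind X x * \<bar>k' x\<bar>) \<le> \<bar>y\<bar> * \<eta>"
  proof (rule L1_norm_le_if_test_le[OF o ik'])
   fix \<psi> assume \<psi>: "test_function X \<psi>" "\<And>x. \<bar>\<psi> x\<bar> \<le> 1"
   have "(LINT x|leb X. \<psi> x * k x) = (LL x. \<psi> x * k' x)"
    by (rule represents_integral(2)[OF bX _ represents_mult[OF k' test_functionD(3)[OF \<psi>(1)]]])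
     (use borel_imp_lebesgue_on[OF test_functionD(3)[OF \<psi>(1)]] borel_measurable_integrable[OF ik] in auto)
   then show "(LL x. \<psi> x * k' x) \<le> \<bar>y\<bar> * \<eta>"
    using pairing_increment[OF \<psi> r r2 r3 y] by (simp add: k_def)
  qed
  moreover have "represents X (\<lambda>x. ind X x * \<bar>k' x\<bar>) (\<lambda>x. \<bar>k x\<bar>)"
   using k' bX unfolding represents_def by (auto elim!: eventually_mono)
  from represents_integral(2)[OF bX _ this] have "(LINT x|leb X. \<bar>k x\<bar>) = (LL x. ind X x * \<bar>k' x\<bar>)"
   using borel_measurable_integrable[OF ik] by simp
  ultimately show "(LINT x|leb X. \<bar>\<rho> (t + y) x - \<rho> t x - y * rt t x\<bar>) \<le> \<bar>y\<bar> * \<eta>"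
   unfolding k_def by simp
 qed
qed

end

section \<open>Integral functionals of the density\<close>

text \<open>The product |b - a| |r| is estimated by the square of |b - a|, which is at most 2 M |b - a|, and a
small multiple of r^2, so that after integration the first part is small with y and the second one with
kappa.\<close>
lemma taylor_remainder_young:
 fixes a b r y d :: real
 assumes M: "\<bar>a\<bar> \<le> M" "\<bar>b\<bar> \<le> M" and d: "d = b - a - y * r" and \<kappa>: "\<kappa> > 0"
 shows "(b - a)\<^sup>2 \<le> 2 * M * \<bar>d\<bar> + \<bar>y\<bar> * (M / \<kappa> * (\<bar>d\<bar> + \<bar>y\<bar> * \<bar>r\<bar>) + \<kappa> / 2 * r\<^sup>2)"
proof -
 define e where "e = b - a"
 define W where "W = \<bar>d\<bar> + \<bar>y\<bar> * \<bar>r\<bar>"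
 have M0: "0 \<le> M" using M(1) by linarith
 have e: "\<bar>e\<bar> \<le> 2 * M" "\<bar>e\<bar> \<le> W" using M by (auto simp: W_def e_def d abs_mult[symmetric])
 have "0 \<le> (\<bar>e\<bar> - \<kappa> * \<bar>r\<bar>)\<^sup>2" by simp
 then have 1: "2 * \<kappa> * (\<bar>e\<bar> * \<bar>r\<bar>) \<le> e\<^sup>2 + \<kappa>\<^sup>2 * r\<^sup>2" by (simp add: power2_eq_square algebra_simps)
 have 2: "e\<^sup>2 \<le> 2 * M * W"
  using mult_mono[OF e] M0 by (simp add: power2_eq_square)
 have "2 * \<kappa> * (M / \<kappa> * W + \<kappa> / 2 * r\<^sup>2) = 2 * M * W + \<kappa>\<^sup>2 * r\<^sup>2"
  using \<kappa> by (simp add: power2_eq_square field_simps)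
 then have "2 * \<kappa> * (\<bar>e\<bar> * \<bar>r\<bar>) \<le> 2 * \<kappa> * (M / \<kappa> * W + \<kappa> / 2 * r\<^sup>2)" using 1 2 by linarith
 then have er: "\<bar>e\<bar> * \<bar>r\<bar> \<le> M / \<kappa> * (\<bar>d\<bar> + \<bar>y\<bar> * \<bar>r\<bar>) + \<kappa> / 2 * r\<^sup>2" using \<kappa> by (simp add: W_def)
 have "e\<^sup>2 = e * d + y * (e * r)" by (simp add: d e_def power2_eq_square algebra_simps)
 also have "\<dots> \<le> \<bar>e\<bar> * \<bar>d\<bar> + \<bar>y\<bar> * (\<bar>e\<bar> * \<bar>r\<bar>)"
  using abs_ge_self[of "e * d"] abs_ge_self[of "y * (e * r)"] unfolding abs_mult by linarith
 also have "\<dots> \<le> 2 * M * \<bar>d\<bar> + \<bar>y\<bar> * (M / \<kappa> * (\<bar>d\<bar> + \<bar>y\<bar> * \<bar>r\<bar>) + \<kappa> / 2 * r\<^sup>2)"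
  by (intro add_mono mult_right_mono mult_left_mono e(1) er) auto
 finally show ?thesis by (simp add: e_def)
qed

locale bounded_density_evolution = density_evolution +
 fixes M :: real
 assumes M: "M > 0" and \<rho>M: "\<And>t. t \<in> {0..T} ==> AE x in leb X. \<bar>\<rho> t x\<bar> \<le> M"
begin

lemma integrable_poly_mult:
 assumes t: "t \<in> {0..T}" and g: "integrable (leb X) g"
 shows "integrable (leb X) (\<lambda>x. poly p (\<rho> t x) * g x)"
proof -
 obtain K where K: "\<And>x. \<bar>x\<bar> \<le> M ==> \<bar>poly p x\<bar> \<le> K" using poly_bounded_on[of M p] by blast
 have c: "continuous_on UNIV (poly p)" by (intro continuous_intros)
 show ?thesis
 proof (rule Bintegrable_bound)
  show "integrable (leb X) (\<lambda>x. K * g x)" using g by simp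
  show "AE x in leb X. norm (poly p (\<rho> t x) * g x) \<le> norm (K * g x)"
   using \<rho>M[OF t] by eventually_elim (auto simp: abs_mult intro!: mult_right_mono order_trans[OF K abs_ge_self])
  show "(\<lambda>x. poly p (\<rho> t x) * g x) \<in> bmeas (leb X)"
   using measurable_compose[OF borel_measurable_integrable[OF integrable_density(1)[OF t]] borel_measurable_continuous_onI[OF c]] g by simp
 qed
qed

lemma integrable_const_on: "integrable (leb X) (\<lambda>x. c::real)"
proof -
 interpret finite_measure "leb X" by (rule finite_measure_lebesgue_on_bounded[OF o])
 show ?thesis by simp
qed

lemma integrable_poly: "t \<in> {0..T} ==> integrable (leb X) (\<lambda>x. poly p (\<rho> t x))"
 using integrable_poly_mult[OF _ integrable_const_on, of _ p 1] by simp

lemma energy_continuous: "continuous_on {0..T} (\<lambda>t. LINT x|leb X. poly p (\<rho> t x))"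
 unfolding continuous_on_def
proof (rule ballI, rule LIM_zero_cancel)
 fix t assume t: "t \<in> {0..T}"
 obtain C where C: "C \<ge> 0" "\<And>a b. \<bar>a\<bar> \<le> M ==> \<bar>b\<bar> \<le> M ==> \<bar>poly p b - poly p a - poly (pderiv p) a * (b - a)\<bar> \<le> C * (b - a)\<^sup>2"
  using poly_taylor_bound[of M p] M by auto
 obtain K where K: "K \<ge> 0" "\<And>x. \<bar>x\<bar> \<le> M ==> \<bar>poly (pderiv p) x\<bar> \<le> K" using poly_bounded_on[of M "pderiv p"] by blast
 have lip: "\<bar>poly p b - poly p a\<bar> \<le> (2 * M * C + K) * \<bar>b - a\<bar>" if "\<bar>a\<bar> \<le> M" "\<bar>b\<bar> \<le> M" for a b
 proof -
  have "\<bar>b - a\<bar> * \<bar>b - a\<bar> \<le> 2 * M * \<bar>b - a\<bar>" using that by (intro mult_right_mono) auto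
  then have "(b - a)\<^sup>2 \<le> 2 * M * \<bar>b - a\<bar>" by (simp add: power2_eq_square)
  then have "C * (b - a)\<^sup>2 \<le> C * (2 * M * \<bar>b - a\<bar>)" using C(1) by (rule mult_left_mono)
  moreover have "\<bar>poly (pderiv p) a * (b - a)\<bar> \<le> K * \<bar>b - a\<bar>" unfolding abs_mult using K(2)[OF that(1)] by (rule mult_right_mono) simp
  ultimately show ?thesis using C(2)[OF that] by (simp add: algebra_simps)
 qed
 have "norm ((LINT x|leb X. poly p (\<rho> s x)) - (LINT x|leb X. poly p (\<rho> t x))) \<le> (2 * M * C + K) * (LINT x|leb X. norm (\<rho> s x - \<rho> t x))"
  if s: "s \<in> {0..T}" for s
 proof -
  note i = integrable_poly[OF s, of p] integrable_poly[OF t, of p]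
  have d: "integrable (leb X) (\<lambda>x. \<rho> s x - \<rho> t x)" using integrable_density(1) s t by simp
  have "norm ((LINT x|leb X. poly p (\<rho> s x)) - (LINT x|leb X. poly p (\<rho> t x))) \<le> (LINT x|leb X. norm (poly p (\<rho> s x) - poly p (\<rho> t x)))"
   using integral_norm_bound[of "leb X" "\<lambda>x. poly p (\<rho> s x) - poly p (\<rho> t x)"] i by simp
  also have "\<dots> \<le> (LINT x|leb X. (2 * M * C + K) * norm (\<rho> s x - \<rho> t x))"
  proof (rule integral_mono_AE)
   show "AE x in leb X. norm (poly p (\<rho> s x) - poly p (\<rho> t x)) \<le> (2 * M * C + K) * norm (\<rho> s x - \<rho> t x)"
    using \<rho>M[OF s] \<rho>M[OF t] by eventually_elim (simp add: lip)
  qed (use i d in auto)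
  finally show ?thesis by simp
 qed
 then have ev: "\<forall>\<^sub>F s in at t within {0..T}. norm ((LINT x|leb X. poly p (\<rho> s x)) - (LINT x|leb X. poly p (\<rho> t x)))
   \<le> (2 * M * C + K) * (LINT x|leb X. norm (\<rho> s x - \<rho> t x))"
  by (auto simp: eventually_at_filter)
 have lim: "((\<lambda>s. (2 * M * C + K) * (LINT x|leb X. norm (\<rho> s x - \<rho> t x))) \<longlongrightarrow> 0) (at t within {0..T})"
  using tendsto_mult_left[OF C_time_L1[OF o q1 \<rho> t], of "2 * M * C + K"] by simp
 show "((\<lambda>s. (LINT x|leb X. poly p (\<rho> s x)) - (LINT x|leb X. poly p (\<rho> t x))) \<longlongrightarrow> 0) (at t within {0..T})"
  by (rule Lim_null_comparison[OF ev lim])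
qed

lemma integrable_rt_square: assumes t: "t \<in> {0..T}" shows "integrable (leb X) (\<lambda>x. (rt t x)\<^sup>2)"
proof -
 have L: "rt t \<in> fst (Lp q X)" by (rule C_time_Lp[OF rt t])
 have "integrable (leb X) (\<lambda>x. 1 + norm (rt t x) powr q)"
  using L integrable_const_on by (auto simp: Lp_iff)
 then show ?thesis
 proof (rule Bintegrable_bound)
  have "r\<^sup>2 \<le> 1 + \<bar>r\<bar> powr q" for r :: real
  proof (cases "\<bar>r\<bar> \<le> 1")
   case True
   then have "r\<^sup>2 \<le> 1" by (simp add: abs_square_le_1)
   then show ?thesis by (rule order_trans) simp
  next
   case False
   then have "\<bar>r\<bar> powr 2 \<le> \<bar>r\<bar> powr q" using q by (intro powr_mono) auto
   then show ?thesis using False by simp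
  qed
  then show "AE x in leb X. norm ((rt t x)\<^sup>2) \<le> norm (1 + norm (rt t x) powr q)" by (intro AE_I2) auto
 qed (use L in \<open>auto simp: Lp_iff\<close>)
qed

text \<open>The Taylor remainder of p is quadratic in the increment of the density, and so negligible in L^1
although the increment is only differentiable in L^1: the density is bounded and its time derivative is square
integrable.\<close>
theorem energy_has_derivative:
 assumes t: "t \<in> {0<..<T}"
 shows "((\<lambda>s. LINT x|leb X. poly p (\<rho> s x)) has_real_derivative (LINT x|leb X. poly (pderiv p) (\<rho> t x) * rt t x)) (at t)"
proof -
 let ?E = "\<lambda>s. LINT x|leb X. poly p (\<rho> s x)" and ?D = "LINT x|leb X. poly (pderiv p) (\<rho> t x) * rt t x"
 have t': "t \<in> {0..T}" using t by auto
 obtain C where C: "C \<ge> 0" "\<And>a b. \<bar>a\<bar> \<le> M ==> \<bar>b\<bar> \<le> M ==> \<bar>poly p b - poly p a - poly (pderiv p) a * (b - a)\<bar> \<le> C * (b - a)\<^sup>2"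
  using poly_taylor_bound[of M p] M by auto
 obtain K where K: "K \<ge> 0" "\<And>x. \<bar>x\<bar> \<le> M ==> \<bar>poly (pderiv p) x\<bar> \<le> K" using poly_bounded_on[of M "pderiv p"] by blast
 define N1 where "N1 = (LINT x|leb X. \<bar>rt t x\<bar>)"
 define N2 where "N2 = (LINT x|leb X. (rt t x)\<^sup>2)"
 have N: "N1 \<ge> 0" "N2 \<ge> 0" by (auto simp: N1_def N2_def intro!: Bintegral_nonneg)
 note ir = integrable_density(2)[OF t'] and ir2 = integrable_rt_square[OF t']
 note irp = integrable_poly_mult[OF t' ir, of "pderiv p"]
 have key: "\<bar>?E (t + y) - ?E t - y * ?D\<bar> \<le> \<bar>y\<bar> * ((K + 2 * M * C) * \<eta> + C * (M / \<kappa>) * (\<bar>y\<bar> * \<eta> + \<bar>y\<bar> * N1) + C * \<kappa> / 2 * N2)"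
  if ty: "t + y \<in> {0<..<T}" and \<kappa>: "\<kappa> > 0" and L: "(LINT x|leb X. \<bar>\<rho> (t + y) x - \<rho> t x - y * rt t x\<bar>) \<le> \<bar>y\<bar> * \<eta>" for y \<kappa> \<eta>
 proof -
  define d where "d x = \<rho> (t + y) x - \<rho> t x - y * rt t x" for x
  have ty': "t + y \<in> {0..T}" using ty by auto
  have id: "integrable (leb X) (\<lambda>x. \<bar>d x\<bar>)" unfolding d_def using integrable_density(1)[OF ty'] integrable_density(1)[OF t'] ir by simp
  let ?g = "\<lambda>x. (K + 2 * M * C + C * \<bar>y\<bar> * (M / \<kappa>)) * \<bar>d x\<bar> + C * (M / \<kappa>) * (\<bar>y\<bar> * (\<bar>y\<bar> * \<bar>rt t x\<bar>)) + C * \<bar>y\<bar> * (\<kappa> / 2) * (rt t x)\<^sup>2"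
  let ?f = "\<lambda>x. poly p (\<rho> (t + y) x) - poly p (\<rho> t x) - y * (poly (pderiv p) (\<rho> t x) * rt t x)"
  have ig: "integrable (leb X) ?g" using id ir ir2 by simp
  have "\<bar>?E (t + y) - ?E t - y * ?D\<bar> = \<bar>LINT x|leb X. ?f x\<bar>"
   using integrable_poly[OF ty', of p] integrable_poly[OF t', of p] irp by simp
  also have "\<dots> \<le> (LINT x|leb X. \<bar>?f x\<bar>)" using integral_norm_bound[of "leb X" ?f] by simp
  also have "\<dots> \<le> (LINT x|leb X. ?g x)"
  proof (rule integral_mono_AE)
   show "AE x in leb X. \<bar>?f x\<bar> \<le> ?g x" using \<rho>M[OF ty'] \<rho>M[OF t']
   proof eventually_elim
    case (elim x)
    note T = C(2)[OF elim(2,1)] and Y = mult_left_mono[OF taylor_remainder_young[OF elim(2,1) d_def[of x] \<kappa>] C(1)]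
    have "\<bar>poly (pderiv p) (\<rho> t x) * d x\<bar> \<le> K * \<bar>d x\<bar>" unfolding abs_mult using K(2)[OF elim(2)] by (rule mult_right_mono) simp
    moreover have "?f x = (poly p (\<rho> (t + y) x) - poly p (\<rho> t x) - poly (pderiv p) (\<rho> t x) * (\<rho> (t + y) x - \<rho> t x)) + poly (pderiv p) (\<rho> t x) * d x"
     by (simp add: d_def algebra_simps)
    ultimately have "\<bar>?f x\<bar> \<le> C * (2 * M * \<bar>d x\<bar> + \<bar>y\<bar> * (M / \<kappa> * (\<bar>d x\<bar> + \<bar>y\<bar> * \<bar>rt t x\<bar>) + \<kappa> / 2 * (rt t x)\<^sup>2)) + K * \<bar>d x\<bar>"
     using T Y by linarith
    then show ?case by (simp add: algebra_simps del: abs_mult_self_eq)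
   qed
  qed (use ig integrable_poly[OF ty', of p] integrable_poly[OF t', of p] irp in auto)
  also have "\<dots> = (K + 2 * M * C + C * \<bar>y\<bar> * (M / \<kappa>)) * (LINT x|leb X. \<bar>d x\<bar>) + C * (M / \<kappa>) * (\<bar>y\<bar> * (\<bar>y\<bar> * N1)) + C * \<bar>y\<bar> * (\<kappa> / 2) * N2"
   unfolding N1_def N2_def using id ir ir2 by simp
  also have "\<dots> \<le> (K + 2 * M * C + C * \<bar>y\<bar> * (M / \<kappa>)) * (\<bar>y\<bar> * \<eta>) + C * (M / \<kappa>) * (\<bar>y\<bar> * (\<bar>y\<bar> * N1)) + C * \<bar>y\<bar> * (\<kappa> / 2) * N2"
   using L K C M \<kappa> unfolding d_def by (intro add_mono mult_left_mono) auto
  finally show ?thesis by (simp add: algebra_simps)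
 qed
 have "(?E has_derivative (\<lambda>h. ?D * h)) (at t)"
  unfolding has_derivative_at_alt
 proof (intro conjI allI impI)
  fix e :: real assume e: "e > 0"
  define P where "P = K + 2 * M * C + 1"
  define Q where "Q = C * N2 + 1"
  \<comment> \<open>Each of the three parts of the estimate contributes at most e / 3.\<close>
  define \<eta> where "\<eta> = e / (3 * P)"
  define \<kappa> where "\<kappa> = 2 * e / (3 * Q)"
  define A where "A = C * (M / \<kappa>) * (\<eta> + N1)"
  have p: "0 < P" "0 < Q" using K C M N by (auto simp: P_def Q_def intro!: add_nonneg_pos)
  have \<eta>: "\<eta> > 0" and \<kappa>: "\<kappa> > 0" using e p by (auto simp: \<eta>_def \<kappa>_def)
  have A: "A \<ge> 0" using C M \<kappa> \<eta> N by (simp add: A_def)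
  have 1: "(K + 2 * M * C) * \<eta> \<le> e / 3"
  proof -
   have "(K + 2 * M * C) * \<eta> \<le> P * \<eta>" unfolding P_def using \<eta> by simp
   also have "\<dots> = e / 3" unfolding \<eta>_def using p by simp
   finally show ?thesis .
  qed
  have 2: "C * \<kappa> / 2 * N2 \<le> e / 3"
  proof -
   have "C * \<kappa> / 2 * N2 \<le> Q * (\<kappa> / 2)" unfolding Q_def using \<kappa> by (simp add: algebra_simps)
   also have "\<dots> = e / 3" unfolding \<kappa>_def using p by simp
   finally show ?thesis .
  qed
  obtain r where r: "r > 0" "\<And>y. \<bar>y\<bar> < r ==> t + y \<in> {0<..<T} \<and> (LINT x|leb X. \<bar>\<rho> (t + y) x - \<rho> t x - y * rt t x\<bar>) \<le> \<bar>y\<bar> * \<eta>"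
   using density_differentiable_L1[OF t \<eta>] by blast
  show "\<exists>\<delta>>0. \<forall>s. norm (s - t) < \<delta> --> norm (?E s - ?E t - ?D * (s - t)) \<le> e * norm (s - t)"
  proof (intro exI[of _ "min r (e / (3 * (A + 1)))"] conjI allI impI)
   show "0 < min r (e / (3 * (A + 1)))" using r e A by simp
   fix s assume s: "norm (s - t) < min r (e / (3 * (A + 1)))"
   define y where "y = s - t"
   have y: "\<bar>y\<bar> < r" "\<bar>y\<bar> < e / (3 * (A + 1))" using s by (auto simp: y_def)
   have "\<bar>y\<bar> * A \<le> \<bar>y\<bar> * (A + 1)" by (simp add: algebra_simps)
   also have "\<dots> \<le> e / 3" using y(2) A by (simp add: field_simps)
   finally have 3: "C * (M / \<kappa>) * (\<bar>y\<bar> * \<eta> + \<bar>y\<bar> * N1) \<le> e / 3" by (simp add: A_def algebra_simps add_divide_distrib)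
   have "\<bar>?E (t + y) - ?E t - y * ?D\<bar> \<le> \<bar>y\<bar> * ((K + 2 * M * C) * \<eta> + C * (M / \<kappa>) * (\<bar>y\<bar> * \<eta> + \<bar>y\<bar> * N1) + C * \<kappa> / 2 * N2)"
    using r(2)[OF y(1)] \<kappa> by (intro key) auto
   also have "\<dots> \<le> \<bar>y\<bar> * e" using 1 2 3 by (intro mult_left_mono) auto
   finally show "norm (?E s - ?E t - ?D * (s - t)) \<le> e * norm (s - t)" by (simp add: y_def mult.commute)
  qed
 qed (rule bounded_linear_mult_right)
 then show ?thesis by (simp add: has_field_derivative_def)
qed

end

section \<open>A logarithmic Gronwall estimate\<close>

text \<open>The logarithm of E is the integral of its derivative D / E, which is at least - a almost
everywhere.\<close>
lemma log_gronwall: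
 fixes E D a :: "real => real"
 assumes T: "T \<ge> 0" and E: "continuous_on {0..T} E" "\<And>t. t \<in> {0..T} ==> E t > 0"
  and D: "\<And>t. t \<in> {0<..<T} ==> (E has_real_derivative D t) (at t)"
  and a: "integrable (leb {0..T}) a" and ae: "AE t in leb {0..T}. \<bar>D t\<bar> \<le> a t * E t"
 shows "E 0 \<le> E T * exp (LINT t|leb {0..T}. a t)"
proof -
 let ?A = "LINT t|leb {0..T}. a t"
 have "((\<lambda>t. D t / E t) has_integral (ln (E T) - ln (E 0))) {0..T}"
 proof (rule fundamental_theorem_of_calculus_interior[OF T])
  show "continuous_on {0..T} (\<lambda>t. ln (E t))" using E(2) by (intro continuous_on_ln E(1)) force
  show "((\<lambda>t. ln (E t)) has_vector_derivative D t / E t) (at t)" if t: "t \<in> {0<..<T}" for t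
   using DERIV_chain2[OF DERIV_ln D[OF t], of] E(2)[of t] t
   by (auto simp: has_real_derivative_iff_has_vector_derivative[symmetric] field_simps)
 qed
 note ftc = this
 have mx: "AE t in lborel. t \<in> {0..T} --> D t / E t = max (D t / E t) (- a t)"
  using ae[unfolded AE_lebesgue_on_iff[OF borel_closed[OF closed_atLeastAtMost]]]
 proof eventually_elim
  case (elim t)
  show ?case
  proof
   assume t: "t \<in> {0..T}"
   then have "- a t * E t \<le> D t" using elim by auto
   then have "- a t \<le> D t / E t" using E(2)[OF t] by (simp add: pos_le_divide_eq)
   then show "D t / E t = max (D t / E t) (- a t)" by simp
  qed
 qed
 have "- ?A \<le> ln (E T) - ln (E 0)"
  by (rule has_integral_le[OF has_integral_neg[OF has_integral_integral_lebesgue_on[OF a]] ftc[unfolded has_integral_AE[OF mx]]]) auto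
 then have "ln (E 0) \<le> ln (E T * exp ?A)" using E(2)[of T] T by (simp add: ln_mult)
 then show ?thesis using E(2)[of 0] E(2)[of T] T by simp
qed

section \<open>Polynomial weights\<close>

text \<open>The Taylor polynomial of degree N of (x / M)^(- n) in the variable 1 - x / M. The recursion by
degree gives an easy access to the derivative.\<close>
primrec weight :: "real => real => nat => real poly" where
 "weight n M 0 = 1"
| "weight n M (Suc N) = weight n M N + smult (pochhammer n (Suc N) / fact (Suc N)) ([:1, - 1 / M:] ^ Suc N)"

lemma poly_weight: "poly (weight n M N) x = (\<Sum>k\<le>N. pochhammer n k / fact k * (1 - x / M) ^ k)"
proof (induction N)
 case (Suc N)
 have "poly (weight n M (Suc N)) x = poly (weight n M N) x + pochhammer n (Suc N) / fact (Suc N) * (1 - x / M) ^ Suc N"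
  by (simp only: weight.simps poly_add poly_smult poly_power) simp
 then show ?case unfolding Suc.IH by simp
qed simp

lemma poly_pderiv_weight_Suc:
 "poly (pderiv (weight n M (Suc N))) x = poly (pderiv (weight n M N)) x
   - (n + real N) * (pochhammer n N / fact N) * (1 - x / M) ^ N / M"
proof -
 have "real (Suc N) * (pochhammer n (Suc N) / fact (Suc N)) = (n + real N) * (pochhammer n N / fact N)"
  by (simp add: pochhammer_Suc)
 moreover have "poly (pderiv (weight n M (Suc N))) x = poly (pderiv (weight n M N)) x
   + (real (Suc N) * (pochhammer n (Suc N) / fact (Suc N))) * (1 - x / M) ^ N * (- 1 / M)"
  by (simp only: weight.simps pderiv_add pderiv_smult pderiv_power_Suc poly_add poly_smult poly_mult poly_power) (simp add: pderiv_pCons)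
 ultimately show ?thesis by simp
qed

text \<open>The full series F satisfies x F'(x) = - n F(x). The truncation leaves the first summand on the
right, which is nonnegative and therefore harmless.\<close>
lemma poly_pderiv_weight:
 assumes M: "M > 0"
 shows "x * poly (pderiv (weight n M N)) x = (n + real N) * (pochhammer n N / fact N) * (1 - x / M) ^ N - n * poly (weight n M N) x"
proof (induction N)
 case (Suc N)
 define c where "c = pochhammer n N / fact N"
 define b where "b = pochhammer n (Suc N) / fact (Suc N)"
 define z where "z = 1 - x / M"
 have b: "(1 + real N) * b = (n + real N) * c" by (simp add: pochhammer_Suc b_def c_def)
 have x: "x / M = 1 - z" by (simp add: z_def)
 have w: "poly (weight n M (Suc N)) x = poly (weight n M N) x + b * (z ^ N * z)"
  unfolding poly_weight b_def z_def by simp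
 have "x * poly (pderiv (weight n M (Suc N))) x = x * poly (pderiv (weight n M N)) x - (x / M) * ((n + real N) * c * z ^ N)"
  unfolding poly_pderiv_weight_Suc c_def z_def by (simp add: right_diff_distrib)
 also have "\<dots> = (n + real N) * c * (z ^ N * z) - n * poly (weight n M N) x"
  unfolding Suc.IH x c_def[symmetric] z_def[symmetric] by (simp add: algebra_simps)
 also have "\<dots> = (n + (1 + real N)) * b * (z ^ N * z) - n * poly (weight n M (Suc N)) x"
  unfolding w b[symmetric] by (simp add: algebra_simps)
 finally show ?case by (simp add: b_def z_def mult.commute)
qed simp

lemma weight_bounds:
 assumes n: "n > 0" and M: "M > 0" and x: "0 \<le> x" "x \<le> M"
 shows "1 \<le> poly (weight n M N) x"
  "\<bar>poly (weight n M N) x - x * poly (pderiv (weight n M N)) x\<bar> \<le> (1 + n) * poly (weight n M N) x"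
proof -
 have z: "0 \<le> 1 - x / M" using x M by simp
 have c: "0 \<le> pochhammer n k / fact k * (1 - x / M) ^ k" for k
  using n z by (intro mult_nonneg_nonneg divide_nonneg_nonneg pochhammer_nonneg) auto
 show ge1: "1 \<le> poly (weight n M N) x"
 proof (induction N)
  case (Suc N)
  then show ?case using c[of "Suc N"] unfolding poly_weight sum.atMost_Suc by linarith
 qed simp
 have c': "0 \<le> (n + real N) * (pochhammer n N / fact N) * (1 - x / M) ^ N" for N
  using mult_nonneg_nonneg[of "n + real N", OF _ c[of N]] n by (simp add: mult.assoc)
 have "poly (pderiv (weight n M N)) x \<le> 0"
 proof (induction N)
  case (Suc N)
  then show ?case using divide_nonneg_pos[OF c'[of N] M] unfolding poly_pderiv_weight_Suc by linarith
 qed simp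
 then have "x * poly (pderiv (weight n M N)) x \<le> 0" using x by (simp add: mult_nonneg_nonpos)
 then show "\<bar>poly (weight n M N) x - x * poly (pderiv (weight n M N)) x\<bar> \<le> (1 + n) * poly (weight n M N) x"
  using ge1 c'[of N] poly_pderiv_weight[OF M, of x n N] by (simp add: algebra_simps)
qed

lemma weight_sums:
 fixes M x n :: real
 assumes M: "M > 0" and x: "0 < x" "x \<le> M"
 shows "(\<lambda>k. pochhammer n k / fact k * (1 - x / M) ^ k) sums (M / x) powr n"
proof -
 have "\<bar>- (1 - x / M)\<bar> < 1" using x M by (simp add: abs_if field_simps)
 from gen_binomial_real[OF this, of "- n"]
 have "(\<lambda>k. ((- n) gchoose k) * (- (1 - x / M)) ^ k) sums (x / M) powr - n" by simp
 moreover have "((- n) gchoose k) * (- (1 - x / M)) ^ k = pochhammer n k / fact k * (1 - x / M) ^ k" for k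
 proof -
  have "(- (1 - x / M)) ^ k = (-1) ^ k * (1 - x / M) ^ k" by (rule power_minus)
  then show ?thesis by (simp add: gbinomial_pochhammer power_mult_distrib[symmetric])
 qed
 moreover have "(x / M) powr - n = (M / x) powr n" using x M by (simp add: powr_minus powr_divide)
 ultimately show ?thesis by simp
qed

lemma weight_limit:
 assumes n: "n > 0" and M: "M > 0" and x: "0 < x" "x \<le> M"
 shows "(\<lambda>N. poly (weight n M N) x) ----> (M / x) powr n" "poly (weight n M N) x \<le> (M / x) powr n"
proof -
 note s = weight_sums[OF M x, of n]
 show "(\<lambda>N. poly (weight n M N) x) ----> (M / x) powr n"
  using LIMSEQ_Suc[OF s[unfolded sums_def]] by (simp only: poly_weight lessThan_Suc_atMost)
 have "(\<Sum>k<Suc N. pochhammer n k / fact k * (1 - x / M) ^ k) \<le> (\<Sum>k. pochhammer n k / fact k * (1 - x / M) ^ k)"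
  using n x M by (intro sum_le_suminf sums_summable[OF s]) (auto simp: pochhammer_nonneg)
 then show "poly (weight n M N) x \<le> (M / x) powr n" by (simp only: poly_weight lessThan_Suc_atMost sums_unique[OF s, symmetric])
qed

lemma weight_antimono:
 assumes n: "n > 0" and M: "M > 0" and x: "0 \<le> x" "x \<le> y" "y \<le> M"
 shows "poly (weight n M N) y \<le> poly (weight n M N) x"
 unfolding poly_weight
 using assms by (intro sum_mono mult_left_mono power_mono) (auto simp: pochhammer_nonneg divide_right_mono)

section \<open>Propagation of a positive lower bound backwards in time\<close>

text \<open>Suppose that r0 < delta on a set of measure m. As the weights decrease, m times the weight at
delta is at most the volume V times the weight at c times exp ((1 + n) A). For N to infinity this becomes m
\<le> V exp(A) theta^n with theta = delta exp(A) / c < 1, and n to infinity gives m = 0.\<close>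
lemma AE_ge_if_weighted_bound:
 fixes X :: "'a::euclidean_space set"
 assumes X: "open X" "bounded X" and M: "M > 0" and c: "c > 0" and A: "A \<ge> 0"
  and r: "r0 \<in> bmeas (leb X)" "AE x in leb X. 0 \<le> r0 x \<and> r0 x \<le> M"
  and r1: "AE x in leb X. c \<le> r1 x \<and> r1 x \<le> M"
  and i: "\<And>p. integrable (leb X) (\<lambda>x. poly p (r0 x))" "\<And>p. integrable (leb X) (\<lambda>x. poly p (r1 x))"
  and le: "\<And>n N. n > 0 ==> (LINT x|leb X. poly (weight n M N) (r0 x))
    \<le> (LINT x|leb X. poly (weight n M N) (r1 x)) * exp ((1 + n) * A)"
  and cM: "c \<le> M" and \<delta>: "0 < \<delta>" "\<delta> < c * exp (- A)"
 shows "AE x in leb X. \<delta> \<le> r0 x"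
proof -
 interpret finite_measure "leb X" by (rule finite_measure_lebesgue_on_bounded[OF X])
 define S where "S = {x \<in> space (leb X). r0 x < \<delta>}"
 have S: "S \<in> sets (leb X)" using r(1) unfolding S_def borel_measurable_iff_less by blast
 define m where "m = measure (leb X) S"
 define V where "V = measure (leb X) (space (leb X))"
 define \<theta> where "\<theta> = \<delta> * exp A / c"
 have \<theta>: "0 < \<theta>" "\<theta> < 1" using \<delta> c by (auto simp: \<theta>_def exp_minus field_simps)
 have "c * exp (- A) \<le> c * 1" using A c by (intro mult_left_mono) auto
 then have \<delta>M: "\<delta> \<le> M" using \<delta> cM by simp
 have bound: "m \<le> V * exp A * \<theta> powr n" if n: "n > 0" for n
 proof -
  have lN: "m * poly (weight n M N) \<delta> \<le> V * (M / c) powr n * exp ((1 + n) * A)" for N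
  proof -
   have w0: "0 \<le> poly (weight n M N) y" if "0 \<le> y" "y \<le> M" for y
    using weight_bounds(1)[OF n M that, of N] by linarith
   have "m * poly (weight n M N) \<delta> = (LINT x|leb X. poly (weight n M N) \<delta> * ind S x)"
    using sets.Int_space_eq2[OF S] by (simp add: m_def)
   also have "\<dots> \<le> (LINT x|leb X. poly (weight n M N) (r0 x))"
   proof (rule integral_mono_AE[OF _ i(1)])
    show "integrable (leb X) (\<lambda>x. poly (weight n M N) \<delta> * ind S x)"
     using S by (intro integrable_mult_right integrable_real_indicator) (auto simp: less_top[symmetric])
    show "AE x in leb X. poly (weight n M N) \<delta> * ind S x \<le> poly (weight n M N) (r0 x)"
     using r(2)
    proof eventually_elim
     case (elim x)
     then show ?case using w0[of "r0 x"] weight_antimono[OF n M, of "r0 x" \<delta> N] \<delta>M by (auto simp: indicator_def S_def)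
    qed
   qed
   also have "\<dots> \<le> (LINT x|leb X. poly (weight n M N) (r1 x)) * exp ((1 + n) * A)" by (rule le[OF n])
   also have "\<dots> \<le> (V * (M / c) powr n) * exp ((1 + n) * A)"
   proof (rule mult_right_mono)
    have "(LINT x|leb X. poly (weight n M N) (r1 x)) \<le> (LINT x|leb X. (M / c) powr n)"
    proof (rule integral_mono_AE[OF i(2)])
     show "AE x in leb X. poly (weight n M N) (r1 x) \<le> (M / c) powr n" using r1
     proof eventually_elim
      case (elim x)
      then have "poly (weight n M N) (r1 x) \<le> poly (weight n M N) c" using c by (intro weight_antimono[OF n M]) auto
      also have "\<dots> \<le> (M / c) powr n" by (rule weight_limit(2)[OF n M c cM])
      finally show ?case .
     qed
    qed simp
    then show "(LINT x|leb X. poly (weight n M N) (r1 x)) \<le> V * (M / c) powr n" by (simp add: V_def)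
   qed simp
   finally show ?thesis .
  qed
  have "m * (M / \<delta>) powr n \<le> V * (M / c) powr n * exp ((1 + n) * A)"
   by (rule LIMSEQ_le_const2[OF tendsto_mult_left[OF weight_limit(1)[OF n M \<delta>(1) \<delta>M]]]) (use lN in blast)
  then have "m * (M / \<delta>) powr n * (\<delta> / M) powr n \<le> V * (M / c) powr n * exp ((1 + n) * A) * (\<delta> / M) powr n"
   by (rule mult_right_mono) simp
  moreover have "(M / \<delta>) powr n * (\<delta> / M) powr n = 1" using M \<delta> by (simp add: powr_mult[symmetric])
  moreover have "(M / c) powr n * exp ((1 + n) * A) * (\<delta> / M) powr n = exp A * \<theta> powr n"
  proof -
   have "exp ((1 + n) * A) = exp A * exp A powr n" by (simp add: powr_def exp_add[symmetric] algebra_simps)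
   moreover have "(M / c) powr n * exp A powr n * (\<delta> / M) powr n = \<theta> powr n"
    using M c \<delta> by (simp add: powr_mult[symmetric] \<theta>_def mult.commute)
   ultimately show ?thesis by (simp add: algebra_simps)
  qed
  ultimately show ?thesis by (simp add: mult.assoc)
 qed
 have lim: "(\<lambda>k. V * exp A * \<theta> powr real (Suc k)) ----> V * exp A * 0"
 proof (intro tendsto_mult_left)
  have "(\<lambda>k. \<theta> ^ Suc k) ----> 0" using \<theta> by (intro LIMSEQ_Suc LIMSEQ_power_zero) simp
  then show "(\<lambda>k. \<theta> powr real (Suc k)) ----> 0" using \<theta> by (simp add: powr_realpow del: of_nat_Suc power_Suc)
 qed
 have "m \<le> V * exp A * 0" by (rule LIMSEQ_le_const[OF lim]) (use bound in auto)
 moreover have "m \<ge> 0" by (simp add: m_def)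
 ultimately have "m = 0" by simp
 then have "emeasure (leb X) S = 0" by (simp add: m_def emeasure_eq_measure)
 then have "AE x in leb X. x \<notin> S" using S by (intro AE_not_in) auto
 then show ?thesis using AE_space by eventually_elim (auto simp: S_def)
qed

lemma Lp_time_norm_integrable:
 assumes "Lp_time 2 T (Wkp k q X) u"
 shows "integrable (leb {0..T}) (\<lambda>t. sobolev_norm k q X (u t))"
  "AE t in leb {0..T}. u t \<in> sobolev_carrier k q X"
proof -
 interpret finite_measure "leb {0..T}"
  by (rule finite_measureI) (simp add: space_restrict_space emeasure_restrict_space emeasure_lborel_Icc_eq)
 have i: "integrable (leb {0..T}) (\<lambda>t. sobolev_norm k q X (u t) powr 2)"
  using assms by (simp add: Lp_time_def Wkp_def)
 have e: "sobolev_norm k q X (u t) = (sobolev_norm k q X (u t) powr 2) powr (1/2)" for t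
  by (simp add: powr_powr sobolev_norm_nonneg)
 have m: "(\<lambda>t. sobolev_norm k q X (u t)) \<in> bmeas (leb {0..T})"
  by (subst e) (use borel_measurable_integrable[OF i] in measurable)
 have "integrable (leb {0..T}) (\<lambda>t. 1 + sobolev_norm k q X (u t) powr 2)" using i by simp
 then show "integrable (leb {0..T}) (\<lambda>t. sobolev_norm k q X (u t))"
 proof (rule Bintegrable_bound[OF _ m])
  have "s \<le> 1 + s\<^sup>2" for s :: real using sum_squares_bound[of s 1] zero_le_power2[of s] unfolding mult_1_right power_one by linarith
  then show "AE t in leb {0..T}. norm (sobolev_norm k q X (u t)) \<le> norm (1 + sobolev_norm k q X (u t) powr 2)"
   by (intro AE_I2) (simp add: sobolev_norm_nonneg)
 qed
 show "AE t in leb {0..T}. u t \<in> sobolev_carrier k q X"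
  using assms unfolding Lp_time_def strongly_measurable_def Wkp_def by (auto elim: eventually_mono)
qed

text \<open>For the weights F the functional E satisfies |E'| \<le> (1 + n) a E at almost every time, where a
bounds |div u|; hence E(0) is at most exp ((1 + n) A) E(T).\<close>
theorem density_lower_bound_backwards:
 assumes X: "smooth_bounded_domain X" and s: "strong_solution \<mu> lam \<gamma> X \<rho>0 u0 T \<rho> u" and T: "T > 0" and M: "M > 0"
  and b: "\<And>t. t \<ge> 0 ==> AE x in leb X. \<bar>\<rho> t x\<bar> \<le> M"
  and c: "c > 0" "AE x in leb X. c \<le> \<rho> T x"
 shows "\<exists>\<delta>>0. AE x in leb X. \<delta> \<le> \<rho> 0 x"
proof -
 have o: "open X" "bounded X" and ne: "X \<noteq> {}" using X by (auto simp: smooth_bounded_domain_def)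
 obtain q rt where q3: "3 < q" and w: "weak_time_deriv T X \<rho> rt" and pos: "\<And>t. t \<in> {0..T} ==> AE x in leb X. 0 \<le> \<rho> t x"
  and C\<rho>: "C_time T (Wkp 1 q X) \<rho>" and Crt: "C_time T (Lp q X) rt" and u: "Lp_time 2 T (Wkp 2 q X) u"
  and ce: "AE t in leb {0..T}. AE x in leb X. rt t x + wdiv X (\<lambda>y. \<rho> t y *\<^sub>R u t y) x = 0"
  using s unfolding strong_solution_def by blast
 have tr: "\<exists>g. has_trace X (u t) g \<and> (AE x in surface_measure X. g x \<bullet> outward_normal X x = 0)" if "t \<in> {0<..T}" for t
  using s that unfolding strong_solution_def by blast
 interpret bounded_density_evolution X T q \<rho> rt M
  by unfold_locales (use o q3 w C\<rho> Crt M b in \<open>auto simp: Wkp_0\<close>)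
 obtain K where K: "K \<ge> 0" "\<And>u. u \<in> sobolev_carrier 2 q X ==> AE x in leb X. \<bar>wdiv X u x\<bar> \<le> K * sobolev_norm 2 q X u"
  using wdiv_sup_bound[OF X q3] by blast
 define a where "a t = K * sobolev_norm 2 q X (u t)" for t
 have a0: "a t \<ge> 0" for t using K by (simp add: a_def sobolev_norm_nonneg)
 have ia: "integrable (leb {0..T}) a" unfolding a_def using Lp_time_norm_integrable(1)[OF u] by simp
 define A where "A = (LINT t|leb {0..T}. a t)"
 have A: "A \<ge> 0" unfolding A_def by (intro Bintegral_nonneg a0)
 have range: "AE x in leb X. 0 \<le> \<rho> t x \<and> \<rho> t x \<le> M" if "t \<in> {0..T}" for t
  using pos[OF that] \<rho>M[OF that] by eventually_elim auto
 have vol: "measure (leb X) (space (leb X)) > 0"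
 proof -
  interpret finite_measure "leb X" by (rule finite_measure_lebesgue_on_bounded[OF o])
  have "emeasure lborel X \<noteq> 0" using open_not_negligible[OF o(1) ne] o(1) null_sets_completionI[of X lborel] by (auto simp: negligible_iff_null_sets null_sets_def)
  then have "emeasure (leb X) (space (leb X)) \<noteq> 0" using o(1) by (simp add: space_restrict_space emeasure_restrict_space)
  then show ?thesis unfolding emeasure_eq_measure by (simp add: zero_less_measure_iff)
 qed
 have growth: "(LINT x|leb X. poly (weight n M N) (\<rho> 0 x)) \<le> (LINT x|leb X. poly (weight n M N) (\<rho> T x)) * exp ((1 + n) * A)"
  if n: "n > 0" for n N
 proof -
  define F where "F = weight n M N"
  define E where "E t = (LINT x|leb X. poly F (\<rho> t x))" for t
  define D where "D t = (LINT x|leb X. poly (pderiv F) (\<rho> t x) * rt t x)" for t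
  have "E 0 \<le> E T * exp (LINT t|leb {0..T}. (1 + n) * a t)"
  proof (rule log_gronwall)
   show "0 \<le> T" using T by simp
   show "continuous_on {0..T} E" unfolding E_def by (rule energy_continuous)
   show "(E has_real_derivative D t) (at t)" if "t \<in> {0<..<T}" for t
    unfolding E_def D_def by (rule energy_has_derivative[OF that])
   show "integrable (leb {0..T}) (\<lambda>t. (1 + n) * a t)" using ia by simp
   show "E t > 0" if t: "t \<in> {0..T}" for t
   proof -
    have "(LINT x|leb X. 1) \<le> E t" unfolding E_def
    proof (rule integral_mono_AE[OF integrable_const_on integrable_poly[OF t]])
     show "AE x in leb X. 1 \<le> poly F (\<rho> t x)" using range[OF t] unfolding F_def
      by eventually_elim (auto intro: weight_bounds(1)[OF n M])
    qed
    then show ?thesis using vol by simp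
   qed
   have "AE t in leb {0..T}. t \<noteq> 0"
    unfolding AE_lebesgue_on_iff[OF borel_closed[OF closed_atLeastAtMost]] using AE_lborel_singleton[of 0] by (auto elim: eventually_mono)
   then show "AE t in leb {0..T}. \<bar>D t\<bar> \<le> (1 + n) * a t * E t"
    using ce Lp_time_norm_integrable(2)[OF u] AE_space
   proof eventually_elim
    case (elim t)
    then have t: "t \<in> {0..T}" "t \<in> {0<..T}" by (auto simp: space_restrict_space)
    obtain g where g: "has_trace X (u t) g" "AE x in surface_measure X. g x \<bullet> outward_normal X x = 0" using tr[OF t(2)] by blast
    have r: "\<rho> t \<in> sobolev_carrier 1 q X" using C\<rho> t(1) unfolding C_time_def Wkp_def by simp
    note R = renormalized_divergence[OF X q3 r \<rho>M[OF t(1)] elim(3) g, of F]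
    let ?G = "\<lambda>x. (poly F (\<rho> t x) - \<rho> t x * poly (pderiv F) (\<rho> t x)) * wdiv X (u t) x"
    have "D t = (LINT x|leb X. - (poly (pderiv F) (\<rho> t x) * wdiv X (\<lambda>y. \<rho> t y *\<^sub>R u t y) x))"
     unfolding D_def
    proof (rule integral_cong_AE)
     show "AE x in leb X. poly (pderiv F) (\<rho> t x) * rt t x = - (poly (pderiv F) (\<rho> t x) * wdiv X (\<lambda>y. \<rho> t y *\<^sub>R u t y) x)"
      using elim(2) by eventually_elim (simp add: eq_neg_iff_add_eq_0 distrib_left[symmetric])
     show "(\<lambda>x. poly (pderiv F) (\<rho> t x) * rt t x) \<in> bmeas (leb X)"
      using integrable_poly_mult[OF t(1) integrable_density(2)[OF t(1)]] by (rule borel_measurable_integrable)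
    qed (use R(2) in simp)
    also have "\<dots> = (LINT x|leb X. ?G x)" using R(1) by simp
    finally have "\<bar>D t\<bar> \<le> (LINT x|leb X. \<bar>?G x\<bar>)" using integral_norm_bound[of "leb X" ?G] by simp
    also have "\<dots> \<le> (LINT x|leb X. (1 + n) * a t * poly F (\<rho> t x))"
    proof (rule integral_mono_AE')
     show "integrable (leb X) (\<lambda>x. (1 + n) * a t * poly F (\<rho> t x))" using integrable_poly[OF t(1)] by simp
     show "AE x in leb X. \<bar>?G x\<bar> \<le> (1 + n) * a t * poly F (\<rho> t x)" using range[OF t(1)] K(2)[OF elim(3)]
     proof eventually_elim
      case (elim x)
      have "\<bar>?G x\<bar> \<le> ((1 + n) * poly F (\<rho> t x)) * a t"
       unfolding abs_mult[of _ "wdiv X (u t) x"]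
      proof (rule mult_mono)
       show le: "\<bar>poly F (\<rho> t x) - \<rho> t x * poly (pderiv F) (\<rho> t x)\<bar> \<le> (1 + n) * poly F (\<rho> t x)"
        unfolding F_def using elim by (intro weight_bounds(2)[OF n M]) auto
       show "\<bar>wdiv X (u t) x\<bar> \<le> a t" using elim by (simp add: a_def)
       show "0 \<le> (1 + n) * poly F (\<rho> t x)" using le by linarith
      qed simp
      then show ?case by (simp add: mult.commute mult.left_commute)
     qed
     show "AE x in leb X. 0 \<le> (1 + n) * a t * poly F (\<rho> t x)" using range[OF t(1)]
     proof eventually_elim
      case (elim x)
      then have "1 \<le> poly F (\<rho> t x)" unfolding F_def by (intro weight_bounds(1)[OF n M]) auto
      then show ?case using a0[of t] n by simp
     qed
    qed
    finally show ?case by (simp add: E_def)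
   qed
  qed
  then show ?thesis by (simp add: E_def F_def A_def)
 qed
 \<comment> \<open>In fact c is at most M, as the domain is not a null set; the minimum avoids this argument.\<close>
 define c' where "c' = min c M"
 define \<delta> where "\<delta> = c' * exp (- A) / 2"
 have c': "0 < c'" "c' \<le> M" using c M by (auto simp: c'_def)
 have \<delta>: "0 < \<delta>" "\<delta> < c' * exp (- A)" using c' by (auto simp: \<delta>_def)
 have T': "0 \<in> {0..T}" "T \<in> {0..T}" using T by auto
 have "AE x in leb X. \<delta> \<le> \<rho> 0 x"
 proof (rule AE_ge_if_weighted_bound[OF o M c'(1) A _ range[OF T'(1)] _ integrable_poly[OF T'(1)] integrable_poly[OF T'(2)] growth c'(2) \<delta>])
  show "\<rho> 0 \<in> bmeas (leb X)" by (rule borel_measurable_integrable[OF integrable_density(1)[OF T'(1)]])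
  show "AE x in leb X. c' \<le> \<rho> T x \<and> \<rho> T x \<le> M" using c(2) range[OF T'(2)] by eventually_elim (auto simp: c'_def)
 qed
 then show ?thesis using \<delta>(1) by blast
qed

section \<open>Persistence of vacuum\<close>

lemma essinf_ge:
 fixes f :: "'a => real"
 assumes "f \<in> bmeas M" "AE x in M. c \<le> f x"
 shows "ereal c \<le> essinf M (\<lambda>x. ereal (f x))"
proof -
 have "esssup M (\<lambda>x. - ereal (f x)) \<le> - ereal c"
  by (rule esssup_I) (use assms in \<open>auto elim: eventually_mono\<close>)
 then show ?thesis unfolding essinf_def by (subst ereal_uminus_uminus[of "ereal c", symmetric]) (simp only: ereal_minus_le_minus)
qed

lemma essinf_positive_imp_AE_ge:
 fixes f :: "'a => real"
 assumes "0 < essinf M (\<lambda>x. ereal (f x))"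
 shows "\<exists>c>0. AE x in M. c \<le> f x"
proof -
 obtain c where c: "0 < ereal c" "ereal c < essinf M (\<lambda>x. ereal (f x))" using ereal_dense2[OF assms] by blast
 have "AE x in M. - ereal (f x) \<le> esssup M (\<lambda>x. - ereal (f x))" by (rule esssup_AE)
 then have "AE x in M. c \<le> f x"
 proof eventually_elim
  case (elim x)
  then have "essinf M (\<lambda>x. ereal (f x)) \<le> ereal (f x)" unfolding essinf_def by (metis ereal_uminus_le_reorder)
  then show ?case using c(2) by (metis ereal_less_eq(3) less_imp_le order_trans)
 qed
 then show ?thesis using c(1) by auto
qed

theorem theorem1p2:
  fixes \<Omega> :: "(real^3) set"
    and \<mu> lam \<gamma> \<rho>hat :: real
    and \<rho>0 :: "real^3 \<Rightarrow> real" and u0 :: "real^3 \<Rightarrow> real^3"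
    and \<rho> :: "real \<Rightarrow> real^3 \<Rightarrow> real" and u :: "real \<Rightarrow> real^3 \<Rightarrow> real^3"
  assumes "smooth_bounded_domain \<Omega>" and "simply_connected \<Omega>"
    and "\<mu> > 0" and "2 * \<mu> + 3 * lam \<ge> 0" and "\<gamma> > 1"
    and "AE x in lebesgue_on \<Omega>. \<rho>0 x \<ge> 0"
    and "(\<lambda>x. \<rho>0 x - mean \<Omega> \<rho>0) \<in> fst (Lp 2 \<Omega>)"
    and "(\<lambda>x. sqrt (\<rho>0 x) *\<^sub>R u0 x) \<in> fst (Lp 2 \<Omega>)"
    and "\<forall>i\<in>Basis. \<exists>g \<in> fst (Hk 1 \<Omega>). weak_deriv \<Omega> i u0 g"
    and "global_strong_solution \<mu> lam \<gamma> \<Omega> \<rho>0 u0 \<rho> u"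
    and "\<rho>hat > 0"
    and "(SUP t\<in>{0..}. esssup (lebesgue_on \<Omega>) (\<lambda>x. ereal \<bar>\<rho> t x\<bar>)) \<le> ereal \<rho>hat"
    and "essinf (lebesgue_on \<Omega>) (\<lambda>x. ereal (\<rho>0 x)) = 0"
  shows "\<forall>t\<ge>0. essinf (lebesgue_on \<Omega>) (\<lambda>x. ereal (\<rho> t x)) = 0"
proof (intro allI impI)
  fix t :: real assume t: "t \<ge> 0"
  let ?M = "lebesgue_on \<Omega>"
  have sol: "strong_solution \<mu> lam \<gamma> \<Omega> \<rho>0 u0 T \<rho> u" if "T > 0" for T
    using assms(10) that by (simp add: global_strong_solution_def)
  have b: "AE x in ?M. \<bar>\<rho> s x\<bar> \<le> \<rho>hat" if "s \<ge> 0" for s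
  proof -
    have "esssup ?M (\<lambda>x. ereal \<bar>\<rho> s x\<bar>) \<le> ereal \<rho>hat"
      using SUP_upper[of s "{0..}" "\<lambda>t. esssup ?M (\<lambda>x. ereal \<bar>\<rho> t x\<bar>)"] that assms(12) by (auto intro: order_trans)
    then show ?thesis using esssup_AE[of "\<lambda>x. ereal \<bar>\<rho> s x\<bar>" ?M] by (auto elim!: eventually_mono dest: order_trans)
  qed
  have S: "strong_solution \<mu> lam \<gamma> \<Omega> \<rho>0 u0 (t + 1) \<rho> u" by (rule sol) (use t in simp)
  have pos: "\<forall>s\<in>{0..t + 1}. AE x in ?M. 0 \<le> \<rho> s x" using S unfolding strong_solution_def by blast
  have C: "\<exists>q. C_time (t + 1) (Wkp 1 q \<Omega>) \<rho>" using S unfolding strong_solution_def by (elim exE conjE) (rule exI)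
  have init: "AE x in ?M. \<rho> 0 x = \<rho>0 x" using S unfolding strong_solution_def by blast
  have m: "\<rho> t \<in> borel_measurable ?M" 
  proof -
    obtain q where "C_time (t + 1) (Wkp 1 q \<Omega>) \<rho>" using C by blast
    from C_time_Lp[OF this, of t] show ?thesis using t by (simp add: Lp_iff)
  qed
  have m0: "\<rho>0 \<in> borel_measurable ?M"
  proof -
    have "(\<lambda>x. \<rho>0 x - mean \<Omega> \<rho>0) \<in> borel_measurable ?M" using assms(7) unfolding Lp_iff by (rule conjunct1)
    from borel_measurable_add[OF this borel_measurable_const[of "mean \<Omega> \<rho>0"]] show ?thesis by simp
  qed
  have "0 \<le> essinf ?M (\<lambda>x. ereal (\<rho> t x))" using essinf_ge[OF m, of 0] pos t by (simp add: zero_ereal_def)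
  moreover have "\<not> 0 < essinf ?M (\<lambda>x. ereal (\<rho> t x))"
  proof
    assume "0 < essinf ?M (\<lambda>x. ereal (\<rho> t x))"
    then obtain c where c: "c > 0" "AE x in ?M. c \<le> \<rho> t x" using essinf_positive_imp_AE_ge by blast
    obtain \<delta> where \<delta>: "\<delta> > 0" "AE x in ?M. \<delta> \<le> \<rho> 0 x"
    proof (cases "t = 0")
      case False
      then have "t > 0" using t by simp
      from density_lower_bound_backwards[OF assms(1) sol[OF this] this assms(11) b c] show ?thesis using that by blast
    qed (use c that in blast)
    have "AE x in ?M. \<delta> \<le> \<rho>0 x" using \<delta>(2) init by eventually_elim simp
    from essinf_ge[OF m0 this] show False using assms(13) \<delta>(1) by simp
  qed
  ultimately show "essinf ?M (\<lambda>x. ereal (\<rho> t x)) = 0" by simp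
qed

end
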